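(* Let $\mathcal C$ be an abelian category in which every object has finite length, equipped with a torsion pair $(\mathcal X,\mathcal Y)$ satisfying conditions (a)–(e) listed in the context, and let $\mathcal F$, $\widetilde{\mathcal F}$, $R$, $R\text{-}\mathrm{mod}$ and $R\text{-}\widetilde{\mathrm{mod}}$ be as defined in the context. Then the abelian categories $\mathcal F$ and $\widetilde{\mathcal F}$ are hereditary, and $\widetilde{\mathcal F}$ has enough projectives. Moreover, there are compatible equivalences of categories $$\mathbf M:\mathcal F\xrightarrow{\ \cong\ }R\text{-}\mathrm{mod},\qquad \widetilde{\mathbf M}:\widetilde{\mathcal F}\xrightarrow{\ \cong\ }R\text{-}\widetilde{\mathrm{mod}}.$$
   Context: All categories are small. A torsion pair in $\mathcal C$ is a pair $(\mathcal X,\mathcal Y)$ of strictly full subcategories such that $\mathrm{Hom}_{\mathcal C}(X,Y)=0$ for $X\in\mathcal X,Y\in\mathcal Y$, and every $C\in\mathcal C$ lies in an exact sequence $0\to X_C\to C\to Y_C\to0$ with $X_C\in\mathcal X$, $Y_C\in\mathcal Y$. A Serre subcategory is a nonempty strictly full subcategory stable under subobjects, quotients and extensions. An abelian category is semi-simple if every short exact sequence splits, and hereditary if $\mathrm{Ext}^i=0$ for all $i\geq2$. Conditions: (a) $\mathcal X,\mathcal Y$ are Serre subcategories of $\mathcal C$. (b) $\mathcal X,\mathcal Y$ are semi-simple. (c) $\mathrm{Hom}_{\mathcal C}(Y,X)=0$ for all $X\in\mathcal X$, $Y\in\mathcal Y$. (d) There is a covariant exact functor $\mathbf F:\mathcal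 Y\to\widetilde{\mathcal X}$, where $\widetilde{\mathcal X}$ is a semi-simple abelian category containing $\mathcal X$ as a Serre subcategory, and a bi-functorial isomorphism $\mathrm{Ext}^1_{\mathcal C}(Y,X)\cong\mathrm{Hom}_{\widetilde{\mathcal X}}(\mathbf F(Y),X)$ for all $X\in\mathcal X$, $Y\in\mathcal Y$. (e) Let $I$ be a set of representatives of the isomorphism classes of simple objects of $\mathcal X$, $D_S:=\mathrm{End}_{\mathcal X}(S)^{\mathrm{op}}$ for $S\in I$, and $R_{\mathcal X}:=\bigoplus_{S\in I}D_S$. The equivalence $\mathcal X\cong R_{\mathcal X}\text{-}\mathrm{mod}$, $X\mapsto\bigoplus_{S\in I}\mathrm{Hom}_{\mathcal X}(S,X)$ (onto modules of finite length) extends to an equivalence of $\widetilde{\mathcal X}$ with the category $R_{\mathcal X}\text{-}\mathrm{Mod}^{\mathrm{ss}}$ of all semi-simple left $R_{\mathcal X}$-modules. Similarly let $J$ be a set of representatives of the simple objects $T$ of $\mathcal Y$, $D_T:=\mathrm{End}_{\mathcal Y}(T)^{\mathrm{op}}$, $R_{\mathcal Y}:=\bigoplus_{T\in J}D_T$; then $\mathcal Y\cong R_{\mathcal Y}\text{-}\mathrm{mod}$ in the same way, $T$ corresponding to the left module $D_T$. The rings $R_{\mathcal X},R_{\mathcal Y}$ need not have a unit; modules $N$ over such a ring $A$ (and over $R$ below) are understood to satisfy $AN=N$. The category $\widetilde{\mathcal F}$ has as objects the triples $(X,Y,\eta)$ with $X\in\widetilde{\mathcal X}$, $Y\in\mathcal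 Y$, $\eta\in\mathrm{Hom}_{\widetilde{\mathcal X}}(\mathbf F(Y),X)$; morphisms $(X,Y,\eta)\to(X',Y',\eta')$ are pairs $(u:X\to X',v:Y\to Y')$ with $u\circ\eta=\eta'\circ\mathbf F(v)$. $\mathcal F$ is the full subcategory of triples with $X\in\mathcal X$. View $\mathbf F$ as a functor to $R_{\mathcal X}\text{-}\mathrm{Mod}^{\mathrm{ss}}$ from $R_{\mathcal Y}\text{-}\mathrm{mod}$. Each $\mathbf F(D_T)$ is a left $R_{\mathcal X}$-module, and a right $D_T$-module via right multiplication of $D_T$ on itself and functoriality. Set $M:=\bigoplus_{T\in J}\mathbf F(D_T)$, an $R_{\mathcal X}$-$R_{\mathcal Y}$-bimodule, and let $$R:=\begin{pmatrix} R_{\mathcal Y} & 0 \\ M & R_{\mathcal X} \end{pmatrix}$$ be the triangular matrix ring. $R\text{-}\mathrm{mod}$ is the category of left $R$-modules of finite length. A left $R$-module $Z$ is locally finite if $Z=X\oplus Y$ as an $R_{\mathcal X}\oplus R_{\mathcal Y}$-module with $X$ a semi-simple $R_{\mathcal X}$-module and $Y$ an $R_{\mathcal Y}$-module of finite length; $R\text{-}\widetilde{\mathrm{mod}}$ is the full subcategory of locally finite $R$-modules. "Compatible" means $\widetilde{\mathbf M}$ extends $\mathbf M$. *)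

theory Defs
  imports
    "HOL-Algebra.Product_Groups"
    "HOL-Algebra.Generated_Groups"
    "HOL-Algebra.Module"
    "HOL-Library.Equipollence"
begin

section \<open>Preadditive categories\<close>

text \<open>
  A small category is given by its set of objects and its family of Hom-sets, all inside fixed
  types. Hom-sets are not required to be disjoint, so composition and the additive structure are
  indexed by objects: \<open>Cmp C A B D g f\<close> is the composite of \<open>f : A \<rightarrow> B\<close> and \<open>g : B \<rightarrow> D\<close>.
  All values outside the Hom-sets are irrelevant.
\<close>

record ('o, 'm) precat =
  Ob :: "'o set"
  Hom :: "'o \<Rightarrow> 'o \<Rightarrow> 'm set"
  Idt :: "'o \<Rightarrow> 'm"
  Cmp :: "'o \<Rightarrow> 'o \<Rightarrow> 'o \<Rightarrow> 'm \<Rightarrow> 'm \<Rightarrow> 'm"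
  Add :: "'o \<Rightarrow> 'o \<Rightarrow> 'm \<Rightarrow> 'm \<Rightarrow> 'm"
  Zer :: "'o \<Rightarrow> 'o \<Rightarrow> 'm"

definition hom_group :: "('o, 'm) precat \<Rightarrow> 'o \<Rightarrow> 'o \<Rightarrow> 'm monoid" where
  "hom_group C A B = \<lparr>carrier = Hom C A B, monoid.mult = Add C A B, one = Zer C A B\<rparr>"

locale preadditive_cat =
  fixes C :: "('o, 'm) precat"
  assumes id_in_hom: "A \<in> Ob C \<Longrightarrow> Idt C A \<in> Hom C A A"
    and cmp_in_hom: "\<lbrakk>A \<in> Ob C; B \<in> Ob C; D \<in> Ob C; f \<in> Hom C A B; g \<in> Hom C B D\<rbrakk>
      \<Longrightarrow> Cmp C A B D g f \<in> Hom C A D"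
    and id_left: "\<lbrakk>A \<in> Ob C; B \<in> Ob C; f \<in> Hom C A B\<rbrakk> \<Longrightarrow> Cmp C A B B (Idt C B) f = f"
    and id_right: "\<lbrakk>A \<in> Ob C; B \<in> Ob C; f \<in> Hom C A B\<rbrakk> \<Longrightarrow> Cmp C A A B f (Idt C A) = f"
    and cmp_assoc: "\<lbrakk>A \<in> Ob C; B \<in> Ob C; D \<in> Ob C; E \<in> Ob C;
        f \<in> Hom C A B; g \<in> Hom C B D; h \<in> Hom C D E\<rbrakk>
      \<Longrightarrow> Cmp C A D E h (Cmp C A B D g f) = Cmp C A B E (Cmp C B D E h g) f"
    and hom_comm_group: "\<lbrakk>A \<in> Ob C; B \<in> Ob C\<rbrakk> \<Longrightarrow> comm_group (hom_group C A B)"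
    and cmp_add_left: "\<lbrakk>A \<in> Ob C; B \<in> Ob C; D \<in> Ob C;
        f \<in> Hom C A B; g \<in> Hom C B D; h \<in> Hom C B D\<rbrakk>
      \<Longrightarrow> Cmp C A B D (Add C B D g h) f = Add C A D (Cmp C A B D g f) (Cmp C A B D h f)"
    and cmp_add_right: "\<lbrakk>A \<in> Ob C; B \<in> Ob C; D \<in> Ob C;
        f \<in> Hom C A B; g \<in> Hom C A B; h \<in> Hom C B D\<rbrakk>
      \<Longrightarrow> Cmp C A B D h (Add C A B f g) = Add C A D (Cmp C A B D h f) (Cmp C A B D h g)"


section \<open>Abelian categories\<close>

definition zero_obj :: "('o, 'm) precat \<Rightarrow> 'o \<Rightarrow> bool" where
  "zero_obj C Z \<longleftrightarrow> Z \<in> Ob C \<and>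
    (\<forall>A \<in> Ob C. (\<exists>!f. f \<in> Hom C Z A) \<and> (\<exists>!f. f \<in> Hom C A Z))"

definition mono_mor :: "('o, 'm) precat \<Rightarrow> 'o \<Rightarrow> 'o \<Rightarrow> 'm \<Rightarrow> bool" where
  "mono_mor C A B f \<longleftrightarrow> A \<in> Ob C \<and> B \<in> Ob C \<and> f \<in> Hom C A B \<and>
    (\<forall>T \<in> Ob C. \<forall>s \<in> Hom C T A. \<forall>t \<in> Hom C T A.
      Cmp C T A B f s = Cmp C T A B f t \<longrightarrow> s = t)"

definition epi_mor :: "('o, 'm) precat \<Rightarrow> 'o \<Rightarrow> 'o \<Rightarrow> 'm \<Rightarrow> bool" where
  "epi_mor C A B f \<longleftrightarrow> A \<in> Ob C \<and> B \<in> Ob C \<and> f \<in> Hom C A B \<and>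
    (\<forall>T \<in> Ob C. \<forall>s \<in> Hom C B T. \<forall>t \<in> Hom C B T.
      Cmp C A B T s f = Cmp C A B T t f \<longrightarrow> s = t)"

definition iso_mor :: "('o, 'm) precat \<Rightarrow> 'o \<Rightarrow> 'o \<Rightarrow> 'm \<Rightarrow> bool" where
  "iso_mor C A B f \<longleftrightarrow> A \<in> Ob C \<and> B \<in> Ob C \<and> f \<in> Hom C A B \<and>
    (\<exists>g \<in> Hom C B A. Cmp C A B A g f = Idt C A \<and> Cmp C B A B f g = Idt C B)"

definition iso_obj :: "('o, 'm) precat \<Rightarrow> 'o \<Rightarrow> 'o \<Rightarrow> bool" where
  "iso_obj C A B \<longleftrightarrow> (\<exists>f. iso_mor C A B f)"

text \<open>\<open>is_ker C A B f K k\<close>: the morphism \<open>k : K \<rightarrow> A\<close> is a kernel of \<open>f : A \<rightarrow> B\<close>.\<close>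

definition is_ker :: "('o, 'm) precat \<Rightarrow> 'o \<Rightarrow> 'o \<Rightarrow> 'm \<Rightarrow> 'o \<Rightarrow> 'm \<Rightarrow> bool" where
  "is_ker C A B f K k \<longleftrightarrow> A \<in> Ob C \<and> B \<in> Ob C \<and> K \<in> Ob C \<and> f \<in> Hom C A B \<and> k \<in> Hom C K A \<and>
    Cmp C K A B f k = Zer C K B \<and>
    (\<forall>T \<in> Ob C. \<forall>t \<in> Hom C T A. Cmp C T A B f t = Zer C T B \<longrightarrow>
      (\<exists>!s. s \<in> Hom C T K \<and> Cmp C T K A k s = t))"

text \<open>\<open>is_coker C A B f Q q\<close>: the morphism \<open>q : B \<rightarrow> Q\<close> is a cokernel of \<open>f : A \<rightarrow> B\<close>.\<close>

definition is_coker :: "('o, 'm) precat \<Rightarrow> 'o \<Rightarrow> 'o \<Rightarrow> 'm \<Rightarrow> 'o \<Rightarrow> 'm \<Rightarrow> bool" where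
  "is_coker C A B f Q q \<longleftrightarrow> A \<in> Ob C \<and> B \<in> Ob C \<and> Q \<in> Ob C \<and> f \<in> Hom C A B \<and> q \<in> Hom C B Q \<and>
    Cmp C A B Q q f = Zer C A Q \<and>
    (\<forall>T \<in> Ob C. \<forall>t \<in> Hom C B T. Cmp C A B T t f = Zer C A T \<longrightarrow>
      (\<exists>!s. s \<in> Hom C Q T \<and> Cmp C B Q T s q = t))"

definition is_biprod ::
  "('o, 'm) precat \<Rightarrow> 'o \<Rightarrow> 'o \<Rightarrow> 'o \<Rightarrow> 'm \<Rightarrow> 'm \<Rightarrow> 'm \<Rightarrow> 'm \<Rightarrow> bool" where
  "is_biprod C A B P i1 i2 p1 p2 \<longleftrightarrow> A \<in> Ob C \<and> B \<in> Ob C \<and> P \<in> Ob C \<and>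
    i1 \<in> Hom C A P \<and> i2 \<in> Hom C B P \<and> p1 \<in> Hom C P A \<and> p2 \<in> Hom C P B \<and>
    Cmp C A P A p1 i1 = Idt C A \<and> Cmp C B P B p2 i2 = Idt C B \<and>
    Cmp C A P B p2 i1 = Zer C A B \<and> Cmp C B P A p1 i2 = Zer C B A \<and>
    Add C P P (Cmp C P A P i1 p1) (Cmp C P B P i2 p2) = Idt C P"

definition abelian_cat :: "('o, 'm) precat \<Rightarrow> bool" where
  "abelian_cat C \<longleftrightarrow> preadditive_cat C \<and> (\<exists>Z. zero_obj C Z) \<and>
    (\<forall>A \<in> Ob C. \<forall>B \<in> Ob C. \<exists>P i1 i2 p1 p2. is_biprod C A B P i1 i2 p1 p2) \<and>
    (\<forall>A \<in> Ob C. \<forall>B \<in> Ob C. \<forall>f \<in> Hom C A B.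
      (\<exists>K k. is_ker C A B f K k) \<and> (\<exists>Q q. is_coker C A B f Q q)) \<and>
    (\<forall>A B f. mono_mor C A B f \<longrightarrow> (\<exists>D g. is_ker C B D g A f)) \<and>
    (\<forall>A B f. epi_mor C A B f \<longrightarrow> (\<exists>D g. is_coker C D A g B f))"

text \<open>Exactness of \<open>A \<rightarrow> B \<rightarrow> D\<close> at \<open>B\<close>: the kernel of \<open>g\<close> is the image of \<open>f\<close>, that is, the kernel
  of the cokernel of \<open>f\<close>.\<close>

definition exact_at :: "('o, 'm) precat \<Rightarrow> 'o \<Rightarrow> 'o \<Rightarrow> 'o \<Rightarrow> 'm \<Rightarrow> 'm \<Rightarrow> bool" where
  "exact_at C A B D f g \<longleftrightarrow>
    (\<exists>K k Q q. is_ker C B D g K k \<and> is_coker C A B f Q q \<and> is_ker C B Q q K k)"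

definition short_exact :: "('o, 'm) precat \<Rightarrow> 'o \<Rightarrow> 'o \<Rightarrow> 'o \<Rightarrow> 'm \<Rightarrow> 'm \<Rightarrow> bool" where
  "short_exact C A B D f g \<longleftrightarrow> mono_mor C A B f \<and> exact_at C A B D f g \<and> epi_mor C B D g"

definition semisimple_cat :: "('o, 'm) precat \<Rightarrow> bool" where
  "semisimple_cat C \<longleftrightarrow> abelian_cat C \<and>
    (\<forall>A B D f g. short_exact C A B D f g \<longrightarrow> (\<exists>s \<in> Hom C D B. Cmp C D B D g s = Idt C D))"

definition simple_obj :: "('o, 'm) precat \<Rightarrow> 'o \<Rightarrow> bool" where
  "simple_obj C S \<longleftrightarrow> S \<in> Ob C \<and> \<not> zero_obj C S \<and>
    (\<forall>A m. mono_mor C A S m \<longrightarrow> zero_obj C A \<or> iso_mor C A S m)"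

inductive finite_length_obj :: "('o, 'm) precat \<Rightarrow> 'o \<Rightarrow> bool" for C where
  zero: "zero_obj C Z \<Longrightarrow> finite_length_obj C Z"
| step: "\<lbrakk>finite_length_obj C A; simple_obj C S; short_exact C A B S f g\<rbrakk>
    \<Longrightarrow> finite_length_obj C B"

definition projective_obj :: "('o, 'm) precat \<Rightarrow> 'o \<Rightarrow> bool" where
  "projective_obj C P \<longleftrightarrow> P \<in> Ob C \<and>
    (\<forall>A B e. epi_mor C A B e \<longrightarrow> (\<forall>f \<in> Hom C P B. \<exists>g \<in> Hom C P A. Cmp C P A B e g = f))"

definition enough_projectives :: "('o, 'm) precat \<Rightarrow> bool" where
  "enough_projectives C \<longleftrightarrow> (\<forall>A \<in> Ob C. \<exists>P e. projective_obj C P \<and> epi_mor C P A e)"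


section \<open>Subcategories and torsion pairs\<close>

definition full_sub :: "('o, 'm) precat \<Rightarrow> 'o set \<Rightarrow> ('o, 'm) precat" where
  "full_sub C P = C\<lparr>Ob := P\<rparr>"

definition is_full_subcat :: "('o, 'm) precat \<Rightarrow> ('o, 'm) precat \<Rightarrow> bool" where
  "is_full_subcat D E \<longleftrightarrow> Ob D \<subseteq> Ob E \<and>
    (\<forall>A \<in> Ob D. Idt D A = Idt E A) \<and>
    (\<forall>A \<in> Ob D. \<forall>B \<in> Ob D. Hom D A B = Hom E A B \<and> Zer D A B = Zer E A B \<and>
      (\<forall>f \<in> Hom D A B. \<forall>g \<in> Hom D A B. Add D A B f g = Add E A B f g)) \<and>
    (\<forall>A \<in> Ob D. \<forall>B \<in> Ob D. \<forall>B' \<in> Ob D. \<forall>f \<in> Hom D A B. \<forall>g \<in> Hom D B B'.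
      Cmp D A B B' g f = Cmp E A B B' g f)"

definition strictly_full :: "('o, 'm) precat \<Rightarrow> 'o set \<Rightarrow> bool" where
  "strictly_full C P \<longleftrightarrow> P \<subseteq> Ob C \<and> (\<forall>A B. A \<in> P \<and> iso_obj C A B \<longrightarrow> B \<in> P)"

definition serre_subcat :: "('o, 'm) precat \<Rightarrow> 'o set \<Rightarrow> bool" where
  "serre_subcat C P \<longleftrightarrow> P \<noteq> {} \<and> strictly_full C P \<and>
    (\<forall>A B m. B \<in> P \<and> mono_mor C A B m \<longrightarrow> A \<in> P) \<and>
    (\<forall>A B e. A \<in> P \<and> epi_mor C A B e \<longrightarrow> B \<in> P) \<and>
    (\<forall>A B D f g. A \<in> P \<and> D \<in> P \<and> short_exact C A B D f g \<longrightarrow> B \<in> P)"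

definition torsion_pair :: "('o, 'm) precat \<Rightarrow> 'o set \<Rightarrow> 'o set \<Rightarrow> bool" where
  "torsion_pair C \<X> \<Y> \<longleftrightarrow> strictly_full C \<X> \<and> strictly_full C \<Y> \<and>
    (\<forall>X \<in> \<X>. \<forall>Y \<in> \<Y>. Hom C X Y = {Zer C X Y}) \<and>
    (\<forall>A \<in> Ob C. \<exists>X \<in> \<X>. \<exists>Y \<in> \<Y>. \<exists>f g. short_exact C X A Y f g)"

text \<open>Representatives of the isomorphism classes of simple objects.\<close>

definition simple_reps :: "('o, 'm) precat \<Rightarrow> 'o set \<Rightarrow> bool" where
  "simple_reps C I \<longleftrightarrow> (\<forall>S \<in> I. simple_obj C S) \<and>
    (\<forall>T. simple_obj C T \<longrightarrow> (\<exists>!S. S \<in> I \<and> iso_obj C S T))"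


section \<open>Functors and equivalences\<close>

record ('o, 'm, 'p, 'q) functr =
  fob :: "'o \<Rightarrow> 'p"
  fmp :: "'o \<Rightarrow> 'o \<Rightarrow> 'm \<Rightarrow> 'q"

definition is_functor ::
  "('o, 'm) precat \<Rightarrow> ('p, 'q) precat \<Rightarrow> ('o, 'm, 'p, 'q) functr \<Rightarrow> bool" where
  "is_functor C D F \<longleftrightarrow>
    (\<forall>A \<in> Ob C. fob F A \<in> Ob D \<and> fmp F A A (Idt C A) = Idt D (fob F A)) \<and>
    (\<forall>A \<in> Ob C. \<forall>B \<in> Ob C. \<forall>f \<in> Hom C A B. fmp F A B f \<in> Hom D (fob F A) (fob F B)) \<and>
    (\<forall>A \<in> Ob C. \<forall>B \<in> Ob C. \<forall>E \<in> Ob C. \<forall>f \<in> Hom C A B. \<forall>g \<in> Hom C B E.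
      fmp F A E (Cmp C A B E g f) =
        Cmp D (fob F A) (fob F B) (fob F E) (fmp F B E g) (fmp F A B f))"

definition exact_functor ::
  "('o, 'm) precat \<Rightarrow> ('p, 'q) precat \<Rightarrow> ('o, 'm, 'p, 'q) functr \<Rightarrow> bool" where
  "exact_functor C D F \<longleftrightarrow> is_functor C D F \<and>
    (\<forall>A \<in> Ob C. \<forall>B \<in> Ob C. \<forall>f \<in> Hom C A B. \<forall>g \<in> Hom C A B.
      fmp F A B (Add C A B f g) = Add D (fob F A) (fob F B) (fmp F A B f) (fmp F A B g)) \<and>
    (\<forall>A B E f g. short_exact C A B E f g \<longrightarrow>
      short_exact D (fob F A) (fob F B) (fob F E) (fmp F A B f) (fmp F B E g))"

definition id_functor :: "('o, 'm, 'o, 'm) functr" where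
  "id_functor = \<lparr>fob = (\<lambda>A. A), fmp = (\<lambda>A B f. f)\<rparr>"

definition comp_functor ::
  "('p, 'q, 'r, 's) functr \<Rightarrow> ('o, 'm, 'p, 'q) functr \<Rightarrow> ('o, 'm, 'r, 's) functr" where
  "comp_functor G F = \<lparr>fob = (\<lambda>A. fob G (fob F A)),
    fmp = (\<lambda>A B f. fmp G (fob F A) (fob F B) (fmp F A B f))\<rparr>"

definition nat_iso :: "('o, 'm) precat \<Rightarrow> ('p, 'q) precat \<Rightarrow>
    ('o, 'm, 'p, 'q) functr \<Rightarrow> ('o, 'm, 'p, 'q) functr \<Rightarrow> ('o \<Rightarrow> 'q) \<Rightarrow> bool" where
  "nat_iso C D F G t \<longleftrightarrow>
    (\<forall>A \<in> Ob C. iso_mor D (fob F A) (fob G A) (t A)) \<and>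
    (\<forall>A \<in> Ob C. \<forall>B \<in> Ob C. \<forall>f \<in> Hom C A B.
      Cmp D (fob F A) (fob F B) (fob G B) (t B) (fmp F A B f) =
      Cmp D (fob F A) (fob G A) (fob G B) (fmp G A B f) (t A))"

definition is_equivalence ::
  "('o, 'm) precat \<Rightarrow> ('p, 'q) precat \<Rightarrow> ('o, 'm, 'p, 'q) functr \<Rightarrow> bool" where
  "is_equivalence C D F \<longleftrightarrow> is_functor C D F \<and>
    (\<exists>G s t. is_functor D C G \<and> nat_iso C C id_functor (comp_functor G F) s \<and>
      nat_iso D D (comp_functor F G) id_functor t)"

text \<open>\<open>extends_functor C F F'\<close>: the functor \<open>F'\<close> restricts to \<open>F\<close> on \<open>C\<close> (strictly, on objects and
  morphisms).\<close>

definition extends_functor ::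
  "('o, 'm) precat \<Rightarrow> ('o, 'm, 'p, 'q) functr \<Rightarrow> ('o, 'm, 'p, 'q) functr \<Rightarrow> bool" where
  "extends_functor C F F' \<longleftrightarrow> (\<forall>A \<in> Ob C. fob F' A = fob F A) \<and>
    (\<forall>A \<in> Ob C. \<forall>B \<in> Ob C. \<forall>f \<in> Hom C A B. fmp F' A B f = fmp F A B f)"


section \<open>Yoneda Ext\<close>

text \<open>
  An \<open>n\<close>-extension (\<open>n \<ge> 1\<close>) of \<open>A\<close> by \<open>B\<close> is an exact sequence
  \<open>0 \<rightarrow> B = E\<^sub>0 \<rightarrow> E\<^sub>1 \<rightarrow> \<dots> \<rightarrow> E\<^sub>n \<rightarrow> E\<^sub>n\<^sub>+\<^sub>1 = A \<rightarrow> 0\<close>, stored as the list of its \<open>n + 2\<close> objects and the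
  list of its \<open>n + 1\<close> morphisms.
\<close>

definition extns :: "('o, 'm) precat \<Rightarrow> nat \<Rightarrow> 'o \<Rightarrow> 'o \<Rightarrow> ('o list \<times> 'm list) set" where
  "extns C n A B = {(es, fs). length es = n + 2 \<and> length fs = n + 1 \<and> set es \<subseteq> Ob C \<and>
    es ! 0 = B \<and> es ! (n + 1) = A \<and>
    (\<forall>i \<le> n. fs ! i \<in> Hom C (es ! i) (es ! (i + 1))) \<and>
    mono_mor C (es ! 0) (es ! 1) (fs ! 0) \<and>
    epi_mor C (es ! n) (es ! (n + 1)) (fs ! n) \<and>
    (\<forall>i < n. exact_at C (es ! i) (es ! (i + 1)) (es ! (i + 2)) (fs ! i) (fs ! (i + 1)))}"

definition extn_mor ::
  "('o, 'm) precat \<Rightarrow> nat \<Rightarrow> 'o list \<times> 'm list \<Rightarrow> 'o list \<times> 'm list \<Rightarrow> (nat \<Rightarrow> 'm) \<Rightarrow> bool" where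
  "extn_mor C n E E' h \<longleftrightarrow>
    (\<forall>i \<le> n + 1. h i \<in> Hom C (fst E ! i) (fst E' ! i)) \<and>
    (\<forall>i \<le> n.
      Cmp C (fst E ! i) (fst E' ! i) (fst E' ! (i + 1)) (snd E' ! i) (h i) =
      Cmp C (fst E ! i) (fst E ! (i + 1)) (fst E' ! (i + 1)) (h (i + 1)) (snd E ! i))"

text \<open>Yoneda equivalence is the equivalence relation generated by the morphisms of extensions that
  are the identity at both ends.\<close>

definition yoneda_rel :: "('o, 'm) precat \<Rightarrow> nat \<Rightarrow> 'o \<Rightarrow> 'o
    \<Rightarrow> (('o list \<times> 'm list) \<times> ('o list \<times> 'm list)) set" where
  "yoneda_rel C n A B = {(E, E'). E \<in> extns C n A B \<and>
    equivclp (\<lambda>E E'. E \<in> extns C n A B \<and> E' \<in> extns C n A B \<and>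
      (\<exists>h. extn_mor C n E E' h \<and> h 0 = Idt C B \<and> h (n + 1) = Idt C A)) E E'}"

text \<open>
  The Baer sum of two classes is the class of \<open>\<nabla>\<^sub>* \<Delta>\<^sup>* (E\<^sub>1 \<oplus> E\<^sub>2)\<close>: below, \<open>D\<close> is a direct sum of
  \<open>E\<^sub>1\<close> and \<open>E\<^sub>2\<close>, \<open>P\<close> is \<open>\<Delta>\<^sup>* D\<close> (there is a morphism \<open>P \<rightarrow> D\<close> that is the identity on the left and the
  diagonal on the right), and \<open>E\<close> is \<open>\<nabla>\<^sub>* P\<close>.
\<close>

definition extn_sum :: "('o, 'm) precat \<Rightarrow> nat \<Rightarrow> 'o list \<times> 'm list \<Rightarrow> 'o list \<times> 'm list
    \<Rightarrow> 'o list \<times> 'm list \<Rightarrow> (nat \<Rightarrow> 'm) \<Rightarrow> (nat \<Rightarrow> 'm) \<Rightarrow> (nat \<Rightarrow> 'm) \<Rightarrow> (nat \<Rightarrow> 'm) \<Rightarrow> bool" where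
  "extn_sum C n E1 E2 D i1 i2 p1 p2 \<longleftrightarrow>
    D \<in> extns C n (fst D ! (n + 1)) (fst D ! 0) \<and>
    extn_mor C n E1 D i1 \<and> extn_mor C n E2 D i2 \<and> extn_mor C n D E1 p1 \<and> extn_mor C n D E2 p2 \<and>
    (\<forall>k \<le> n + 1. is_biprod C (fst E1 ! k) (fst E2 ! k) (fst D ! k) (i1 k) (i2 k) (p1 k) (p2 k))"

definition baer_sum :: "('o, 'm) precat \<Rightarrow> nat \<Rightarrow> 'o \<Rightarrow> 'o
    \<Rightarrow> ('o list \<times> 'm list) set \<Rightarrow> ('o list \<times> 'm list) set \<Rightarrow> ('o list \<times> 'm list) set" where
  "baer_sum C n A B c1 c2 = yoneda_rel C n A B `` {E \<in> extns C n A B.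
    \<exists>E1 \<in> c1. \<exists>E2 \<in> c2. \<exists>D i1 i2 p1 p2. extn_sum C n E1 E2 D i1 i2 p1 p2 \<and>
      (\<exists>P \<in> extns C n A (fst D ! 0).
        (\<exists>h. extn_mor C n P D h \<and> h 0 = Idt C (fst D ! 0) \<and>
          h (n + 1) = Add C A (fst D ! (n + 1)) (i1 (n + 1)) (i2 (n + 1))) \<and>
        (\<exists>k. extn_mor C n P E k \<and> k 0 = Add C (fst D ! 0) B (p1 0) (p2 0) \<and>
          k (n + 1) = Idt C A))}"

text \<open>
  The group \<open>Ext\<^sup>n(A, B)\<close> for \<open>n \<ge> 1\<close>. Its zero element is the class of the extensions whose first
  morphism \<open>B \<rightarrow> E\<^sub>1\<close> is a split monomorphism: for \<open>n = 1\<close> the split extensions, and for \<open>n \<ge> 2\<close> the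
  class of \<open>0 \<rightarrow> B \<rightarrow> B \<rightarrow> 0 \<rightarrow> \<dots> \<rightarrow> 0 \<rightarrow> A \<rightarrow> A \<rightarrow> 0\<close>.
\<close>

definition Ext :: "('o, 'm) precat \<Rightarrow> nat \<Rightarrow> 'o \<Rightarrow> 'o \<Rightarrow> ('o list \<times> 'm list) set monoid" where
  "Ext C n A B = \<lparr>carrier = extns C n A B // yoneda_rel C n A B,
    monoid.mult = baer_sum C n A B,
    one = yoneda_rel C n A B `` {E \<in> extns C n A B.
      \<exists>r \<in> Hom C (fst E ! 1) B. Cmp C B (fst E ! 1) B r (snd E ! 0) = Idt C B}\<rparr>"

definition ext_push :: "('o, 'm) precat \<Rightarrow> nat \<Rightarrow> 'o \<Rightarrow> 'o \<Rightarrow> 'o \<Rightarrow> 'm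
    \<Rightarrow> ('o list \<times> 'm list) set \<Rightarrow> ('o list \<times> 'm list) set" where
  "ext_push C n A B B' u c = yoneda_rel C n A B' `` {E' \<in> extns C n A B'.
    \<exists>E \<in> c. \<exists>h. extn_mor C n E E' h \<and> h 0 = u \<and> h (n + 1) = Idt C A}"

definition ext_pull :: "('o, 'm) precat \<Rightarrow> nat \<Rightarrow> 'o \<Rightarrow> 'o \<Rightarrow> 'o \<Rightarrow> 'm
    \<Rightarrow> ('o list \<times> 'm list) set \<Rightarrow> ('o list \<times> 'm list) set" where
  "ext_pull C n A' A B v c = yoneda_rel C n A' B `` {E' \<in> extns C n A' B.
    \<exists>E \<in> c. \<exists>h. extn_mor C n E' E h \<and> h 0 = Idt C B \<and> h (n + 1) = v}"

definition hereditary_cat :: "('o, 'm) precat \<Rightarrow> bool" where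
  "hereditary_cat C \<longleftrightarrow> abelian_cat C \<and>
    (\<forall>n \<ge> 2. \<forall>A \<in> Ob C. \<forall>B \<in> Ob C. carrier (Ext C n A B) = {\<one>\<^bsub>Ext C n A B\<^esub>})"

text \<open>A bifunctorial isomorphism \<open>Ext\<^sup>1\<^sub>C(Y, X) \<cong> Hom\<^sub>D(F(Y), X)\<close> of abelian groups, for \<open>X \<in> \<X>\<close> and
  \<open>Y \<in> \<Y>\<close>.\<close>

definition ext_hom_iso :: "('o, 'm) precat \<Rightarrow> ('o, 'm) precat \<Rightarrow> 'o set \<Rightarrow> 'o set
    \<Rightarrow> ('o, 'm, 'o, 'm) functr \<Rightarrow> ('o \<Rightarrow> 'o \<Rightarrow> ('o list \<times> 'm list) set \<Rightarrow> 'm) \<Rightarrow> bool" where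
  "ext_hom_iso C D \<X> \<Y> F \<phi> \<longleftrightarrow>
    (\<forall>Y \<in> \<Y>. \<forall>X \<in> \<X>. \<phi> Y X \<in> iso (Ext C 1 Y X) (hom_group D (fob F Y) X)) \<and>
    (\<forall>Y \<in> \<Y>. \<forall>X \<in> \<X>. \<forall>X' \<in> \<X>. \<forall>u \<in> Hom C X X'. \<forall>c \<in> carrier (Ext C 1 Y X).
      \<phi> Y X' (ext_push C 1 Y X X' u c) = Cmp D (fob F Y) X X' u (\<phi> Y X c)) \<and>
    (\<forall>Y' \<in> \<Y>. \<forall>Y \<in> \<Y>. \<forall>X \<in> \<X>. \<forall>v \<in> Hom C Y' Y. \<forall>c \<in> carrier (Ext C 1 Y X).
      \<phi> Y' X (ext_pull C 1 Y' Y X v c) =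
        Cmp D (fob F Y') (fob F Y) X (\<phi> Y X c) (fmp F Y' Y v))"


section \<open>Modules over rings without unit\<close>

text \<open>
  Rings without unit are stored in the library's ring records and modules over them in the library's
  module records; the field \<open>one\<close> of the rings and the fields \<open>mult\<close> and \<open>one\<close> of the modules carry no
  information. A left module \<open>N\<close> over \<open>A\<close> has to satisfy \<open>A N = N\<close>.
\<close>

definition nu_module :: "'r ring \<Rightarrow> ('r, 'u) module \<Rightarrow> bool" where
  "nu_module A N \<longleftrightarrow> abelian_group N \<and>
    (\<forall>a \<in> carrier A. \<forall>x \<in> carrier N. a \<odot>\<^bsub>N\<^esub> x \<in> carrier N) \<and>
    (\<forall>a \<in> carrier A. \<forall>b \<in> carrier A. \<forall>x \<in> carrier N.
      (a \<oplus>\<^bsub>A\<^esub> b) \<odot>\<^bsub>N\<^esub> x = a \<odot>\<^bsub>N\<^esub> x \<oplus>\<^bsub>N\<^esub> b \<odot>\<^bsub>N\<^esub> x) \<and>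
    (\<forall>a \<in> carrier A. \<forall>x \<in> carrier N. \<forall>y \<in> carrier N.
      a \<odot>\<^bsub>N\<^esub> (x \<oplus>\<^bsub>N\<^esub> y) = a \<odot>\<^bsub>N\<^esub> x \<oplus>\<^bsub>N\<^esub> a \<odot>\<^bsub>N\<^esub> y) \<and>
    (\<forall>a \<in> carrier A. \<forall>b \<in> carrier A. \<forall>x \<in> carrier N.
      (a \<otimes>\<^bsub>A\<^esub> b) \<odot>\<^bsub>N\<^esub> x = a \<odot>\<^bsub>N\<^esub> (b \<odot>\<^bsub>N\<^esub> x)) \<and>
    generate (add_monoid N) {a \<odot>\<^bsub>N\<^esub> x | a x. a \<in> carrier A \<and> x \<in> carrier N} = carrier N"

definition nu_submod :: "'r ring \<Rightarrow> ('r, 'u) module \<Rightarrow> 'u set \<Rightarrow> bool" where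
  "nu_submod A N H \<longleftrightarrow> H \<subseteq> carrier N \<and> nu_module A (N\<lparr>carrier := H\<rparr>)"

definition simple_mod :: "'r ring \<Rightarrow> ('r, 'u) module \<Rightarrow> bool" where
  "simple_mod A N \<longleftrightarrow> nu_module A N \<and> carrier N \<noteq> {\<zero>\<^bsub>N\<^esub>} \<and>
    (\<forall>H. nu_submod A N H \<longrightarrow> H = {\<zero>\<^bsub>N\<^esub>} \<or> H = carrier N)"

text \<open>Semi-simple modules: sums of simple submodules.\<close>

definition semisimple_mod :: "'r ring \<Rightarrow> ('r, 'u) module \<Rightarrow> bool" where
  "semisimple_mod A N \<longleftrightarrow> nu_module A N \<and>
    generate (add_monoid N) (\<Union>{H. nu_submod A N H \<and> simple_mod A (N\<lparr>carrier := H\<rparr>)}) = carrier N"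

text \<open>Finite length: existence of a composition series.\<close>

definition finite_length_mod :: "'r ring \<Rightarrow> ('r, 'u) module \<Rightarrow> bool" where
  "finite_length_mod A N \<longleftrightarrow> nu_module A N \<and>
    (\<exists>n Hs. Hs 0 = {\<zero>\<^bsub>N\<^esub>} \<and> Hs n = carrier N \<and> (\<forall>i \<le> n. nu_submod A N (Hs i)) \<and>
      (\<forall>i < n. Hs i \<subset> Hs (Suc i) \<and> \<not> (\<exists>H. nu_submod A N H \<and> Hs i \<subset> H \<and> H \<subset> Hs (Suc i))))"

definition mod_homs ::
  "'r ring \<Rightarrow> ('r, 'u) module \<Rightarrow> ('r, 'v) module \<Rightarrow> ('u \<Rightarrow> 'v) set" where
  "mod_homs A N N' = {f \<in> carrier N \<rightarrow>\<^sub>E carrier N'.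
    (\<forall>x \<in> carrier N. \<forall>y \<in> carrier N. f (x \<oplus>\<^bsub>N\<^esub> y) = f x \<oplus>\<^bsub>N'\<^esub> f y) \<and>
    (\<forall>a \<in> carrier A. \<forall>x \<in> carrier N. f (a \<odot>\<^bsub>N\<^esub> x) = a \<odot>\<^bsub>N'\<^esub> f x)}"

text \<open>The category of the left \<open>A\<close>-modules with property \<open>P\<close> whose underlying set is a subset of the
  type \<open>'u\<close>.\<close>

definition mod_cat ::
  "'r ring \<Rightarrow> (('r, 'u) module \<Rightarrow> bool) \<Rightarrow> (('r, 'u) module, 'u \<Rightarrow> 'u) precat" where
  "mod_cat A P = \<lparr>Ob = {N. nu_module A N \<and> P N},
    Hom = mod_homs A,
    Idt = (\<lambda>N. \<lambda>x \<in> carrier N. x),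
    Cmp = (\<lambda>N N' N'' g f. compose (carrier N) g f),
    Add = (\<lambda>N N' f g. \<lambda>x \<in> carrier N. f x \<oplus>\<^bsub>N'\<^esub> g x),
    Zer = (\<lambda>N N'. \<lambda>x \<in> carrier N. \<zero>\<^bsub>N'\<^esub>)\<rparr>"


section \<open>The rings attached to semi-simple categories\<close>

text \<open>The ring \<open>\<Oplus>\<^sub>S\<^sub>\<in>\<^sub>I End(S)\<^sup>o\<^sup>p\<close>; because of the opposite rings, \<open>r \<cdot> s\<close> has the components
  \<open>s\<^sub>S \<circ> r\<^sub>S\<close>.\<close>

definition simples_ring :: "('o, 'm) precat \<Rightarrow> 'o set \<Rightarrow> ('o \<Rightarrow> 'm) ring" where
  "simples_ring C I =
    \<lparr>carrier = carrier (sum_group I (\<lambda>S. hom_group C S S)),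
     monoid.mult = (\<lambda>r s. \<lambda>S \<in> I. Cmp C S S S (s S) (r S)),
     one = undefined,
     zero = \<one>\<^bsub>sum_group I (\<lambda>S. hom_group C S S)\<^esub>,
     add = mult (sum_group I (\<lambda>S. hom_group C S S))\<rparr>"

text \<open>The left module \<open>\<Oplus>\<^sub>S\<^sub>\<in>\<^sub>I Hom(S, A)\<close> over it.\<close>

definition simples_hom :: "('o, 'm) precat \<Rightarrow> 'o set \<Rightarrow> 'o \<Rightarrow> ('o \<Rightarrow> 'm, 'o \<Rightarrow> 'm) module" where
  "simples_hom C I A =
    \<lparr>carrier = carrier (sum_group I (\<lambda>S. hom_group C S A)),
     monoid.mult = undefined,
     one = undefined,
     zero = \<one>\<^bsub>sum_group I (\<lambda>S. hom_group C S A)\<^esub>,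
     add = mult (sum_group I (\<lambda>S. hom_group C S A)),
     smult = (\<lambda>r f. \<lambda>S \<in> I. Cmp C S S A (f S) (r S))\<rparr>"

definition simples_hom_map ::
  "('o, 'm) precat \<Rightarrow> 'o set \<Rightarrow> 'o \<Rightarrow> 'o \<Rightarrow> 'm \<Rightarrow> ('o \<Rightarrow> 'm) \<Rightarrow> ('o \<Rightarrow> 'm)" where
  "simples_hom_map C I A B u = (\<lambda>f \<in> carrier (simples_hom C I A). \<lambda>S \<in> I. Cmp C S A B u (f S))"

text \<open>
  \<open>D\<close> is the larger category. The functor \<open>\<Phi>\<close> is an equivalence of \<open>D\<close> with the category of all
  semi-simple modules, and it extends \<open>X \<mapsto> \<Oplus>\<^sub>S\<^sub>\<in>\<^sub>I Hom(S, X)\<close> on the subcategory \<open>C\<close>. The values of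
  the latter functor are modules on sets of families of morphisms, not on subsets of \<open>'u\<close>, hence
  extension is understood up to a natural isomorphism \<open>\<theta>\<close>.
\<close>

definition extends_simples_hom :: "('o, 'm) precat \<Rightarrow> ('o, 'm) precat \<Rightarrow> 'o set
    \<Rightarrow> ('o, 'm, ('o \<Rightarrow> 'm, 'u) module, 'u \<Rightarrow> 'u) functr \<Rightarrow> bool" where
  "extends_simples_hom C D I \<Phi> \<longleftrightarrow>
    is_equivalence D (mod_cat (simples_ring C I) (semisimple_mod (simples_ring C I))) \<Phi> \<and>
    (\<exists>\<theta>. (\<forall>X \<in> Ob C.
        \<theta> X \<in> mod_homs (simples_ring C I) (fob \<Phi> X) (simples_hom C I X) \<and>
        bij_betw (\<theta> X) (carrier (fob \<Phi> X)) (carrier (simples_hom C I X))) \<and>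
      (\<forall>X \<in> Ob C. \<forall>X' \<in> Ob C. \<forall>u \<in> Hom C X X'. \<forall>a \<in> carrier (fob \<Phi> X).
        \<theta> X' (fmp \<Phi> X X' u a) = simples_hom_map C I X X' u (\<theta> X a)))"


section \<open>The category of triples\<close>

text \<open>\<open>D\<close> is the target category of \<open>F\<close>, and \<open>\<Y>\<close> is the source category, a full subcategory
  of \<open>C\<close>.\<close>

definition triple_cat :: "('o, 'm) precat \<Rightarrow> ('o, 'm) precat \<Rightarrow> 'o set
    \<Rightarrow> ('o, 'm, 'o, 'm) functr \<Rightarrow> ('o \<times> 'o \<times> 'm, 'm \<times> 'm) precat" where
  "triple_cat C D \<Y> F =
    \<lparr>Ob = {(X, Y, \<eta>). X \<in> Ob D \<and> Y \<in> \<Y> \<and> \<eta> \<in> Hom D (fob F Y) X},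
     Hom = (\<lambda>(X, Y, \<eta>) (X', Y', \<eta>'). {(u, v). u \<in> Hom D X X' \<and> v \<in> Hom C Y Y' \<and>
       Cmp D (fob F Y) X X' u \<eta> = Cmp D (fob F Y) (fob F Y') X' \<eta>' (fmp F Y Y' v)}),
     Idt = (\<lambda>(X, Y, \<eta>). (Idt D X, Idt C Y)),
     Cmp = (\<lambda>(X, Y, \<eta>) (X', Y', \<eta>') (X'', Y'', \<eta>'') (u', v') (u, v).
       (Cmp D X X' X'' u' u, Cmp C Y Y' Y'' v' v)),
     Add = (\<lambda>(X, Y, \<eta>) (X', Y', \<eta>') (u, v) (u', v'). (Add D X X' u u', Add C Y Y' v v')),
     Zer = (\<lambda>(X, Y, \<eta>) (X', Y', \<eta>'). (Zer D X X', Zer C Y Y'))\<rparr>"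

definition triple_subcat :: "('o, 'm) precat \<Rightarrow> ('o, 'm) precat \<Rightarrow> 'o set \<Rightarrow> 'o set
    \<Rightarrow> ('o, 'm, 'o, 'm) functr \<Rightarrow> ('o \<times> 'o \<times> 'm, 'm \<times> 'm) precat" where
  "triple_subcat C D \<X> \<Y> F =
    full_sub (triple_cat C D \<Y> F) {t \<in> Ob (triple_cat C D \<Y> F). fst t \<in> \<X>}"


section \<open>The triangular matrix ring\<close>

text \<open>
  The bimodule \<open>M = \<Oplus>\<^sub>T\<^sub>\<in>\<^sub>J F(D\<^sub>T)\<close>. The left module \<open>D\<^sub>T\<close> corresponds to the simple object \<open>T\<close> under
  \<open>Y \<mapsto> \<Oplus>\<^sub>T\<^sub>'\<^sub>\<in>\<^sub>J Hom(T', Y)\<close>, so \<open>F(D\<^sub>T)\<close>, viewed as a module, is \<open>\<Phi> (F T)\<close>. Right multiplication by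
  \<open>d \<in> D\<^sub>T = End(T)\<^sup>o\<^sup>p\<close> sends \<open>f\<close> to \<open>d \<circ> f\<close>, i.e. it corresponds to the endomorphism \<open>d\<close> of \<open>T\<close>; hence
  \<open>d\<close> acts from the right on \<open>\<Phi> (F T)\<close> by \<open>\<Phi> (F d)\<close>.
\<close>

definition simples_bimod :: "'o set \<Rightarrow> ('o, 'm, 'o, 'm) functr
    \<Rightarrow> ('o, 'm, ('o \<Rightarrow> 'm, 'u) module, 'u \<Rightarrow> 'u) functr \<Rightarrow> ('o \<Rightarrow> 'm, 'o \<Rightarrow> 'u) module" where
  "simples_bimod J F \<Phi> =
    \<lparr>carrier = carrier (sum_group J (\<lambda>T. add_monoid (fob \<Phi> (fob F T)))),
     monoid.mult = undefined,
     one = undefined,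
     zero = \<one>\<^bsub>sum_group J (\<lambda>T. add_monoid (fob \<Phi> (fob F T)))\<^esub>,
     add = mult (sum_group J (\<lambda>T. add_monoid (fob \<Phi> (fob F T)))),
     smult = (\<lambda>s m. \<lambda>T \<in> J. s \<odot>\<^bsub>fob \<Phi> (fob F T)\<^esub> m T)\<rparr>"

definition simples_bimod_right :: "'o set \<Rightarrow> ('o, 'm, 'o, 'm) functr
    \<Rightarrow> ('o, 'm, ('o \<Rightarrow> 'm, 'u) module, 'u \<Rightarrow> 'u) functr
    \<Rightarrow> ('o \<Rightarrow> 'u) \<Rightarrow> ('o \<Rightarrow> 'm) \<Rightarrow> ('o \<Rightarrow> 'u)" where
  "simples_bimod_right J F \<Phi> m r =
    (\<lambda>T \<in> J. fmp \<Phi> (fob F T) (fob F T) (fmp F T T (r T)) (m T))"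

text \<open>The ring of lower triangular matrices with diagonal entries \<open>r \<in> A\<close>, \<open>s \<in> B\<close> and off-diagonal
  entry \<open>m \<in> M\<close>, written \<open>(r, m, s)\<close>, for a \<open>B\<close>-\<open>A\<close>-bimodule \<open>M\<close> with right action \<open>ra\<close>.\<close>

definition tri_ring :: "'a ring \<Rightarrow> ('b, 'c) module \<Rightarrow> ('c \<Rightarrow> 'a \<Rightarrow> 'c) \<Rightarrow> 'b ring
    \<Rightarrow> ('a \<times> 'c \<times> 'b) ring" where
  "tri_ring A M ra B =
    \<lparr>carrier = carrier A \<times> carrier M \<times> carrier B,
     monoid.mult = (\<lambda>(r, m, s) (r', m', s').
       (r \<otimes>\<^bsub>A\<^esub> r', ra m r' \<oplus>\<^bsub>M\<^esub> s \<odot>\<^bsub>M\<^esub> m', s \<otimes>\<^bsub>B\<^esub> s')),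
     one = undefined,
     zero = (\<zero>\<^bsub>A\<^esub>, \<zero>\<^bsub>M\<^esub>, \<zero>\<^bsub>B\<^esub>),
     add = (\<lambda>(r, m, s) (r', m', s'). (r \<oplus>\<^bsub>A\<^esub> r', m \<oplus>\<^bsub>M\<^esub> m', s \<oplus>\<^bsub>B\<^esub> s'))\<rparr>"

definition restrict_left :: "('b, 'c) module \<Rightarrow> 'b ring \<Rightarrow> ('a \<times> 'c \<times> 'b, 'u) module \<Rightarrow> 'u set
    \<Rightarrow> ('a, 'u) module" where
  "restrict_left M B Z H = \<lparr>carrier = H, monoid.mult = undefined, one = undefined,
    zero = \<zero>\<^bsub>Z\<^esub>, add = add Z, smult = (\<lambda>r z. (r, \<zero>\<^bsub>M\<^esub>, \<zero>\<^bsub>B\<^esub>) \<odot>\<^bsub>Z\<^esub> z)\<rparr>"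

definition restrict_right :: "'a ring \<Rightarrow> ('b, 'c) module \<Rightarrow> ('a \<times> 'c \<times> 'b, 'u) module \<Rightarrow> 'u set
    \<Rightarrow> ('b, 'u) module" where
  "restrict_right A M Z H = \<lparr>carrier = H, monoid.mult = undefined, one = undefined,
    zero = \<zero>\<^bsub>Z\<^esub>, add = add Z, smult = (\<lambda>s z. (\<zero>\<^bsub>A\<^esub>, \<zero>\<^bsub>M\<^esub>, s) \<odot>\<^bsub>Z\<^esub> z)\<rparr>"

text \<open>
  \<open>Z\<close> is the internal direct sum of \<open>X\<close> and \<open>Y\<close> as a module over the diagonal \<open>A \<oplus> B\<close>, where \<open>X\<close> is a
  semi-simple \<open>B\<close>-module on which \<open>A\<close> acts as zero, and \<open>Y\<close> is an \<open>A\<close>-module of finite length on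
  which \<open>B\<close> acts as zero. \<open>Y\<close> need not be stable under \<open>M\<close>.
\<close>

definition locally_finite_mod ::
  "'a ring \<Rightarrow> ('b, 'c) module \<Rightarrow> 'b ring \<Rightarrow> ('a \<times> 'c \<times> 'b, 'u) module \<Rightarrow> bool" where
  "locally_finite_mod A M B Z \<longleftrightarrow>
    (\<exists>X Y. X \<subseteq> carrier Z \<and> Y \<subseteq> carrier Z \<and>
      (\<forall>z \<in> carrier Z. \<exists>!(x, y). x \<in> X \<and> y \<in> Y \<and> z = x \<oplus>\<^bsub>Z\<^esub> y) \<and>
      semisimple_mod B (restrict_right A M Z X) \<and>
      finite_length_mod A (restrict_left M B Z Y) \<and>
      (\<forall>r \<in> carrier A. \<forall>x \<in> X. (r, \<zero>\<^bsub>M\<^esub>, \<zero>\<^bsub>B\<^esub>) \<odot>\<^bsub>Z\<^esub> x = \<zero>\<^bsub>Z\<^esub>) \<and>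
      (\<forall>s \<in> carrier B. \<forall>y \<in> Y. (\<zero>\<^bsub>A\<^esub>, \<zero>\<^bsub>M\<^esub>, s) \<odot>\<^bsub>Z\<^esub> y = \<zero>\<^bsub>Z\<^esub>))"

end

theory Submission
  imports Defs
begin

text \<open>
  In a semi-simple abelian category every morphism \<open>u\<close> has a quasi-inverse \<open>w\<close>, that is,
  \<open>u \<circ> w \<circ> u = u\<close>. Kernels and cokernels of triples are therefore formed componentwise. Given a
  morphism \<open>E\<^sub>1 \<rightarrow> E\<^sub>2\<close> of triples with cokernel \<open>L\<close>, a quasi-inverse yields an extension
  \<open>G\<close> of \<open>L\<close> by \<open>E\<^sub>1\<close> with a morphism \<open>G \<rightarrow> E\<^sub>2\<close> over \<open>L\<close> that restricts to the given one on \<open>E\<^sub>1\<close>.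
  Inserting \<open>G\<close> into an \<open>n\<close>-extension with \<open>n \<ge> 2\<close> splits off its left end, so \<open>Ext\<^sup>n = 0\<close>.
  The triple \<open>(F Y \<oplus> X, Y, inclusion)\<close> is projective and maps onto \<open>(X, Y, \<eta>)\<close>.

  The module of \<open>(X, Y, \<eta>)\<close> is \<open>\<Phi> X \<oplus> (\<Oplus>\<^sub>T Hom(T, Y))\<close>. Because \<open>\<Phi> \<circ> F\<close> is additive and \<open>Y\<close> is a finite
  direct sum of simple objects, \<open>\<Phi> (F Y)\<close> is the tensor product of \<open>M\<close> and \<open>\<Oplus>\<^sub>T Hom(T, Y)\<close> over the
  diagonal ring, so that \<open>\<eta>\<close> amounts to the action of \<open>M\<close>. Conversely, the local units of \<open>R\<close> decompose
  every \<open>R\<close>-module into its two diagonal parts.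
\<close>

section \<open>Preadditive and abelian categories\<close>

text \<open>Two obstacles shape the development. None of the three rings is assumed to have a unit,
  so every argument with an identity matrix is made with the idempotents \<open>unit_on K\<close>
  for finite \<open>K\<close>: they fix any given element, separate the two diagonal parts of a
  module and supply negatives in submodules. Moreover, the modules of \<open>mod_cat\<close> have to
  live on subsets of the type \<open>'u\<close>, whereas the natural module of a triple consists of
  pairs of an element and a family of morphisms. It is copied into \<open>'u\<close> along a chosen
  injection, which exists by the cardinality hypotheses.

  Both categories of triples are treated at once: the locale \<open>triple_data\<close> carries a
  Serre subcategory \<open>P\<close> of the target of \<open>F\<close>, specialised at the end to
  \<open>\<X>\<close> and to all objects. The functor to modules does not mention \<open>P\<close>,
  so the two equivalences agree on the smaller category without any correction.\<close>

definition Neg :: "('o, 'm) precat \<Rightarrow> 'o \<Rightarrow> 'o \<Rightarrow> 'm \<Rightarrow> 'm" where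
  "Neg C A B f = inv\<^bsub>hom_group C A B\<^esub> f"

context preadditive_cat
begin

declare id_in_hom [simp] cmp_in_hom [simp] id_left [simp] id_right [simp]

lemmas cmp_assoc' = cmp_assoc [symmetric]

lemma zer_in_hom [simp]: "\<lbrakk>A \<in> Ob C; B \<in> Ob C\<rbrakk> \<Longrightarrow> Zer C A B \<in> Hom C A B"
  using comm_group.axioms(2)[OF hom_comm_group, THEN group.is_monoid, THEN monoid.one_closed]
  by (auto simp: hom_group_def)

lemma add_in_hom [simp]:
  "\<lbrakk>A \<in> Ob C; B \<in> Ob C; f \<in> Hom C A B; g \<in> Hom C A B\<rbrakk> \<Longrightarrow> Add C A B f g \<in> Hom C A B"
  using comm_group.axioms(2)[OF hom_comm_group, THEN group.is_monoid, THEN monoid.m_closed]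
  by (auto simp: hom_group_def)

lemma add_assoc:
  "\<lbrakk>A \<in> Ob C; B \<in> Ob C; f \<in> Hom C A B; g \<in> Hom C A B; h \<in> Hom C A B\<rbrakk>
    \<Longrightarrow> Add C A B (Add C A B f g) h = Add C A B f (Add C A B g h)"
  using comm_group.axioms(2)[OF hom_comm_group, THEN group.is_monoid, THEN monoid.m_assoc]
  by (fastforce simp: hom_group_def)

lemma add_commute:
  "\<lbrakk>A \<in> Ob C; B \<in> Ob C; f \<in> Hom C A B; g \<in> Hom C A B\<rbrakk> \<Longrightarrow> Add C A B f g = Add C A B g f"
  using comm_monoid.m_comm[OF comm_group.axioms(1), OF hom_comm_group, of A B f g]
  by (simp add: hom_group_def)

lemma add_left_commute:
  "\<lbrakk>A \<in> Ob C; B \<in> Ob C; f \<in> Hom C A B; g \<in> Hom C A B; h \<in> Hom C A B\<rbrakk>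
    \<Longrightarrow> Add C A B f (Add C A B g h) = Add C A B g (Add C A B f h)"
  by (metis add_assoc add_commute)

lemmas add_ac = add_assoc add_commute add_left_commute

lemma add_zero_left [simp]:
  "\<lbrakk>A \<in> Ob C; B \<in> Ob C; f \<in> Hom C A B\<rbrakk> \<Longrightarrow> Add C A B (Zer C A B) f = f"
  using comm_group.axioms(2)[OF hom_comm_group, THEN group.is_monoid, THEN monoid.l_one]
  by (fastforce simp: hom_group_def)

lemma add_zero_right [simp]:
  "\<lbrakk>A \<in> Ob C; B \<in> Ob C; f \<in> Hom C A B\<rbrakk> \<Longrightarrow> Add C A B f (Zer C A B) = f"
  by (metis add_commute add_zero_left zer_in_hom)

lemma neg_in_hom [simp]:
  "\<lbrakk>A \<in> Ob C; B \<in> Ob C; f \<in> Hom C A B\<rbrakk> \<Longrightarrow> Neg C A B f \<in> Hom C A B"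
  using comm_group.axioms(2)[OF hom_comm_group, THEN group.inv_closed, of A B f]
  by (auto simp: hom_group_def Neg_def)

lemma add_neg [simp]:
  "\<lbrakk>A \<in> Ob C; B \<in> Ob C; f \<in> Hom C A B\<rbrakk> \<Longrightarrow> Add C A B f (Neg C A B f) = Zer C A B"
  using comm_group.axioms(2)[OF hom_comm_group, THEN group.r_inv, of A B f]
  by (auto simp: hom_group_def Neg_def)

lemma neg_add [simp]:
  "\<lbrakk>A \<in> Ob C; B \<in> Ob C; f \<in> Hom C A B\<rbrakk> \<Longrightarrow> Add C A B (Neg C A B f) f = Zer C A B"
  by (metis add_commute add_neg neg_in_hom)

lemma add_left_cancel:
  "\<lbrakk>A \<in> Ob C; B \<in> Ob C; f \<in> Hom C A B; g \<in> Hom C A B; h \<in> Hom C A B\<rbrakk>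
    \<Longrightarrow> Add C A B f g = Add C A B f h \<longleftrightarrow> g = h"
  by (metis add_assoc add_zero_left neg_add neg_in_hom)

lemma add_neg_eq_zero_iff:
  "\<lbrakk>A \<in> Ob C; B \<in> Ob C; f \<in> Hom C A B; g \<in> Hom C A B\<rbrakk>
    \<Longrightarrow> Add C A B f (Neg C A B g) = Zer C A B \<longleftrightarrow> f = g"
  by (metis add_assoc add_zero_left add_zero_right neg_add neg_in_hom add_neg)

lemma neg_zero [simp]: "\<lbrakk>A \<in> Ob C; B \<in> Ob C\<rbrakk> \<Longrightarrow> Neg C A B (Zer C A B) = Zer C A B"
  by (metis add_neg add_zero_left neg_in_hom zer_in_hom)

lemma add_self_zero:
  "\<lbrakk>A \<in> Ob C; B \<in> Ob C; f \<in> Hom C A B; Add C A B f f = f\<rbrakk> \<Longrightarrow> f = Zer C A B"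
  by (metis add_left_cancel add_zero_right zer_in_hom)

lemma cmp_zero_left [simp]:
  assumes "A \<in> Ob C" "B \<in> Ob C" "D \<in> Ob C" "f \<in> Hom C A B"
  shows "Cmp C A B D (Zer C B D) f = Zer C A D"
  by (rule add_self_zero) (use assms in \<open>simp_all add: cmp_add_left [symmetric]\<close>)

lemma cmp_zero_right [simp]:
  assumes "A \<in> Ob C" "B \<in> Ob C" "D \<in> Ob C" "g \<in> Hom C B D"
  shows "Cmp C A B D g (Zer C A B) = Zer C A D"
  by (rule add_self_zero) (use assms in \<open>simp_all add: cmp_add_right [symmetric]\<close>)

lemma cmp_neg_left:
  assumes "A \<in> Ob C" "B \<in> Ob C" "D \<in> Ob C" "f \<in> Hom C A B" "g \<in> Hom C B D"
  shows "Cmp C A B D (Neg C B D g) f = Neg C A D (Cmp C A B D g f)"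
proof -
  have "Add C A D (Cmp C A B D g f) (Cmp C A B D (Neg C B D g) f)
      = Add C A D (Cmp C A B D g f) (Neg C A D (Cmp C A B D g f))"
    using assms by (simp add: cmp_add_left [symmetric])
  then show ?thesis using assms by (subst (asm) add_left_cancel) simp_all
qed

lemma cmp_neg_right:
  assumes "A \<in> Ob C" "B \<in> Ob C" "D \<in> Ob C" "f \<in> Hom C A B" "g \<in> Hom C B D"
  shows "Cmp C A B D g (Neg C A B f) = Neg C A D (Cmp C A B D g f)"
proof -
  have "Add C A D (Cmp C A B D g f) (Cmp C A B D g (Neg C A B f))
      = Add C A D (Cmp C A B D g f) (Neg C A D (Cmp C A B D g f))"
    using assms by (simp add: cmp_add_right [symmetric])
  then show ?thesis using assms by (subst (asm) add_left_cancel) simp_all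
qed

text \<open>With a known composite as first premise this becomes a rewrite rule for that composite
  inside a longer one, once \<open>cmp_assoc'\<close> has moved all brackets to the right.\<close>

lemma cmp_reduce:
  assumes "Cmp C A B D g f = e" "A \<in> Ob C" "B \<in> Ob C" "D \<in> Ob C" "f \<in> Hom C A B" "g \<in> Hom C B D"
    and "T \<in> Ob C" "t \<in> Hom C T A"
  shows "Cmp C T B D g (Cmp C T A B f t) = Cmp C T A D e t"
  using assms cmp_assoc by metis

text \<open>In a preadditive category the cancellation of two morphisms becomes a test on their
  difference.\<close>

lemma mono_iff:
  "mono_mor C A B f \<longleftrightarrow> A \<in> Ob C \<and> B \<in> Ob C \<and> f \<in> Hom C A B \<and>
    (\<forall>T \<in> Ob C. \<forall>t \<in> Hom C T A. Cmp C T A B f t = Zer C T B \<longrightarrow> t = Zer C T A)" (is "_ \<longleftrightarrow> ?R")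
proof
  assume "mono_mor C A B f"
  then show ?R unfolding mono_mor_def by (metis cmp_zero_right zer_in_hom)
next
  assume R: ?R
  show "mono_mor C A B f" unfolding mono_mor_def
  proof (intro conjI ballI impI)
    fix T s t assume st: "T \<in> Ob C" "s \<in> Hom C T A" "t \<in> Hom C T A" "Cmp C T A B f s = Cmp C T A B f t"
    have "Cmp C T A B f (Add C T A s (Neg C T A t)) = Zer C T B"
      using R st by (simp add: cmp_add_right cmp_neg_right)
    then have "Add C T A s (Neg C T A t) = Zer C T A" using R st by simp
    then show "s = t" using R st by (simp add: add_neg_eq_zero_iff)
  qed (use R in auto)
qed

lemma epi_iff:
  "epi_mor C A B f \<longleftrightarrow> A \<in> Ob C \<and> B \<in> Ob C \<and> f \<in> Hom C A B \<and>
    (\<forall>T \<in> Ob C. \<forall>t \<in> Hom C B T. Cmp C A B T t f = Zer C A T \<longrightarrow> t = Zer C B T)" (is "_ \<longleftrightarrow> ?R")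
proof
  assume "epi_mor C A B f"
  then show ?R unfolding epi_mor_def by (metis cmp_zero_left zer_in_hom)
next
  assume R: ?R
  show "epi_mor C A B f" unfolding epi_mor_def
  proof (intro conjI ballI impI)
    fix T s t assume st: "T \<in> Ob C" "s \<in> Hom C B T" "t \<in> Hom C B T" "Cmp C A B T s f = Cmp C A B T t f"
    have "Cmp C A B T (Add C B T s (Neg C B T t)) f = Zer C A T"
      using R st by (simp add: cmp_add_left cmp_neg_left)
    then have "Add C B T s (Neg C B T t) = Zer C B T" using R st by simp
    then show "s = t" using R st by (simp add: add_neg_eq_zero_iff)
  qed (use R in auto)
qed

lemma monoI_retraction:
  assumes "A \<in> Ob C" "B \<in> Ob C" "f \<in> Hom C A B" "r \<in> Hom C B A" "Cmp C A B A r f = Idt C A"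
  shows "mono_mor C A B f"
  unfolding mono_iff using assms by (metis cmp_reduce cmp_zero_right id_left)

lemma epiI_section:
  assumes "A \<in> Ob C" "B \<in> Ob C" "f \<in> Hom C A B" "s \<in> Hom C B A" "Cmp C B A B f s = Idt C B"
  shows "epi_mor C A B f"
  unfolding epi_iff
proof (intro conjI ballI impI)
  fix T t assume t: "T \<in> Ob C" "t \<in> Hom C B T" "Cmp C A B T t f = Zer C A T"
  have "t = Cmp C B B T t (Cmp C B A B f s)" using assms t by simp
  also have "\<dots> = Cmp C B A T (Cmp C A B T t f) s" using assms t by (subst cmp_assoc) auto
  also have "\<dots> = Zer C B T" using assms t by simp
  finally show "t = Zer C B T" .
qed (use assms in auto)

lemma is_kerD:
  assumes "is_ker C A B f K k"
  shows "A \<in> Ob C" "B \<in> Ob C" "K \<in> Ob C" "f \<in> Hom C A B" "k \<in> Hom C K A"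
    "Cmp C K A B f k = Zer C K B"
  using assms by (auto simp: is_ker_def)

lemma is_ker_factor:
  assumes "is_ker C A B f K k" "T \<in> Ob C" "t \<in> Hom C T A" "Cmp C T A B f t = Zer C T B"
  obtains s where "s \<in> Hom C T K" "Cmp C T K A k s = t"
  using assms unfolding is_ker_def by metis

lemma is_ker_mono: "is_ker C A B f K k \<Longrightarrow> mono_mor C K A k"
  unfolding mono_iff
proof (intro conjI ballI impI)
  assume k: "is_ker C A B f K k"
  note kD = is_kerD[OF k]
  fix T t assume t: "T \<in> Ob C" "t \<in> Hom C T K" "Cmp C T K A k t = Zer C T A"
  have "\<exists>!s. s \<in> Hom C T K \<and> Cmp C T K A k s = Zer C T A"
    using k t kD unfolding is_ker_def by simp
  then show "t = Zer C T K" using t kD by (metis cmp_zero_right zer_in_hom)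
qed (auto simp: is_ker_def)

lemma is_kerI:
  assumes "mono_mor C K A k" "B \<in> Ob C" "f \<in> Hom C A B" "Cmp C K A B f k = Zer C K B"
    and "\<And>T t. \<lbrakk>T \<in> Ob C; t \<in> Hom C T A; Cmp C T A B f t = Zer C T B\<rbrakk>
      \<Longrightarrow> \<exists>s \<in> Hom C T K. Cmp C T K A k s = t"
  shows "is_ker C A B f K k"
  unfolding is_ker_def
proof (intro conjI ballI impI)
  fix T t assume "T \<in> Ob C" "t \<in> Hom C T A" "Cmp C T A B f t = Zer C T B"
  then show "\<exists>!s. s \<in> Hom C T K \<and> Cmp C T K A k s = t"
    using assms(5) assms(1) unfolding mono_mor_def by metis
qed (use assms in \<open>auto simp: mono_mor_def\<close>)

lemma is_cokerD:
  assumes "is_coker C A B f Q q"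
  shows "A \<in> Ob C" "B \<in> Ob C" "Q \<in> Ob C" "f \<in> Hom C A B" "q \<in> Hom C B Q"
    "Cmp C A B Q q f = Zer C A Q"
  using assms by (auto simp: is_coker_def)

lemma is_coker_factor:
  assumes "is_coker C A B f Q q" "T \<in> Ob C" "t \<in> Hom C B T" "Cmp C A B T t f = Zer C A T"
  obtains s where "s \<in> Hom C Q T" "Cmp C B Q T s q = t"
  using assms unfolding is_coker_def by metis

lemma is_coker_epi: "is_coker C A B f Q q \<Longrightarrow> epi_mor C B Q q"
  unfolding epi_iff
proof (intro conjI ballI impI)
  assume k: "is_coker C A B f Q q"
  note kD = is_cokerD[OF k]
  fix T t assume t: "T \<in> Ob C" "t \<in> Hom C Q T" "Cmp C B Q T t q = Zer C B T"
  have "\<exists>!s. s \<in> Hom C Q T \<and> Cmp C B Q T s q = Zer C B T"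
    using k t kD unfolding is_coker_def by simp
  then show "t = Zer C Q T" using t kD by (metis cmp_zero_left zer_in_hom)
qed (auto simp: is_coker_def)

lemma is_cokerI:
  assumes "epi_mor C B Q q" "A \<in> Ob C" "f \<in> Hom C A B" "Cmp C A B Q q f = Zer C A Q"
    and "\<And>T t. \<lbrakk>T \<in> Ob C; t \<in> Hom C B T; Cmp C A B T t f = Zer C A T\<rbrakk>
      \<Longrightarrow> \<exists>s \<in> Hom C Q T. Cmp C B Q T s q = t"
  shows "is_coker C A B f Q q"
  unfolding is_coker_def
proof (intro conjI ballI impI)
  fix T t assume "T \<in> Ob C" "t \<in> Hom C B T" "Cmp C A B T t f = Zer C A T"
  then show "\<exists>!s. s \<in> Hom C Q T \<and> Cmp C B Q T s q = t"
    using assms(5) assms(1) unfolding epi_mor_def by metis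
qed (use assms in \<open>auto simp: epi_mor_def\<close>)

lemma monoD_zero:
  "\<lbrakk>mono_mor C A B f; T \<in> Ob C; t \<in> Hom C T A; Cmp C T A B f t = Zer C T B\<rbrakk> \<Longrightarrow> t = Zer C T A"
  by (simp add: mono_iff)

lemma epiD_zero:
  "\<lbrakk>epi_mor C A B f; T \<in> Ob C; t \<in> Hom C B T; Cmp C A B T t f = Zer C A T\<rbrakk> \<Longrightarrow> t = Zer C B T"
  by (simp add: epi_iff)

lemma monoD:
  assumes "mono_mor C A B f"
  shows "A \<in> Ob C" "B \<in> Ob C" "f \<in> Hom C A B"
  using assms by (auto simp: mono_mor_def)

lemma epiD:
  assumes "epi_mor C A B f"
  shows "A \<in> Ob C" "B \<in> Ob C" "f \<in> Hom C A B"
  using assms by (auto simp: epi_mor_def)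

lemma epi_cmp:
  assumes "epi_mor C A B f" "epi_mor C B D g"
  shows "epi_mor C A D (Cmp C A B D g f)"
  unfolding epi_iff using epiD[OF assms(1)] epiD[OF assms(2)] epiD_zero[OF assms(1)] epiD_zero[OF assms(2)]
  by (auto simp: cmp_assoc)

lemma epi_of_epi_cmp:
  assumes "epi_mor C A D (Cmp C A B D g f)" "f \<in> Hom C A B" "g \<in> Hom C B D" "B \<in> Ob C"
  shows "epi_mor C B D g"
  unfolding epi_iff using epiD[OF assms(1)] epiD_zero[OF assms(1)] assms
  by (auto simp: cmp_assoc)

text \<open>\<open>h\<close> kills \<open>f\<close>, so it factors through the cokernel
  \<open>q\<close>. A morphism killed by \<open>q\<close> is therefore killed by \<open>h\<close>
  and factors through the kernel \<open>f\<close> of \<open>h\<close>.\<close>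

lemma is_ker_of_coker:
  assumes m: "is_ker C B E h A f" and q: "is_coker C A B f Q q"
  shows "is_ker C B Q q A f"
proof (rule is_kerI)
  note mD = is_kerD[OF m] and qD = is_cokerD[OF q]
  obtain h' where h': "h' \<in> Hom C Q E" "Cmp C B Q E h' q = h"
    using is_coker_factor[OF q] mD by metis
  fix T t assume t: "T \<in> Ob C" "t \<in> Hom C T B" "Cmp C T B Q q t = Zer C T Q"
  have "Cmp C T B E h t = Zer C T E"
    unfolding h'(2)[symmetric] using h'(1) t mD qD by (simp add: cmp_assoc')
  then show "\<exists>s\<in>Hom C T A. Cmp C T A B f s = t" using is_ker_factor[OF m] t by metis
qed (use is_cokerD[OF q] is_ker_mono[OF m] in auto)

lemma is_coker_of_ker:
  assumes m: "is_coker C E A h B f" and k: "is_ker C A B f K k"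
  shows "is_coker C K A k B f"
proof (rule is_cokerI)
  note mD = is_cokerD[OF m] and kD = is_kerD[OF k]
  obtain h' where h': "h' \<in> Hom C E K" "Cmp C E K A k h' = h"
    using is_ker_factor[OF k] mD by metis
  fix T t assume t: "T \<in> Ob C" "t \<in> Hom C A T" "Cmp C K A T t k = Zer C K T"
  have "Cmp C E A T t h = Zer C E T"
    unfolding h'(2)[symmetric] using h'(1) t mD kD by (simp add: cmp_assoc)
  then show "\<exists>s\<in>Hom C B T. Cmp C A B T s f = t" using is_coker_factor[OF m] t by metis
qed (use is_kerD[OF k] is_coker_epi[OF m] in auto)

lemma is_ker_mono_cmp:
  assumes "is_ker C A B f K k" "mono_mor C B D m"
  shows "is_ker C A D (Cmp C A B D m f) K k"
proof (rule is_kerI)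
  note kD = is_kerD[OF assms(1)] and mD = monoD[OF assms(2)]
  show "Cmp C K A D (Cmp C A B D m f) k = Zer C K D" using kD mD by (simp add: cmp_assoc')
  fix T t assume t: "T \<in> Ob C" "t \<in> Hom C T A" "Cmp C T A D (Cmp C A B D m f) t = Zer C T D"
  have "Cmp C T A B f t = Zer C T B"
    by (rule monoD_zero[OF assms(2)]) (use t kD mD in \<open>simp_all add: cmp_assoc'\<close>)
  then show "\<exists>s\<in>Hom C T K. Cmp C T K A k s = t" using is_ker_factor[OF assms(1)] t by metis
qed (use is_kerD[OF assms(1)] monoD[OF assms(2)] is_ker_mono[OF assms(1)] in auto)

lemma is_coker_epi_cmp:
  assumes "is_coker C A B f Q q" "epi_mor C E A e"
  shows "is_coker C E B (Cmp C E A B f e) Q q"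
proof (rule is_cokerI)
  note kD = is_cokerD[OF assms(1)] and mD = epiD[OF assms(2)]
  show "Cmp C E B Q q (Cmp C E A B f e) = Zer C E Q" using kD mD by (simp add: cmp_assoc)
  fix T t assume t: "T \<in> Ob C" "t \<in> Hom C B T" "Cmp C E B T t (Cmp C E A B f e) = Zer C E T"
  have "Cmp C A B T t f = Zer C A T"
    by (rule epiD_zero[OF assms(2)]) (use t kD mD in \<open>simp_all add: cmp_assoc\<close>)
  then show "\<exists>s\<in>Hom C Q T. Cmp C B Q T s q = t" using is_coker_factor[OF assms(1)] t by metis
qed (use is_cokerD[OF assms(1)] epiD[OF assms(2)] is_coker_epi[OF assms(1)] in auto)

lemma biprodD:
  assumes "is_biprod C A B P i1 i2 p1 p2"
  shows "A \<in> Ob C" "B \<in> Ob C" "P \<in> Ob C"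
    "i1 \<in> Hom C A P" "i2 \<in> Hom C B P" "p1 \<in> Hom C P A" "p2 \<in> Hom C P B"
    "Cmp C A P A p1 i1 = Idt C A" "Cmp C B P B p2 i2 = Idt C B"
    "Cmp C A P B p2 i1 = Zer C A B" "Cmp C B P A p1 i2 = Zer C B A"
    "Add C P P (Cmp C P A P i1 p1) (Cmp C P B P i2 p2) = Idt C P"
  using assms unfolding is_biprod_def by auto

lemma biprod_decomp:
  assumes "is_biprod C A B P i1 i2 p1 p2" "T \<in> Ob C" "t \<in> Hom C T P"
  shows "Add C T P (Cmp C T A P i1 (Cmp C T P A p1 t)) (Cmp C T B P i2 (Cmp C T P B p2 t)) = t"
proof -
  note D = biprodD[OF assms(1)]
  have "t = Cmp C T P P (Add C P P (Cmp C P A P i1 p1) (Cmp C P B P i2 p2)) t"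
    using D assms by simp
  also have "\<dots> = Add C T P (Cmp C T A P i1 (Cmp C T P A p1 t)) (Cmp C T B P i2 (Cmp C T P B p2 t))"
    using D(1-7) assms(2,3) by (subst cmp_add_left) (auto simp: cmp_assoc')
  finally show ?thesis by simp
qed

lemma biprod_codecomp:
  assumes "is_biprod C A B P i1 i2 p1 p2" "T \<in> Ob C" "t \<in> Hom C P T"
  shows "Add C P T (Cmp C P A T (Cmp C A P T t i1) p1) (Cmp C P B T (Cmp C B P T t i2) p2) = t"
proof -
  note D = biprodD[OF assms(1)]
  have "t = Cmp C P P T t (Add C P P (Cmp C P A P i1 p1) (Cmp C P B P i2 p2))"
    using D assms by simp
  also have "\<dots> = Add C P T (Cmp C P A T (Cmp C A P T t i1) p1) (Cmp C P B T (Cmp C B P T t i2) p2)"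
    using D(1-7) assms(2,3) by (subst cmp_add_right) (auto simp: cmp_assoc')
  finally show ?thesis by simp
qed

lemma biprod_eqI:
  assumes "is_biprod C A B P i1 i2 p1 p2" "T \<in> Ob C" "s \<in> Hom C P T" "t \<in> Hom C P T"
    and "Cmp C A P T s i1 = Cmp C A P T t i1" "Cmp C B P T s i2 = Cmp C B P T t i2"
  shows "s = t"
  using biprod_codecomp[OF assms(1,2,3)] biprod_codecomp[OF assms(1,2,4)] assms(5,6) by metis

lemma biprod_ker_coker:
  assumes "is_biprod C A B P i1 i2 p1 p2"
  shows "is_ker C P B p2 A i1" "is_coker C A P i1 B p2"
proof -
  note D = biprodD[OF assms(1)]
  show "is_ker C P B p2 A i1"
  proof (rule is_kerI)
    show "mono_mor C A P i1" by (rule monoI_retraction[OF _ _ _ _ D(8)]) (use D in auto)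
    fix T t assume t: "T \<in> Ob C" "t \<in> Hom C T P" "Cmp C T P B p2 t = Zer C T B"
    then have "Cmp C T A P i1 (Cmp C T P A p1 t) = t" using biprod_decomp[OF assms t(1,2)] D by simp
    then show "\<exists>s\<in>Hom C T A. Cmp C T A P i1 s = t" using D t by (meson cmp_in_hom)
  qed (use D in auto)
  show "is_coker C A P i1 B p2"
  proof (rule is_cokerI)
    show "epi_mor C P B p2" by (rule epiI_section[OF _ _ _ _ D(9)]) (use D in auto)
    fix T t assume t: "T \<in> Ob C" "t \<in> Hom C P T" "Cmp C A P T t i1 = Zer C A T"
    then have "Cmp C P B T (Cmp C B P T t i2) p2 = t" using biprod_codecomp[OF assms t(1,2)] D by simp
    then show "\<exists>s\<in>Hom C B T. Cmp C P B T s p2 = t" using D t by (meson cmp_in_hom)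
  qed (use D in auto)
qed

text \<open>This form is an equation between morphisms, which can be checked componentwise and is
  preserved by additive functors.\<close>

lemma zero_obj_iff: "zero_obj C Z \<longleftrightarrow> Z \<in> Ob C \<and> Idt C Z = Zer C Z Z"
proof
  assume "zero_obj C Z"
  then show "Z \<in> Ob C \<and> Idt C Z = Zer C Z Z" unfolding zero_obj_def using id_in_hom[of Z] zer_in_hom[of Z Z] by blast
next
  assume Z: "Z \<in> Ob C \<and> Idt C Z = Zer C Z Z"
  have "f = Zer C Z A" if "A \<in> Ob C" "f \<in> Hom C Z A" for A f
    using Z that by (metis cmp_zero_right id_right)
  moreover have "f = Zer C A Z" if "A \<in> Ob C" "f \<in> Hom C A Z" for A f
    using Z that by (metis cmp_zero_left id_left)
  ultimately show "zero_obj C Z" unfolding zero_obj_def using Z by (metis zer_in_hom)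
qed

lemma zero_obj_from: "\<lbrakk>zero_obj C Z; A \<in> Ob C; f \<in> Hom C Z A\<rbrakk> \<Longrightarrow> f = Zer C Z A"
  unfolding zero_obj_def using zer_in_hom[of Z A] by blast

lemma zero_obj_to: "\<lbrakk>zero_obj C Z; A \<in> Ob C; f \<in> Hom C A Z\<rbrakk> \<Longrightarrow> f = Zer C A Z"
  unfolding zero_obj_def using zer_in_hom[of A Z] by blast

lemma iso_morD:
  assumes "iso_mor C A B f"
  shows "A \<in> Ob C" "B \<in> Ob C" "f \<in> Hom C A B"
  using assms by (auto simp: iso_mor_def)

lemma iso_mor_id: "A \<in> Ob C \<Longrightarrow> iso_mor C A A (Idt C A)"
  unfolding iso_mor_def by (intro conjI bexI[of _ "Idt C A"]) simp_all

end

locale abelian = preadditive_cat C for C :: "('o, 'm) precat" +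
  assumes is_abelian: "abelian_cat C"
begin

lemma zero_ex: "\<exists>Z. zero_obj C Z"
  using is_abelian by (simp add: abelian_cat_def)

lemma biprod_ex: "\<lbrakk>A \<in> Ob C; B \<in> Ob C\<rbrakk> \<Longrightarrow> \<exists>P i1 i2 p1 p2. is_biprod C A B P i1 i2 p1 p2"
  using is_abelian by (simp add: abelian_cat_def)

lemma ker_ex: "\<lbrakk>A \<in> Ob C; B \<in> Ob C; f \<in> Hom C A B\<rbrakk> \<Longrightarrow> \<exists>K k. is_ker C A B f K k"
  using is_abelian by (simp add: abelian_cat_def)

lemma coker_ex: "\<lbrakk>A \<in> Ob C; B \<in> Ob C; f \<in> Hom C A B\<rbrakk> \<Longrightarrow> \<exists>Q q. is_coker C A B f Q q"
  using is_abelian by (simp add: abelian_cat_def)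

lemma mono_is_ker:
  assumes "mono_mor C A B f" "is_coker C A B f Q q"
  shows "is_ker C B Q q A f"
proof -
  obtain D g where "is_ker C B D g A f" using is_abelian assms(1) unfolding abelian_cat_def by metis
  then show ?thesis using is_ker_of_coker assms(2) by metis
qed

lemma epi_is_coker:
  assumes "epi_mor C A B f" "is_ker C A B f K k"
  shows "is_coker C K A k B f"
proof -
  obtain D g where "is_coker C D A g B f" using is_abelian assms(1) unfolding abelian_cat_def by metis
  then show ?thesis using is_coker_of_ker assms(2) by metis
qed

lemma short_exactI:
  assumes "is_ker C B D g A f" "epi_mor C B D g"
  shows "short_exact C A B D f g"
  unfolding short_exact_def exact_at_def
  using assms is_ker_mono[OF assms(1)] epi_is_coker[OF assms(2,1)] by metis

text \<open>\<open>exact_at\<close> only provides some kernel \<open>K\<close> of \<open>g\<close>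
  and some cokernel \<open>Q\<close> of \<open>f\<close> such that \<open>K\<close> is a kernel of
  \<open>q\<close>. As a monomorphism, \<open>f\<close> is a second kernel of \<open>q\<close>, so
  \<open>f\<close> and \<open>k\<close> factor through each other.\<close>

lemma short_exactD:
  assumes "short_exact C A B D f g"
  shows "is_ker C B D g A f" "is_coker C A B f D g"
proof -
  from assms obtain K k Q q where *: "is_ker C B D g K k" "is_coker C A B f Q q" "is_ker C B Q q K k"
    and m: "mono_mor C A B f" and e: "epi_mor C B D g"
    unfolding short_exact_def exact_at_def by metis
  note D = is_kerD[OF *(1)] is_cokerD[OF *(2)] is_kerD[OF *(3)]
  have f: "is_ker C B Q q A f" using mono_is_ker[OF m *(2)] .
  obtain a where a: "a \<in> Hom C A K" "Cmp C A K B k a = f" using is_ker_factor[OF *(3), of A f] D by metis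
  obtain b where b: "b \<in> Hom C K A" "Cmp C K A B f b = k" using is_ker_factor[OF f, of K k] D by metis
  show k: "is_ker C B D g A f"
  proof (rule is_kerI[OF m])
    show "Cmp C A B D g f = Zer C A D" unfolding a(2)[symmetric] using D a(1) by (simp add: cmp_assoc)
    fix T t assume t: "T \<in> Ob C" "t \<in> Hom C T B" "Cmp C T B D g t = Zer C T D"
    then obtain s where s: "s \<in> Hom C T K" "Cmp C T K B k s = t" using is_ker_factor[OF *(1)] by metis
    have "Cmp C T A B f (Cmp C T K A b s) = t" using s b D t by (simp add: cmp_assoc)
    then show "\<exists>s\<in>Hom C T A. Cmp C T A B f s = t" using s b D t by (intro bexI[of _ "Cmp C T K A b s"]) auto
  qed (use D in auto)
  show "is_coker C A B f D g" using epi_is_coker[OF e k] .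
qed

text \<open>Let \<open>fb t = 0\<close> and let \<open>c\<close> be the cokernel of
  \<open>t\<close>. The aim is a left inverse \<open>y\<close> of \<open>c\<close>, since then
  \<open>c t = 0\<close> yields \<open>t = 0\<close>; it comes from comparing the kernels of
  \<open>q\<close> and of \<open>c q\<close>.\<close>

lemma coimage_mono:
  assumes k: "is_ker C A B f K k" and q: "is_coker C K A k Q q"
    and fb: "fb \<in> Hom C Q B" "Cmp C A Q B fb q = f"
  shows "mono_mor C Q B fb"
  unfolding mono_iff
proof (intro conjI ballI impI)
  note D = is_kerD[OF k] is_cokerD[OF q]
  have qe: "epi_mor C A Q q" using is_coker_epi[OF q] .
  fix T t assume t: "T \<in> Ob C" "t \<in> Hom C T Q" "Cmp C T Q B fb t = Zer C T B"
  obtain W c where c: "is_coker C T Q t W c" using coker_ex D t by metis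
  note cD = is_cokerD[OF c]
  obtain f' where f': "f' \<in> Hom C W B" "Cmp C Q W B f' c = fb"
    using is_coker_factor[OF c, of B fb] D t fb by metis
  have cqe: "epi_mor C A W (Cmp C A Q W c q)" using epi_cmp[OF qe is_coker_epi[OF c]] .
  obtain H h where h: "is_ker C A W (Cmp C A Q W c q) H h" using ker_ex cqe epiD by metis
  note hD = is_kerD[OF h]
  have hc: "is_coker C H A h W (Cmp C A Q W c q)" using epi_is_coker[OF cqe h] .
  \<comment> \<open>\<open>f\<close> factors through \<open>c q\<close>, so it kills the kernel
    \<open>h\<close> of \<open>c q\<close>. Hence \<open>h\<close> factors through \<open>k\<close>,
    which gives \<open>q h = 0\<close>, and \<open>q\<close> factors through the cokernel
    \<open>c q\<close> of \<open>h\<close>.\<close>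
  have "Cmp C H A B f h = Cmp C H W B f' (Cmp C H A W (Cmp C A Q W c q) h)"
    unfolding fb(2)[symmetric] f'(2)[symmetric] using D(1-5) cD(1-5) hD(1-5) f'(1) D(7-11) by (simp add: cmp_assoc')
  also have "\<dots> = Zer C H B" using hD D f' by simp
  finally obtain h' where h': "h' \<in> Hom C H K" "Cmp C H K A k h' = h"
    using is_ker_factor[OF k] hD by metis
  have "Cmp C H A Q q h = Zer C H Q" unfolding h'(2)[symmetric] using D hD h'(1) by (simp add: cmp_assoc)
  then obtain y where y: "y \<in> Hom C W Q" "Cmp C A W Q y (Cmp C A Q W c q) = q"
    using is_coker_factor[OF hc] D by metis
  have "Cmp C A Q Q (Cmp C Q W Q y c) q = Cmp C A Q Q (Idt C Q) q"
    using y D cD by (simp add: cmp_assoc')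
  then have yc: "Cmp C Q W Q y c = Idt C Q"
    using qe y cD D unfolding epi_mor_def by (meson cmp_in_hom id_in_hom)
  have "t = Cmp C T Q Q (Cmp C Q W Q y c) t" unfolding yc using t D by simp
  also have "\<dots> = Zer C T Q" using t D cD y by (simp add: cmp_assoc')
  finally show "t = Zer C T Q" .
qed (use is_kerD[OF k] is_cokerD[OF q] fb in auto)

end

lemma abelian_locale: "abelian_cat C \<longleftrightarrow> abelian C"
  by (auto simp: abelian_def abelian_axioms_def abelian_cat_def)


section \<open>Semi-simple categories are von Neumann regular\<close>

text \<open>The categorical form of von Neumann regularity. It provides sections of epimorphisms and
  complements of images by explicit idempotents, which is how semi-simplicity enters the
  constructions with triples.\<close>

locale regular_cat = abelian C for C :: "('o, 'm) precat" +
  assumes regular: "\<lbrakk>A \<in> Ob C; B \<in> Ob C; f \<in> Hom C A B\<rbrakk>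
    \<Longrightarrow> \<exists>w \<in> Hom C B A. Cmp C A B B (Cmp C B A B f w) f = f"
begin

lemma epi_split:
  assumes "epi_mor C A B f"
  obtains s where "s \<in> Hom C B A" "Cmp C B A B f s = Idt C B"
proof -
  note D = epiD[OF assms]
  obtain w where w: "w \<in> Hom C B A" "Cmp C A B B (Cmp C B A B f w) f = f" using regular D by metis
  have "Cmp C A B B (Cmp C B A B f w) f = Cmp C A B B (Idt C B) f" using w D by (simp add: cmp_assoc)
  then have "Cmp C B A B f w = Idt C B" using assms w D unfolding epi_mor_def by (meson cmp_in_hom id_in_hom)
  then show ?thesis using that w by blast
qed

text \<open>The morphism \<open>1 - f w\<close> kills \<open>f\<close> and hence equals
  \<open>s q\<close> for some \<open>s\<close>. Since \<open>q\<close> kills \<open>f\<close>, this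
  gives \<open>q s q = q\<close>, and the epimorphism \<open>q\<close> can be cancelled.\<close>

lemma coker_section:
  assumes "is_coker C A B f Q q"
  obtains w s where "w \<in> Hom C B A" "s \<in> Hom C Q B"
    "Cmp C A B B (Cmp C B A B f w) f = f"
    "Cmp C Q B Q q s = Idt C Q" "Add C B B (Cmp C B A B f w) (Cmp C B Q B s q) = Idt C B"
proof -
  note D = is_cokerD[OF assms]
  obtain w where w: "w \<in> Hom C B A" "Cmp C A B B (Cmp C B A B f w) f = f" using regular D by metis
  let ?e = "Add C B B (Idt C B) (Neg C B B (Cmp C B A B f w))"
  have "Cmp C A B B ?e f = Zer C A B" using D w by (simp add: cmp_add_left cmp_neg_left)
  then obtain s where s: "s \<in> Hom C Q B" "Cmp C B Q B s q = ?e"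
    using is_coker_factor[OF assms, of B ?e] D w by auto
  have "Cmp C B Q Q (Cmp C Q B Q q s) q = Cmp C B B Q q (Cmp C B Q B s q)" using D s by (simp add: cmp_assoc')
  also have "\<dots> = q" unfolding s(2) using D w by (simp add: cmp_add_right cmp_neg_right cmp_assoc)
  also have "\<dots> = Cmp C B Q Q (Idt C Q) q" using D by simp
  finally have "Cmp C Q B Q q s = Idt C Q"
    using is_coker_epi[OF assms] s D unfolding epi_mor_def by (meson cmp_in_hom id_in_hom)
  moreover have "Add C B B (Cmp C B A B f w) (Cmp C B Q B s q) = Idt C B"
    unfolding s(2) using D w by (subst add_left_commute) simp_all
  ultimately show ?thesis using that w s by blast
qed

end

text \<open>Factor \<open>v\<close> into its coimage \<open>c\<close> and a monomorphism. If
  \<open>s\<close> is a section of \<open>c\<close> and \<open>\<rho>\<close> a retraction of the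
  monomorphism, then \<open>w = s \<rho>\<close> is a quasi-inverse of \<open>v\<close>.\<close>

lemma semisimple_regular:
  assumes "semisimple_cat C"
  shows "regular_cat C"
proof -
  interpret abelian C using assms by (simp add: semisimple_cat_def abelian_locale)
  have epi_split: "\<exists>s \<in> Hom C B A. Cmp C B A B e s = Idt C B" if e: "epi_mor C A B e" for A B e
  proof -
    obtain K k where "is_ker C A B e K k" using ker_ex epiD[OF e] by metis
    then show ?thesis using short_exactI[OF _ e] assms unfolding semisimple_cat_def by metis
  qed
  have split_both: "\<exists>s r. s \<in> Hom C D B \<and> r \<in> Hom C B A \<and> Cmp C D B D q s = Idt C D \<and>
      Cmp C A B A r m = Idt C A \<and> Add C B B (Cmp C B A B m r) (Cmp C B D B s q) = Idt C B"
    if m: "mono_mor C A B m" and q: "is_coker C A B m D q" for A B D m q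
  proof -
    have k: "is_ker C B D q A m" using mono_is_ker[OF m q] .
    note E = monoD[OF m] is_cokerD[OF q]
    obtain s where s: "s \<in> Hom C D B" "Cmp C D B D q s = Idt C D" using epi_split[OF is_coker_epi[OF q]] by metis
    let ?e = "Add C B B (Idt C B) (Neg C B B (Cmp C B D B s q))"
    have "Cmp C B B D q ?e = Zer C B D" using E s
      by (simp add: cmp_add_right cmp_neg_right cmp_assoc)
    then obtain r where r: "r \<in> Hom C B A" "Cmp C B A B m r = ?e" using is_ker_factor[OF k, of B ?e] E s by auto
    have "Cmp C A A B m (Cmp C A B A r m) = Cmp C A B B ?e m" using E r by (simp add: cmp_assoc)
    also have "\<dots> = Cmp C A A B m (Idt C A)" using E s
      by (simp add: cmp_add_left cmp_neg_left cmp_assoc')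
    finally have "Cmp C A B A r m = Idt C A" using m r E unfolding mono_mor_def by (meson cmp_in_hom id_in_hom)
    moreover have "Add C B B (Cmp C B A B m r) (Cmp C B D B s q) = Idt C B"
      unfolding r(2) using E s by (simp add: add_assoc)
    ultimately show ?thesis using s r by blast
  qed
  show ?thesis
  proof unfold_locales
    fix A B v assume AB: "A \<in> Ob C" "B \<in> Ob C" "v \<in> Hom C A B"
    obtain K k where k: "is_ker C A B v K k" using ker_ex AB by metis
    note kD = is_kerD[OF k] and km = is_ker_mono[OF k]
    obtain Q c where c: "is_coker C K A k Q c" using coker_ex kD by metis
    note cD = is_cokerD[OF c]
    obtain s r where s: "s \<in> Hom C Q A" "r \<in> Hom C A K" "Cmp C Q A Q c s = Idt C Q"
      "Add C A A (Cmp C A K A k r) (Cmp C A Q A s c) = Idt C A" using split_both[OF km c] by metis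
    \<comment> \<open>\<open>v\<close> kills the summand \<open>K\<close>, so of the decomposition
      \<open>k r + s c\<close> of the identity only \<open>s c\<close> survives.\<close>
    have vsc: "Cmp C A Q B (Cmp C Q A B v s) c = v"
    proof -
      have "v = Cmp C A A B v (Add C A A (Cmp C A K A k r) (Cmp C A Q A s c))" using s AB by simp
      also have "\<dots> = Add C A B (Cmp C A K B (Cmp C K A B v k) r) (Cmp C A Q B (Cmp C Q A B v s) c)"
        using AB kD(1-5) cD s(1,2) by (simp add: cmp_add_right cmp_assoc)
      finally show ?thesis using AB kD cD s by simp
    qed
    have "mono_mor C Q B (Cmp C Q A B v s)" by (rule coimage_mono[OF k c _ vsc]) (use AB cD s in auto)
    then obtain D q where "is_coker C Q B (Cmp C Q A B v s) D q" and m: "mono_mor C Q B (Cmp C Q A B v s)"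
      using coker_ex monoD by metis
    then obtain \<rho> where \<rho>: "\<rho> \<in> Hom C B Q" "Cmp C Q B Q \<rho> (Cmp C Q A B v s) = Idt C Q"
      using split_both[OF m] by metis
    let ?w = "Cmp C B Q A s \<rho>"
    have "Cmp C A B B (Cmp C B A B v ?w) v = Cmp C A Q B (Cmp C Q A B v s) (Cmp C A B Q \<rho> v)"
      using AB cD s \<rho> by (simp add: cmp_assoc')
    also have "Cmp C A B Q \<rho> v = Cmp C A B Q \<rho> (Cmp C A Q B (Cmp C Q A B v s) c)" unfolding vsc ..
    also have "\<dots> = Cmp C A Q Q (Cmp C Q B Q \<rho> (Cmp C Q A B v s)) c" using AB cD s \<rho>(1) by (simp add: cmp_assoc')
    also have "\<dots> = c" using \<rho> cD by simp
    finally have "Cmp C A B B (Cmp C B A B v ?w) v = v" using vsc by simp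
    then show "\<exists>w\<in>Hom C B A. Cmp C A B B (Cmp C B A B v w) v = v" using s \<rho> AB cD by (meson cmp_in_hom)
  qed
qed


section \<open>Vanishing of Yoneda extensions\<close>

context abelian
begin

lemma exact_cmp_zero:
  assumes "exact_at C A B D f g"
  shows "Cmp C A B D g f = Zer C A D"
proof -
  from assms obtain K k Q q where *: "is_ker C B D g K k" "is_coker C A B f Q q" "is_ker C B Q q K k"
    unfolding exact_at_def by metis
  note D = is_kerD[OF *(1)] is_cokerD[OF *(2)] is_kerD[OF *(3)]
  obtain a where a: "a \<in> Hom C A K" "Cmp C A K B k a = f" using is_ker_factor[OF *(3), of A f] D by metis
  show ?thesis unfolding a(2)[symmetric] using D a(1) by (simp add: cmp_assoc)
qed

text \<open>Together with \<open>exact_epi_zero\<close> this yields the exactness of the trivial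
  extension, in which each zero map is preceded by an identity or followed by a
  monomorphism.\<close>

lemma exact_zero_mono:
  assumes "A \<in> Ob C" "mono_mor C B D g"
  shows "exact_at C A B D (Zer C A B) g"
proof -
  note m = monoD[OF assms(2)]
  obtain Z where Z: "zero_obj C Z" using zero_ex by blast
  then have ZO: "Z \<in> Ob C" by (simp add: zero_obj_def)
  have zm: "mono_mor C Z T (Zer C Z T)" if "T \<in> Ob C" for T
    unfolding mono_iff using that ZO zero_obj_to[OF Z] by auto
  have "is_ker C B D g Z (Zer C Z B)"
    by (rule is_kerI[OF zm]) (use m ZO monoD_zero[OF assms(2)] in \<open>auto intro!: bexI[of _ "Zer C _ Z"] intro: zer_in_hom\<close>)
  moreover have "is_coker C A B (Zer C A B) B (Idt C B)"
    by (rule is_cokerI) (use m assms in \<open>auto simp: epi_iff\<close>)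
  moreover have "is_ker C B B (Idt C B) Z (Zer C Z B)"
    by (rule is_kerI[OF zm]) (use m ZO in \<open>auto intro!: bexI[of _ "Zer C _ Z"] intro: zer_in_hom\<close>)
  ultimately show ?thesis unfolding exact_at_def by metis
qed

lemma exact_epi_zero:
  assumes "epi_mor C A B f" "D \<in> Ob C"
  shows "exact_at C A B D f (Zer C B D)"
proof -
  note m = epiD[OF assms(1)]
  obtain Z where Z: "zero_obj C Z" using zero_ex by blast
  then have ZO: "Z \<in> Ob C" by (simp add: zero_obj_def)
  have "is_ker C B D (Zer C B D) B (Idt C B)"
    by (rule is_kerI) (use m ZO assms in \<open>auto simp: mono_iff\<close>)
  moreover have "is_coker C A B f Z (Zer C B Z)"
  proof (rule is_cokerI)
    show "epi_mor C B Z (Zer C B Z)" unfolding epi_iff using m ZO zero_obj_from[OF Z] by auto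
  qed (use m ZO epiD_zero[OF assms(1)] in \<open>auto intro!: bexI[of _ "Zer C Z _"] intro: zer_in_hom\<close>)
  moreover have "is_ker C B Z (Zer C B Z) B (Idt C B)"
    by (rule is_kerI) (use m ZO assms in \<open>auto simp: mono_iff\<close>)
  ultimately show ?thesis unfolding exact_at_def by metis
qed

text \<open>Replacing the first two middle terms of \<open>B \<rightarrow> E\<^sub>1 \<rightarrow> E\<^sub>2 \<rightarrow> \<dots>\<close> by \<open>B \<oplus> E\<^sub>1 \<rightarrow> G\<close> gives an
  extension that maps both to the given one and to the trivial one.\<close>

lemma hereditaryI:
  assumes lift: "\<And>E1 E2 L f q. is_coker C E1 E2 f L q \<Longrightarrow> \<exists>G a \<pi> g. is_ker C G L \<pi> E1 a \<and> epi_mor C G L \<pi> \<and>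
    g \<in> Hom C G E2 \<and> Cmp C E1 G E2 g a = f \<and> Cmp C G E2 L q g = \<pi>"
  shows "hereditary_cat C"
  unfolding hereditary_cat_def
proof (intro conjI allI impI ballI is_abelian)
  fix n :: nat and A B assume n: "n \<ge> 2" and A: "A \<in> Ob C" and B: "B \<in> Ob C"
  obtain Z where Z: "zero_obj C Z" using zero_ex by blast
  then have ZO: "Z \<in> Ob C" by (simp add: zero_obj_def)
  \<comment> \<open>\<open>E0\<close> is the sequence
    \<open>B = B -> 0 -> ... -> 0 -> A = A\<close>. The identities are the maps number
    \<open>0\<close> and \<open>n\<close>, and \<open>n \<ge> 2\<close> keeps them apart.\<close>
  define ob where "ob i = (if i \<le> 1 then B else if i < n then Z else A)" for i
  define mo where "mo i = (if i = 0 then Idt C B else if i = n then Idt C A else Zer C (ob i) (ob (i+1)))" for i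
  define E0 where "E0 = (map ob [0..<n+2], map mo [0..<n+1])"
  have fE0: "fst E0 ! i = ob i" if "i \<le> n+1" for i
    using that by (simp add: E0_def del: upt_Suc)
  have sE0: "snd E0 ! i = mo i" if "i \<le> n" for i
    using that by (simp add: E0_def del: upt_Suc)
  have obO: "ob i \<in> Ob C" for i by (simp add: ob_def A B ZO)
  have moH: "mo i \<in> Hom C (ob i) (ob (i+1))" if "i \<le> n" for i
    using that n A B obO by (auto simp: mo_def) (auto simp: ob_def)
  have mo_mono: "mono_mor C (ob (i+1)) (ob (i+2)) (mo (i+1))" if "i < n" "0 < i" for i
  proof (cases "i + 1 = n")
    case True
    then show ?thesis using that n A by (simp add: ob_def mo_def mono_iff)
  next
    case False
    then have "ob (i+1) = Z" using that by (simp add: ob_def)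
    then show ?thesis using moH[of "i+1"] obO zero_obj_to[OF Z] that unfolding mono_iff by auto
  qed
  have E0: "E0 \<in> extns C n A B"
    unfolding extns_def
  proof (clarsimp simp: E0_def simp del: upt_Suc, intro conjI allI impI)
    show "ob ` {0..<Suc (Suc n)} \<subseteq> Ob C" using obO by auto
    show "ob 0 = B" "ob (Suc n) = A" using n by (auto simp: ob_def)
    show "mo i \<in> Hom C (ob i) (ob (Suc i))" if "i \<le> n" for i using moH[OF that] by simp
    show "mono_mor C (ob 0) (ob (Suc 0)) (mo 0)" using B by (simp add: ob_def mo_def mono_iff)
    show "epi_mor C (ob n) (ob (Suc n)) (mo n)" using A n by (simp add: ob_def mo_def epi_iff)
    fix i assume i: "i < n"
    show "exact_at C (ob i) (ob (Suc i)) (ob (Suc (Suc i))) (mo i) (mo (Suc i))"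
    proof (cases "i = 0")
      case True
      have "epi_mor C B B (Idt C B)" using B by (simp add: epi_iff)
      then have "exact_at C B B (ob 2) (Idt C B) (Zer C B (ob 2))" using exact_epi_zero obO by blast
      then show ?thesis using True n by (simp add: mo_def numeral_2_eq_2) (simp add: ob_def numeral_2_eq_2)
    next
      case False
      then have "mo i = Zer C (ob i) (ob (i+1))" using i by (simp add: mo_def)
      then show ?thesis using exact_zero_mono[OF obO mo_mono[of i], of i] False i by simp
    qed
  qed
  define R where "R E E' \<longleftrightarrow> E \<in> extns C n A B \<and> E' \<in> extns C n A B \<and>
      (\<exists>h. extn_mor C n E E' h \<and> h 0 = Idt C B \<and> h (n + 1) = Idt C A)" for E E'
  have equiv: "equivclp R E E0" if E: "E \<in> extns C n A B" for E
  proof -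
    obtain es fs where Ees: "E = (es, fs)" by (cases E)
    have len: "length es = n + 2" "length fs = n + 1" and ends: "es ! 0 = B" "es ! (n+1) = A"
      and esO: "\<And>i. i < n + 2 \<Longrightarrow> es ! i \<in> Ob C"
      and fsH: "\<And>i. i \<le> n \<Longrightarrow> fs ! i \<in> Hom C (es ! i) (es ! (i+1))"
      and en: "epi_mor C (es ! n) (es ! (n+1)) (fs ! n)"
      and ex: "\<And>i. i < n \<Longrightarrow> exact_at C (es ! i) (es ! (i+1)) (es ! (i+2)) (fs ! i) (fs ! (i+1))"
      using E unfolding extns_def Ees by auto
    define E1 E2 E3 where "E1 = es ! 1" and "E2 = es ! 2" and "E3 = es ! 3"
    define f0 f1 f2 where "f0 = fs ! 0" and "f1 = fs ! 1" and "f2 = fs ! 2"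
    have O: "E1 \<in> Ob C" "E2 \<in> Ob C" "E3 \<in> Ob C" using esO n by (auto simp: E1_def E2_def E3_def)
    have H: "f0 \<in> Hom C B E1" "f1 \<in> Hom C E1 E2" "f2 \<in> Hom C E2 E3"
      using fsH[of 0] fsH[of 1] fsH[of 2] n ends
      by (auto simp: E1_def E2_def E3_def f0_def f1_def f2_def numeral_2_eq_2 numeral_3_eq_3)
    have f10: "Cmp C B E1 E2 f1 f0 = Zer C B E2" using exact_cmp_zero[OF ex[of 0]] n ends
      by (simp add: E1_def E2_def f0_def f1_def numeral_2_eq_2)
    have ex12: "exact_at C E1 E2 E3 f1 f2" using ex[of 1] n
      by (simp add: E1_def E2_def E3_def f2_def f1_def numeral_2_eq_2 numeral_3_eq_3)
    obtain K k L q where K: "is_ker C E2 E3 f2 K k" "is_coker C E1 E2 f1 L q" "is_ker C E2 L q K k"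
      using ex12 unfolding exact_at_def by metis
    note LD = is_cokerD[OF K(2)]
    have qe: "epi_mor C E2 L q" using is_coker_epi[OF K(2)] .
    have qk: "is_coker C K E2 k L q" using epi_is_coker[OF qe K(3)] .
    \<comment> \<open>By exactness at \<open>E2\<close> the cokernel \<open>L\<close> of
      \<open>f1\<close> is also the coimage of \<open>f2\<close>, so \<open>f2\<close> is
      \<open>q\<close> followed by a monomorphism \<open>fb\<close>.\<close>
    obtain fb where fb: "fb \<in> Hom C L E3" "Cmp C E2 L E3 fb q = f2"
      using is_coker_factor[OF qk, of E3 f2] is_kerD[OF K(1)] by metis
    have fbm: "mono_mor C L E3 fb" using coimage_mono[OF K(1) qk fb] .
    obtain G a \<pi> g where G: "is_ker C G L \<pi> E1 a" "epi_mor C G L \<pi>" "g \<in> Hom C G E2"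
      "Cmp C E1 G E2 g a = f1" "Cmp C G E2 L q g = \<pi>" using lift[OF K(2)] by metis
    note GD = is_kerD[OF G(1)] and am = is_ker_mono[OF G(1)]
    obtain P i1 i2 p1 p2 where P: "is_biprod C B E1 P i1 i2 p1 p2" using biprod_ex B O by metis
    note PD = biprodD[OF P] and Pk = biprod_ker_coker[OF P]
    let ?c = "Cmp C P E1 G a p2" and ?d = "Cmp C G E2 E3 f2 g"
    have d: "?d = Cmp C G L E3 fb \<pi>" unfolding G(5)[symmetric] fb(2)[symmetric]
      using O GD(1) G(3) fb(1) LD by (simp add: cmp_assoc')
    have cH: "?c \<in> Hom C P G" and dH: "?d \<in> Hom C G E3" using GD PD O G H by auto
    \<comment> \<open>\<open>E'\<close> reads \<open>B -> B + E1 -> G -> E3 -> ...\<close>. The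
      first map is a split inclusion. Exactness at \<open>G\<close> holds because the image of
      \<open>?c\<close> is \<open>E1\<close>, the kernel of \<open>\<pi>\<close> and hence also of
      \<open>?d = fb \<pi>\<close>.\<close>
    define E' where "E' = (es[1:=P, 2:=G], fs[0:=i1, 1:=?c, 2:=?d])"
    have fE': "fst E' ! i = (if i = 1 then P else if i = 2 then G else es ! i)" for i
      using len n by (auto simp: E'_def nth_list_update)
    have sE': "snd E' ! i = (if i = 0 then i1 else if i = 1 then ?c else if i = 2 then ?d else fs ! i)" for i
      using len n by (auto simp: E'_def nth_list_update)
    have ex': "exact_at C (fst E' ! i) (fst E' ! (i+1)) (fst E' ! (i+2)) (snd E' ! i) (snd E' ! (i+1))"
      if i: "i < n" for i
    proof -
      consider "i = 0" | "i = 1" | "i = 2" | "i \<ge> 3" by linarith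
      then show ?thesis
      proof cases
        case 1
        have "exact_at C B P G i1 ?c" unfolding exact_at_def
          using is_ker_mono_cmp[OF Pk(1) am] Pk by metis
        then show ?thesis using 1 ends by (simp add: fE' sE')
      next
        case 2
        have "is_ker C G E3 ?d E1 a" unfolding d by (rule is_ker_mono_cmp[OF G(1) fbm])
        moreover have "is_coker C P G ?c L \<pi>"
          by (rule is_coker_epi_cmp[OF epi_is_coker[OF G(2,1)] is_coker_epi[OF Pk(2)]])
        ultimately have "exact_at C P G E3 ?c ?d" unfolding exact_at_def using G(1) by metis
        then show ?thesis using 2 by (simp add: fE' sE' E3_def numeral_3_eq_3 numeral_2_eq_2)
      next
        case 3
        obtain K' k' Q' q' where K': "is_ker C E3 (es ! 4) (fs ! 3) K' k'" "is_coker C E2 E3 f2 Q' q'"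
          "is_ker C E3 Q' q' K' k'" using ex[of 2] i 3 unfolding exact_at_def
          by (auto simp: E2_def E3_def f2_def)
        \<comment> \<open>\<open>f2 = fb q\<close> and \<open>?d = fb \<pi>\<close> differ from
          \<open>fb\<close> by epimorphisms only, so all three have the same cokernel and exactness
          at \<open>E3\<close> carries over.\<close>
        have "is_coker C L E3 fb Q' q'"
        proof (rule is_cokerI)
          show "epi_mor C E3 Q' q'" using is_coker_epi[OF K'(2)] .
          show "Cmp C L E3 Q' q' fb = Zer C L Q'"
            by (rule epiD_zero[OF qe]) (use is_cokerD[OF K'(2)] LD fb in \<open>simp_all add: cmp_assoc'\<close>)
          fix T t assume t: "T \<in> Ob C" "t \<in> Hom C E3 T" "Cmp C L E3 T t fb = Zer C L T"
          have "Cmp C E2 E3 T t f2 = Zer C E2 T"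
            unfolding fb(2)[symmetric] using t LD fb(1) O by (simp add: cmp_assoc)
          then show "\<exists>s\<in>Hom C Q' T. Cmp C E3 Q' T s q' = t" using is_coker_factor[OF K'(2)] t by metis
        qed (use LD fb in auto)
        then have "is_coker C G E3 ?d Q' q'" unfolding d using is_coker_epi_cmp G(2) by metis
        then have "exact_at C G E3 (es ! 4) ?d (fs ! 3)" unfolding exact_at_def using K' by metis
        then show ?thesis using 3 by (simp add: fE' sE' E3_def)
      next
        case 4
        then show ?thesis using ex[OF i] by (simp add: fE' sE')
      qed
    qed
    have E': "E' \<in> extns C n A B"
    proof -
      have "set (fst E') \<subseteq> Ob C"
      proof
        fix x assume "x \<in> set (fst E')"
        then obtain i where "i < n + 2" "x = fst E' ! i" using len by (auto simp: in_set_conv_nth E'_def)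
        then show "x \<in> Ob C" using esO[of i] PD GD by (auto simp: fE')
      qed
      moreover have "snd E' ! i \<in> Hom C (fst E' ! i) (fst E' ! (i+1))" if "i \<le> n" for i
      proof -
        consider "i = 0" | "i = 1" | "i = 2" | "i \<ge> 3" by linarith
        then show ?thesis
          using fsH[OF that] PD ends cH dH by cases (auto simp: fE' sE' E3_def numeral_3_eq_3 numeral_2_eq_2)
      qed
      moreover have "mono_mor C (fst E' ! 0) (fst E' ! 1) (snd E' ! 0)"
        using is_ker_mono[OF Pk(1)] ends by (simp add: fE' sE')
      moreover have "epi_mor C (fst E' ! n) (fst E' ! (n+1)) (snd E' ! n)"
      \<comment> \<open>For \<open>n = 2\<close> the last map of the extension is the modified map
        \<open>?d\<close>; for larger \<open>n\<close> it is unchanged.\<close>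
      proof (cases "n = 2")
        case True
        have "epi_mor C E2 E3 f2" using en True by (simp add: E2_def E3_def f2_def)
        then have "epi_mor C L E3 fb" using epi_of_epi_cmp[of E2 E3 L fb q] fb LD by auto
        then have "epi_mor C G E3 ?d" unfolding d using epi_cmp G(2) by metis
        then show ?thesis using True by (simp add: fE' sE' E3_def)
      next
        case False
        then show ?thesis using en n by (simp add: fE' sE')
      qed
      moreover have "length (fst E') = n + 2" "length (snd E') = n + 1" using len by (auto simp: E'_def)
      moreover have "fst E' ! 0 = B" "fst E' ! (n+1) = A" using ends n by (auto simp: fE')
      ultimately show ?thesis using ex' unfolding extns_def by (cases E') auto
    qed
    have 1: "R E' E"
    proof -
      \<comment> \<open>The map from \<open>E'\<close> to \<open>E\<close> is the identity except at
        the positions \<open>1\<close> and \<open>2\<close>. On \<open>B + E1\<close> it is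
        \<open>f0\<close> on the first summand and the identity on the second;
        \<open>f1 f0 = 0\<close> makes the next square commute.\<close>
      let ?m = "Add C P E1 (Cmp C P B E1 f0 p1) p2"
      define h where "h i = (if i = 1 then ?m else if i = 2 then g else Idt C (es ! i))" for i
      have "extn_mor C n E' E h"
        unfolding extn_mor_def
      proof (intro conjI allI impI)
        fix i assume "i \<le> n + 1"
        then show "h i \<in> Hom C (fst E' ! i) (fst E ! i)" unfolding fE' h_def Ees
          using PD H O B G(3) GD(1) esO[of i] by (auto simp: E1_def[symmetric, unfolded One_nat_def] E2_def[symmetric])
      next
        fix i assume i: "i \<le> n"
        consider "i = 0" | "i = 1" | "i = 2" | "i \<ge> 3" by linarith
        then show "Cmp C (fst E' ! i) (fst E ! i) (fst E ! (i + 1)) (snd E ! i) (h i) =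
          Cmp C (fst E' ! i) (fst E' ! (i + 1)) (fst E ! (i + 1)) (h (i + 1)) (snd E' ! i)"
        proof cases
          case 1
          have "Cmp C B B E1 f0 (Idt C B) = Cmp C B P E1 ?m i1"
            using B O H PD by (simp add: cmp_add_left cmp_assoc')
          then show ?thesis using 1 ends by (simp add: fE' sE' h_def Ees E1_def f0_def)
        next
          case 2
          have "Cmp C P E1 E2 f1 ?m = Cmp C P E1 E2 f1 p2"
            using B O H PD f10 by (simp add: cmp_add_right cmp_assoc)
          also have "\<dots> = Cmp C P G E2 g ?c"
            using G O PD GD by (simp add: cmp_assoc)
          finally show ?thesis using 2 by (simp add: fE' sE' h_def Ees E1_def E2_def f1_def numeral_2_eq_2)
        next
          case 3
          have "Cmp C G E2 E3 f2 g = Cmp C G E3 E3 (Idt C E3) ?d" using dH O GD by simp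
          then show ?thesis using 3 by (simp add: fE' sE' h_def Ees E2_def E3_def f2_def)
        next
          case 4
          then show ?thesis using fsH[OF i] esO[of i] esO[of "i+1"] i by (simp add: fE' sE' h_def Ees)
        qed
      qed
      moreover have "h 0 = Idt C B" "h (n+1) = Idt C A" using ends n by (auto simp: h_def)
      ultimately show ?thesis unfolding R_def using E E' by blast
    qed
    have 2: "R E' E0"
    proof -
      have snH: "snd E' ! n \<in> Hom C (fst E' ! n) A" and O': "\<And>i. i \<le> n + 1 \<Longrightarrow> fst E' ! i \<in> Ob C"
        and sH: "\<And>i. i \<le> n \<Longrightarrow> snd E' ! i \<in> Hom C (fst E' ! i) (fst E' ! (i+1))"
        and e0: "fst E' ! 0 = B" and e1: "fst E' ! (n+1) = A"
        using E' unfolding extns_def by force+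
      \<comment> \<open>The map from \<open>E'\<close> to \<open>E0\<close> is the retraction
        \<open>p1\<close> at position \<open>1\<close> and the last map of \<open>E'\<close> at
        position \<open>n\<close>, with zeros in between.\<close>
      define h where "h i = (if i = 0 then Idt C B else if i = 1 then p1 else if i < n then Zer C (fst E' ! i) Z
        else if i = n then snd E' ! n else Idt C A)" for i
      have hH: "h i \<in> Hom C (fst E' ! i) (fst E0 ! i)" if i: "i \<le> n + 1" for i
      proof -
        have "h 1 \<in> Hom C (fst E' ! 1) B" using PD n by (simp add: h_def fE')
        then have "h i \<in> Hom C (fst E' ! i) (ob i)" using i n snH O'[OF i] ZO A B e0 e1
          by (cases "i = 0"; cases "i = 1"; cases "i < n"; cases "i = n"; cases "i = n+1") (auto simp: h_def ob_def)
        then show ?thesis using fE0[OF i] by simp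
      qed
      have "extn_mor C n E' E0 h"
        unfolding extn_mor_def
      proof (intro conjI allI impI hH)
        fix i assume i: "i \<le> n"
        have "Cmp C (fst E' ! i) (ob i) (ob (i + 1)) (mo i) (h i) =
          Cmp C (fst E' ! i) (fst E' ! (i + 1)) (ob (i + 1)) (h (i + 1)) (snd E' ! i)"
        proof -
          consider "i = 0" | "0 < i" "i < n" "i + 1 < n" | "0 < i" "i + 1 = n" | "i = n" using i by linarith
          then show ?thesis
          proof cases
            case 1
            then show ?thesis using PD B n by (simp add: h_def mo_def ob_def fE' sE' ends)
          next
            case 2
            then have "h (i+1) = Zer C (fst E' ! (i+1)) Z" "ob (i+1) = Z" "mo i = Zer C (ob i) (ob (i+1))"
              by (auto simp: h_def ob_def mo_def)
            then show ?thesis using sH[OF i] hH[of i] i O'[of i] O'[of "i+1"] obO fE0[of i] ZO by simp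
          next
            case 3
            then have *: "h (i+1) = snd E' ! n" "ob (i+1) = A" "mo i = Zer C (ob i) (ob (i+1))"
              using n by (auto simp: h_def ob_def mo_def)
            have "Cmp C (fst E' ! i) (fst E' ! n) A (snd E' ! n) (snd E' ! i) = Zer C (fst E' ! i) A"
              using exact_cmp_zero[OF ex'[of i]] 3 e1 by (simp add: numeral_2_eq_2)
            then show ?thesis using * 3 hH[of i] i O'[of i] obO fE0[of i] A by simp
          next
            case 4
            then show ?thesis using n A O'[of n] snH e1 by (simp add: h_def mo_def ob_def)
          qed
        qed
        then show "Cmp C (fst E' ! i) (fst E0 ! i) (fst E0 ! (i + 1)) (snd E0 ! i) (h i) =
          Cmp C (fst E' ! i) (fst E' ! (i + 1)) (fst E0 ! (i + 1)) (h (i + 1)) (snd E' ! i)"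
          using i fE0 sE0 by simp
      qed
      moreover have "h 0 = Idt C B" "h (n+1) = Idt C A" using n by (auto simp: h_def)
      ultimately show ?thesis unfolding R_def using E0 E' by blast
    qed
    show ?thesis using 1 2 by (meson converse_r_into_equivclp equivclp_trans r_into_equivclp)
  qed
  have yr: "yoneda_rel C n A B = {(E, E'). E \<in> extns C n A B \<and> equivclp R E E'}"
    unfolding yoneda_rel_def R_def ..
  define cl where "cl = {E'. equivclp R E0 E'}"
  have cl: "yoneda_rel C n A B `` {E} = cl" if "E \<in> extns C n A B" for E
    using equiv[OF that] that unfolding yr cl_def by (auto intro: equivclp_trans equivclp_sym)
  have "extns C n A B // yoneda_rel C n A B = {cl}"
    unfolding quotient_def using cl E0 by auto
  moreover have "yoneda_rel C n A B `` {E \<in> extns C n A B.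
      \<exists>r \<in> Hom C (fst E ! 1) B. Cmp C B (fst E ! 1) B r (snd E ! 0) = Idt C B} = cl" (is "_ `` ?S = _")
  proof -
    have "Idt C B \<in> Hom C (fst E0 ! 1) B" "Cmp C B (fst E0 ! 1) B (Idt C B) (snd E0 ! 0) = Idt C B"
      using fE0[of 1] sE0[of 0] B n by (auto simp: ob_def mo_def)
    then have "E0 \<in> ?S" using E0 by blast
    moreover have "yoneda_rel C n A B `` ?S = (\<Union>E \<in> ?S. yoneda_rel C n A B `` {E})" by blast
    ultimately show ?thesis using cl by auto
  qed
  ultimately show "carrier (Ext C n A B) = {\<one>\<^bsub>Ext C n A B\<^esub>}" by (simp add: Ext_def)
qed

end

section \<open>The category of triples\<close>

text \<open>\<open>B\<close> is the source and \<open>D\<close> the target of \<open>F\<close>. The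
  choice \<open>P = Ob D\<close> gives all triples, a smaller \<open>P\<close> only those with first
  component in \<open>P\<close>; closure of \<open>P\<close> under subobjects, quotients and
  extensions keeps the constructions below inside the subcategory.\<close>

locale triple_data = B: regular_cat B + D: regular_cat D for B D :: "('o, 'm) precat" +
  fixes F :: "('o, 'm, 'o, 'm) functr" and P :: "'o set"
  assumes F_functor: "is_functor B D F"
    and F_add: "\<lbrakk>A \<in> Ob B; A' \<in> Ob B; f \<in> Hom B A A'; g \<in> Hom B A A'\<rbrakk> \<Longrightarrow>
      fmp F A A' (Add B A A' f g) = Add D (fob F A) (fob F A') (fmp F A A' f) (fmp F A A' g)"
    and P_serre: "serre_subcat D P"
begin

definition T :: "('o \<times> 'o \<times> 'm, 'm \<times> 'm) precat" where
  "T = full_sub (triple_cat B D (Ob B) F) {t \<in> Ob (triple_cat B D (Ob B) F). fst t \<in> P}"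

lemma P_sub: "X \<in> P \<Longrightarrow> X \<in> Ob D"
  using P_serre unfolding serre_subcat_def strictly_full_def by blast

lemma P_mono: "\<lbrakk>mono_mor D A A' m; A' \<in> P\<rbrakk> \<Longrightarrow> A \<in> P"
  using P_serre unfolding serre_subcat_def by blast

lemma P_epi: "\<lbrakk>epi_mor D A A' m; A \<in> P\<rbrakk> \<Longrightarrow> A' \<in> P"
  using P_serre unfolding serre_subcat_def by blast

lemma P_biprod:
  assumes "is_biprod D X X' Q i1 i2 p1 p2" "X \<in> P" "X' \<in> P"
  shows "Q \<in> P"
proof -
  have "short_exact D X Q X' i1 p2"
    using D.short_exactI D.biprod_ker_coker[OF assms(1)] D.is_coker_epi by metis
  then show ?thesis using P_serre assms unfolding serre_subcat_def by blast
qed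

lemma P_zero: "\<exists>Z \<in> P. zero_obj D Z"
proof -
  obtain X where X: "X \<in> P" using P_serre unfolding serre_subcat_def by blast
  obtain Z where Z: "zero_obj D Z" using D.zero_ex by blast
  have "mono_mor D Z X (Zer D Z X)"
    unfolding D.mono_iff using D.zero_obj_to[OF Z] Z P_sub[OF X] by (auto simp: zero_obj_def)
  then show ?thesis using P_mono X Z by blast
qed

lemma F_ob [simp]: "A \<in> Ob B \<Longrightarrow> fob F A \<in> Ob D"
  using F_functor by (auto simp: is_functor_def)

lemma F_id [simp]: "A \<in> Ob B \<Longrightarrow> fmp F A A (Idt B A) = Idt D (fob F A)"
  using F_functor by (auto simp: is_functor_def)

lemma F_hom [simp]:
  "\<lbrakk>A \<in> Ob B; A' \<in> Ob B; f \<in> Hom B A A'\<rbrakk> \<Longrightarrow> fmp F A A' f \<in> Hom D (fob F A) (fob F A')"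
  using F_functor by (auto simp: is_functor_def)

lemma F_cmp:
  "\<lbrakk>A \<in> Ob B; A' \<in> Ob B; A'' \<in> Ob B; f \<in> Hom B A A'; g \<in> Hom B A' A''\<rbrakk> \<Longrightarrow>
    fmp F A A'' (Cmp B A A' A'' g f) =
      Cmp D (fob F A) (fob F A') (fob F A'') (fmp F A' A'' g) (fmp F A A' f)"
  using F_functor by (auto simp: is_functor_def)

lemma F_zer [simp]: "\<lbrakk>A \<in> Ob B; A' \<in> Ob B\<rbrakk> \<Longrightarrow> fmp F A A' (Zer B A A') = Zer D (fob F A) (fob F A')"
  by (rule D.add_self_zero) (simp_all add: F_add[symmetric])

text \<open>Epimorphisms of \<open>B\<close> split, and a functor preserves sections.\<close>

lemma F_epi:
  assumes "epi_mor B A A' f"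
  shows "epi_mor D (fob F A) (fob F A') (fmp F A A' f)"
proof -
  note fD = B.epiD[OF assms]
  obtain s where s: "s \<in> Hom B A' A" "Cmp B A' A A' f s = Idt B A'" using B.epi_split[OF assms] .
  show ?thesis
    by (rule D.epiI_section[where s = "fmp F A' A s"]) (use fD s in \<open>simp_all flip: F_cmp\<close>)
qed

lemma T_Ob [simp]: "(X, Y, e) \<in> Ob T \<longleftrightarrow> X \<in> P \<and> X \<in> Ob D \<and> Y \<in> Ob B \<and> e \<in> Hom D (fob F Y) X"
  by (auto simp: T_def full_sub_def triple_cat_def P_sub)

lemma T_Hom [simp]: "(u, v) \<in> Hom T (X, Y, e) (X', Y', e') \<longleftrightarrow>
    u \<in> Hom D X X' \<and> v \<in> Hom B Y Y' \<and>
    Cmp D (fob F Y) X X' u e = Cmp D (fob F Y) (fob F Y') X' e' (fmp F Y Y' v)"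
  by (auto simp: T_def full_sub_def triple_cat_def)

lemma T_Idt [simp]: "Idt T (X, Y, e) = (Idt D X, Idt B Y)"
  and T_Cmp [simp]: "Cmp T (X, Y, e) (X', Y', e') (X'', Y'', e'') (u', v') (u, v) =
    (Cmp D X X' X'' u' u, Cmp B Y Y' Y'' v' v)"
  and T_Add [simp]: "Add T (X, Y, e) (X', Y', e') (u, v) (u', v') = (Add D X X' u u', Add B Y Y' v v')"
  and T_Zer [simp]: "Zer T (X, Y, e) (X', Y', e') = (Zer D X X', Zer B Y Y')"
  by (simp_all add: T_def full_sub_def triple_cat_def)

lemma T_hom_cmp:
  assumes "X \<in> Ob D" "X' \<in> Ob D" "X'' \<in> Ob D" "Y \<in> Ob B" "Y' \<in> Ob B" "Y'' \<in> Ob B"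
    "e \<in> Hom D (fob F Y) X" "e' \<in> Hom D (fob F Y') X'" "e'' \<in> Hom D (fob F Y'') X''"
    "u \<in> Hom D X X'" "u' \<in> Hom D X' X''" "v \<in> Hom B Y Y'" "v' \<in> Hom B Y' Y''"
    and eq: "Cmp D (fob F Y) X X' u e = Cmp D (fob F Y) (fob F Y') X' e' (fmp F Y Y' v)"
    and eq': "Cmp D (fob F Y') X' X'' u' e' = Cmp D (fob F Y') (fob F Y'') X'' e'' (fmp F Y' Y'' v')"
  shows "Cmp D (fob F Y) X X'' (Cmp D X X' X'' u' u) e =
    Cmp D (fob F Y) (fob F Y'') X'' e'' (fmp F Y Y'' (Cmp B Y Y' Y'' v' v))"
  using assms(1-13) by (simp add: D.cmp_assoc' F_cmp eq D.cmp_reduce[OF eq'])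

lemma T_hom_add:
  assumes "X \<in> Ob D" "X' \<in> Ob D" "Y \<in> Ob B" "Y' \<in> Ob B"
    "e \<in> Hom D (fob F Y) X" "e' \<in> Hom D (fob F Y') X'"
    "u \<in> Hom D X X'" "u' \<in> Hom D X X'" "v \<in> Hom B Y Y'" "v' \<in> Hom B Y Y'"
    and eq: "Cmp D (fob F Y) X X' u e = Cmp D (fob F Y) (fob F Y') X' e' (fmp F Y Y' v)"
    and eq': "Cmp D (fob F Y) X X' u' e = Cmp D (fob F Y) (fob F Y') X' e' (fmp F Y Y' v')"
  shows "Cmp D (fob F Y) X X' (Add D X X' u u') e =
    Cmp D (fob F Y) (fob F Y') X' e' (fmp F Y Y' (Add B Y Y' v v'))"
  using assms(1-10) by (simp add: D.cmp_add_left D.cmp_add_right F_add eq eq')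

lemma F_neg:
  assumes "A \<in> Ob B" "A' \<in> Ob B" "f \<in> Hom B A A'"
  shows "fmp F A A' (Neg B A A' f) = Neg D (fob F A) (fob F A') (fmp F A A' f)"
proof -
  have "Add D (fob F A) (fob F A') (fmp F A A' f) (fmp F A A' (Neg B A A' f))
      = Add D (fob F A) (fob F A') (fmp F A A' f) (Neg D (fob F A) (fob F A') (fmp F A A' f))"
    using assms by (simp add: F_add[symmetric])
  then show ?thesis using assms by (subst (asm) D.add_left_cancel) simp_all
qed

lemma T_hom_group:
  assumes "s \<in> Ob T" "t \<in> Ob T"
  shows "comm_group (hom_group T s t)"
proof -
  obtain X Y e X' Y' e' where st: "s = (X, Y, e)" "t = (X', Y', e')" by (cases s; cases t)
  note st' = assms[unfolded st T_Ob]
  show ?thesis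
  proof (rule comm_groupI)
    fix f assume "f \<in> carrier (hom_group T s t)"
    moreover obtain u v where uv: "f = (u, v)" by (cases f)
    ultimately have f: "(u, v) \<in> Hom T s t" by (simp add: hom_group_def)
    have "(Neg D X X' u, Neg B Y Y' v) \<in> Hom T s t"
      using f st' unfolding st by (simp add: D.cmp_neg_left D.cmp_neg_right F_neg)
    moreover have "Add T s t (Neg D X X' u, Neg B Y Y' v) (u, v) = Zer T s t"
      using f st' unfolding st by simp
    ultimately show "\<exists>y\<in>carrier (hom_group T s t). y \<otimes>\<^bsub>hom_group T s t\<^esub> f = \<one>\<^bsub>hom_group T s t\<^esub>"
      unfolding uv hom_group_def by auto
  qed (use st' in \<open>auto simp: hom_group_def st T_hom_add D.add_ac B.add_ac\<close>)
qed

sublocale T: preadditive_cat T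
proof (rule preadditive_cat.intro)
  fix A1 assume "A1 \<in> Ob T" then show "Idt T A1 \<in> Hom T A1 A1" by (cases A1) auto
next
  fix A1 A2 f assume "A1 \<in> Ob T" "A2 \<in> Ob T" "f \<in> Hom T A1 A2"
  then show "Cmp T A1 A2 A2 (Idt T A2) f = f" "Cmp T A1 A1 A2 f (Idt T A1) = f"
    by (cases A1; cases A2; cases f; auto)+
next
  fix A1 A2 A3 f g assume "A1 \<in> Ob T" "A2 \<in> Ob T" "A3 \<in> Ob T" "f \<in> Hom T A1 A2" "g \<in> Hom T A2 A3"
  then show "Cmp T A1 A2 A3 g f \<in> Hom T A1 A3"
    by (cases A1; cases A2; cases A3; cases f; cases g; auto intro!: T_hom_cmp)
next
  fix A1 A2 A3 A4 f g h
  assume "A1 \<in> Ob T" "A2 \<in> Ob T" "A3 \<in> Ob T" "A4 \<in> Ob T"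
    "f \<in> Hom T A1 A2" "g \<in> Hom T A2 A3" "h \<in> Hom T A3 A4"
  then show "Cmp T A1 A3 A4 h (Cmp T A1 A2 A3 g f) = Cmp T A1 A2 A4 (Cmp T A2 A3 A4 h g) f"
    by (cases A1; cases A2; cases A3; cases A4; cases f; cases g; cases h)
      (simp add: D.cmp_assoc B.cmp_assoc)
next
  fix A1 A2 A3 f g h
  assume "A1 \<in> Ob T" "A2 \<in> Ob T" "A3 \<in> Ob T" "f \<in> Hom T A1 A2" "g \<in> Hom T A2 A3" "h \<in> Hom T A2 A3"
  then show "Cmp T A1 A2 A3 (Add T A2 A3 g h) f = Add T A1 A3 (Cmp T A1 A2 A3 g f) (Cmp T A1 A2 A3 h f)"
    by (cases A1; cases A2; cases A3; cases f; cases g; cases h)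
      (simp add: D.cmp_add_left B.cmp_add_left)
next
  fix A1 A2 A3 f g h
  assume "A1 \<in> Ob T" "A2 \<in> Ob T" "A3 \<in> Ob T" "f \<in> Hom T A1 A2" "g \<in> Hom T A1 A2" "h \<in> Hom T A2 A3"
  then show "Cmp T A1 A2 A3 h (Add T A1 A2 f g) = Add T A1 A3 (Cmp T A1 A2 A3 h f) (Cmp T A1 A2 A3 h g)"
    by (cases A1; cases A2; cases A3; cases f; cases g; cases h)
      (simp add: D.cmp_add_right B.cmp_add_right)
qed (rule T_hom_group)

section \<open>Componentwise kernels, cokernels and biproducts of triples\<close>

lemma T_monoI:
  assumes "(X, Y, e) \<in> Ob T" "(X', Y', e') \<in> Ob T" "(u, v) \<in> Hom T (X, Y, e) (X', Y', e')"
    and "mono_mor D X X' u" "mono_mor B Y Y' v"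
  shows "mono_mor T (X, Y, e) (X', Y', e') (u, v)"
  unfolding T.mono_iff
proof (intro conjI ballI impI assms(1-3))
  fix s t assume s: "s \<in> Ob T" "t \<in> Hom T s (X, Y, e)"
    "Cmp T s (X, Y, e) (X', Y', e') (u, v) t = Zer T s (X', Y', e')"
  then show "t = Zer T s (X, Y, e)"
    using D.monoD_zero[OF assms(4)] B.monoD_zero[OF assms(5)] by (cases s; cases t) auto
qed

lemma T_epiI:
  assumes "(X, Y, e) \<in> Ob T" "(X', Y', e') \<in> Ob T" "(u, v) \<in> Hom T (X, Y, e) (X', Y', e')"
    and "epi_mor D X X' u" "epi_mor B Y Y' v"
  shows "epi_mor T (X, Y, e) (X', Y', e') (u, v)"
  unfolding T.epi_iff
proof (intro conjI ballI impI assms(1-3))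
  fix s t assume s: "s \<in> Ob T" "t \<in> Hom T (X', Y', e') s"
    "Cmp T (X, Y, e) (X', Y', e') s t (u, v) = Zer T (X, Y, e) s"
  then show "t = Zer T (X', Y', e') s"
    using D.epiD_zero[OF assms(4)] B.epiD_zero[OF assms(5)] by (cases s; cases t) auto
qed

text \<open>The two components of a factorization are found separately. That they commute with the
  structure maps is checked after composition with the monomorphism \<open>k\<close>.\<close>

lemma T_kerI:
  assumes Ob: "(X, Y, e) \<in> Ob T" "(X', Y', e') \<in> Ob T" "(K, L, d) \<in> Ob T"
    and uv: "(u, v) \<in> Hom T (X, Y, e) (X', Y', e')" and kl: "(k, l) \<in> Hom T (K, L, d) (X, Y, e)"
    and k: "is_ker D X X' u K k" and l: "is_ker B Y Y' v L l"
  shows "is_ker T (X, Y, e) (X', Y', e') (u, v) (K, L, d) (k, l)"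
proof (rule T.is_kerI)
  show "mono_mor T (K, L, d) (X, Y, e) (k, l)"
    by (rule T_monoI[OF Ob(3,1) kl D.is_ker_mono[OF k] B.is_ker_mono[OF l]])
  show "Cmp T (K, L, d) (X, Y, e) (X', Y', e') (u, v) (k, l) = Zer T (K, L, d) (X', Y', e')"
    using D.is_kerD[OF k] B.is_kerD[OF l] by simp
  fix s t assume s: "s \<in> Ob T" and t: "t \<in> Hom T s (X, Y, e)"
    and 0: "Cmp T s (X, Y, e) (X', Y', e') (u, v) t = Zer T s (X', Y', e')"
  obtain X1 Y1 e1 t1 t2 where st: "s = (X1, Y1, e1)" "t = (t1, t2)" by (cases s; cases t)
  note s = s[unfolded st T_Ob] and t = t[unfolded st T_Hom] and 0 = 0[unfolded st T_Zer T_Cmp prod.inject]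
  note Ob = Ob[unfolded T_Ob] and uv = uv[unfolded T_Hom] and kl = kl[unfolded T_Hom]
  obtain a where a: "a \<in> Hom D X1 K" "Cmp D X1 K X k a = t1" using D.is_ker_factor[OF k] s t 0 by metis
  obtain b where b: "b \<in> Hom B Y1 L" "Cmp B Y1 L Y l b = t2" using B.is_ker_factor[OF l] s t 0 by metis
  have "Cmp D (fob F Y1) K X k (Cmp D (fob F Y1) X1 K a e1) = Cmp D (fob F Y1) X1 X t1 e1"
    unfolding a(2)[symmetric] using s Ob kl a(1) by (simp add: D.cmp_assoc)
  also have "\<dots> = Cmp D (fob F Y1) (fob F Y) X e (fmp F Y1 Y t2)" using t by simp
  also have "\<dots> = Cmp D (fob F Y1) (fob F L) X (Cmp D (fob F L) (fob F Y) X e (fmp F L Y l)) (fmp F Y1 L b)"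
    unfolding b(2)[symmetric] using s Ob kl b(1) by (simp add: F_cmp D.cmp_assoc)
  also have "\<dots> = Cmp D (fob F Y1) K X k (Cmp D (fob F Y1) (fob F L) K d (fmp F Y1 L b))"
    using s Ob kl[THEN conjunct2, THEN conjunct2, symmetric] kl b(1) by (simp add: D.cmp_assoc)
  finally have "Cmp D (fob F Y1) X1 K a e1 = Cmp D (fob F Y1) (fob F L) K d (fmp F Y1 L b)"
    using D.is_ker_mono[OF k] s Ob a b unfolding mono_mor_def by (meson D.cmp_in_hom F_hom F_ob)
  then show "\<exists>y\<in>Hom T s (K, L, d). Cmp T s (K, L, d) (X, Y, e) (k, l) y = t"
    unfolding st using a b by (intro bexI[of _ "(a, b)"]) auto
qed (use assms in auto)

text \<open>Here compatibility with the structure maps is tested after composition with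
  \<open>fmp F Y' R r\<close>, an epimorphism by \<open>F_epi\<close>.\<close>

lemma T_cokerI:
  assumes Ob: "(X, Y, e) \<in> Ob T" "(X', Y', e') \<in> Ob T" "(Q, R, d) \<in> Ob T"
    and uv: "(u, v) \<in> Hom T (X, Y, e) (X', Y', e')" and kl: "(q, r) \<in> Hom T (X', Y', e') (Q, R, d)"
    and q: "is_coker D X X' u Q q" and r: "is_coker B Y Y' v R r"
  shows "is_coker T (X, Y, e) (X', Y', e') (u, v) (Q, R, d) (q, r)"
proof (rule T.is_cokerI)
  show "epi_mor T (X', Y', e') (Q, R, d) (q, r)"
    by (rule T_epiI[OF Ob(2,3) kl D.is_coker_epi[OF q] B.is_coker_epi[OF r]])
  show "Cmp T (X, Y, e) (X', Y', e') (Q, R, d) (q, r) (u, v) = Zer T (X, Y, e) (Q, R, d)"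
    using D.is_cokerD[OF q] B.is_cokerD[OF r] by simp
  fix s t assume s: "s \<in> Ob T" and t: "t \<in> Hom T (X', Y', e') s"
    and 0: "Cmp T (X, Y, e) (X', Y', e') s t (u, v) = Zer T (X, Y, e) s"
  obtain X1 Y1 e1 t1 t2 where st: "s = (X1, Y1, e1)" "t = (t1, t2)" by (cases s; cases t)
  note s = s[unfolded st T_Ob] and t = t[unfolded st T_Hom] and 0 = 0[unfolded st T_Zer T_Cmp prod.inject]
  note Ob = Ob[unfolded T_Ob] and uv = uv[unfolded T_Hom] and kl = kl[unfolded T_Hom]
  obtain a where a: "a \<in> Hom D Q X1" "Cmp D X' Q X1 a q = t1" using D.is_coker_factor[OF q] s t 0 by metis
  obtain b where b: "b \<in> Hom B R Y1" "Cmp B Y' R Y1 b r = t2" using B.is_coker_factor[OF r] s t 0 by metis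
  have ep: "epi_mor D (fob F Y') (fob F R) (fmp F Y' R r)" using F_epi B.is_coker_epi[OF r] by blast
  have "Cmp D (fob F Y') (fob F R) X1 (Cmp D (fob F R) Q X1 a d) (fmp F Y' R r)
      = Cmp D (fob F Y') Q X1 a (Cmp D (fob F Y') (fob F R) Q d (fmp F Y' R r))"
    using s Ob kl a(1) by (simp add: D.cmp_assoc)
  also have "\<dots> = Cmp D (fob F Y') X' X1 t1 e'"
    unfolding a(2)[symmetric] using s Ob kl a(1) by (simp add: D.cmp_assoc')
  also have "\<dots> = Cmp D (fob F Y') (fob F Y1) X1 e1 (fmp F Y' Y1 t2)" using t by simp
  also have "\<dots> = Cmp D (fob F Y') (fob F R) X1 (Cmp D (fob F R) (fob F Y1) X1 e1 (fmp F R Y1 b)) (fmp F Y' R r)"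
    unfolding b(2)[symmetric] using s Ob kl b(1) by (simp add: F_cmp D.cmp_assoc)
  finally have "Cmp D (fob F R) Q X1 a d = Cmp D (fob F R) (fob F Y1) X1 e1 (fmp F R Y1 b)"
    using ep s Ob a b unfolding epi_mor_def by (meson D.cmp_in_hom F_hom F_ob)
  then show "\<exists>y\<in>Hom T (Q, R, d) s. Cmp T (X', Y', e') (Q, R, d) s y (q, r) = t"
    unfolding st using a b by (intro bexI[of _ "(a, b)"]) auto
qed (use assms in auto)

text \<open>From \<open>u e F(l) = e' F(v l) = 0\<close> it follows that \<open>e F(l)\<close>
  factors through the kernel of \<open>u\<close>; the factor is the structure map.\<close>

lemma T_ker_ex:
  assumes Ob: "(X, Y, e) \<in> Ob T" "(X', Y', e') \<in> Ob T" and uv: "(u, v) \<in> Hom T (X, Y, e) (X', Y', e')"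
    and k: "is_ker D X X' u K k" and l: "is_ker B Y Y' v L l"
  obtains d where "is_ker T (X, Y, e) (X', Y', e') (u, v) (K, L, d) (k, l)"
proof -
  note O = Ob[unfolded T_Ob] and H = uv[unfolded T_Hom] and kD = D.is_kerD[OF k] and lD = B.is_kerD[OF l]
  have "Cmp D (fob F L) X X' u (Cmp D (fob F L) (fob F Y) X e (fmp F L Y l))
      = Cmp D (fob F L) (fob F Y) X' (Cmp D (fob F Y) X X' u e) (fmp F L Y l)"
    using O H kD lD by (simp add: D.cmp_assoc)
  also have "\<dots> = Cmp D (fob F L) (fob F Y') X' e' (fmp F L Y' (Cmp B L Y Y' v l))"
    unfolding H[THEN conjunct2, THEN conjunct2] using O H kD lD(1-5) by (simp add: D.cmp_assoc F_cmp)
  also have "\<dots> = Zer D (fob F L) X'" using O lD by simp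
  finally obtain d where d: "d \<in> Hom D (fob F L) K"
    "Cmp D (fob F L) K X k d = Cmp D (fob F L) (fob F Y) X e (fmp F L Y l)"
    using D.is_ker_factor[OF k, of "fob F L" "Cmp D (fob F L) (fob F Y) X e (fmp F L Y l)"] O lD by auto
  have "K \<in> P" using P_mono D.is_ker_mono[OF k] O by blast
  then show ?thesis using that[OF T_kerI[OF Ob _ uv _ k l]] d kD lD by simp
qed

text \<open>The structure map must satisfy \<open>d F(r) = q e'\<close>, and a section
  \<open>s\<close> of \<open>r\<close> suggests \<open>d = q e' F(s)\<close>. The equation follows
  from \<open>v w + s r = 1\<close>, because \<open>q e' F(v) = q u e = 0\<close>.\<close>

lemma T_coker_ex:
  assumes Ob: "(X, Y, e) \<in> Ob T" "(X', Y', e') \<in> Ob T" and uv: "(u, v) \<in> Hom T (X, Y, e) (X', Y', e')"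
    and q: "is_coker D X X' u Q q" and r: "is_coker B Y Y' v R r"
  obtains d where "is_coker T (X, Y, e) (X', Y', e') (u, v) (Q, R, d) (q, r)"
proof -
  note O = Ob[unfolded T_Ob] and H = uv[unfolded T_Hom] and qD = D.is_cokerD[OF q] and rD = B.is_cokerD[OF r]
  obtain w s where ws: "w \<in> Hom B Y' Y" "s \<in> Hom B R Y'"
    "Add B Y' Y' (Cmp B Y' Y Y' v w) (Cmp B Y' R Y' s r) = Idt B Y'"
    using B.coker_section[OF r] by metis
  let ?d = "Cmp D (fob F R) X' Q q (Cmp D (fob F R) (fob F Y') X' e' (fmp F R Y' s))"
  have z: "Cmp D (fob F Y) X' Q q (Cmp D (fob F Y) (fob F Y') X' e' (fmp F Y Y' v)) = Zer D (fob F Y) Q"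
    unfolding H[THEN conjunct2, THEN conjunct2, symmetric]
    by (subst D.cmp_reduce[OF qD(6)]) (use O H qD in auto)
  have "Cmp D (fob F Y') X' Q q e' = Cmp D (fob F Y') X' Q q (Cmp D (fob F Y') (fob F Y') X' e'
      (fmp F Y' Y' (Add B Y' Y' (Cmp B Y' Y Y' v w) (Cmp B Y' R Y' s r))))"
    unfolding ws(3) using O qD by simp
  also have "\<dots> = Add D (fob F Y') Q
      (Cmp D (fob F Y') (fob F Y) Q (Cmp D (fob F Y) X' Q q (Cmp D (fob F Y) (fob F Y') X' e' (fmp F Y Y' v))) (fmp F Y' Y w))
      (Cmp D (fob F Y') (fob F R) Q ?d (fmp F Y' R r))"
    using O H qD(1-5) rD(1-5) ws(1,2) by (simp add: D.cmp_assoc' F_cmp F_add D.cmp_add_right)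
  also have "\<dots> = Cmp D (fob F Y') (fob F R) Q ?d (fmp F Y' R r)"
    unfolding z using O qD rD ws by simp
  finally have H': "(q, r) \<in> Hom T (X', Y', e') (Q, R, ?d)" using qD rD by simp
  have "Q \<in> P" using P_epi D.is_coker_epi[OF q] O by blast
  then have "(Q, R, ?d) \<in> Ob T" using qD rD ws O by simp
  then show ?thesis using that[OF T_cokerI[OF Ob _ uv H' q r]] by blast
qed

text \<open>The comparison morphisms \<open>s\<close> and \<open>t\<close> with the cokernel built
  componentwise satisfy \<open>t s = 1\<close>. Their components carry epimorphy and factorizations
  over to the given cokernel.\<close>

lemma T_cokerD:
  assumes c: "is_coker T (X, Y, e) (X', Y', e') (u, v) (Q, R, d) (q, r)"
  shows "is_coker D X X' u Q q" "is_coker B Y Y' v R r"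
proof -
  note cD = T.is_cokerD[OF c]
  obtain Q' q' where q': "is_coker D X X' u Q' q'" using D.coker_ex cD by fastforce
  obtain R' r' where r': "is_coker B Y Y' v R' r'" using B.coker_ex cD by fastforce
  obtain d' where c': "is_coker T (X, Y, e) (X', Y', e') (u, v) (Q', R', d') (q', r')"
    using T_coker_ex[OF cD(1,2,4) q' r'] by metis
  note cD' = T.is_cokerD[OF c']
  obtain s where s: "s \<in> Hom T (Q, R, d) (Q', R', d')"
    "Cmp T (X', Y', e') (Q, R, d) (Q', R', d') s (q, r) = (q', r')"
    using T.is_coker_factor[OF c] cD' by metis
  obtain t where t: "t \<in> Hom T (Q', R', d') (Q, R, d)"
    "Cmp T (X', Y', e') (Q', R', d') (Q, R, d) t (q', r') = (q, r)"
    using T.is_coker_factor[OF c'] cD by metis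
  obtain s1 s2 t1 t2 where st: "s = (s1, s2)" "t = (t1, t2)" by (cases s; cases t)
  note s = s[unfolded st T_Hom T_Cmp prod.inject] and t = t[unfolded st T_Hom T_Cmp prod.inject]
  have "Cmp T (X', Y', e') (Q, R, d) (Q, R, d) (Cmp T (Q, R, d) (Q', R', d') (Q, R, d) (t1, t2) (s1, s2)) (q, r) = (q, r)"
    using s t cD cD' by (simp add: D.cmp_assoc' B.cmp_assoc')
  moreover have "Cmp T (Q, R, d) (Q', R', d') (Q, R, d) (t1, t2) (s1, s2) \<in> Hom T (Q, R, d) (Q, R, d)"
    by (rule T.cmp_in_hom) (use s t cD cD' in auto)
  ultimately have "Cmp T (Q, R, d) (Q', R', d') (Q, R, d) (t1, t2) (s1, s2) = Idt T (Q, R, d)"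
    using T.is_coker_epi[OF c] unfolding epi_mor_def using cD by (metis T.id_in_hom T.id_left)
  then have ts: "Cmp D Q Q' Q t1 s1 = Idt D Q" "Cmp B R R' R t2 s2 = Idt B R" by simp_all
  show "is_coker D X X' u Q q"
  proof (rule D.is_cokerI)
    show "epi_mor D X' Q q"
      unfolding t(2)[THEN conjunct1, symmetric]
      by (rule D.epi_cmp[OF D.is_coker_epi[OF q']]) (rule D.epiI_section[OF _ _ _ _ ts(1)], use s t cD cD' in auto)
    fix Z z assume z: "Z \<in> Ob D" "z \<in> Hom D X' Z" "Cmp D X X' Z z u = Zer D X Z"
    then obtain a where "a \<in> Hom D Q' Z" "Cmp D X' Q' Z a q' = z" using D.is_coker_factor[OF q'] by metis
    then show "\<exists>y\<in>Hom D Q Z. Cmp D X' Q Z y q = z"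
      using s z cD cD' by (intro bexI[of _ "Cmp D Q Q' Z a s1"]) (auto simp: D.cmp_assoc')
  qed (use cD in auto)
  show "is_coker B Y Y' v R r"
  proof (rule B.is_cokerI)
    show "epi_mor B Y' R r"
      unfolding t(2)[THEN conjunct2, symmetric]
      by (rule B.epi_cmp[OF B.is_coker_epi[OF r']]) (rule B.epiI_section[OF _ _ _ _ ts(2)], use s t cD cD' in auto)
    fix Z z assume z: "Z \<in> Ob B" "z \<in> Hom B Y' Z" "Cmp B Y Y' Z z v = Zer B Y Z"
    then obtain a where "a \<in> Hom B R' Z" "Cmp B Y' R' Z a r' = z" using B.is_coker_factor[OF r'] by metis
    then show "\<exists>y\<in>Hom B R Z. Cmp B Y' R Z y r = z"
      using s z cD cD' by (intro bexI[of _ "Cmp B R R' Z a s2"]) (auto simp: B.cmp_assoc')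
  qed (use cD in auto)
qed

text \<open>The kernel of a monomorphism of triples has zero inclusion, and by
  \<open>T_ker_ex\<close> that inclusion consists of the kernels of the two components.\<close>

lemma T_monoD:
  assumes "mono_mor T (X, Y, e) (X', Y', e') (u, v)"
  shows "mono_mor D X X' u" "mono_mor B Y Y' v"
proof -
  note m = T.monoD[OF assms]
  obtain K k where k: "is_ker D X X' u K k" using D.ker_ex m by fastforce
  obtain L l where l: "is_ker B Y Y' v L l" using B.ker_ex m by fastforce
  obtain d where d: "is_ker T (X, Y, e) (X', Y', e') (u, v) (K, L, d) (k, l)" using T_ker_ex[OF m k l] .
  note dD = T.is_kerD[OF d]
  have "(k, l) = Zer T (K, L, d) (X, Y, e)" using T.monoD_zero[OF assms dD(3,5,6)] .
  then have kl: "k = Zer D K X" "l = Zer B L Y" by auto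
  show "mono_mor D X X' u" unfolding D.mono_iff
  proof (intro conjI ballI impI)
    fix Z z assume z: "Z \<in> Ob D" "z \<in> Hom D Z X" "Cmp D Z X X' u z = Zer D Z X'"
    then obtain a where "a \<in> Hom D Z K" "Cmp D Z K X k a = z" using D.is_ker_factor[OF k] by metis
    then show "z = Zer D Z X" using kl z m dD by auto
  qed (use m in auto)
  show "mono_mor B Y Y' v" unfolding B.mono_iff
  proof (intro conjI ballI impI)
    fix Z z assume z: "Z \<in> Ob B" "z \<in> Hom B Z Y" "Cmp B Z Y Y' v z = Zer B Z Y'"
    then obtain a where "a \<in> Hom B Z L" "Cmp B Z L Y l a = z" using B.is_ker_factor[OF l] by metis
    then show "z = Zer B Z Y" using kl z m dD by auto
  qed (use m in auto)
qed

lemma T_epiD: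
  assumes "epi_mor T (X, Y, e) (X', Y', e') (u, v)"
  shows "epi_mor D X X' u" "epi_mor B Y Y' v"
proof -
  note m = T.epiD[OF assms]
  obtain K k where k: "is_coker D X X' u K k" using D.coker_ex m by fastforce
  obtain L l where l: "is_coker B Y Y' v L l" using B.coker_ex m by fastforce
  obtain d where d: "is_coker T (X, Y, e) (X', Y', e') (u, v) (K, L, d) (k, l)" using T_coker_ex[OF m k l] .
  note dD = T.is_cokerD[OF d]
  have "(k, l) = Zer T (X', Y', e') (K, L, d)" using T.epiD_zero[OF assms dD(3,5,6)] .
  then have kl: "k = Zer D X' K" "l = Zer B Y' L" by auto
  show "epi_mor D X X' u" unfolding D.epi_iff
  proof (intro conjI ballI impI)
    fix Z z assume z: "Z \<in> Ob D" "z \<in> Hom D X' Z" "Cmp D X X' Z z u = Zer D X Z"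
    then obtain a where "a \<in> Hom D K Z" "Cmp D X' K Z a k = z" using D.is_coker_factor[OF k] by metis
    then show "z = Zer D X' Z" using kl z m dD by auto
  qed (use m in auto)
  show "epi_mor B Y Y' v" unfolding B.epi_iff
  proof (intro conjI ballI impI)
    fix Z z assume z: "Z \<in> Ob B" "z \<in> Hom B Y' Z" "Cmp B Y Y' Z z v = Zer B Y Z"
    then obtain a where "a \<in> Hom B L Z" "Cmp B Y' L Z a l = z" using B.is_coker_factor[OF l] by metis
    then show "z = Zer B Y' Z" using kl z m dD by auto
  qed (use m in auto)
qed

lemma T_biprod:
  assumes Ob: "(X, Y, e) \<in> Ob T" "(X', Y', e') \<in> Ob T"
    and x: "is_biprod D X X' Q i1 i2 p1 p2" and y: "is_biprod B Y Y' R j1 j2 q1 q2"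
  obtains d where "is_biprod T (X, Y, e) (X', Y', e') (Q, R, d) (i1, j1) (i2, j2) (p1, q1) (p2, q2)"
proof -
  note O = Ob[unfolded T_Ob] and xD = D.biprodD[OF x] and yD = B.biprodD[OF y]
  \<comment> \<open>The direct sum of \<open>e\<close> and \<open>e'\<close>, written in the
    coordinates of the two biproducts.\<close>
  let ?d = "Add D (fob F R) Q (Cmp D (fob F R) X Q i1 (Cmp D (fob F R) (fob F Y) X e (fmp F R Y q1)))
    (Cmp D (fob F R) X' Q i2 (Cmp D (fob F R) (fob F Y') X' e' (fmp F R Y' q2)))"
  have Q: "Q \<in> P" using P_biprod[OF x] O by blast
  have c1: "Cmp D A Q X p1 (Cmp D A X Q i1 a) = a" "Cmp D A Q X' p2 (Cmp D A X Q i1 a) = Zer D A X'"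
    if "A \<in> Ob D" "a \<in> Hom D A X" for A a
    using that xD D.cmp_reduce[OF xD(8)] D.cmp_reduce[OF xD(10)] by simp_all
  have c2: "Cmp D A Q X p1 (Cmp D A X' Q i2 a) = Zer D A X" "Cmp D A Q X' p2 (Cmp D A X' Q i2 a) = a"
    if "A \<in> Ob D" "a \<in> Hom D A X'" for A a
    using that xD D.cmp_reduce[OF xD(11)] D.cmp_reduce[OF xD(9)] by simp_all
  have f: "Cmp D (fob F Y) (fob F R) (fob F Y) (fmp F R Y q1) (fmp F Y R j1) = Idt D (fob F Y)"
    "Cmp D (fob F Y') (fob F R) (fob F Y') (fmp F R Y' q2) (fmp F Y' R j2) = Idt D (fob F Y')"
    "Cmp D (fob F Y) (fob F R) (fob F Y') (fmp F R Y' q2) (fmp F Y R j1) = Zer D (fob F Y) (fob F Y')"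
    "Cmp D (fob F Y') (fob F R) (fob F Y) (fmp F R Y q1) (fmp F Y' R j2) = Zer D (fob F Y') (fob F Y)"
    using yD by (simp_all flip: F_cmp)
  have "is_biprod T (X, Y, e) (X', Y', e') (Q, R, ?d) (i1, j1) (i2, j2) (p1, q1) (p2, q2)"
    unfolding is_biprod_def using O Q xD yD
    by (simp add: D.cmp_add_left D.cmp_add_right D.cmp_assoc' f c1 c2)
  then show ?thesis using that by blast
qed

section \<open>The category of triples is abelian and hereditary, and its projectives\<close>

lemma T_zero: "\<exists>Z. zero_obj T Z"
proof -
  obtain Z where Z: "Z \<in> P" "zero_obj D Z" using P_zero by blast
  obtain W where W: "zero_obj B W" using B.zero_ex by blast
  have "zero_obj T (Z, W, Zer D (fob F W) Z)"
    using Z W unfolding T.zero_obj_iff by (simp add: D.zero_obj_iff B.zero_obj_iff)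
  then show ?thesis by blast
qed

lemma T_abelian: "abelian_cat T"
  unfolding abelian_cat_def
proof (intro conjI ballI allI impI T.preadditive_cat_axioms T_zero)
  fix s t assume st: "s \<in> Ob T" "t \<in> Ob T"
  obtain X Y e X' Y' e' where st': "s = (X, Y, e)" "t = (X', Y', e')" by (cases s; cases t)
  note O = st[unfolded st' T_Ob]
  show "\<exists>P i1 i2 p1 p2. is_biprod T s t P i1 i2 p1 p2"
    using D.biprod_ex[of X X'] B.biprod_ex[of Y Y'] O st T_biprod unfolding st' by metis
  fix f assume f: "f \<in> Hom T s t"
  obtain u v where uv: "f = (u, v)" by (cases f)
  note H = f[unfolded uv st' T_Hom]
  show "\<exists>K k. is_ker T s t f K k"
    using D.ker_ex[of X X' u] B.ker_ex[of Y Y' v] O H st f T_ker_ex unfolding st' uv by metis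
  show "\<exists>Q q. is_coker T s t f Q q"
    using D.coker_ex[of X X' u] B.coker_ex[of Y Y' v] O H st f T_coker_ex unfolding st' uv by metis
next
  fix s t f assume m: "mono_mor T s t f"
  obtain X Y e X' Y' e' u v where st': "s = (X, Y, e)" "t = (X', Y', e')" "f = (u, v)" by (cases s; cases t; cases f)
  note mm = T_monoD[OF m[unfolded st']] and mD = T.monoD[OF m, unfolded st']
  obtain Q q where q: "is_coker D X X' u Q q" using D.coker_ex D.monoD[OF mm(1)] by metis
  obtain R r where r: "is_coker B Y Y' v R r" using B.coker_ex B.monoD[OF mm(2)] by metis
  obtain d where d: "is_coker T s t f (Q, R, d) (q, r)" using T_coker_ex[OF mD q r] unfolding st' .
  have "is_ker T t (Q, R, d) (q, r) s f" unfolding st'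
    by (rule T_kerI) (use T.is_cokerD[OF d] D.mono_is_ker[OF mm(1) q] B.mono_is_ker[OF mm(2) r] in \<open>simp_all add: st'\<close>)
  then show "\<exists>D g. is_ker T t D g s f" by blast
next
  fix s t f assume m: "epi_mor T s t f"
  obtain X Y e X' Y' e' u v where st': "s = (X, Y, e)" "t = (X', Y', e')" "f = (u, v)" by (cases s; cases t; cases f)
  note mm = T_epiD[OF m[unfolded st']] and mD = T.epiD[OF m, unfolded st']
  obtain Q q where q: "is_ker D X X' u Q q" using D.ker_ex D.epiD[OF mm(1)] by metis
  obtain R r where r: "is_ker B Y Y' v R r" using B.ker_ex B.epiD[OF mm(2)] by metis
  obtain d where d: "is_ker T s t f (Q, R, d) (q, r)" using T_ker_ex[OF mD q r] unfolding st' .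
  have "is_coker T (Q, R, d) s (q, r) t f" unfolding st'
    by (rule T_cokerI) (use T.is_kerD[OF d] D.epi_is_coker[OF mm(1) q] B.epi_is_coker[OF mm(2) r] in \<open>simp_all add: st'\<close>)
  then show "\<exists>D g. is_coker T D s g t f" by blast
qed

sublocale T: abelian T
  by unfold_locales (rule T_abelian)

text \<open>The lift adjoins the cokernel to the source; the connecting component of its structure map is
  obtained from a quasi-inverse \<open>w\<close> of \<open>u\<close>.\<close>

lemma T_hereditary: "hereditary_cat T"
proof (rule T.hereditaryI)
  fix E1 E2 L f q assume c: "is_coker T E1 E2 f L q"
  obtain X1 Y1 e1 X2 Y2 e2 XL YL eL u v qx qy where
    eqs: "E1 = (X1, Y1, e1)" "E2 = (X2, Y2, e2)" "L = (XL, YL, eL)" "f = (u, v)" "q = (qx, qy)"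
    by (cases E1; cases E2; cases L; cases f; cases q)
  note cc = T_cokerD[OF c[unfolded eqs]] and cD = T.is_cokerD[OF c, unfolded eqs T_Ob T_Hom]
  note xD = D.is_cokerD[OF cc(1)] and yD = B.is_cokerD[OF cc(2)]
  obtain w s where s: "w \<in> Hom D X2 X1" "s \<in> Hom D XL X2" "Cmp D XL X2 XL qx s = Idt D XL"
    "Add D X2 X2 (Cmp D X2 X1 X2 u w) (Cmp D X2 XL X2 s qx) = Idt D X2"
    using D.coker_section[OF cc(1)] by metis
  obtain s' where s': "s' \<in> Hom B YL Y2" "Cmp B YL Y2 YL qy s' = Idt B YL"
    using B.coker_section[OF cc(2)] by metis
  obtain GX i1 i2 p1 p2 where gx: "is_biprod D X1 XL GX i1 i2 p1 p2" using D.biprod_ex xD by metis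
  obtain GY j1 j2 q1 q2 where gy: "is_biprod B Y1 YL GY j1 j2 q1 q2" using B.biprod_ex yD by metis
  note gxD = D.biprodD[OF gx] and gyD = B.biprodD[OF gy]
  note kx = D.biprod_ker_coker[OF gx] and ky = B.biprod_ker_coker[OF gy]
  have GP: "GX \<in> P" using P_biprod[OF gx] cD by blast
  let ?m = "Cmp D (fob F YL) X2 X1 w (Cmp D (fob F YL) (fob F Y2) X2 e2 (fmp F YL Y2 s'))"
  let ?n = "Add D (fob F GY) X1 (Cmp D (fob F GY) (fob F Y1) X1 e1 (fmp F GY Y1 q1))
    (Cmp D (fob F GY) (fob F YL) X1 ?m (fmp F GY YL q2))"
  \<comment> \<open>With respect to the decompositions of \<open>GX\<close> into \<open>X1\<close>,
    \<open>XL\<close> and of \<open>GY\<close> into \<open>Y1\<close>, \<open>YL\<close>, the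
    structure map \<open>?e\<close> is triangular, with diagonal \<open>e1\<close>,
    \<open>eL\<close> and off-diagonal entry \<open>?m\<close>. The components \<open>?g\<close> and
    \<open>?h\<close> extend \<open>u\<close> and \<open>v\<close> by the sections \<open>s\<close>
    and \<open>s'\<close>.\<close>
  let ?e = "Add D (fob F GY) GX (Cmp D (fob F GY) X1 GX i1 ?n)
    (Cmp D (fob F GY) XL GX i2 (Cmp D (fob F GY) (fob F YL) XL eL (fmp F GY YL q2)))"
  let ?g = "Add D GX X2 (Cmp D GX X1 X2 u p1) (Cmp D GX XL X2 s p2)"
  let ?h = "Add B GY Y2 (Cmp B GY Y1 Y2 v q1) (Cmp B GY YL Y2 s' q2)"
  have c1: "Cmp D A GX X1 p1 (Cmp D A X1 GX i1 a) = a" "Cmp D A GX XL p2 (Cmp D A X1 GX i1 a) = Zer D A XL"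
    if "A \<in> Ob D" "a \<in> Hom D A X1" for A a
    using that gxD D.cmp_reduce[OF gxD(8)] D.cmp_reduce[OF gxD(10)] by simp_all
  have c2: "Cmp D A GX X1 p1 (Cmp D A XL GX i2 a) = Zer D A X1" "Cmp D A GX XL p2 (Cmp D A XL GX i2 a) = a"
    if "A \<in> Ob D" "a \<in> Hom D A XL" for A a
    using that gxD D.cmp_reduce[OF gxD(11)] D.cmp_reduce[OF gxD(9)] by simp_all
  have fj: "Cmp D (fob F Y1) (fob F GY) (fob F Y1) (fmp F GY Y1 q1) (fmp F Y1 GY j1) = Idt D (fob F Y1)"
    "Cmp D (fob F Y1) (fob F GY) (fob F YL) (fmp F GY YL q2) (fmp F Y1 GY j1) = Zer D (fob F Y1) (fob F YL)"
    using gyD by (simp_all flip: F_cmp)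
  have nH: "?n \<in> Hom D (fob F GY) X1" and mH: "?m \<in> Hom D (fob F YL) X1"
    using cD xD yD gyD s s' by simp_all
  have eH: "?e \<in> Hom D (fob F GY) GX"
    using nH mH cD gxD gyD s s' by simp
  have G: "(GX, GY, ?e) \<in> Ob T" using GP eH gxD gyD by simp
  have a: "(i1, j1) \<in> Hom T E1 (GX, GY, ?e)"
    unfolding eqs using cD gxD gyD s s' xD yD
    by (simp add: D.cmp_add_left D.cmp_add_right D.cmp_assoc' fj)
  have pi: "(p2, q2) \<in> Hom T (GX, GY, ?e) L"
    unfolding eqs using cD gxD gyD s s' xD yD
    by (simp add: D.cmp_add_left D.cmp_add_right D.cmp_assoc' fj c1 c2)
  have qs: "Cmp D (fob F YL) XL X2 s eL =
      Cmp D (fob F YL) XL X2 s (Cmp D (fob F YL) X2 XL qx (Cmp D (fob F YL) (fob F Y2) X2 e2 (fmp F YL Y2 s')))"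
  proof -
    have "eL = Cmp D (fob F YL) (fob F YL) XL eL (fmp F YL YL (Cmp B YL Y2 YL qy s'))"
      unfolding s'(2) using cD by simp
    also have "\<dots> = Cmp D (fob F YL) (fob F Y2) XL (Cmp D (fob F Y2) (fob F YL) XL eL (fmp F Y2 YL qy)) (fmp F YL Y2 s')"
      using cD s'(1) by (simp add: F_cmp D.cmp_assoc)
    also have "\<dots> = Cmp D (fob F YL) X2 XL qx (Cmp D (fob F YL) (fob F Y2) X2 e2 (fmp F YL Y2 s'))"
      using cD(5)[THEN conjunct2, THEN conjunct2, symmetric] cD s'(1) by (simp add: D.cmp_assoc)
    finally show ?thesis by simp
  qed
  \<comment> \<open>This is the square for \<open>(?g, ?h)\<close> on the summand \<open>YL\<close>.
    Since \<open>eL = qx e2 F(s')\<close>, the left side is \<open>(u w + s qx) e2 F(s')\<close>, so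
    the choice of \<open>?m\<close> is exactly what the decomposition of the identity
    requires.\<close>
  have us: "Add D (fob F YL) X2 (Cmp D (fob F YL) X1 X2 u ?m) (Cmp D (fob F YL) XL X2 s eL)
      = Cmp D (fob F YL) (fob F Y2) X2 e2 (fmp F YL Y2 s')"
  proof -
    have "Add D (fob F YL) X2 (Cmp D (fob F YL) X1 X2 u ?m) (Cmp D (fob F YL) XL X2 s eL)
        = Cmp D (fob F YL) X2 X2 (Add D X2 X2 (Cmp D X2 X1 X2 u w) (Cmp D X2 XL X2 s qx))
          (Cmp D (fob F YL) (fob F Y2) X2 e2 (fmp F YL Y2 s'))"
      unfolding qs using cD s(1,2) s'(1) xD(1-5) yD(1-5) by (simp add: D.cmp_add_left D.cmp_assoc')
    then show ?thesis unfolding s(4) using cD s' by simp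
  qed
  have g: "(?g, ?h) \<in> Hom T (GX, GY, ?e) E2"
  proof -
    have mm: "Add D (fob F GY) X2 (Cmp D (fob F GY) X1 X2 u (Add D (fob F GY) X1
          (Cmp D (fob F GY) (fob F Y1) X1 e1 (fmp F GY Y1 q1)) (Cmp D (fob F GY) (fob F YL) X1 m (fmp F GY YL q2))))
        (Cmp D (fob F GY) XL X2 s (Cmp D (fob F GY) (fob F YL) XL eL (fmp F GY YL q2)))
      = Add D (fob F GY) X2 (Cmp D (fob F GY) (fob F Y1) X2 (Cmp D (fob F Y1) X1 X2 u e1) (fmp F GY Y1 q1))
        (Cmp D (fob F GY) (fob F YL) X2
          (Add D (fob F YL) X2 (Cmp D (fob F YL) X1 X2 u m) (Cmp D (fob F YL) XL X2 s eL)) (fmp F GY YL q2))"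
      if "m \<in> Hom D (fob F YL) X1" for m
      using that cD(1,2,3) gyD(1-7) s(1,2) xD(1-5) yD(1-5)
      by (simp add: D.cmp_add_left D.cmp_add_right D.cmp_assoc' D.add_assoc)
    have "Cmp D (fob F GY) GX X2 ?g ?e = Add D (fob F GY) X2 (Cmp D (fob F GY) X1 X2 u ?n)
        (Cmp D (fob F GY) XL X2 s (Cmp D (fob F GY) (fob F YL) XL eL (fmp F GY YL q2)))"
    proof -
      have "Cmp D (fob F GY) GX X1 p1 ?e = ?n"
        using nH mH cD gxD gyD s s' by (simp add: D.cmp_add_right c1 c2)
      moreover have "Cmp D (fob F GY) GX XL p2 ?e = Cmp D (fob F GY) (fob F YL) XL eL (fmp F GY YL q2)"
        using nH mH cD gxD gyD s s' by (simp add: D.cmp_add_right c1 c2)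
      moreover have "Cmp D (fob F GY) GX X2 ?g E = Add D (fob F GY) X2
          (Cmp D (fob F GY) X1 X2 u (Cmp D (fob F GY) GX X1 p1 E)) (Cmp D (fob F GY) XL X2 s (Cmp D (fob F GY) GX XL p2 E))"
        if "E \<in> Hom D (fob F GY) GX" for E
        using that gxD(1-7) gyD(3) s(1,2) xD(1-5) by (simp add: D.cmp_add_left D.cmp_assoc')
      ultimately show ?thesis using eH by (simp only:)
    qed
    also have "\<dots> = Add D (fob F GY) X2 (Cmp D (fob F GY) (fob F Y1) X2 (Cmp D (fob F Y1) X1 X2 u e1) (fmp F GY Y1 q1))
      (Cmp D (fob F GY) (fob F YL) X2
        (Add D (fob F YL) X2 (Cmp D (fob F YL) X1 X2 u ?m) (Cmp D (fob F YL) XL X2 s eL)) (fmp F GY YL q2))"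
      by (rule mm[OF mH])
    also have "\<dots> = Cmp D (fob F GY) (fob F Y2) X2 e2 (fmp F GY Y2 ?h)"
      unfolding us using cD s' gyD(1-7) by (simp add: D.cmp_add_right D.cmp_assoc' F_cmp F_add)
    finally show ?thesis unfolding eqs using cD gxD gyD s s' by simp
  qed
  have "is_ker T (GX, GY, ?e) L (p2, q2) E1 (i1, j1)"
    unfolding eqs by (rule T_kerI) (use cD G pi a kx ky in \<open>simp_all add: eqs del: T_Hom\<close>)
  moreover have "epi_mor T (GX, GY, ?e) L (p2, q2)"
    unfolding eqs by (rule T_epiI)
      (use cD G pi D.is_coker_epi[OF kx(2)] B.is_coker_epi[OF ky(2)] in \<open>simp_all add: eqs del: T_Hom\<close>)
  moreover have "Cmp T E1 (GX, GY, ?e) E2 (?g, ?h) (i1, j1) = f"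
    unfolding eqs using cD gxD gyD s s' by (simp add: D.cmp_add_left B.cmp_add_left D.cmp_assoc' B.cmp_assoc')
  moreover have "Cmp T (GX, GY, ?e) E2 L q (?g, ?h) = (p2, q2)"
    unfolding eqs using cD gxD gyD s s' xD yD by (simp add: D.cmp_add_right B.cmp_add_right D.cmp_assoc B.cmp_assoc)
  ultimately show "\<exists>G a \<pi> g. is_ker T G L \<pi> E1 a \<and> epi_mor T G L \<pi> \<and>
    g \<in> Hom T G E2 \<and> Cmp T E1 G E2 g a = f \<and> Cmp T G E2 L q g = \<pi>" using g by metis
qed

text \<open>A morphism out of \<open>(F Y + X, Y, i1)\<close> amounts to an arbitrary pair of
  morphisms out of \<open>X\<close> and \<open>Y\<close>, and such pairs lift because epimorphisms
  split in both categories. The assumption on \<open>P\<close> admits \<open>F Y + X\<close> as a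
  first component.\<close>

lemma T_enough_projectives:
  assumes P: "P = Ob D"
  shows "enough_projectives T"
  unfolding enough_projectives_def
proof
  fix A assume A: "A \<in> Ob T"
  obtain X Y e where Ae: "A = (X, Y, e)" by (cases A)
  note A = A[unfolded Ae T_Ob]
  obtain Q i1 i2 p1 p2 where q: "is_biprod D (fob F Y) X Q i1 i2 p1 p2" using D.biprod_ex A F_ob by metis
  note qD = D.biprodD[OF q]
  have QO: "(Q, Y, i1) \<in> Ob T" unfolding T_Ob using A qD P by simp
  let ?p = "Add D Q X (Cmp D Q (fob F Y) X e p1) p2"
  have "epi_mor T (Q, Y, i1) A (?p, Idt B Y)" unfolding Ae
  proof (rule T_epiI)
    show "epi_mor D Q X ?p"
      by (rule D.epiI_section[of _ _ _ i2]) (use qD A in \<open>simp_all add: D.cmp_add_left D.cmp_assoc'\<close>)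
    show "epi_mor B Y Y (Idt B Y)" using A by (simp add: B.epi_iff)
    show "(?p, Idt B Y) \<in> Hom T (Q, Y, i1) (X, Y, e)"
      using qD A by (simp add: D.cmp_add_left D.cmp_assoc')
  qed (use A QO in auto)
  moreover have "projective_obj T (Q, Y, i1)"
    unfolding projective_obj_def
  proof (intro conjI allI impI ballI QO)
    fix A1 A2 ep f assume ep: "epi_mor T A1 A2 ep" and f: "f \<in> Hom T (Q, Y, i1) A2"
    obtain X1 Y1 e1 X2 Y2 e2 u v a b where eqs: "A1 = (X1, Y1, e1)" "A2 = (X2, Y2, e2)" "ep = (u, v)" "f = (a, b)"
      by (cases A1; cases A2; cases ep; cases f)
    note eD = T.epiD[OF ep, unfolded eqs T_Ob T_Hom] and uv = T_epiD[OF ep[unfolded eqs]]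
    note f = f[unfolded eqs T_Hom]
    obtain s where s: "s \<in> Hom D X2 X1" "Cmp D X2 X1 X2 u s = Idt D X2" using D.epi_split[OF uv(1)] .
    obtain t where t: "t \<in> Hom B Y2 Y1" "Cmp B Y2 Y1 Y2 v t = Idt B Y2" using B.epi_split[OF uv(2)] .
    define b' where "b' = Cmp B Y Y2 Y1 t b"
    \<comment> \<open>On the summand \<open>F Y\<close> the lift is forced by compatibility with
      \<open>b'\<close>; on \<open>X\<close> it is free, and there the section \<open>s\<close> of
      \<open>u\<close> is used.\<close>
    define h where "h = Cmp D (fob F Y) (fob F Y1) X1 e1 (fmp F Y Y1 b')"
    define c where "c = Cmp D X X2 X1 s (Cmp D X Q X2 a i2)"
    define a' where "a' = Add D Q X1 (Cmp D Q (fob F Y) X1 h p1) (Cmp D Q X X1 c p2)"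
    have bH: "b' \<in> Hom B Y Y1" using eD(1,2) f A t by (simp add: b'_def)
    have hH: "h \<in> Hom D (fob F Y) X1" using eD(1,2) A bH by (simp add: h_def)
    have iH: "Cmp D X Q X2 a i2 \<in> Hom D X X2" using eD(1,2) f A qD by simp
    have cH: "c \<in> Hom D X X1" using iH eD(1,2) A s by (simp add: c_def del: D.cmp_in_hom add: D.cmp_in_hom[of X X2 X1])
    have vb: "Cmp B Y Y1 Y2 v b' = b" unfolding b'_def using eD f A t by (simp add: B.cmp_assoc)
    have aH: "a' \<in> Hom D Q X1" unfolding a'_def using hH cH eD(1) A qD(1-7) by simp
    have ai1: "Cmp D (fob F Y) Q X1 a' i1 = h" unfolding a'_def
      using hH cH eD(1) A qD by (simp add: D.cmp_add_left D.cmp_assoc')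
    have ai2: "Cmp D X Q X1 a' i2 = c" unfolding a'_def
      using hH cH eD(1) A qD by (simp add: D.cmp_add_left D.cmp_assoc')
    have uh: "Cmp D (fob F Y) X1 X2 u h = Cmp D (fob F Y) Q X2 a i1"
    proof -
      have "Cmp D (fob F Y) X1 X2 u h = Cmp D (fob F Y) (fob F Y1) X2 (Cmp D (fob F Y1) X1 X2 u e1) (fmp F Y Y1 b')"
        unfolding h_def using eD A bH by (simp add: D.cmp_assoc)
      also have "\<dots> = Cmp D (fob F Y) (fob F Y2) X2 e2 (fmp F Y Y2 (Cmp B Y Y1 Y2 v b'))"
        unfolding eD(3)[THEN conjunct2, THEN conjunct2] using eD A bH by (simp add: D.cmp_assoc' F_cmp)
      finally show ?thesis unfolding vb using f by simp
    qed
    have ua: "Cmp D Q X1 X2 u a' = a"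
    proof (rule D.biprod_eqI[OF q])
      have "Cmp D (fob F Y) Q X2 (Cmp D Q X1 X2 u a') i1 = Cmp D (fob F Y) X1 X2 u h"
        unfolding ai1[symmetric] using aH eD qD A by (simp add: D.cmp_assoc')
      then show "Cmp D (fob F Y) Q X2 (Cmp D Q X1 X2 u a') i1 = Cmp D (fob F Y) Q X2 a i1" using uh by simp
      have "Cmp D X Q X2 (Cmp D Q X1 X2 u a') i2 = Cmp D X X1 X2 u c"
        unfolding ai2[symmetric] using aH eD qD A by (simp add: D.cmp_assoc')
      also have "\<dots> = Cmp D X Q X2 a i2" unfolding c_def
        by (subst D.cmp_reduce[OF s(2)]) (use iH s eD A in auto)
      finally show "Cmp D X Q X2 (Cmp D Q X1 X2 u a') i2 = Cmp D X Q X2 a i2" .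
    qed (use aH eD f qD in auto)
    have aeq: "Cmp D (fob F Y) Q X1 a' i1 = Cmp D (fob F Y) (fob F Y1) X1 e1 (fmp F Y Y1 b')"
      unfolding ai1 h_def ..
    have "(a', b') \<in> Hom T (Q, Y, i1) A1" unfolding eqs T_Hom using aH bH aeq by blast
    moreover have "Cmp T (Q, Y, i1) A1 A2 ep (a', b') = f" unfolding eqs T_Cmp ua vb ..
    ultimately show "\<exists>g\<in>Hom T (Q, Y, i1) A1. Cmp T (Q, Y, i1) A1 A2 ep g = f" by metis
  qed
  ultimately show "\<exists>P e. projective_obj T P \<and> epi_mor T P A e" by metis
qed

end

section \<open>Modules over rings with local units\<close>

lemma nu_moduleD:
  assumes "nu_module A N"
  shows "abelian_group N"
    and "\<And>a x. \<lbrakk>a \<in> carrier A; x \<in> carrier N\<rbrakk> \<Longrightarrow> a \<odot>\<^bsub>N\<^esub> x \<in> carrier N"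
    and "\<And>a b x. \<lbrakk>a \<in> carrier A; b \<in> carrier A; x \<in> carrier N\<rbrakk>
      \<Longrightarrow> (a \<oplus>\<^bsub>A\<^esub> b) \<odot>\<^bsub>N\<^esub> x = a \<odot>\<^bsub>N\<^esub> x \<oplus>\<^bsub>N\<^esub> b \<odot>\<^bsub>N\<^esub> x"
    and "\<And>a x y. \<lbrakk>a \<in> carrier A; x \<in> carrier N; y \<in> carrier N\<rbrakk>
      \<Longrightarrow> a \<odot>\<^bsub>N\<^esub> (x \<oplus>\<^bsub>N\<^esub> y) = a \<odot>\<^bsub>N\<^esub> x \<oplus>\<^bsub>N\<^esub> a \<odot>\<^bsub>N\<^esub> y"
    and "\<And>a b x. \<lbrakk>a \<in> carrier A; b \<in> carrier A; x \<in> carrier N\<rbrakk>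
      \<Longrightarrow> (a \<otimes>\<^bsub>A\<^esub> b) \<odot>\<^bsub>N\<^esub> x = a \<odot>\<^bsub>N\<^esub> (b \<odot>\<^bsub>N\<^esub> x)"
  using assms unfolding nu_module_def by blast+

text \<open>The condition \<open>A N = N\<close> is deduced from the stronger one that every element
  is fixed by some scalar; over rings with local units the converse is
  \<open>nu_unit\<close>.\<close>

lemma nu_moduleI:
  assumes N: "abelian_group N"
    and cl: "\<And>a x. \<lbrakk>a \<in> carrier A; x \<in> carrier N\<rbrakk> \<Longrightarrow> a \<odot>\<^bsub>N\<^esub> x \<in> carrier N"
    and "\<And>a b x. \<lbrakk>a \<in> carrier A; b \<in> carrier A; x \<in> carrier N\<rbrakk>
      \<Longrightarrow> (a \<oplus>\<^bsub>A\<^esub> b) \<odot>\<^bsub>N\<^esub> x = a \<odot>\<^bsub>N\<^esub> x \<oplus>\<^bsub>N\<^esub> b \<odot>\<^bsub>N\<^esub> x"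
    and "\<And>a x y. \<lbrakk>a \<in> carrier A; x \<in> carrier N; y \<in> carrier N\<rbrakk>
      \<Longrightarrow> a \<odot>\<^bsub>N\<^esub> (x \<oplus>\<^bsub>N\<^esub> y) = a \<odot>\<^bsub>N\<^esub> x \<oplus>\<^bsub>N\<^esub> a \<odot>\<^bsub>N\<^esub> y"
    and "\<And>a b x. \<lbrakk>a \<in> carrier A; b \<in> carrier A; x \<in> carrier N\<rbrakk>
      \<Longrightarrow> (a \<otimes>\<^bsub>A\<^esub> b) \<odot>\<^bsub>N\<^esub> x = a \<odot>\<^bsub>N\<^esub> (b \<odot>\<^bsub>N\<^esub> x)"
    and unit: "\<And>x. x \<in> carrier N \<Longrightarrow> \<exists>a \<in> carrier A. a \<odot>\<^bsub>N\<^esub> x = x"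
  shows "nu_module A N"
proof -
  interpret abelian_group N by (rule N)
  let ?S = "{a \<odot>\<^bsub>N\<^esub> x | a x. a \<in> carrier A \<and> x \<in> carrier N}"
  have "?S \<subseteq> carrier N" using cl by blast
  moreover have "carrier N \<subseteq> ?S"
  proof
    fix x assume "x \<in> carrier N"
    then obtain a where "a \<in> carrier A" "a \<odot>\<^bsub>N\<^esub> x = x" using unit by blast
    then show "x \<in> ?S" using \<open>x \<in> carrier N\<close> by (intro CollectI exI[of _ a] exI[of _ x]) simp
  qed
  ultimately have "?S = carrier (add_monoid N)" by simp
  moreover have "generate (add_monoid N) (carrier (add_monoid N)) = carrier (add_monoid N)"
    using add.generate_incl[of "carrier N"] generate.incl by fastforce
  ultimately have gen: "generate (add_monoid N) ?S = carrier N" by simp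
  show ?thesis unfolding nu_module_def by (intro conjI ballI assms(1-5) gen)
qed

lemma mod_homsD:
  assumes "f \<in> mod_homs A N N'"
  shows "\<And>x. x \<in> carrier N \<Longrightarrow> f x \<in> carrier N'"
    and "\<And>x y. \<lbrakk>x \<in> carrier N; y \<in> carrier N\<rbrakk> \<Longrightarrow> f (x \<oplus>\<^bsub>N\<^esub> y) = f x \<oplus>\<^bsub>N'\<^esub> f y"
    and "\<And>a x. \<lbrakk>a \<in> carrier A; x \<in> carrier N\<rbrakk> \<Longrightarrow> f (a \<odot>\<^bsub>N\<^esub> x) = a \<odot>\<^bsub>N'\<^esub> f x"
    and "f \<in> extensional (carrier N)"
  using assms unfolding mod_homs_def by (auto simp: PiE_def)

lemma mod_homsI:
  assumes "\<And>x. x \<in> carrier N \<Longrightarrow> f x \<in> carrier N'"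
    and "\<And>x y. \<lbrakk>x \<in> carrier N; y \<in> carrier N\<rbrakk> \<Longrightarrow> f (x \<oplus>\<^bsub>N\<^esub> y) = f x \<oplus>\<^bsub>N'\<^esub> f y"
    and "\<And>a x. \<lbrakk>a \<in> carrier A; x \<in> carrier N\<rbrakk> \<Longrightarrow> f (a \<odot>\<^bsub>N\<^esub> x) = a \<odot>\<^bsub>N'\<^esub> f x"
    and "f \<in> extensional (carrier N)"
  shows "f \<in> mod_homs A N N'"
  using assms unfolding mod_homs_def by (auto simp: PiE_def)

lemma additive_zero:
  assumes "abelian_group N" "abelian_group N'"
    and "\<And>x. x \<in> carrier N \<Longrightarrow> f x \<in> carrier N'"
    and "\<And>x y. \<lbrakk>x \<in> carrier N; y \<in> carrier N\<rbrakk> \<Longrightarrow> f (x \<oplus>\<^bsub>N\<^esub> y) = f x \<oplus>\<^bsub>N'\<^esub> f y"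
  shows "f \<zero>\<^bsub>N\<^esub> = \<zero>\<^bsub>N'\<^esub>" "x \<in> carrier N \<Longrightarrow> f (\<ominus>\<^bsub>N\<^esub> x) = \<ominus>\<^bsub>N'\<^esub> f x"
proof -
  interpret N: abelian_group N by fact
  interpret N': abelian_group N' by fact
  have "f \<zero>\<^bsub>N\<^esub> \<oplus>\<^bsub>N'\<^esub> f \<zero>\<^bsub>N\<^esub> = f \<zero>\<^bsub>N\<^esub> \<oplus>\<^bsub>N'\<^esub> \<zero>\<^bsub>N'\<^esub>" using assms(3,4)[of "\<zero>\<^bsub>N\<^esub>"] assms(4)[of "\<zero>\<^bsub>N\<^esub>" "\<zero>\<^bsub>N\<^esub>"] by simp
  then show z: "f \<zero>\<^bsub>N\<^esub> = \<zero>\<^bsub>N'\<^esub>" using assms(3)[of "\<zero>\<^bsub>N\<^esub>"] by simp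
  assume x: "x \<in> carrier N"
  have "f (\<ominus>\<^bsub>N\<^esub> x) \<oplus>\<^bsub>N'\<^esub> f x = \<zero>\<^bsub>N'\<^esub>" using assms(4)[of "\<ominus>\<^bsub>N\<^esub> x" x] x z by (simp add: N.l_neg)
  then show "f (\<ominus>\<^bsub>N\<^esub> x) = \<ominus>\<^bsub>N'\<^esub> f x" using assms(3) x by (simp add: N'.minus_equality)
qed

lemma mod_homs_zero:
  assumes "abelian_group N" "abelian_group N'" "f \<in> mod_homs A N N'"
  shows "f \<zero>\<^bsub>N\<^esub> = \<zero>\<^bsub>N'\<^esub>" "x \<in> carrier N \<Longrightarrow> f (\<ominus>\<^bsub>N\<^esub> x) = \<ominus>\<^bsub>N'\<^esub> f x"
  using additive_zero[OF assms(1,2), of f] mod_homsD[OF assms(3)] by auto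

lemma mod_homs_compose:
  assumes "nu_module A N" "f \<in> mod_homs A N N'" "g \<in> mod_homs A N' N''"
  shows "compose (carrier N) g f \<in> mod_homs A N N''"
proof -
  interpret abelian_group N using nu_moduleD(1)[OF assms(1)] .
  note f = mod_homsD[OF assms(2)] and g = mod_homsD[OF assms(3)] and N = nu_moduleD[OF assms(1)]
  show ?thesis by (rule mod_homsI) (use f g N in \<open>auto simp: compose_def\<close>)
qed

lemma mod_homs_inv:
  assumes N: "nu_module A N" and f: "f \<in> mod_homs A N N'" and b: "bij_betw f (carrier N) (carrier N')"
  shows "restrict (inv_into (carrier N) f) (carrier N') \<in> mod_homs A N' N"
proof -
  interpret abelian_group N using nu_moduleD(1)[OF N] .
  note f' = mod_homsD[OF f] and N' = nu_moduleD[OF N]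
  let ?g = "inv_into (carrier N) f"
  have g: "?g y \<in> carrier N" "f (?g y) = y" if "y \<in> carrier N'" for y
    using that b by (auto simp: bij_betw_def inv_into_into f_inv_into_f)
  have gf: "?g (f x) = x" if "x \<in> carrier N" for x
    using that b by (auto simp: bij_betw_def)
  have add: "x \<oplus>\<^bsub>N'\<^esub> y = f (?g x \<oplus>\<^bsub>N\<^esub> ?g y)" if "x \<in> carrier N'" "y \<in> carrier N'" for x y
    using f'(2) g that by simp
  have sm: "a \<odot>\<^bsub>N'\<^esub> x = f (a \<odot>\<^bsub>N\<^esub> ?g x)" if "a \<in> carrier A" "x \<in> carrier N'" for a x
    using f'(3) g that by simp
  show ?thesis
    by (rule mod_homsI) (use f' g N' in \<open>auto simp: add sm gf\<close>)
qed

text \<open>The submodules of \<open>N\<close> at the top of a composition series that starts at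
  zero. This inductive form of \<open>finite_length_mod\<close> allows rule induction; the two are
  identified in \<open>finite_length_iff\<close>.\<close>

inductive fl :: "'r ring \<Rightarrow> ('r, 'u) module \<Rightarrow> 'u set \<Rightarrow> bool" for A N where
  zero: "fl A N {\<zero>\<^bsub>N\<^esub>}"
| step: "\<lbrakk>fl A N H; nu_submod A N H'; H \<subset> H';
    \<And>L. nu_submod A N L \<Longrightarrow> H \<subset> L \<Longrightarrow> L \<subset> H' \<Longrightarrow> False\<rbrakk> \<Longrightarrow> fl A N H'"

text \<open>Local units in place of a unit element. The directedness \<open>E_dir\<close> makes the
  set of module elements fixed by some member of \<open>E\<close> closed under addition.\<close>

locale lu_ring =
  fixes A :: "'r ring" and E :: "'r set"
  assumes A_group: "abelian_group A"
    and A_mult: "\<lbrakk>a \<in> carrier A; b \<in> carrier A\<rbrakk> \<Longrightarrow> a \<otimes>\<^bsub>A\<^esub> b \<in> carrier A"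
    and E_sub: "E \<subseteq> carrier A"
    and E_unit: "a \<in> carrier A \<Longrightarrow> \<exists>e \<in> E. e \<otimes>\<^bsub>A\<^esub> a = a"
    and E_dir: "\<lbrakk>e \<in> E; e' \<in> E\<rbrakk> \<Longrightarrow> \<exists>d \<in> E. d \<otimes>\<^bsub>A\<^esub> e = e \<and> d \<otimes>\<^bsub>A\<^esub> e' = e'"
begin

sublocale A: abelian_group A by (rule A_group)

lemma smult_zero:
  assumes "nu_module A N"
  shows "x \<in> carrier N \<Longrightarrow> \<zero>\<^bsub>A\<^esub> \<odot>\<^bsub>N\<^esub> x = \<zero>\<^bsub>N\<^esub>" "a \<in> carrier A \<Longrightarrow> a \<odot>\<^bsub>N\<^esub> \<zero>\<^bsub>N\<^esub> = \<zero>\<^bsub>N\<^esub>"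
    "\<lbrakk>a \<in> carrier A; x \<in> carrier N\<rbrakk> \<Longrightarrow> (\<ominus>\<^bsub>A\<^esub> a) \<odot>\<^bsub>N\<^esub> x = \<ominus>\<^bsub>N\<^esub> (a \<odot>\<^bsub>N\<^esub> x)"
    "\<lbrakk>a \<in> carrier A; x \<in> carrier N\<rbrakk> \<Longrightarrow> a \<odot>\<^bsub>N\<^esub> (\<ominus>\<^bsub>N\<^esub> x) = \<ominus>\<^bsub>N\<^esub> (a \<odot>\<^bsub>N\<^esub> x)"
  using additive_zero[OF A_group nu_moduleD(1)[OF assms], of "\<lambda>a. a \<odot>\<^bsub>N\<^esub> x"] nu_moduleD[OF assms]
    additive_zero[OF nu_moduleD(1)[OF assms] nu_moduleD(1)[OF assms], of "\<lambda>x. a \<odot>\<^bsub>N\<^esub> x"]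
  by auto

text \<open>The elements fixed by some member of \<open>E\<close> form a subgroup. It contains all
  products of a scalar and an element, and these generate \<open>N\<close>.\<close>

lemma nu_unit:
  assumes N: "nu_module A N" and x: "x \<in> carrier N"
  shows "\<exists>e \<in> E. e \<odot>\<^bsub>N\<^esub> x = x"
proof -
  interpret abelian_group N using nu_moduleD(1)[OF N] .
  note D = nu_moduleD[OF N] and ES = E_sub[THEN subsetD]
  let ?S = "{a \<odot>\<^bsub>N\<^esub> x | a x. a \<in> carrier A \<and> x \<in> carrier N}"
  let ?U = "{x \<in> carrier N. \<exists>e \<in> E. e \<odot>\<^bsub>N\<^esub> x = x}"
  have "subgroup ?U (add_monoid N)"
  proof (rule add.subgroupI)
    have "\<zero>\<^bsub>A\<^esub> \<in> carrier A" by simp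
    then obtain e where "e \<in> E" using E_unit by blast
    then have "\<zero>\<^bsub>N\<^esub> \<in> ?U" using smult_zero(2)[OF N] ES by auto
    then show "?U \<noteq> {}" by blast
    fix a assume "a \<in> ?U"
    then obtain e where "e \<in> E" "e \<odot>\<^bsub>N\<^esub> a = a" "a \<in> carrier N" by blast
    then show "\<ominus>\<^bsub>N\<^esub> a \<in> ?U" using smult_zero(4)[OF N] ES
      by (auto intro!: bexI[of _ e])
    fix b assume "b \<in> ?U"
    then obtain e' where e': "e' \<in> E" "e' \<odot>\<^bsub>N\<^esub> b = b" "b \<in> carrier N" by blast
    note e = \<open>e \<in> E\<close> \<open>e \<odot>\<^bsub>N\<^esub> a = a\<close> \<open>a \<in> carrier N\<close>
    obtain d where d: "d \<in> E" "d \<otimes>\<^bsub>A\<^esub> e = e" "d \<otimes>\<^bsub>A\<^esub> e' = e'" using E_dir e e' by blast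
    have "d \<odot>\<^bsub>N\<^esub> a = a" "d \<odot>\<^bsub>N\<^esub> b = b" using D(5)[of d e a] D(5)[of d e' b] ES d e e' by auto
    then have "d \<odot>\<^bsub>N\<^esub> (a \<oplus>\<^bsub>N\<^esub> b) = a \<oplus>\<^bsub>N\<^esub> b" using D(4) ES d e e' by simp
    then show "a \<oplus>\<^bsub>N\<^esub> b \<in> ?U" using d e e' by auto
  qed auto
  moreover have "?S \<subseteq> ?U"
  proof
    fix z assume "z \<in> ?S"
    then obtain a x where z: "z = a \<odot>\<^bsub>N\<^esub> x" "a \<in> carrier A" "x \<in> carrier N" by blast
    obtain e where "e \<in> E" "e \<otimes>\<^bsub>A\<^esub> a = a" using E_unit z by blast
    then have "e \<odot>\<^bsub>N\<^esub> z = z" "e \<in> E" using D(5)[of e a x] ES z by auto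
    then show "z \<in> ?U" using z D by auto
  qed
  ultimately have "generate (add_monoid N) ?S \<subseteq> ?U"
    using add.generate_subgroup_incl by blast
  then show ?thesis using N x unfolding nu_module_def by blast
qed

text \<open>Transport of structure along a bijection, applied to the copies of modules in
  \<open>'u\<close> and to the images of the two diagonal parts.\<close>

lemma nu_module_iso:
  assumes N: "nu_module A N" and b: "bij_betw h (carrier N) (carrier N')"
    and add: "\<And>x y. \<lbrakk>x \<in> carrier N; y \<in> carrier N\<rbrakk> \<Longrightarrow> h (x \<oplus>\<^bsub>N\<^esub> y) = h x \<oplus>\<^bsub>N'\<^esub> h y"
    and sm: "\<And>a x. \<lbrakk>a \<in> carrier A; x \<in> carrier N\<rbrakk> \<Longrightarrow> h (a \<odot>\<^bsub>N\<^esub> x) = a \<odot>\<^bsub>N'\<^esub> h x"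
    and z: "h \<zero>\<^bsub>N\<^esub> = \<zero>\<^bsub>N'\<^esub>"
  shows "nu_module A N'"
proof -
  interpret abelian_group N using nu_moduleD(1)[OF N] .
  note D = nu_moduleD[OF N]
  have im: "carrier N' = h ` carrier N" using b by (simp add: bij_betw_def)
  have *: "h x \<in> carrier N'" if "x \<in> carrier N" for x using that im by simp
  show ?thesis
  proof (rule nu_moduleI)
    show "abelian_group N'"
    proof (rule abelian_groupI)
      fix x assume "x \<in> carrier N'"
      then obtain u where u: "u \<in> carrier N" "x = h u" unfolding im by blast
      show "\<exists>y\<in>carrier N'. y \<oplus>\<^bsub>N'\<^esub> x = \<zero>\<^bsub>N'\<^esub>"
        using u by (intro bexI[of _ "h (\<ominus>\<^bsub>N\<^esub> u)"]) (auto simp: add[symmetric] z[symmetric] l_neg *)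
    qed (auto simp: im add[symmetric] z[symmetric] a_ac)
  next
    fix x assume "x \<in> carrier N'"
    then obtain u where u: "u \<in> carrier N" "x = h u" unfolding im by blast
    then show "\<exists>a\<in>carrier A. a \<odot>\<^bsub>N'\<^esub> x = x" using nu_unit[OF N u(1)] sm E_sub by (metis subsetD)
  qed (auto simp: im add[symmetric] sm[symmetric] D A_mult)
qed

lemma nu_submodD:
  assumes N: "nu_module A N" and H: "nu_submod A N H"
  shows "H \<subseteq> carrier N" "\<zero>\<^bsub>N\<^esub> \<in> H" "\<And>x y. \<lbrakk>x \<in> H; y \<in> H\<rbrakk> \<Longrightarrow> x \<oplus>\<^bsub>N\<^esub> y \<in> H"
    "\<And>a x. \<lbrakk>a \<in> carrier A; x \<in> H\<rbrakk> \<Longrightarrow> a \<odot>\<^bsub>N\<^esub> x \<in> H" "\<And>x. x \<in> H \<Longrightarrow> \<ominus>\<^bsub>N\<^esub> x \<in> H"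
proof -
  interpret N: abelian_group N using nu_moduleD(1)[OF N] .
  have HM: "nu_module A (N\<lparr>carrier := H\<rparr>)" and HN: "H \<subseteq> carrier N" using H by (auto simp: nu_submod_def)
  note D = nu_moduleD[OF HM, simplified]
  interpret H: abelian_group "N\<lparr>carrier := H\<rparr>" by (rule D(1))
  show "H \<subseteq> carrier N" by fact
  show "\<zero>\<^bsub>N\<^esub> \<in> H" using H.zero_closed by simp
  show "\<And>x y. \<lbrakk>x \<in> H; y \<in> H\<rbrakk> \<Longrightarrow> x \<oplus>\<^bsub>N\<^esub> y \<in> H" using H.a_closed by simp
  show sm: "\<And>a x. \<lbrakk>a \<in> carrier A; x \<in> H\<rbrakk> \<Longrightarrow> a \<odot>\<^bsub>N\<^esub> x \<in> H" by (rule D(2))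
  fix x assume x: "x \<in> H"
  then obtain e where e: "e \<in> E" "e \<odot>\<^bsub>N\<^esub> x = x" using nu_unit[OF N] HN by blast
  then have "\<ominus>\<^bsub>N\<^esub> x = (\<ominus>\<^bsub>A\<^esub> e) \<odot>\<^bsub>N\<^esub> x" using smult_zero(3)[OF N, of e x] E_sub[THEN subsetD] HN[THEN subsetD] x by simp
  then show "\<ominus>\<^bsub>N\<^esub> x \<in> H" using sm[of "\<ominus>\<^bsub>A\<^esub> e" x] x e E_sub by auto
qed

text \<open>Negatives and the condition \<open>A H = H\<close> both come from a local unit
  \<open>e\<close> of \<open>x\<close>: \<open>-x = (-e) x\<close> and
  \<open>x = e x\<close>.\<close>

lemma nu_submodI:
  assumes N: "nu_module A N" and H: "H \<subseteq> carrier N" "\<zero>\<^bsub>N\<^esub> \<in> H"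
    "\<And>x y. \<lbrakk>x \<in> H; y \<in> H\<rbrakk> \<Longrightarrow> x \<oplus>\<^bsub>N\<^esub> y \<in> H"
    "\<And>a x. \<lbrakk>a \<in> carrier A; x \<in> H\<rbrakk> \<Longrightarrow> a \<odot>\<^bsub>N\<^esub> x \<in> H"
  shows "nu_submod A N H"
proof -
  interpret N: abelian_group N using nu_moduleD(1)[OF N] .
  note D = nu_moduleD[OF N] and HS = H(1)[THEN subsetD] and ES = E_sub[THEN subsetD]
  have neg: "\<ominus>\<^bsub>N\<^esub> x \<in> H" if x: "x \<in> H" for x
  proof -
    obtain e where e: "e \<in> E" "e \<odot>\<^bsub>N\<^esub> x = x" using nu_unit[OF N] HS x by blast
    then have "\<ominus>\<^bsub>N\<^esub> x = (\<ominus>\<^bsub>A\<^esub> e) \<odot>\<^bsub>N\<^esub> x" using smult_zero(3)[OF N, of e x] E_sub[THEN subsetD] HS x by simp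
    then show "\<ominus>\<^bsub>N\<^esub> x \<in> H" using H(4)[of "\<ominus>\<^bsub>A\<^esub> e" x] x e E_sub by auto
  qed
  have "nu_module A (N\<lparr>carrier := H\<rparr>)"
  proof (rule nu_moduleI)
    show "abelian_group (N\<lparr>carrier := H\<rparr>)"
    proof (rule abelian_groupI)
      fix x assume "x \<in> carrier (N\<lparr>carrier := H\<rparr>)"
      then show "\<exists>y\<in>carrier (N\<lparr>carrier := H\<rparr>). y \<oplus>\<^bsub>N\<lparr>carrier := H\<rparr>\<^esub> x = \<zero>\<^bsub>N\<lparr>carrier := H\<rparr>\<^esub>"
        using neg HS by (auto intro!: bexI[of _ "\<ominus>\<^bsub>N\<^esub> x"] simp: N.l_neg)
    qed (use H HS in \<open>auto simp: N.a_ac\<close>)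
    fix x assume "x \<in> carrier (N\<lparr>carrier := H\<rparr>)"
    then show "\<exists>a\<in>carrier A. a \<odot>\<^bsub>N\<lparr>carrier := H\<rparr>\<^esub> x = x" using nu_unit[OF N, of x] HS ES by auto
  qed (use D H HS in auto)
  then show ?thesis using H by (simp add: nu_submod_def)
qed

lemma zero_submod: "nu_module A N \<Longrightarrow> nu_submod A N {\<zero>\<^bsub>N\<^esub>}"
proof (rule nu_submodI)
  assume N: "nu_module A N"
  interpret N: abelian_group N using nu_moduleD(1)[OF N] .
  show "{\<zero>\<^bsub>N\<^esub>} \<subseteq> carrier N" "\<zero>\<^bsub>N\<^esub> \<in> {\<zero>\<^bsub>N\<^esub>}" by auto
  show "x \<oplus>\<^bsub>N\<^esub> y \<in> {\<zero>\<^bsub>N\<^esub>}" if "x \<in> {\<zero>\<^bsub>N\<^esub>}" "y \<in> {\<zero>\<^bsub>N\<^esub>}" for x y using that by simp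
  show "a \<odot>\<^bsub>N\<^esub> x \<in> {\<zero>\<^bsub>N\<^esub>}" if "a \<in> carrier A" "x \<in> {\<zero>\<^bsub>N\<^esub>}" for a x
    using that smult_zero(2)[OF N] by simp
qed

lemma carrier_submod: "nu_module A N \<Longrightarrow> nu_submod A N (carrier N)"
  by (simp add: nu_submod_def)

lemma fl_submod: "nu_module A N \<Longrightarrow> fl A N H \<Longrightarrow> nu_submod A N H"
  by (erule fl.cases) (blast intro: zero_submod)+

lemma finite_length_iff: "finite_length_mod A N \<longleftrightarrow> nu_module A N \<and> fl A N (carrier N)"
proof (intro iffI conjI)
  assume *: "finite_length_mod A N"
  then show "nu_module A N" by (simp add: finite_length_mod_def)
  from * obtain n Hs where H: "Hs 0 = {\<zero>\<^bsub>N\<^esub>}" "Hs n = carrier N" "\<And>i. i \<le> n \<Longrightarrow> nu_submod A N (Hs i)"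
    "\<And>i. i < n \<Longrightarrow> Hs i \<subset> Hs (Suc i) \<and> \<not> (\<exists>H. nu_submod A N H \<and> Hs i \<subset> H \<and> H \<subset> Hs (Suc i))"
    unfolding finite_length_mod_def by metis
  have "fl A N (Hs i)" if "i \<le> n" for i
    using that
  proof (induction i)
    case (Suc i)
    show ?case by (rule fl.step[of A N "Hs i"]) (use Suc H(3)[of "Suc i"] H(4)[of i] in auto)
  qed (simp add: H fl.zero)
  then show "fl A N (carrier N)" using H(2) by (metis order_refl)
next
  assume *: "nu_module A N \<and> fl A N (carrier N)"
  then have N: "nu_module A N" by simp
  have "\<exists>n Hs. Hs 0 = {\<zero>\<^bsub>N\<^esub>} \<and> Hs n = H \<and> (\<forall>i \<le> n. nu_submod A N (Hs i)) \<and>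
      (\<forall>i < n. Hs i \<subset> Hs (Suc i) \<and> \<not> (\<exists>H. nu_submod A N H \<and> Hs i \<subset> H \<and> H \<subset> Hs (Suc i)))"
    if "fl A N H" for H
    using that
  proof induction
    case zero
    then show ?case using zero_submod[OF N] by (intro exI[of _ 0] exI[of _ "\<lambda>_. {\<zero>\<^bsub>N\<^esub>}"]) auto
  next
    case (step H H')
    from step.IH obtain n Hs where H: "Hs 0 = {\<zero>\<^bsub>N\<^esub>}" "Hs n = H" "\<forall>i \<le> n. nu_submod A N (Hs i)"
      "\<forall>i < n. Hs i \<subset> Hs (Suc i) \<and> \<not> (\<exists>H. nu_submod A N H \<and> Hs i \<subset> H \<and> H \<subset> Hs (Suc i))"
      by (elim exE conjE) (rule that)
    show ?case
    proof (intro exI[of _ "Suc n"] exI[of _ "\<lambda>i. if i \<le> n then Hs i else H'"] conjI allI impI)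
      fix i assume i: "i < Suc n"
      show "(if i \<le> n then Hs i else H') \<subset> (if Suc i \<le> n then Hs (Suc i) else H')"
        using i H step.hyps by (cases "i = n") auto
      show "\<not> (\<exists>L. nu_submod A N L \<and> (if i \<le> n then Hs i else H') \<subset> L \<and> L \<subset> (if Suc i \<le> n then Hs (Suc i) else H'))"
        using i H(2,4) step.hyps(4) by (cases "i = n") (simp, blast, simp)
    qed (use H step.hyps in auto)
  qed
  then show "finite_length_mod A N" using * by (simp add: finite_length_mod_def)
qed

lemma submod_image:
  assumes N: "nu_module A N" and N': "nu_module A N'" and f: "f \<in> mod_homs A N N'" and H: "nu_submod A N H"
  shows "nu_submod A N' (f ` H)"
proof (rule nu_submodI[OF N'])
  note f' = mod_homsD[OF f] and HD = nu_submodD[OF N H]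
  show "f ` H \<subseteq> carrier N'" using f' HD by blast
  show "\<zero>\<^bsub>N'\<^esub> \<in> f ` H" using HD mod_homs_zero(1)[OF nu_moduleD(1)[OF N] nu_moduleD(1)[OF N'] f] by force
  fix x y assume "x \<in> f ` H" "y \<in> f ` H"
  then obtain u v where uv: "u \<in> H" "v \<in> H" "x = f u" "y = f v" by blast
  then have "x \<oplus>\<^bsub>N'\<^esub> y = f (u \<oplus>\<^bsub>N\<^esub> v)" using f'(2) HD(1)[THEN subsetD] by simp
  then show "x \<oplus>\<^bsub>N'\<^esub> y \<in> f ` H" using HD(3) uv by blast
next
  note f' = mod_homsD[OF f] and HD = nu_submodD[OF N H]
  fix a x assume a: "a \<in> carrier A" and "x \<in> f ` H"
  then obtain u where u: "u \<in> H" "x = f u" by blast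
  then have "a \<odot>\<^bsub>N'\<^esub> x = f (a \<odot>\<^bsub>N\<^esub> u)" using f'(3) HD(1)[THEN subsetD] a by simp
  then show "a \<odot>\<^bsub>N'\<^esub> x \<in> f ` H" using HD(4) u a by blast
qed

text \<open>A submodule of the image is pulled back along the inverse homomorphism, where simplicity
  of \<open>H\<close> applies.\<close>

lemma simple_image:
  assumes N: "nu_module A N" and N': "nu_module A N'" and f: "f \<in> mod_homs A N N'"
    and b: "bij_betw f (carrier N) (carrier N')"
    and H: "nu_submod A N H" and S: "simple_mod A (N\<lparr>carrier := H\<rparr>)"
  shows "simple_mod A (N'\<lparr>carrier := f ` H\<rparr>)"
proof -
  note HD = nu_submodD[OF N H] and fH = submod_image[OF N N' f H]
  note z = mod_homs_zero(1)[OF nu_moduleD(1)[OF N] nu_moduleD(1)[OF N'] f]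
  have inj: "inj_on f (carrier N)" using b by (simp add: bij_betw_def)
  let ?g = "restrict (inv_into (carrier N) f) (carrier N')"
  have g: "?g \<in> mod_homs A N' N" by (rule mod_homs_inv[OF N f b])
  have gf: "?g (f x) = x" if "x \<in> carrier N" for x using that inj mod_homsD(1)[OF f] by simp
  show ?thesis unfolding simple_mod_def
  proof (intro conjI allI impI)
    show "nu_module A (N'\<lparr>carrier := f ` H\<rparr>)" using fH by (simp add: nu_submod_def)
    show "carrier (N'\<lparr>carrier := f ` H\<rparr>) \<noteq> {\<zero>\<^bsub>N'\<lparr>carrier := f ` H\<rparr>\<^esub>}"
    proof
      assume "carrier (N'\<lparr>carrier := f ` H\<rparr>) = {\<zero>\<^bsub>N'\<lparr>carrier := f ` H\<rparr>\<^esub>}"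
      then have *: "f x = f \<zero>\<^bsub>N\<^esub>" if "x \<in> H" for x using that z by auto
      have "x = \<zero>\<^bsub>N\<^esub>" if "x \<in> H" for x
        by (rule inj_onD[OF inj *]) (use that HD in auto)
      then have "H = {\<zero>\<^bsub>N\<^esub>}" using HD(2) by blast
      then show False using S by (simp add: simple_mod_def)
    qed
    fix K assume "nu_submod A (N'\<lparr>carrier := f ` H\<rparr>) K"
    then have K: "K \<subseteq> f ` H" "nu_submod A N' K"
      using nu_submodD(1)[OF N' fH] by (auto simp: nu_submod_def)
    have gK: "nu_submod A N (?g ` K)" by (rule submod_image[OF N' N g K(2)])
    have "?g ` K \<subseteq> H" using K gf HD(1) by force
    then have "nu_submod A (N\<lparr>carrier := H\<rparr>) (?g ` K)" using gK by (simp add: nu_submod_def)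
    then have "?g ` K = {\<zero>\<^bsub>N\<^esub>} \<or> ?g ` K = H" using S by (simp add: simple_mod_def)
    moreover have "f (?g k) = k" if "k \<in> K" for k using that K(1) gf HD(1)[THEN subsetD] by fastforce
    then have "K = f ` (?g ` K)" by (auto simp: image_image simp del: restrict_apply)
    ultimately show "K = {\<zero>\<^bsub>N'\<lparr>carrier := f ` H\<rparr>\<^esub>} \<or> K = carrier (N'\<lparr>carrier := f ` H\<rparr>)"
      using z by auto
  qed
qed

text \<open>Simple submodules go to simple submodules, and a homomorphism commutes with the
  generation of subgroups.\<close>

lemma semisimple_iso:
  assumes N: "semisimple_mod A N" and N': "nu_module A N'" and f: "f \<in> mod_homs A N N'"
    and b: "bij_betw f (carrier N) (carrier N')"
  shows "semisimple_mod A N'"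
proof -
  have M: "nu_module A N" using N by (simp add: semisimple_mod_def)
  interpret N: abelian_group N using nu_moduleD(1)[OF M] .
  interpret N': abelian_group N' using nu_moduleD(1)[OF N'] .
  interpret h: group_hom "add_monoid N" "add_monoid N'" f
    using mod_homsD[OF f] by unfold_locales (auto simp: hom_def)
  let ?S = "\<Union>{H. nu_submod A N H \<and> simple_mod A (N\<lparr>carrier := H\<rparr>)}"
  let ?S' = "\<Union>{H. nu_submod A N' H \<and> simple_mod A (N'\<lparr>carrier := H\<rparr>)}"
  have SN: "?S \<subseteq> carrier N" and SN': "?S' \<subseteq> carrier N'" by (auto simp: nu_submod_def)
  have "f ` ?S \<subseteq> ?S'"
    using submod_image[OF M N' f] simple_image[OF M N' f b] by blast
  have "carrier N' = f ` carrier N" using b by (simp add: bij_betw_def)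
  also have "\<dots> = f ` generate (add_monoid N) ?S" using N by (simp add: semisimple_mod_def)
  also have "\<dots> = generate (add_monoid N') (f ` ?S)" using h.generate_img SN by simp
  also have "\<dots> \<subseteq> generate (add_monoid N') ?S'"
    using \<open>f ` ?S \<subseteq> ?S'\<close> N'.add.mono_generate by blast
  finally have "carrier N' = generate (add_monoid N') ?S'"
    using N'.add.generate_incl SN' by auto
  then show ?thesis using N' by (simp add: semisimple_mod_def)
qed

end

section \<open>Categories of modules over rings with local units\<close>

lemma mod_cat_simps [simp]:
  "Ob (mod_cat A Q) = {N. nu_module A N \<and> Q N}"
  "Hom (mod_cat A Q) = mod_homs A"
  "Idt (mod_cat A Q) = (\<lambda>N. \<lambda>x \<in> carrier N. x)"
  "Cmp (mod_cat A Q) = (\<lambda>N N' N'' g f. compose (carrier N) g f)"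
  "Add (mod_cat A Q) = (\<lambda>N N' f g. \<lambda>x \<in> carrier N. f x \<oplus>\<^bsub>N'\<^esub> g x)"
  "Zer (mod_cat A Q) = (\<lambda>N N'. \<lambda>x \<in> carrier N. \<zero>\<^bsub>N'\<^esub>)"
  by (simp_all add: mod_cat_def)

lemma (in lu_ring) mod_cat_preadditive:
  fixes Q :: "('r, 'b) module \<Rightarrow> bool"
  shows "preadditive_cat (mod_cat A Q)"
proof (rule preadditive_cat.intro, simp_all only: mod_cat_simps mem_Collect_eq)
  fix N :: "('r, 'b) module" assume "nu_module A N \<and> Q N"
  then have "nu_module A N" by simp
  note D = nu_moduleD[OF this]
  interpret abelian_group N by (rule D(1))
  show "restrict (\<lambda>x. x) (carrier N) \<in> mod_homs A N N"
    by (rule mod_homsI) (use D in auto)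
next
  fix N N' N'' :: "('r, 'b) module" and f g
  assume "nu_module A N \<and> Q N" "f \<in> mod_homs A N N'" "g \<in> mod_homs A N' N''"
  then show "compose (carrier N) g f \<in> mod_homs A N N''" using mod_homs_compose by blast
next
  fix N N' :: "('r, 'b) module" and f
  assume "f \<in> mod_homs A N N'"
  note f = mod_homsD[OF this]
  show "compose (carrier N) (restrict (\<lambda>x. x) (carrier N')) f = f"
    "compose (carrier N) f (restrict (\<lambda>x. x) (carrier N)) = f"
    using f by (auto simp: compose_def fun_eq_iff extensional_def)
next
  fix N N' N'' N''' :: "('r, 'b) module" and f g h
  assume "f \<in> mod_homs A N N'"
  note f = mod_homsD[OF this]
  show "compose (carrier N) h (compose (carrier N) g f) = compose (carrier N) (compose (carrier N') h g) f"
    using f by (auto simp: compose_def fun_eq_iff)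
next
  fix N N' :: "('r, 'b) module"
  assume N: "nu_module A N \<and> Q N" and N': "nu_module A N' \<and> Q N'"
  note D = nu_moduleD[OF N[THEN conjunct1]] and D' = nu_moduleD[OF N'[THEN conjunct1]]
  interpret N: abelian_group N by (rule D(1))
  interpret N': abelian_group N' by (rule D'(1))
  show "comm_group (hom_group (mod_cat A Q) N N')"
  proof (rule comm_groupI)
    fix f assume "f \<in> carrier (hom_group (mod_cat A Q) N N')"
    then have f: "f \<in> mod_homs A N N'" by (simp add: hom_group_def)
    note f' = mod_homsD[OF f]
    let ?g = "\<lambda>x\<in>carrier N. \<ominus>\<^bsub>N'\<^esub> f x"
    have "?g \<in> mod_homs A N N'"
      by (rule mod_homsI) (use f' D D' in \<open>auto simp: N'.minus_add smult_zero(4)[OF N'[THEN conjunct1]]\<close>)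
    then show "\<exists>g\<in>carrier (hom_group (mod_cat A Q) N N').
        g \<otimes>\<^bsub>hom_group (mod_cat A Q) N N'\<^esub> f = \<one>\<^bsub>hom_group (mod_cat A Q) N N'\<^esub>"
      using f' by (intro bexI[of _ ?g]) (auto simp: hom_group_def N'.l_neg)
  next
    fix f g assume "f \<in> carrier (hom_group (mod_cat A Q) N N')" "g \<in> carrier (hom_group (mod_cat A Q) N N')"
    then have "f \<in> mod_homs A N N'" "g \<in> mod_homs A N N'" by (simp_all add: hom_group_def)
    note f' = mod_homsD[OF this(1)] and g' = mod_homsD[OF this(2)]
    have "(\<lambda>x\<in>carrier N. f x \<oplus>\<^bsub>N'\<^esub> g x) \<in> mod_homs A N N'"
      by (rule mod_homsI) (use f' g' D D' in \<open>auto simp: N'.a_ac\<close>)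
    then show "f \<otimes>\<^bsub>hom_group (mod_cat A Q) N N'\<^esub> g \<in> carrier (hom_group (mod_cat A Q) N N')"
      by (simp add: hom_group_def)
    show "f \<otimes>\<^bsub>hom_group (mod_cat A Q) N N'\<^esub> g = g \<otimes>\<^bsub>hom_group (mod_cat A Q) N N'\<^esub> f"
      using f' g' by (auto simp: hom_group_def N'.a_comm fun_eq_iff)
  next
    have "(\<lambda>x\<in>carrier N. \<zero>\<^bsub>N'\<^esub>) \<in> mod_homs A N N'"
      by (rule mod_homsI) (use D D' in \<open>auto simp: smult_zero(2)[OF N'[THEN conjunct1]]\<close>)
    then show "\<one>\<^bsub>hom_group (mod_cat A Q) N N'\<^esub> \<in> carrier (hom_group (mod_cat A Q) N N')"
      by (simp add: hom_group_def)
  next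
    fix f g h assume "f \<in> carrier (hom_group (mod_cat A Q) N N')" "g \<in> carrier (hom_group (mod_cat A Q) N N')"
      "h \<in> carrier (hom_group (mod_cat A Q) N N')"
    then show "f \<otimes>\<^bsub>hom_group (mod_cat A Q) N N'\<^esub> g \<otimes>\<^bsub>hom_group (mod_cat A Q) N N'\<^esub> h =
      f \<otimes>\<^bsub>hom_group (mod_cat A Q) N N'\<^esub> (g \<otimes>\<^bsub>hom_group (mod_cat A Q) N N'\<^esub> h)"
      using mod_homsD(1)[of f A N N'] mod_homsD(1)[of g A N N'] mod_homsD(1)[of h A N N']
      by (auto simp: hom_group_def N'.a_assoc fun_eq_iff)
  next
    fix f assume "f \<in> carrier (hom_group (mod_cat A Q) N N')"
    then show "\<one>\<^bsub>hom_group (mod_cat A Q) N N'\<^esub> \<otimes>\<^bsub>hom_group (mod_cat A Q) N N'\<^esub> f = f"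
      using mod_homsD(1,4)[of f A N N'] by (auto simp: hom_group_def fun_eq_iff extensional_def)
  qed
next
  fix N N' N'' :: "('r, 'b) module" and f g h
  assume "f \<in> mod_homs A N N'"
  note f = mod_homsD[OF this]
  show "compose (carrier N) (\<lambda>x\<in>carrier N'. g x \<oplus>\<^bsub>N''\<^esub> h x) f =
      (\<lambda>x\<in>carrier N. compose (carrier N) g f x \<oplus>\<^bsub>N''\<^esub> compose (carrier N) h f x)"
    using f by (auto simp: compose_def fun_eq_iff)
next
  fix N N' N'' :: "('r, 'b) module" and f g h
  assume "f \<in> mod_homs A N N'" "g \<in> mod_homs A N N'" "h \<in> mod_homs A N' N''"
  note f = mod_homsD[OF this(1)] mod_homsD[OF this(2)] mod_homsD[OF this(3)]
  show "compose (carrier N) h (\<lambda>x\<in>carrier N. f x \<oplus>\<^bsub>N'\<^esub> g x) =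
      (\<lambda>x\<in>carrier N. compose (carrier N) h f x \<oplus>\<^bsub>N''\<^esub> compose (carrier N) h g x)"
    using f by (auto simp: compose_def fun_eq_iff)
qed

lemma mod_iso_iff:
  assumes "nu_module A N" "Q N" "nu_module A N'" "Q N'"
  shows "iso_mor (mod_cat A Q) N N' f \<longleftrightarrow> f \<in> mod_homs A N N' \<and> bij_betw f (carrier N) (carrier N')"
proof
  assume "iso_mor (mod_cat A Q) N N' f"
  then obtain g where f: "f \<in> mod_homs A N N'" and g: "g \<in> mod_homs A N' N"
    and gf: "compose (carrier N) g f = (\<lambda>x\<in>carrier N. x)" and fg: "compose (carrier N') f g = (\<lambda>x\<in>carrier N'. x)"
    by (auto simp: iso_mor_def)
  have "g (f x) = x" if "x \<in> carrier N" for x using fun_cong[OF gf, of x] that by (simp add: compose_def)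
  moreover have "f (g x) = x" if "x \<in> carrier N'" for x using fun_cong[OF fg, of x] that by (simp add: compose_def)
  ultimately have "bij_betw f (carrier N) (carrier N')"
    using mod_homsD(1)[OF f] mod_homsD(1)[OF g] by (intro bij_betwI[of _ _ _ g]) auto
  then show "f \<in> mod_homs A N N' \<and> bij_betw f (carrier N) (carrier N')" using f by blast
next
  assume f: "f \<in> mod_homs A N N' \<and> bij_betw f (carrier N) (carrier N')"
  let ?g = "restrict (inv_into (carrier N) f) (carrier N')"
  have g: "?g \<in> mod_homs A N' N" using mod_homs_inv[OF assms(1)] f by blast
  have "compose (carrier N) ?g f = (\<lambda>x\<in>carrier N. x)" "compose (carrier N') f ?g = (\<lambda>x\<in>carrier N'. x)"
    using f mod_homsD(1)[of f A N N'] by (auto simp: compose_def fun_eq_iff bij_betw_def f_inv_into_f)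
  then show "iso_mor (mod_cat A Q) N N' f"
    unfolding iso_mor_def using f g assms by auto
qed

section \<open>Equivalences of preadditive categories\<close>

context preadditive_cat
begin

lemma iso_mono: "iso_mor C A B f \<Longrightarrow> mono_mor C A B f"
  using monoI_retraction unfolding iso_mor_def by blast

lemma epi_cancel:
  "\<lbrakk>epi_mor C A B f; T \<in> Ob C; s \<in> Hom C B T; t \<in> Hom C B T; Cmp C A B T s f = Cmp C A B T t f\<rbrakk> \<Longrightarrow> s = t"
  unfolding epi_mor_def by blast

lemma iso_epi: "iso_mor C A B f \<Longrightarrow> epi_mor C A B f"
  using epiI_section unfolding iso_mor_def by blast

end

locale additive_equivalence = C: preadditive_cat C + D: preadditive_cat D
  for C :: "('o, 'm) precat" and D :: "('p, 'q) precat" +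
  fixes \<Phi> :: "('o, 'm, 'p, 'q) functr"
  assumes equiv: "is_equivalence C D \<Phi>"
begin

lemma ob [simp]: "A \<in> Ob C \<Longrightarrow> fob \<Phi> A \<in> Ob D"
  and id [simp]: "A \<in> Ob C \<Longrightarrow> fmp \<Phi> A A (Idt C A) = Idt D (fob \<Phi> A)"
  and hom [simp]: "\<lbrakk>A \<in> Ob C; B \<in> Ob C; f \<in> Hom C A B\<rbrakk> \<Longrightarrow> fmp \<Phi> A B f \<in> Hom D (fob \<Phi> A) (fob \<Phi> B)"
  and cmp: "\<lbrakk>A \<in> Ob C; B \<in> Ob C; E \<in> Ob C; f \<in> Hom C A B; g \<in> Hom C B E\<rbrakk> \<Longrightarrow>
    fmp \<Phi> A E (Cmp C A B E g f) =
        Cmp D (fob \<Phi> A) (fob \<Phi> B) (fob \<Phi> E) (fmp \<Phi> B E g) (fmp \<Phi> A B f)"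
  using equiv by (auto simp: is_equivalence_def is_functor_def)

lemma unit:
  assumes "nat_iso C C id_functor (comp_functor G \<Phi>) s"
  shows "A \<in> Ob C \<Longrightarrow> iso_mor C A (fob G (fob \<Phi> A)) (s A)"
    and "\<lbrakk>A \<in> Ob C; B \<in> Ob C; f \<in> Hom C A B\<rbrakk> \<Longrightarrow> Cmp C A B (fob G (fob \<Phi> B)) (s B) f =
      Cmp C A (fob G (fob \<Phi> A)) (fob G (fob \<Phi> B)) (fmp G (fob \<Phi> A) (fob \<Phi> B) (fmp \<Phi> A B f)) (s A)"
  using assms unfolding nat_iso_def id_functor_def comp_functor_def functr.simps by blast+

lemma counit:
  assumes "nat_iso D D (comp_functor \<Phi> G) id_functor t"
  shows "A \<in> Ob D \<Longrightarrow> iso_mor D (fob \<Phi> (fob G A)) A (t A)"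
    and "\<lbrakk>A \<in> Ob D; B \<in> Ob D; f \<in> Hom D A B\<rbrakk> \<Longrightarrow>
      Cmp D (fob \<Phi> (fob G A)) (fob \<Phi> (fob G B)) B (t B) (fmp \<Phi> (fob G A) (fob G B) (fmp G A B f)) =
      Cmp D (fob \<Phi> (fob G A)) A B f (t A)"
  using assms unfolding nat_iso_def id_functor_def comp_functor_def functr.simps by blast+

lemma quasi_inverse:
  obtains G s t where "is_functor D C G" "nat_iso C C id_functor (comp_functor G \<Phi>) s"
    "nat_iso D D (comp_functor \<Phi> G) id_functor t"
  using equiv unfolding is_equivalence_def by blast

lemma ess_surj:
  assumes "A \<in> Ob D"
  shows "\<exists>A' \<in> Ob C. iso_obj D (fob \<Phi> A') A"
proof -
  obtain G s t where "is_functor D C G" "nat_iso D D (comp_functor \<Phi> G) id_functor t" by (rule quasi_inverse)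
  then show ?thesis using assms counit(1) unfolding is_functor_def iso_obj_def by blast
qed

lemma faithful:
  assumes "A \<in> Ob C" "B \<in> Ob C" "f \<in> Hom C A B" "g \<in> Hom C A B" "fmp \<Phi> A B f = fmp \<Phi> A B g"
  shows "f = g"
proof -
  obtain G s t where "nat_iso C C id_functor (comp_functor G \<Phi>) s" by (rule quasi_inverse)
  note s = unit[OF this]
  have "Cmp C A B (fob G (fob \<Phi> B)) (s B) f = Cmp C A B (fob G (fob \<Phi> B)) (s B) g"
    using assms s(2) by simp
  then show ?thesis using C.iso_mono[OF s(1)[OF assms(2)]] assms unfolding mono_mor_def by blast
qed

text \<open>The preimage is the conjugate of \<open>G h\<close> by the unit isomorphisms
  \<open>s\<close>. Naturality of \<open>s\<close> gives \<open>G (\<Phi> f) = G h\<close>, and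
  naturality of the counit \<open>t\<close>, whose components are epimorphisms, turns this into
  \<open>\<Phi> f = h\<close>.\<close>

lemma full:
  assumes "A \<in> Ob C" "B \<in> Ob C" "h \<in> Hom D (fob \<Phi> A) (fob \<Phi> B)"
  obtains f where "f \<in> Hom C A B" "fmp \<Phi> A B f = h"
proof -
  obtain G s t where G: "is_functor D C G" and n: "nat_iso C C id_functor (comp_functor G \<Phi>) s"
    "nat_iso D D (comp_functor \<Phi> G) id_functor t" by (rule quasi_inverse)
  note s = unit[OF n(1)] and t = counit[OF n(2)]
  let ?A = "fob G (fob \<Phi> A)" and ?B = "fob G (fob \<Phi> B)"
  have O: "?A \<in> Ob C" "?B \<in> Ob C" using G assms by (auto simp: is_functor_def)
  have Gh: "fmp G (fob \<Phi> A) (fob \<Phi> B) h \<in> Hom C ?A ?B" using G assms by (auto simp: is_functor_def)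
  obtain s' where s': "s' \<in> Hom C ?B B" "Cmp C ?B B ?B (s B) s' = Idt C ?B"
    using s(1)[OF assms(2)] unfolding iso_mor_def by blast
  note sA = C.iso_morD[OF s(1)[OF assms(1)]] and sB = C.iso_morD[OF s(1)[OF assms(2)]]
  define f where "f = Cmp C A ?B B s' (Cmp C A ?A ?B (fmp G (fob \<Phi> A) (fob \<Phi> B) h) (s A))"
  have f: "f \<in> Hom C A B" using s' sA sB Gh by (simp add: f_def)
  have "Cmp C A ?A ?B (fmp G (fob \<Phi> A) (fob \<Phi> B) (fmp \<Phi> A B f)) (s A) = Cmp C A B ?B (s B) f"
    using s(2) f assms by simp
  also have "\<dots> = Cmp C A ?A ?B (fmp G (fob \<Phi> A) (fob \<Phi> B) h) (s A)"
    unfolding f_def by (subst C.cmp_reduce[OF s'(2)]) (use s' sA sB Gh in auto)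
  finally have GG: "fmp G (fob \<Phi> A) (fob \<Phi> B) (fmp \<Phi> A B f) = fmp G (fob \<Phi> A) (fob \<Phi> B) h"
    by (rule C.epi_cancel[OF C.iso_epi[OF s(1)[OF assms(1)]] O(2) _ Gh, rotated])
      (use G f assms in \<open>simp_all add: is_functor_def\<close>)
  have "Cmp D (fob \<Phi> ?A) (fob \<Phi> A) (fob \<Phi> B) (fmp \<Phi> A B f) (t (fob \<Phi> A)) =
      Cmp D (fob \<Phi> ?A) (fob \<Phi> A) (fob \<Phi> B) h (t (fob \<Phi> A))"
    using t(2)[of "fob \<Phi> A" "fob \<Phi> B" "fmp \<Phi> A B f"] t(2)[of "fob \<Phi> A" "fob \<Phi> B" h] GG f assms by simp
  then have "fmp \<Phi> A B f = h"
    by (rule D.epi_cancel[OF D.iso_epi[OF t(1)], rotated -1]) (use f assms in simp_all)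
  then show ?thesis using that f by blast
qed

end

text \<open>An equivalence is additive because the sum of two morphisms is determined by the biproducts,
  which an equivalence preserves.\<close>

locale abelian_equivalence = additive_equivalence + C: abelian C
begin

text \<open>By fullness some endomorphism \<open>z\<close> of a zero object \<open>Z\<close> is sent
  to zero, and \<open>z\<close> can only be the identity of \<open>Z\<close>. Hence everything that
  factors through \<open>Z\<close> is sent to zero.\<close>

lemma zer:
  assumes A: "A \<in> Ob C" and B: "B \<in> Ob C"
  shows "fmp \<Phi> A B (Zer C A B) = Zer D (fob \<Phi> A) (fob \<Phi> B)"
proof -
  obtain Z where Z: "zero_obj C Z" using C.zero_ex by blast
  then have ZO: "Z \<in> Ob C" and id0: "Idt C Z = Zer C Z Z" by (auto simp: C.zero_obj_iff)
  obtain z where z: "z \<in> Hom C Z Z" "fmp \<Phi> Z Z z = Zer D (fob \<Phi> Z) (fob \<Phi> Z)"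
    using full[OF ZO ZO, of "Zer D (fob \<Phi> Z) (fob \<Phi> Z)"] ZO by auto
  have "z = Zer C Z Z" using C.zero_obj_from[OF Z ZO z(1)] .
  then have idZ: "fmp \<Phi> Z Z (Idt C Z) = Zer D (fob \<Phi> Z) (fob \<Phi> Z)" using z id0 by simp
  have "Zer C A B = Cmp C A Z B (Zer C Z B) (Cmp C A Z Z (Idt C Z) (Zer C A Z))" using A B ZO by simp
  then have "fmp \<Phi> A B (Zer C A B) = Cmp D (fob \<Phi> A) (fob \<Phi> Z) (fob \<Phi> B) (fmp \<Phi> Z B (Zer C Z B))
      (Cmp D (fob \<Phi> A) (fob \<Phi> Z) (fob \<Phi> Z) (fmp \<Phi> Z Z (Idt C Z)) (fmp \<Phi> A Z (Zer C A Z)))"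
    using A B ZO by (simp del: C.cmp_zero_right C.cmp_zero_left C.id_left C.id_right id add: cmp)
  then show ?thesis unfolding idZ using A B ZO by simp
qed

text \<open>Essential surjectivity moves the test object \<open>T\<close> into the image of
  \<open>\<Phi>\<close>, where fullness and faithfulness reduce the claim to the biproduct in
  \<open>C\<close>.\<close>

lemma biprod_jointly_monic:
  assumes P: "is_biprod C A B P i1 i2 p1 p2" and T: "T \<in> Ob D" "s \<in> Hom D T (fob \<Phi> P)" "t \<in> Hom D T (fob \<Phi> P)"
    and 1: "Cmp D T (fob \<Phi> P) (fob \<Phi> A) (fmp \<Phi> P A p1) s = Cmp D T (fob \<Phi> P) (fob \<Phi> A) (fmp \<Phi> P A p1) t"
    and 2: "Cmp D T (fob \<Phi> P) (fob \<Phi> B) (fmp \<Phi> P B p2) s = Cmp D T (fob \<Phi> P) (fob \<Phi> B) (fmp \<Phi> P B p2) t"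
  shows "s = t"
proof -
  note PD = C.biprodD[OF P]
  obtain T' j where T': "T' \<in> Ob C" "iso_mor D (fob \<Phi> T') T j" using ess_surj T(1) unfolding iso_obj_def by blast
  note jD = D.iso_morD[OF T'(2)]
  obtain a where a: "a \<in> Hom C T' P" "fmp \<Phi> T' P a = Cmp D (fob \<Phi> T') T (fob \<Phi> P) s j"
    using full[OF T'(1) PD(3)] jD T PD ob by (metis D.cmp_in_hom)
  obtain b where b: "b \<in> Hom C T' P" "fmp \<Phi> T' P b = Cmp D (fob \<Phi> T') T (fob \<Phi> P) t j"
    using full[OF T'(1) PD(3)] jD T PD ob by (metis D.cmp_in_hom)
  have "Cmp C T' P A p1 a = Cmp C T' P A p1 b"
    by (rule faithful[of T' A]) (use a b PD T' jD T 1 in \<open>simp_all add: cmp D.cmp_assoc\<close>)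
  moreover have "Cmp C T' P B p2 a = Cmp C T' P B p2 b"
    by (rule faithful[of T' B]) (use a b PD T' jD T 2 in \<open>simp_all add: cmp D.cmp_assoc\<close>)
  ultimately have "a = b" using C.biprod_decomp[OF P T'(1) a(1)] C.biprod_decomp[OF P T'(1) b(1)] by metis
  then have "Cmp D (fob \<Phi> T') T (fob \<Phi> P) s j = Cmp D (fob \<Phi> T') T (fob \<Phi> P) t j" using a b by simp
  then show ?thesis using D.epi_cancel[OF D.iso_epi[OF T'(2)]] T PD(3) ob by blast
qed

text \<open>Write \<open>f + g = (p1 + p2) h\<close>, where \<open>h\<close> has the components
  \<open>f\<close> and \<open>g\<close>. The image of the biproduct is again a biproduct, and the
  image \<open>c\<close> of the codiagonal \<open>p1 + p2\<close> is recognised by its composites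
  with the two injections.\<close>

lemma add:
  assumes A: "A \<in> Ob C" and B: "B \<in> Ob C" and f: "f \<in> Hom C A B" and g: "g \<in> Hom C A B"
  shows "fmp \<Phi> A B (Add C A B f g) = Add D (fob \<Phi> A) (fob \<Phi> B) (fmp \<Phi> A B f) (fmp \<Phi> A B g)"
proof -
  obtain P i1 i2 p1 p2 where P: "is_biprod C B B P i1 i2 p1 p2" using C.biprod_ex B by blast
  note PD = C.biprodD[OF P]
  let ?F = "\<lambda>A. fob \<Phi> A"
  define q1 q2 j1 j2 where "q1 = fmp \<Phi> P B p1" and "q2 = fmp \<Phi> P B p2" and "j1 = fmp \<Phi> B P i1" and "j2 = fmp \<Phi> B P i2"
  have H: "q1 \<in> Hom D (?F P) (?F B)" "q2 \<in> Hom D (?F P) (?F B)" "j1 \<in> Hom D (?F B) (?F P)" "j2 \<in> Hom D (?F B) (?F P)"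
    using PD by (simp_all add: q1_def q2_def j1_def j2_def)
  have E: "Cmp D (?F B) (?F P) (?F B) q1 j1 = Idt D (?F B)" "Cmp D (?F B) (?F P) (?F B) q2 j2 = Idt D (?F B)"
    "Cmp D (?F B) (?F P) (?F B) q1 j2 = Zer D (?F B) (?F B)" "Cmp D (?F B) (?F P) (?F B) q2 j1 = Zer D (?F B) (?F B)"
    unfolding q1_def q2_def j1_def j2_def using PD zer[OF B B] by (simp_all flip: cmp)
  have idP: "Add D (?F P) (?F P) (Cmp D (?F P) (?F B) (?F P) j1 q1) (Cmp D (?F P) (?F B) (?F P) j2 q2) = Idt D (?F P)"
    by (rule biprod_jointly_monic[OF P, of "?F P"])
      (use H B PD(3) E in \<open>simp_all flip: q1_def q2_def add: D.cmp_add_right D.cmp_reduce[OF E(1)] D.cmp_reduce[OF E(2)]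
        D.cmp_reduce[OF E(3)] D.cmp_reduce[OF E(4)]\<close>)
  define c where "c = fmp \<Phi> P B (Add C P B p1 p2)"
  have cH: "c \<in> Hom D (?F P) (?F B)" using PD by (simp add: c_def)
  have c1: "Cmp D (?F B) (?F P) (?F B) c j1 = Idt D (?F B)" "Cmp D (?F B) (?F P) (?F B) c j2 = Idt D (?F B)"
    unfolding c_def j1_def j2_def using PD by (simp_all flip: cmp add: C.cmp_add_left)
  have "c = Cmp D (?F P) (?F P) (?F B) c (Add D (?F P) (?F P) (Cmp D (?F P) (?F B) (?F P) j1 q1) (Cmp D (?F P) (?F B) (?F P) j2 q2))"
    unfolding idP using cH B PD(3) by simp
  also have "\<dots> = Add D (?F P) (?F B) q1 q2"
    using cH H B PD(3) by (simp add: D.cmp_add_right D.cmp_reduce[OF c1(1)] D.cmp_reduce[OF c1(2)])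
  finally have c: "c = Add D (?F P) (?F B) q1 q2" .
  define h where "h = Add C A P (Cmp C A B P i1 f) (Cmp C A B P i2 g)"
  have h: "h \<in> Hom C A P" "Cmp C A P B p1 h = f" "Cmp C A P B p2 h = g"
    unfolding h_def using PD A B f g
    by (simp_all add: C.cmp_add_right C.cmp_reduce[OF PD(8)] C.cmp_reduce[OF PD(9)]
        C.cmp_reduce[OF PD(10)] C.cmp_reduce[OF PD(11)])
  have "Add C A B f g = Cmp C A P B (Add C P B p1 p2) h" using h PD A by (simp add: C.cmp_add_left)
  then have "fmp \<Phi> A B (Add C A B f g) = Cmp D (?F A) (?F P) (?F B) c (fmp \<Phi> A P h)"
    unfolding c_def using h PD A by (simp add: cmp)
  also have "\<dots> = Add D (?F A) (?F B) (Cmp D (?F A) (?F P) (?F B) q1 (fmp \<Phi> A P h)) (Cmp D (?F A) (?F P) (?F B) q2 (fmp \<Phi> A P h))"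
    unfolding c using H h PD A by (simp add: D.cmp_add_left)
  also have "\<dots> = Add D (?F A) (?F B) (fmp \<Phi> A B f) (fmp \<Phi> A B g)"
    unfolding q1_def q2_def using h PD A by (simp flip: cmp)
  finally show ?thesis .
qed

end

text \<open>The quasi-inverse is obtained by choice: objects and isomorphisms \<open>e A\<close>
  from essential surjectivity, morphisms by conjugating with these and lifting along the full
  functor. Each identity is then checked after applying the faithful \<open>F\<close>.\<close>

lemma is_equivalenceI:
  assumes C: "preadditive_cat C" and D: "preadditive_cat D" and F: "is_functor C D F"
    and faithful: "\<And>A B f g. \<lbrakk>A \<in> Ob C; B \<in> Ob C; f \<in> Hom C A B; g \<in> Hom C A B; fmp F A B f = fmp F A B g\<rbrakk> \<Longrightarrow> f = g"
    and full: "\<And>A B h. \<lbrakk>A \<in> Ob C; B \<in> Ob C; h \<in> Hom D (fob F A) (fob F B)\<rbrakk> \<Longrightarrow> \<exists>f \<in> Hom C A B. fmp F A B f = h"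
    and ess: "\<And>A. A \<in> Ob D \<Longrightarrow> \<exists>A' \<in> Ob C. iso_obj D (fob F A') A"
  shows "is_equivalence C D F"
proof -
  interpret C: preadditive_cat C by (rule C)
  interpret D: preadditive_cat D by (rule D)
  have Fo [simp]: "A \<in> Ob C \<Longrightarrow> fob F A \<in> Ob D" and Fi [simp]: "A \<in> Ob C \<Longrightarrow> fmp F A A (Idt C A) = Idt D (fob F A)"
    and Fh [simp]: "\<lbrakk>A \<in> Ob C; B \<in> Ob C; f \<in> Hom C A B\<rbrakk> \<Longrightarrow> fmp F A B f \<in> Hom D (fob F A) (fob F B)"
    and Fc: "\<lbrakk>A \<in> Ob C; B \<in> Ob C; E \<in> Ob C; f \<in> Hom C A B; g \<in> Hom C B E\<rbrakk> \<Longrightarrow>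
      fmp F A E (Cmp C A B E g f) = Cmp D (fob F A) (fob F B) (fob F E) (fmp F B E g) (fmp F A B f)"
    for A B E f g using F by (auto simp: is_functor_def)
  have "\<forall>A \<in> Ob D. \<exists>A' e e'. A' \<in> Ob C \<and> e \<in> Hom D (fob F A') A \<and> e' \<in> Hom D A (fob F A') \<and>
      Cmp D (fob F A') A (fob F A') e' e = Idt D (fob F A') \<and> Cmp D A (fob F A') A e e' = Idt D A"
    using ess unfolding iso_obj_def iso_mor_def by meson
  then obtain G e e' where G [simp]: "\<And>A. A \<in> Ob D \<Longrightarrow> G A \<in> Ob C"
    and e [simp]: "\<And>A. A \<in> Ob D \<Longrightarrow> e A \<in> Hom D (fob F (G A)) A" "\<And>A. A \<in> Ob D \<Longrightarrow> e' A \<in> Hom D A (fob F (G A))"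
    and ee: "\<And>A. A \<in> Ob D \<Longrightarrow> Cmp D (fob F (G A)) A (fob F (G A)) (e' A) (e A) = Idt D (fob F (G A))"
    "\<And>A. A \<in> Ob D \<Longrightarrow> Cmp D A (fob F (G A)) A (e A) (e' A) = Idt D A"
    by metis
  define conj where "conj A B h = Cmp D (fob F (G A)) B (fob F (G B)) (e' B) (Cmp D (fob F (G A)) A B h (e A))" for A B h
  define g where "g A B h = (SOME f. f \<in> Hom C (G A) (G B) \<and> fmp F (G A) (G B) f = conj A B h)" for A B h
  have g: "g A B h \<in> Hom C (G A) (G B)" "fmp F (G A) (G B) (g A B h) = conj A B h"
    if "A \<in> Ob D" "B \<in> Ob D" "h \<in> Hom D A B" for A B h
  proof -
    have "conj A B h \<in> Hom D (fob F (G A)) (fob F (G B))" using that by (simp add: conj_def)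
    then have "\<exists>f. f \<in> Hom C (G A) (G B) \<and> fmp F (G A) (G B) f = conj A B h" using full that G by metis
    then show "g A B h \<in> Hom C (G A) (G B)" "fmp F (G A) (G B) (g A B h) = conj A B h"
      unfolding g_def by (metis (mono_tags, lifting) someI_ex)+
  qed
  define s where "s A = (SOME f. f \<in> Hom C A (G (fob F A)) \<and> fmp F A (G (fob F A)) f = e' (fob F A))" for A
  have s: "s A \<in> Hom C A (G (fob F A))" "fmp F A (G (fob F A)) (s A) = e' (fob F A)" if "A \<in> Ob C" for A
  proof -
    have "\<exists>f. f \<in> Hom C A (G (fob F A)) \<and> fmp F A (G (fob F A)) f = e' (fob F A)"
      using full[of A "G (fob F A)" "e' (fob F A)"] that by auto
    then show "s A \<in> Hom C A (G (fob F A))" "fmp F A (G (fob F A)) (s A) = e' (fob F A)"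
      unfolding s_def by (metis (mono_tags, lifting) someI_ex)+
  qed
  let ?G = "\<lparr>fob = G, fmp = g\<rparr>"
  have "is_functor D C ?G"
    unfolding is_functor_def
  proof (intro conjI ballI, simp_all add: g)
    fix A assume A: "A \<in> Ob D"
    show "g A A (Idt D A) = Idt C (G A)"
      by (rule faithful[of "G A" "G A"]) (use A g[OF A A] ee in \<open>auto simp: conj_def\<close>)
    fix B E h k assume *: "B \<in> Ob D" "E \<in> Ob D" "h \<in> Hom D A B" "k \<in> Hom D B E"
    show "g A E (Cmp D A B E k h) = Cmp C (G A) (G B) (G E) (g B E k) (g A B h)"
    proof (rule faithful)
      have "conj A E (Cmp D A B E k h) = Cmp D (fob F (G A)) (fob F (G B)) (fob F (G E)) (conj B E k) (conj A B h)"
        using A * by (simp add: conj_def D.cmp_assoc' D.cmp_reduce[OF ee(2)])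
      then show "fmp F (G A) (G E) (g A E (Cmp D A B E k h)) =
          fmp F (G A) (G E) (Cmp C (G A) (G B) (G E) (g B E k) (g A B h))"
        using A * g by (simp add: Fc)
    qed (use A * g in auto)
  qed
  moreover have "nat_iso C C id_functor (comp_functor ?G F) s"
    unfolding nat_iso_def id_functor_def comp_functor_def
  proof (intro conjI ballI, simp_all)
    fix A assume A: "A \<in> Ob C"
    obtain k where k: "k \<in> Hom C (G (fob F A)) A" "fmp F (G (fob F A)) A k = e (fob F A)"
      using full[of "G (fob F A)" A "e (fob F A)"] A by auto
    have "Cmp C A (G (fob F A)) A k (s A) = Idt C A"
      by (rule faithful[of A A]) (use A k s[OF A] ee in \<open>auto simp: Fc\<close>)
    moreover have "Cmp C (G (fob F A)) A (G (fob F A)) (s A) k = Idt C (G (fob F A))"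
      by (rule faithful[of "G (fob F A)" "G (fob F A)"]) (use A k s[OF A] ee in \<open>auto simp: Fc\<close>)
    ultimately show "iso_mor C A (G (fob F A)) (s A)" unfolding iso_mor_def using A k s[OF A] by auto
    fix B f assume B: "B \<in> Ob C" "f \<in> Hom C A B"
    show "Cmp C A B (G (fob F B)) (s B) f =
        Cmp C A (G (fob F A)) (G (fob F B)) (g (fob F A) (fob F B) (fmp F A B f)) (s A)"
    proof (rule faithful)
      show "fmp F A (G (fob F B)) (Cmp C A B (G (fob F B)) (s B) f) =
        fmp F A (G (fob F B)) (Cmp C A (G (fob F A)) (G (fob F B)) (g (fob F A) (fob F B) (fmp F A B f)) (s A))"
        using A B s g[of "fob F A" "fob F B" "fmp F A B f"] ee by (simp add: Fc conj_def D.cmp_assoc')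
    qed (use A B s g in auto)
  qed
  moreover have "nat_iso D D (comp_functor F ?G) id_functor e"
    unfolding nat_iso_def id_functor_def comp_functor_def
  proof (intro conjI ballI, simp_all)
    fix A assume A: "A \<in> Ob D"
    show "iso_mor D (fob F (G A)) A (e A)" unfolding iso_mor_def using A ee[OF A] by auto
    fix B h assume B: "B \<in> Ob D" "h \<in> Hom D A B"
    show "Cmp D (fob F (G A)) (fob F (G B)) B (e B) (fmp F (G A) (G B) (g A B h)) = Cmp D (fob F (G A)) A B h (e A)"
      unfolding g(2)[OF A B] conj_def by (subst D.cmp_reduce[OF ee(2)]) (use A B in auto)
  qed
  ultimately show ?thesis unfolding is_equivalence_def using F by blast
qed

section \<open>Semi-simple categories of finite length\<close>

text \<open>The quasi-inverse \<open>w\<close> of \<open>f\<close> is the missing projection: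
  \<open>f w f = f\<close> gives \<open>w f = 1\<close>, and \<open>f w + s g = 1\<close> composed
  with \<open>s\<close> gives \<open>f w s = 0\<close>, where \<open>f\<close> can be cancelled each
  time.\<close>

lemma (in regular_cat) short_exact_biprod:
  assumes "short_exact C A X S f g"
  obtains s r where "is_biprod C A S X f s r g"
proof -
  note k = short_exactD(1)[OF assms] and q = short_exactD(2)[OF assms]
  note D = is_kerD[OF k]
  obtain w s where s: "w \<in> Hom C X A" "s \<in> Hom C S X" "Cmp C A X X (Cmp C X A X f w) f = f"
    "Cmp C S X S g s = Idt C S" "Add C X X (Cmp C X A X f w) (Cmp C X S X s g) = Idt C X"
    using coker_section[OF q] by metis
  have fm: "mono_mor C A X f" using is_ker_mono[OF k] .
  have "Cmp C A X A w f = Idt C A"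
    using fm D s unfolding mono_mor_def by (metis cmp_assoc cmp_in_hom id_in_hom id_right)
  moreover have "Cmp C S X A w s = Zer C S A"
  proof (rule monoD_zero[OF fm])
    have "Add C S X (Cmp C S A X f (Cmp C S X A w s)) s = Cmp C S X X (Add C X X (Cmp C X A X f w) (Cmp C X S X s g)) s"
      using D s(1-4) by (simp add: cmp_add_left cmp_assoc')
    also have "\<dots> = Add C S X (Zer C S X) s" unfolding s(5) using D s by simp
    finally have "Add C S X s (Cmp C S A X f (Cmp C S X A w s)) = Add C S X s (Zer C S X)"
      using D s by (simp add: add_commute)
    then show "Cmp C S A X f (Cmp C S X A w s) = Zer C S X"
      using add_left_cancel[of S X s "Cmp C S A X f (Cmp C S X A w s)" "Zer C S X"] D s by simp
  qed (use D s in auto)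
  ultimately have "is_biprod C A S X f s w g" unfolding is_biprod_def using D s by auto
  then show ?thesis using that by blast
qed

lemma (in preadditive_cat) biprod_iso:
  assumes P: "is_biprod C A S X i1 i2 p1 p2" and j: "iso_mor C T S j"
  obtains i2' p2' where "is_biprod C A T X i1 i2' p1 p2'"
proof -
  note D = biprodD[OF P]
  obtain k where k: "k \<in> Hom C S T" "Cmp C T S T k j = Idt C T" "Cmp C S T S j k = Idt C S"
    using j unfolding iso_mor_def by blast
  note jD = iso_morD[OF j]
  have "Cmp C X T X (Cmp C T S X i2 j) (Cmp C X S T k p2) = Cmp C X S X i2 p2"
    using D jD k by (simp add: cmp_assoc' cmp_reduce[OF k(3)])
  then have "is_biprod C A T X i1 (Cmp C T S X i2 j) p1 (Cmp C X S T k p2)"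
    unfolding is_biprod_def using D jD k
    by (simp add: cmp_assoc' cmp_reduce[OF D(9)] cmp_reduce[OF D(11)] cmp_reduce[OF k(3)])
  then show ?thesis using that by blast
qed

lemma (in abelian) Schur:
  assumes S: "simple_obj C S" and S': "simple_obj C S'" and f: "f \<in> Hom C S S'" and nz: "f \<noteq> Zer C S S'"
  shows "iso_mor C S S' f"
proof -
  have O: "S \<in> Ob C" "S' \<in> Ob C" using S S' by (auto simp: simple_obj_def)
  obtain K k where k: "is_ker C S S' f K k" using ker_ex O f by blast
  note kD = is_kerD[OF k] and km = is_ker_mono[OF k]
  have "\<not> iso_mor C K S k"
  proof
    assume "iso_mor C K S k"
    then obtain l where "l \<in> Hom C S K" "Cmp C S K S k l = Idt C S" unfolding iso_mor_def by blast
    then have "f = Cmp C S K S' (Cmp C K S S' f k) l" using kD(1-5) O by (simp add: cmp_assoc')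
    then show False using nz kD \<open>l \<in> _\<close> by simp
  qed
  then have Kz: "zero_obj C K" using S km unfolding simple_obj_def by blast
  have "mono_mor C S S' f" unfolding mono_iff
  proof (intro conjI ballI impI O f)
    fix T t assume t: "T \<in> Ob C" "t \<in> Hom C T S" "Cmp C T S S' f t = Zer C T S'"
    then obtain a where a: "a \<in> Hom C T K" "Cmp C T K S k a = t" using is_ker_factor[OF k] by metis
    then have "a = Zer C T K" using zero_obj_to[OF Kz] t by blast
    then show "t = Zer C T S" using a kD t by simp
  qed
  then show ?thesis using S S' unfolding simple_obj_def by blast
qed

lemma abelian_group_sum_group:
  fixes N :: "('i \<Rightarrow> 'a, 'z) ring_scheme" and G :: "'i \<Rightarrow> ('a, 'g) monoid_scheme"
  assumes "\<And>i. i \<in> I \<Longrightarrow> comm_group (G i)" and N: "carrier N = carrier (sum_group I G)"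
    "(\<oplus>\<^bsub>N\<^esub>) = (\<otimes>\<^bsub>sum_group I G\<^esub>)" "\<zero>\<^bsub>N\<^esub> = \<one>\<^bsub>sum_group I G\<^esub>"
  shows "abelian_group N"
proof -
  have g: "\<And>i. i \<in> I \<Longrightarrow> Group.group (G i)" using assms(1) comm_group.axioms(2) by blast
  interpret comm_group "sum_group I G"
  proof (rule group.group_comm_groupI)
    show "Group.group (sum_group I G)" using g by (rule sum_group)
    fix x y assume "x \<in> carrier (sum_group I G)" "y \<in> carrier (sum_group I G)"
    then have "x i \<in> carrier (G i)" "y i \<in> carrier (G i)" if "i \<in> I" for i
      using that by (auto simp: carrier_sum_group[OF g])
    then show "x \<otimes>\<^bsub>sum_group I G\<^esub> y = y \<otimes>\<^bsub>sum_group I G\<^esub> x"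
      using comm_monoid.m_comm[OF comm_group.axioms(1)[OF assms(1)]] by (auto intro!: restrict_ext)
  qed
  show ?thesis
  proof (rule abelian_groupI)
    fix x assume "x \<in> carrier N"
    then show "\<exists>y\<in>carrier N. y \<oplus>\<^bsub>N\<^esub> x = \<zero>\<^bsub>N\<^esub>" unfolding N by (metis inv_closed l_inv)
  qed (unfold N, simp_all add: m_ac del: mult_sum_group one_sum_group)
qed

text \<open>Used twice in the main proof: for \<open>full_sub C \<X>\<close> with the simple objects
  \<open>I\<close>, and for \<open>full_sub C \<Y>\<close> with \<open>J\<close>.\<close>

locale fin_ss = regular_cat B for B :: "('o, 'm) precat" +
  fixes J :: "'o set"
  assumes reps: "simple_reps B J" and fin: "A \<in> Ob B \<Longrightarrow> finite_length_obj B A"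
begin

lemma J_simple: "S \<in> J \<Longrightarrow> simple_obj B S"
  using reps by (simp add: simple_reps_def)

lemma J_Ob [simp]: "S \<in> J \<Longrightarrow> S \<in> Ob B"
  using J_simple by (simp add: simple_obj_def)

lemma J_hom_zero:
  assumes "S \<in> J" "S' \<in> J" "S \<noteq> S'" "f \<in> Hom B S S'"
  shows "f = Zer B S S'"
proof (rule ccontr)
  assume "f \<noteq> Zer B S S'"
  then have "iso_obj B S S'" using Schur J_simple assms unfolding iso_obj_def by blast
  moreover have "iso_obj B S' S'" unfolding iso_obj_def using iso_mor_id assms J_Ob by blast
  ultimately show False using reps J_simple assms unfolding simple_reps_def by blast
qed

lemma J_inverse:
  assumes "S \<in> J" "f \<in> Hom B S S" "f \<noteq> Zer B S S"
  obtains g where "g \<in> Hom B S S" "Cmp B S S S f g = Idt B S" "Cmp B S S S g f = Idt B S"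
  using Schur[OF J_simple[OF assms(1)] J_simple[OF assms(1)] assms(2,3)] unfolding iso_mor_def by blast

text \<open>A composition series consists of biproducts because short exact sequences split, and
  each simple factor can be exchanged for its representative in \<open>J\<close>. Statements on
  arbitrary objects are thus proved by adjoining one member of \<open>J\<close> at a time.\<close>

lemma ss_induct [consumes 1, case_names zero step]:
  assumes "Y \<in> Ob B" and "\<And>Z. zero_obj B Z \<Longrightarrow> Q Z"
    and step: "\<And>A S X i1 i2 p1 p2. \<lbrakk>Q A; S \<in> J; is_biprod B A S X i1 i2 p1 p2\<rbrakk> \<Longrightarrow> Q X"
  shows "Q Y"
  using fin[OF assms(1)]
proof induction
  case (zero Z)
  then show ?case using assms(2) by blast
next
  case (step A S X f g)
  obtain T where T: "T \<in> J" "iso_obj B T S" using step(2) reps unfolding simple_reps_def by metis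
  obtain s r where "is_biprod B A S X f s r g" using short_exact_biprod step(3) by blast
  moreover obtain j where "iso_mor B T S j" using T unfolding iso_obj_def by blast
  ultimately obtain i2 p2 where "is_biprod B A T X f i2 r p2" using biprod_iso by blast
  then show ?case using assms(3) step(4) T by blast
qed

text \<open>Faithfulness of \<open>H\<close> in disguise: two morphisms are compared on the simple
  summands of their source.\<close>

lemma J_separating:
  assumes "Y \<in> Ob B" "Y' \<in> Ob B" "u \<in> Hom B Y Y'" "v \<in> Hom B Y Y'"
    and "\<And>S f. \<lbrakk>S \<in> J; f \<in> Hom B S Y\<rbrakk> \<Longrightarrow> Cmp B S Y Y' u f = Cmp B S Y Y' v f"
  shows "u = v"
  using assms(1,3-5)
proof (induction Y arbitrary: u v rule: ss_induct)
  case (zero Z)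
  then show ?case using zero_obj_from assms(2) by metis
next
  case (step A S X i1 i2 p1 p2)
  note D = biprodD[OF step.hyps(2)]
  show ?case
  proof (rule biprod_eqI[OF step.hyps(2) assms(2) step.prems(1,2)])
    show "Cmp B A X Y' u i1 = Cmp B A X Y' v i1"
      by (rule step.IH) (use D step.prems assms(2) in \<open>simp_all add: cmp_assoc'\<close>)
    show "Cmp B S X Y' u i2 = Cmp B S X Y' v i2" using step D by blast
  qed
qed

section \<open>The functor \<open>H\<close> to modules over the ring of the simple objects\<close>

abbreviation R where "R \<equiv> simples_ring B J"
abbreviation H where "H \<equiv> simples_hom B J"

lemma hom_grp: "\<lbrakk>A \<in> Ob B; A' \<in> Ob B\<rbrakk> \<Longrightarrow> Group.group (hom_group B A A')"
  using hom_comm_group comm_group.axioms(2) by blast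

lemma H_carrier:
  assumes "Y \<in> Ob B"
  shows "f \<in> carrier (H Y) \<longleftrightarrow> f \<in> extensional J \<and> (\<forall>S\<in>J. f S \<in> Hom B S Y) \<and> finite {S \<in> J. f S \<noteq> Zer B S Y}"
  unfolding simples_hom_def using assms
  by (simp add: carrier_sum_group hom_grp PiE_iff) (auto simp: hom_group_def)

lemma H_ops:
  "\<zero>\<^bsub>H Y\<^esub> = (\<lambda>S\<in>J. Zer B S Y)" "f \<oplus>\<^bsub>H Y\<^esub> g = (\<lambda>S\<in>J. Add B S Y (f S) (g S))"
  "r \<odot>\<^bsub>H Y\<^esub> f = (\<lambda>S\<in>J. Cmp B S S Y (f S) (r S))"
  by (simp_all add: simples_hom_def hom_group_def)

lemma R_carrier:
  "r \<in> carrier R \<longleftrightarrow> r \<in> extensional J \<and> (\<forall>S\<in>J. r S \<in> Hom B S S) \<and> finite {S \<in> J. r S \<noteq> Zer B S S}"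
  unfolding simples_ring_def
  by (simp add: carrier_sum_group hom_grp PiE_iff) (auto simp: hom_group_def)

lemma R_ops:
  "\<zero>\<^bsub>R\<^esub> = (\<lambda>S\<in>J. Zer B S S)" "r \<oplus>\<^bsub>R\<^esub> s = (\<lambda>S\<in>J. Add B S S (r S) (s S))"
  "r \<otimes>\<^bsub>R\<^esub> s = (\<lambda>S\<in>J. Cmp B S S S (s S) (r S))"
  by (simp_all add: simples_ring_def hom_group_def)

lemma finite_supp_add:
  assumes "finite {S \<in> J. f S \<noteq> z S}" "finite {S \<in> J. g S \<noteq> z S}" "\<And>S. S \<in> J \<Longrightarrow> f S = z S \<Longrightarrow> g S = z S \<Longrightarrow> h S = z S"
  shows "finite {S \<in> J. h S \<noteq> z S}"
  by (rule finite_subset[of _ "{S \<in> J. f S \<noteq> z S} \<union> {S \<in> J. g S \<noteq> z S}"]) (use assms in auto)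

lemma H_group: "Y \<in> Ob B \<Longrightarrow> abelian_group (H Y)"
  by (rule abelian_group_sum_group[of J "\<lambda>S. hom_group B S Y"])
    (auto simp: hom_comm_group simples_hom_def)

lemma R_group: "abelian_group R"
  by (rule abelian_group_sum_group[of J "\<lambda>S. hom_group B S S"])
    (auto simp: hom_comm_group simples_ring_def)

lemma R_mult_closed:
  assumes "r \<in> carrier R" "s \<in> carrier R"
  shows "r \<otimes>\<^bsub>R\<^esub> s \<in> carrier R"
  using assms finite_supp_add[of r "\<lambda>S. Zer B S S" r "r \<otimes>\<^bsub>R\<^esub> s"] by (auto simp: R_carrier R_ops)

lemma H_smult_closed:
  assumes "Y \<in> Ob B" "r \<in> carrier R" "f \<in> carrier (H Y)"
  shows "r \<odot>\<^bsub>H Y\<^esub> f \<in> carrier (H Y)"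
  using assms finite_supp_add[of f "\<lambda>S. Zer B S Y" f "r \<odot>\<^bsub>H Y\<^esub> f"]
  by (auto simp: H_carrier R_carrier H_ops)

text \<open>These idempotents replace the unit of \<open>R\<close>: an element is fixed by
  \<open>unit_on K\<close> as soon as \<open>K\<close> contains its support.\<close>

definition unit_on :: "'o set \<Rightarrow> 'o \<Rightarrow> 'm" where
  "unit_on K = (\<lambda>S\<in>J. if S \<in> K then Idt B S else Zer B S S)"

lemma unit_on_carrier: "finite K \<Longrightarrow> unit_on K \<in> carrier R"
  by (auto simp: R_carrier unit_on_def elim!: rev_finite_subset)

lemma unit_on_mult:
  assumes "r \<in> carrier R" "\<And>S. S \<in> J \<Longrightarrow> r S \<noteq> Zer B S S \<Longrightarrow> S \<in> K"
  shows "unit_on K \<otimes>\<^bsub>R\<^esub> r = r"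
proof
  fix S show "(unit_on K \<otimes>\<^bsub>R\<^esub> r) S = r S"
    using assms(1) assms(2)[of S]
    by (cases "S \<in> J \<and> r S = Zer B S S") (auto simp: R_carrier R_ops unit_on_def extensional_def)
qed

sublocale R: lu_ring R "{unit_on K | K. finite K}"
proof (rule lu_ring.intro)
  show "\<exists>e \<in> {unit_on K | K. finite K}. e \<otimes>\<^bsub>R\<^esub> r = r" if "r \<in> carrier R" for r
    using unit_on_mult[of r "{S \<in> J. r S \<noteq> Zer B S S}"] that by (auto simp: R_carrier)
  fix e e' assume "e \<in> {unit_on K | K. finite K}" "e' \<in> {unit_on K | K. finite K}"
  then obtain K K' where K: "e = unit_on K" "e' = unit_on K'" "finite K" "finite K'" by blast
  have "unit_on (K \<union> K') \<otimes>\<^bsub>R\<^esub> e = e" "unit_on (K \<union> K') \<otimes>\<^bsub>R\<^esub> e' = e'"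
    unfolding K by (rule unit_on_mult; use K unit_on_carrier in \<open>auto simp: unit_on_def split: if_splits\<close>)+
  then show "\<exists>d\<in>{unit_on K | K. finite K}. d \<otimes>\<^bsub>R\<^esub> e = e \<and> d \<otimes>\<^bsub>R\<^esub> e' = e'" using K by blast
qed (use R_group R_mult_closed unit_on_carrier in auto)

lemma H_module:
  assumes Y: "Y \<in> Ob B"
  shows "nu_module R (H Y)"
proof (rule nu_moduleI[OF H_group[OF Y] H_smult_closed[OF Y]])
  fix f assume f: "f \<in> carrier (H Y)"
  let ?K = "{S \<in> J. f S \<noteq> Zer B S Y}"
  have "finite ?K" using f Y by (simp add: H_carrier)
  moreover have "unit_on ?K \<odot>\<^bsub>H Y\<^esub> f = f"
  proof
    fix S show "(unit_on ?K \<odot>\<^bsub>H Y\<^esub> f) S = f S"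
      using f Y by (auto simp: H_carrier H_ops unit_on_def extensional_def)
  qed
  ultimately show "\<exists>a\<in>carrier R. a \<odot>\<^bsub>H Y\<^esub> f = f" using unit_on_carrier by blast
qed (use Y in \<open>auto simp: H_carrier R_carrier H_ops R_ops cmp_add_left cmp_add_right cmp_assoc intro!: restrict_ext\<close>)

definition hmap :: "'o \<Rightarrow> 'o \<Rightarrow> 'm \<Rightarrow> ('o \<Rightarrow> 'm) \<Rightarrow> 'o \<Rightarrow> 'm" where
  "hmap Y Y' u f = (\<lambda>S\<in>J. Cmp B S Y Y' u (f S))"

text \<open>\<open>sing\<close> and \<open>rsing\<close> insert a single component, into
  \<open>H Y\<close> and into \<open>R\<close> respectively; \<open>rsing S (Idt B S)\<close> is the
  idempotent that belongs to the simple object \<open>S\<close>.\<close>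

definition sing :: "'o \<Rightarrow> 'o \<Rightarrow> 'm \<Rightarrow> 'o \<Rightarrow> 'm" where
  "sing Y S d = (\<lambda>S'\<in>J. if S' = S then d else Zer B S' Y)"

definition rsing :: "'o \<Rightarrow> 'm \<Rightarrow> 'o \<Rightarrow> 'm" where
  "rsing S d = (\<lambda>S'\<in>J. if S' = S then d else Zer B S' S')"

lemma hmap_closed:
  assumes "Y \<in> Ob B" "Y' \<in> Ob B" "u \<in> Hom B Y Y'" "f \<in> carrier (H Y)"
  shows "hmap Y Y' u f \<in> carrier (H Y')"
proof -
  have "finite {S \<in> J. hmap Y Y' u f S \<noteq> Zer B S Y'}"
    by (rule finite_subset[of _ "{S \<in> J. f S \<noteq> Zer B S Y}"]) (use assms in \<open>auto simp: H_carrier hmap_def\<close>)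
  then show ?thesis using assms by (auto simp: H_carrier hmap_def)
qed

lemma hmap_add:
  assumes "Y \<in> Ob B" "Y' \<in> Ob B" "u \<in> Hom B Y Y'" "f \<in> carrier (H Y)" "g \<in> carrier (H Y)"
  shows "hmap Y Y' u (f \<oplus>\<^bsub>H Y\<^esub> g) = hmap Y Y' u f \<oplus>\<^bsub>H Y'\<^esub> hmap Y Y' u g"
  using assms by (auto simp: H_carrier hmap_def H_ops cmp_add_right intro!: restrict_ext)

lemma hmap_smult:
  assumes "Y \<in> Ob B" "Y' \<in> Ob B" "u \<in> Hom B Y Y'" "r \<in> carrier R" "f \<in> carrier (H Y)"
  shows "hmap Y Y' u (r \<odot>\<^bsub>H Y\<^esub> f) = r \<odot>\<^bsub>H Y'\<^esub> hmap Y Y' u f"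
  using assms by (auto simp: H_carrier R_carrier hmap_def H_ops cmp_assoc intro!: restrict_ext)

lemma hmap_cmp:
  assumes "Y \<in> Ob B" "Y' \<in> Ob B" "Y'' \<in> Ob B" "u \<in> Hom B Y Y'" "v \<in> Hom B Y' Y''" "f \<in> carrier (H Y)"
  shows "hmap Y Y'' (Cmp B Y Y' Y'' v u) f = hmap Y' Y'' v (hmap Y Y' u f)"
  using assms by (auto simp: H_carrier hmap_def cmp_assoc' intro!: restrict_ext)

lemma hmap_id: "\<lbrakk>Y \<in> Ob B; f \<in> carrier (H Y)\<rbrakk> \<Longrightarrow> hmap Y Y (Idt B Y) f = f"
  by (rule ext) (auto simp: H_carrier hmap_def extensional_def)

lemma hmap_biprod:
  assumes "is_biprod B A S X i1 i2 p1 p2" "f \<in> carrier (H X)"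
  shows "hmap A X i1 (hmap X A p1 f) \<oplus>\<^bsub>H X\<^esub> hmap S X i2 (hmap X S p2 f) = f"
  by (rule ext) (use assms biprodD[OF assms(1)] biprod_decomp[OF assms(1)] in
    \<open>auto simp: H_carrier hmap_def H_ops extensional_def\<close>)

lemma sing_carrier: "\<lbrakk>Y \<in> Ob B; S \<in> J; d \<in> Hom B S Y\<rbrakk> \<Longrightarrow> sing Y S d \<in> carrier (H Y)"
  by (auto simp: H_carrier sing_def intro: finite_subset[of _ "{S}"])

lemma rsing_carrier: "\<lbrakk>S \<in> J; d \<in> Hom B S S\<rbrakk> \<Longrightarrow> rsing S d \<in> carrier R"
  by (auto simp: R_carrier rsing_def intro: finite_subset[of _ "{S}"])

text \<open>Different members of \<open>J\<close> have only zero morphisms between them, so nothing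
  but the component at \<open>S\<close> can survive.\<close>

lemma H_simple:
  assumes "S \<in> J" "f \<in> carrier (H S)"
  shows "f = sing S S (f S)"
  by (rule ext) (use assms J_hom_zero in \<open>auto simp: H_carrier sing_def extensional_def\<close>)

lemma rsing_smult:
  assumes "Y \<in> Ob B" "S \<in> J" "d \<in> Hom B S S" "f \<in> carrier (H Y)"
  shows "rsing S d \<odot>\<^bsub>H Y\<^esub> f = sing Y S (Cmp B S S Y (f S) d)"
  using assms by (auto simp: H_carrier H_ops rsing_def sing_def intro!: restrict_ext)

lemma rsing_mult:
  assumes "S \<in> J" "d \<in> Hom B S S" "r \<in> carrier R"
  shows "r \<otimes>\<^bsub>R\<^esub> rsing S d = rsing S (Cmp B S S S d (r S))" "rsing S d \<otimes>\<^bsub>R\<^esub> r = rsing S (Cmp B S S S (r S) d)"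
  using assms by (auto simp: R_carrier R_ops rsing_def intro!: restrict_ext)

lemma rsing_add:
  assumes "S \<in> J" "d \<in> Hom B S S" "d' \<in> Hom B S S"
  shows "rsing S d \<oplus>\<^bsub>R\<^esub> rsing S d' = rsing S (Add B S S d d')"
  using assms by (auto simp: R_ops rsing_def intro!: restrict_ext)

lemma rsing_zero: "rsing S (Zer B S S) = \<zero>\<^bsub>R\<^esub>"
  by (auto simp: R_ops rsing_def intro!: restrict_ext)

text \<open>Fullness of \<open>H\<close>. The morphism is assembled along a decomposition of
  \<open>Y\<close> into members of \<open>J\<close>; on a simple summand it is read off from the
  image of the identity.\<close>

lemma hmap_full:
  assumes Y: "Y \<in> Ob B" and Y': "Y' \<in> Ob B"
    and cl: "\<And>f. f \<in> carrier (H Y) \<Longrightarrow> \<phi> f \<in> carrier (H Y')"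
    and add: "\<And>f g. \<lbrakk>f \<in> carrier (H Y); g \<in> carrier (H Y)\<rbrakk> \<Longrightarrow> \<phi> (f \<oplus>\<^bsub>H Y\<^esub> g) = \<phi> f \<oplus>\<^bsub>H Y'\<^esub> \<phi> g"
    and sm: "\<And>r f. \<lbrakk>r \<in> carrier R; f \<in> carrier (H Y)\<rbrakk> \<Longrightarrow> \<phi> (r \<odot>\<^bsub>H Y\<^esub> f) = r \<odot>\<^bsub>H Y'\<^esub> \<phi> f"
  shows "\<exists>v \<in> Hom B Y Y'. \<forall>f \<in> carrier (H Y). \<phi> f = hmap Y Y' v f"
  using Y cl add sm
proof (induction Y arbitrary: \<phi> rule: ss_induct)
  case (zero Z)
  have Z: "Z \<in> Ob B" using zero by (simp add: zero_obj_def)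
  show ?case
  proof (intro bexI ballI)
    fix f assume f: "f \<in> carrier (H Z)"
    have "f = \<zero>\<^bsub>H Z\<^esub>"
      by (rule ext) (use f Z zero_obj_to[OF zero.hyps] in \<open>auto simp: H_carrier H_ops extensional_def\<close>)
    then have "\<phi> f = \<zero>\<^bsub>H Y'\<^esub>" using additive_zero(1)[OF H_group[OF Z] H_group[OF Y'], of \<phi>] zero.prems by simp
    also have "\<dots> = hmap Z Y' (Zer B Z Y') f"
      using f Z Y' by (auto simp: H_carrier H_ops hmap_def intro!: restrict_ext)
    finally show "\<phi> f = hmap Z Y' (Zer B Z Y') f" .
  qed (use Z Y' in auto)
next
  case (step A S X i1 i2 p1 p2)
  note D = biprodD[OF step.hyps(2)]
  have "\<exists>v \<in> Hom B A Y'. \<forall>f \<in> carrier (H A). (\<lambda>f. \<phi> (hmap A X i1 f)) f = hmap A Y' v f"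
    by (rule step.IH) (use D step.prems in \<open>auto simp: hmap_closed hmap_add hmap_smult\<close>)
  then obtain v1 where v1: "v1 \<in> Hom B A Y'" "\<And>f. f \<in> carrier (H A) \<Longrightarrow> \<phi> (hmap A X i1 f) = hmap A Y' v1 f" by blast
  define x where "x = \<phi> (hmap S X i2 (sing S S (Idt B S)))"
  have sc: "sing S S (Idt B S) \<in> carrier (H S)" using sing_carrier step.hyps by simp
  have x: "x \<in> carrier (H Y')" unfolding x_def using step.prems(1) hmap_closed D sc by blast
  define v2 where "v2 = x S"
  have v2: "v2 \<in> Hom B S Y'" using x step.hyps Y' by (simp add: v2_def H_carrier)
  have 2: "\<phi> (hmap S X i2 g) = hmap S Y' v2 g" if g: "g \<in> carrier (H S)" for g
  proof -
    have gS: "g S \<in> Hom B S S" using g step.hyps D by (simp add: H_carrier)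
    \<comment> \<open>\<open>H S\<close> is cyclic, generated by the identity of \<open>S\<close> in
      the component \<open>S\<close>, so \<open>\<phi>\<close> is determined on it by the single
      element \<open>x\<close>.\<close>
    have "g = rsing S (g S) \<odot>\<^bsub>H S\<^esub> sing S S (Idt B S)"
      using rsing_smult[OF D(2) step.hyps(1) gS sc] gS D H_simple[OF step.hyps(1) g] step.hyps by (simp add: sing_def)
    then have "\<phi> (hmap S X i2 g) = \<phi> (hmap S X i2 (rsing S (g S) \<odot>\<^bsub>H S\<^esub> sing S S (Idt B S)))" by simp
    also have "\<dots> = rsing S (g S) \<odot>\<^bsub>H Y'\<^esub> x"
      unfolding x_def using hmap_smult step.prems(3) hmap_closed D sc rsing_carrier gS step.hyps by simp
    also have "\<dots> = sing Y' S (Cmp B S S Y' v2 (g S))"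
      using rsing_smult x gS step.hyps Y' by (simp add: v2_def)
    also have "\<dots> = hmap S Y' v2 g"
    proof
      fix S' show "sing Y' S (Cmp B S S Y' v2 (g S)) S' = hmap S Y' v2 g S'"
        using J_hom_zero[of S' S "g S'"] step.hyps g D Y' v2 by (auto simp: sing_def hmap_def H_carrier)
    qed
    finally show ?thesis .
  qed
  let ?v = "Add B X Y' (Cmp B X A Y' v1 p1) (Cmp B X S Y' v2 p2)"
  show ?case
  proof (intro bexI ballI)
    fix f assume f: "f \<in> carrier (H X)"
    have "\<phi> f = \<phi> (hmap A X i1 (hmap X A p1 f) \<oplus>\<^bsub>H X\<^esub> hmap S X i2 (hmap X S p2 f))"
      using hmap_biprod[OF step.hyps(2) f] by simp
    also have "\<dots> = hmap A Y' v1 (hmap X A p1 f) \<oplus>\<^bsub>H Y'\<^esub> hmap S Y' v2 (hmap X S p2 f)"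
      using step.prems(2) v1(2) 2 hmap_closed D f by simp
    also have "\<dots> = hmap X Y' ?v f"
      using f D Y' v1(1) v2 by (auto simp: hmap_def H_ops H_carrier cmp_add_left cmp_assoc' intro!: restrict_ext)
    finally show "\<phi> f = hmap X Y' ?v f" .
  qed (use D v1 v2 Y' in auto)
qed

text \<open>The form in which essential surjectivity of \<open>H\<close> is proved: \<open>L\<close>
  is an isomorphic copy of some \<open>H Y\<close> inside \<open>N\<close>. Keeping the ambient
  module fixed makes it amenable to induction along \<open>fl\<close>.\<close>

definition rep :: "('o \<Rightarrow> 'm, 'u) module \<Rightarrow> 'u set \<Rightarrow> bool" where
  "rep N L \<longleftrightarrow> (\<exists>Y \<in> Ob B. \<exists>\<psi> \<in> mod_homs R (H Y) N. inj_on \<psi> (carrier (H Y)) \<and> \<psi> ` carrier (H Y) = L)"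

lemma rep_submod:
  assumes "nu_module R N" "rep N L"
  shows "nu_submod R N L"
  using assms R.submod_image[OF H_module assms(1) _ R.carrier_submod[OF H_module]] unfolding rep_def by blast

lemma H_zero_obj:
  assumes "zero_obj B Z"
  shows "carrier (H Z) = {\<zero>\<^bsub>H Z\<^esub>}"
proof -
  have Z: "Z \<in> Ob B" using assms by (simp add: zero_obj_def)
  interpret abelian_group "H Z" by (rule H_group[OF Z])
  have "f = \<zero>\<^bsub>H Z\<^esub>" if "f \<in> carrier (H Z)" for f
    by (rule ext) (use that Z zero_obj_to[OF assms] in \<open>auto simp: H_carrier H_ops extensional_def\<close>)
  then show ?thesis using zero_closed by blast
qed

lemma rep_zero:
  assumes N: "nu_module R N"
  shows "rep N {\<zero>\<^bsub>N\<^esub>}"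
proof -
  obtain Z where Z: "zero_obj B Z" using zero_ex by blast
  then have ZO: "Z \<in> Ob B" by (simp add: zero_obj_def)
  interpret N: abelian_group N using nu_moduleD(1)[OF N] .
  interpret Z: abelian_group "H Z" by (rule H_group[OF ZO])
  have "(\<lambda>f\<in>carrier (H Z). \<zero>\<^bsub>N\<^esub>) \<in> mod_homs R (H Z) N"
    by (rule mod_homsI) (use nu_moduleD[OF H_module[OF ZO]] R.smult_zero(2)[OF N] in auto)
  then show ?thesis unfolding rep_def using ZO H_zero_obj[OF Z] by (intro bexI) auto
qed

text \<open>If \<open>x\<close> lies in \<open>L\<close>, nothing is added. Otherwise the sum with
  \<open>L\<close> is direct, because nonzero endomorphisms of \<open>S\<close> are invertible, and
  it is a copy of \<open>H P\<close> for the biproduct \<open>P\<close> of \<open>Y\<close> and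
  \<open>S\<close>.\<close>

lemma rep_step:
  assumes N: "nu_module R N" and L: "rep N L" and x: "x \<in> carrier N" and S: "S \<in> J"
    and ex: "rsing S (Idt B S) \<odot>\<^bsub>N\<^esub> x = x"
  shows "rep N {h \<oplus>\<^bsub>N\<^esub> rsing S d \<odot>\<^bsub>N\<^esub> x | h d. h \<in> L \<and> d \<in> Hom B S S}" (is "rep N ?L")
proof -
  interpret N: abelian_group N using nu_moduleD(1)[OF N] .
  note ND = nu_moduleD[OF N] and LD = R.nu_submodD[OF N rep_submod[OF N L]]
  have SO: "S \<in> Ob B" using S by simp
  have dx: "rsing S d \<odot>\<^bsub>N\<^esub> x \<in> carrier N" if "d \<in> Hom B S S" for d
    using ND(2) x rsing_carrier S that by blast
  have zx: "rsing S (Zer B S S) \<odot>\<^bsub>N\<^esub> x = \<zero>\<^bsub>N\<^esub>" using R.smult_zero(1)[OF N] x by (simp add: rsing_zero)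
  show ?thesis
  proof (cases "x \<in> L")
    case True
    have "?L = L"
    proof
      show "?L \<subseteq> L" using LD(3,4) rsing_carrier S True by blast
      show "L \<subseteq> ?L"
      proof
        fix h assume h: "h \<in> L"
        then have "h = h \<oplus>\<^bsub>N\<^esub> rsing S (Zer B S S) \<odot>\<^bsub>N\<^esub> x" using zx LD(1) by auto
        then show "h \<in> ?L" using h SO zer_in_hom by blast
      qed
    qed
    then show ?thesis using L by simp
  next
    case False
    obtain Y \<psi> where Y: "Y \<in> Ob B" and psi: "\<psi> \<in> mod_homs R (H Y) N" "inj_on \<psi> (carrier (H Y))" "\<psi> ` carrier (H Y) = L"
      using L unfolding rep_def by blast
    note pD = mod_homsD[OF psi(1)]
    obtain P i1 i2 p1 p2 where P: "is_biprod B Y S P i1 i2 p1 p2" using biprod_ex Y SO by blast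
    note D = biprodD[OF P]
    interpret HP: abelian_group "H P" by (rule H_group[OF D(3)])
    interpret HY: abelian_group "H Y" by (rule H_group[OF Y])
    define c where "c g = Cmp B S P S p2 (g S)" for g
    have c: "c g \<in> Hom B S S" if "g \<in> carrier (H P)" for g using that D S by (simp add: c_def H_carrier)
    define \<psi>' where "\<psi>' = (\<lambda>g\<in>carrier (H P). \<psi> (hmap P Y p1 g) \<oplus>\<^bsub>N\<^esub> rsing S (c g) \<odot>\<^bsub>N\<^esub> x)"
    have h1: "hmap P Y p1 g \<in> carrier (H Y)" if "g \<in> carrier (H P)" for g using that hmap_closed D by blast
    have psiL: "\<psi> f \<in> L" if "f \<in> carrier (H Y)" for f using psi(3) that by blast
    have hom: "\<psi>' \<in> mod_homs R (H P) N"
    proof (rule mod_homsI)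
      fix g assume "g \<in> carrier (H P)"
      then show "\<psi>' g \<in> carrier N" using pD(1) h1 dx c by (simp add: \<psi>'_def)
    next
      fix f g assume fg: "f \<in> carrier (H P)" "g \<in> carrier (H P)"
      have "c (f \<oplus>\<^bsub>H P\<^esub> g) = Add B S S (c f) (c g)"
        using fg D S by (simp add: c_def H_ops H_carrier cmp_add_right)
      then have "rsing S (c (f \<oplus>\<^bsub>H P\<^esub> g)) \<odot>\<^bsub>N\<^esub> x = rsing S (c f) \<odot>\<^bsub>N\<^esub> x \<oplus>\<^bsub>N\<^esub> rsing S (c g) \<odot>\<^bsub>N\<^esub> x"
        using ND(3)[OF rsing_carrier rsing_carrier x, OF S c[OF fg(1)] S c[OF fg(2)]] rsing_add[OF S c[OF fg(1)] c[OF fg(2)]] by simp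
      moreover have "\<psi> (hmap P Y p1 (f \<oplus>\<^bsub>H P\<^esub> g)) = \<psi> (hmap P Y p1 f) \<oplus>\<^bsub>N\<^esub> \<psi> (hmap P Y p1 g)"
        using fg D hmap_add pD(2) h1 by simp
      ultimately show "\<psi>' (f \<oplus>\<^bsub>H P\<^esub> g) = \<psi>' f \<oplus>\<^bsub>N\<^esub> \<psi>' g"
        using fg pD(1) h1 dx c by (simp add: \<psi>'_def N.a_ac)
    next
      fix r g assume r: "r \<in> carrier R" and g: "g \<in> carrier (H P)"
      have "c (r \<odot>\<^bsub>H P\<^esub> g) = Cmp B S S S (c g) (r S)"
        using r g D S by (simp add: c_def H_ops H_carrier R_carrier cmp_assoc)
      then have "rsing S (c (r \<odot>\<^bsub>H P\<^esub> g)) \<odot>\<^bsub>N\<^esub> x = r \<odot>\<^bsub>N\<^esub> (rsing S (c g) \<odot>\<^bsub>N\<^esub> x)"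
        using ND(5)[OF r rsing_carrier x, OF S c[OF g]] rsing_mult(1)[OF S c[OF g] r] by simp
      moreover have "\<psi> (hmap P Y p1 (r \<odot>\<^bsub>H P\<^esub> g)) = r \<odot>\<^bsub>N\<^esub> \<psi> (hmap P Y p1 g)"
        using r g D hmap_smult pD(3) h1 by simp
      ultimately show "\<psi>' (r \<odot>\<^bsub>H P\<^esub> g) = r \<odot>\<^bsub>N\<^esub> \<psi>' g"
        using r g pD(1) h1 dx c ND(4) H_smult_closed[OF D(3) r g] by (simp add: \<psi>'_def)
    qed (simp add: \<psi>'_def)
    note p'D = mod_homsD[OF hom]
    have ker: "g = \<zero>\<^bsub>H P\<^esub>" if g: "g \<in> carrier (H P)" and 0: "\<psi>' g = \<zero>\<^bsub>N\<^esub>" for g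
    proof -
      have e: "\<psi> (hmap P Y p1 g) \<oplus>\<^bsub>N\<^esub> rsing S (c g) \<odot>\<^bsub>N\<^esub> x = \<zero>\<^bsub>N\<^esub>" using g 0 by (simp add: \<psi>'_def)
      have pc: "\<psi> (hmap P Y p1 g) \<in> carrier N" using pD(1) h1 g by blast
      \<comment> \<open>A nonzero \<open>c g\<close> would be invertible by Schur's lemma, and the
        relation \<open>e\<close> could be solved for \<open>x\<close>, placing it in
        \<open>L\<close>.\<close>
      have cz: "c g = Zer B S S"
      proof (rule ccontr)
        assume "c g \<noteq> Zer B S S"
        then obtain d where d: "d \<in> Hom B S S" "Cmp B S S S (c g) d = Idt B S" using J_inverse S c[OF g] by metis
        have "rsing S (c g) \<odot>\<^bsub>N\<^esub> x = \<ominus>\<^bsub>N\<^esub> \<psi> (hmap P Y p1 g)"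
          using e pc dx[OF c[OF g]] N.minus_equality[of "rsing S (c g) \<odot>\<^bsub>N\<^esub> x" "\<psi> (hmap P Y p1 g)"] N.a_comm by simp
        then have "rsing S (c g) \<odot>\<^bsub>N\<^esub> x \<in> L" using LD(5) psiL h1 g by simp
        then have "rsing S d \<odot>\<^bsub>N\<^esub> (rsing S (c g) \<odot>\<^bsub>N\<^esub> x) \<in> L" using LD(4) rsing_carrier S d by blast
        moreover have "rsing S d \<odot>\<^bsub>N\<^esub> (rsing S (c g) \<odot>\<^bsub>N\<^esub> x) = x"
          using ND(5)[OF rsing_carrier rsing_carrier x, OF S d(1) S c[OF g]] rsing_mult(1)[OF S c[OF g] rsing_carrier[OF S d(1)]] d ex S
          by (simp add: rsing_def)
        ultimately show False using False by simp
      qed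
      then have "\<psi> (hmap P Y p1 g) = \<psi> \<zero>\<^bsub>H Y\<^esub>" using e zx pc mod_homs_zero(1)[OF H_group[OF Y] ND(1) psi(1)] by simp
      then have 1: "hmap P Y p1 g = \<zero>\<^bsub>H Y\<^esub>" using inj_onD[OF psi(2)] h1 g by simp
      have 2: "hmap P S p2 g = \<zero>\<^bsub>H S\<^esub>"
        using H_simple[OF S hmap_closed[OF D(3) SO D(7) g]] cz S unfolding c_def hmap_def H_ops sing_def
        by (auto intro!: restrict_ext simp: fun_eq_iff)
      have "hmap Y P i1 \<zero>\<^bsub>H Y\<^esub> = \<zero>\<^bsub>H P\<^esub>" "hmap S P i2 \<zero>\<^bsub>H S\<^esub> = \<zero>\<^bsub>H P\<^esub>"
        using D by (auto simp: hmap_def H_ops intro!: restrict_ext)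
      then show ?thesis using hmap_biprod[OF P g] unfolding 1 2 by simp
    qed
    have inj: "inj_on \<psi>' (carrier (H P))"
    proof (rule inj_onI)
      fix f g assume fg: "f \<in> carrier (H P)" "g \<in> carrier (H P)" "\<psi>' f = \<psi>' g"
      have "\<psi>' (f \<oplus>\<^bsub>H P\<^esub> (\<ominus>\<^bsub>H P\<^esub> g)) = \<zero>\<^bsub>N\<^esub>"
        using p'D fg mod_homs_zero(2)[OF H_group[OF D(3)] ND(1) hom] by (simp add: N.r_neg)
      then have "f \<oplus>\<^bsub>H P\<^esub> (\<ominus>\<^bsub>H P\<^esub> g) = \<zero>\<^bsub>H P\<^esub>" using ker fg by simp
      then show "f = g" using fg HP.minus_equality[of f "\<ominus>\<^bsub>H P\<^esub> g"] by simp
    qed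
    have "\<psi>' ` carrier (H P) = ?L"
    proof
      show "\<psi>' ` carrier (H P) \<subseteq> ?L"
      proof (rule image_subsetI)
        fix g assume g: "g \<in> carrier (H P)"
        then have "\<psi>' g = \<psi> (hmap P Y p1 g) \<oplus>\<^bsub>N\<^esub> rsing S (c g) \<odot>\<^bsub>N\<^esub> x" by (simp add: \<psi>'_def)
        then show "\<psi>' g \<in> ?L" using psiL[OF h1[OF g]] c[OF g] by blast
      qed
      show "?L \<subseteq> \<psi>' ` carrier (H P)"
      proof
        fix z assume "z \<in> ?L"
        then obtain h d where z: "z = h \<oplus>\<^bsub>N\<^esub> rsing S d \<odot>\<^bsub>N\<^esub> x" "h \<in> L" "d \<in> Hom B S S" by blast
        then obtain f where f: "f \<in> carrier (H Y)" "h = \<psi> f" using psi(3) by blast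
        define g where "g = hmap Y P i1 f \<oplus>\<^bsub>H P\<^esub> hmap S P i2 (sing S S d)"
        have sc: "sing S S d \<in> carrier (H S)" using sing_carrier SO S z by blast
        have gs: "hmap Y P i1 f \<in> carrier (H P)" "hmap S P i2 (sing S S d) \<in> carrier (H P)"
          using hmap_closed D f sc by blast+
        have g: "g \<in> carrier (H P)" unfolding g_def using gs by simp
        have "hmap P Y p1 g = hmap P Y p1 (hmap Y P i1 f) \<oplus>\<^bsub>H Y\<^esub> hmap P Y p1 (hmap S P i2 (sing S S d))"
          unfolding g_def using hmap_add D gs by blast
        also have "\<dots> = f \<oplus>\<^bsub>H Y\<^esub> \<zero>\<^bsub>H Y\<^esub>"
        proof -
          have "hmap P Y p1 (hmap Y P i1 f) = f"
            using hmap_cmp[of Y P Y i1 p1 f] D f hmap_id Y by simp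
          moreover have "hmap P Y p1 (hmap S P i2 (sing S S d)) = \<zero>\<^bsub>H Y\<^esub>"
          proof -
            have "hmap P Y p1 (hmap S P i2 (sing S S d)) = hmap S Y (Zer B S Y) (sing S S d)"
              using hmap_cmp[of S P Y i2 p1 "sing S S d"] D sc by simp
            then show ?thesis using sc SO Y by (auto simp: hmap_def H_ops H_carrier intro!: restrict_ext)
          qed
          ultimately show ?thesis by simp
        qed
        finally have 1: "hmap P Y p1 g = f" using f by simp
        have "c g = d"
          using f z D S sc by (simp add: g_def c_def H_ops hmap_def H_carrier sing_def cmp_add_right cmp_assoc)
        then have "\<psi>' g = z" using g z f 1 by (simp add: \<psi>'_def)
        then show "z \<in> \<psi>' ` carrier (H P)" using g by blast
      qed
    qed
    then show ?thesis unfolding rep_def using D(3) hom inj by blast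
  qed
qed

text \<open>\<open>unit_on K\<close> is the sum of the idempotents of the simple objects in
  \<open>K\<close>, whence the induction on \<open>K\<close>.\<close>

lemma unit_on_rsing:
  assumes N: "nu_module R N" and x: "x \<in> carrier N" and L: "nu_submod R N L" and K: "finite K"
    and "\<And>S. S \<in> K \<inter> J \<Longrightarrow> rsing S (Idt B S) \<odot>\<^bsub>N\<^esub> x \<in> L"
  shows "unit_on K \<odot>\<^bsub>N\<^esub> x \<in> L"
  using K assms(5)
proof (induction K)
  case empty
  have "unit_on {} = \<zero>\<^bsub>R\<^esub>" by (simp add: unit_on_def R_ops)
  then show ?case using R.smult_zero(1)[OF N x] R.nu_submodD(2)[OF N L] by simp
next
  case (insert S K)
  show ?case
  proof (cases "S \<in> J")
    case True
    have "unit_on (insert S K) = rsing S (Idt B S) \<oplus>\<^bsub>R\<^esub> unit_on K"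
      using insert True by (auto simp: unit_on_def R_ops rsing_def intro!: restrict_ext)
    then show ?thesis
      using nu_moduleD(3)[OF N rsing_carrier unit_on_carrier x, of S "Idt B S" K] insert True
        R.nu_submodD(3)[OF N L] by auto
  next
    case False
    then have "unit_on (insert S K) = unit_on K" by (auto simp: unit_on_def intro!: restrict_ext)
    then show ?thesis using insert by auto
  qed
qed

text \<open>A local unit writes \<open>x\<close> as the finite sum of its components at simple
  objects; if all of these lay in \<open>L\<close>, so would \<open>x\<close>.\<close>

lemma exists_rsing_notin:
  assumes N: "nu_module R N" and x: "x \<in> carrier N" "x \<notin> L" and L: "nu_submod R N L"
  obtains S where "S \<in> J" "rsing S (Idt B S) \<odot>\<^bsub>N\<^esub> x \<notin> L"
proof -
  obtain K where "finite K" "unit_on K \<odot>\<^bsub>N\<^esub> x = x" using R.nu_unit[OF N x(1)] by blast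
  then show ?thesis using unit_on_rsing[OF N x(1) L] x(2) that by fastforce
qed

text \<open>Given consecutive members \<open>L\<close> and \<open>L'\<close> of a series, pick an
  element \<open>y\<close> of \<open>L'\<close> outside \<open>L\<close> that is concentrated at one
  simple object \<open>S\<close>. Adjoining its multiples to \<open>L\<close> gives a submodule
  strictly above \<open>L\<close> and inside \<open>L'\<close>, hence \<open>L'\<close>
  itself.\<close>

lemma fl_rep:
  assumes N: "nu_module R N" and "fl R N L"
  shows "rep N L"
  using assms(2)
proof induction
  case zero
  then show ?case using rep_zero[OF N] .
next
  case (step L L')
  note LD = R.nu_submodD[OF N rep_submod[OF N step.IH]] and L'D = R.nu_submodD[OF N step.hyps(2)]
  note ND = nu_moduleD[OF N]
  interpret N: abelian_group N using ND(1) .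
  obtain x where x: "x \<in> L'" "x \<notin> L" using step.hyps by blast
  have xN: "x \<in> carrier N" using x L'D by blast
  obtain S where S: "S \<in> J" "rsing S (Idt B S) \<odot>\<^bsub>N\<^esub> x \<notin> L"
    using exists_rsing_notin[OF N xN x(2) rep_submod[OF N step.IH]] .
  define y where "y = rsing S (Idt B S) \<odot>\<^bsub>N\<^esub> x"
  have rc: "rsing S (Idt B S) \<in> carrier R" using rsing_carrier S by simp
  have y: "y \<in> L'" "y \<notin> L" "y \<in> carrier N" using L'D(1,4) x S rc by (auto simp: y_def)
  have ey: "rsing S (Idt B S) \<odot>\<^bsub>N\<^esub> y = y"
    unfolding y_def using ND(5)[OF rc rc xN] rsing_mult(1)[OF S(1) id_in_hom rc] S(1) by (simp add: rsing_def)
  let ?L = "{h \<oplus>\<^bsub>N\<^esub> rsing S d \<odot>\<^bsub>N\<^esub> y | h d. h \<in> L \<and> d \<in> Hom B S S}"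
  have r: "rep N ?L" by (rule rep_step[OF N step.IH y(3) S(1) ey])
  have "L \<subseteq> ?L"
  proof
    fix h assume h: "h \<in> L"
    then have "h = h \<oplus>\<^bsub>N\<^esub> rsing S (Zer B S S) \<odot>\<^bsub>N\<^esub> y"
      using R.smult_zero(1)[OF N y(3)] LD(1) by (auto simp: rsing_zero)
    then show "h \<in> ?L" using h S zer_in_hom J_Ob by blast
  qed
  moreover have "y = \<zero>\<^bsub>N\<^esub> \<oplus>\<^bsub>N\<^esub> rsing S (Idt B S) \<odot>\<^bsub>N\<^esub> y" using ey y by simp
  then have "y \<in> ?L" using LD(2) S id_in_hom J_Ob by blast
  moreover have "?L \<subseteq> L'"
    using L'D(3,4) y rsing_carrier[OF S(1)] step.hyps(3) by blast
  ultimately have "?L = L'" using step.hyps(4)[OF rep_submod[OF N r]] y by blast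
  then show ?case using r by simp
qed

text \<open>Adjoining to a submodule of finite length the image of some \<open>H Y\<close> under a map that is linear
  modulo the submodule; the scalars of \<open>Z\<close> act on \<open>H Y\<close> through \<open>\<kappa>\<close>.\<close>

lemma fl_hom_image:
  fixes A :: "'r ring" and Z :: "('r, 'u) module"
  assumes A: "lu_ring A E" and Z: "nu_module A Z" and Y: "Y \<in> Ob B"
    and \<kappa>: "\<And>a. a \<in> carrier A \<Longrightarrow> \<kappa> a \<in> carrier R" "\<And>r. r \<in> carrier R \<Longrightarrow> \<exists>a \<in> carrier A. \<kappa> a = r"
    and L: "fl A Z L"
    and cl: "\<And>f. f \<in> carrier (H Y) \<Longrightarrow> \<psi> f \<in> carrier Z"
    and add: "\<And>f g. \<lbrakk>f \<in> carrier (H Y); g \<in> carrier (H Y)\<rbrakk> \<Longrightarrow> \<psi> (f \<oplus>\<^bsub>H Y\<^esub> g) = \<psi> f \<oplus>\<^bsub>Z\<^esub> \<psi> g"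
    and sm: "\<And>a f. \<lbrakk>a \<in> carrier A; f \<in> carrier (H Y)\<rbrakk> \<Longrightarrow> \<exists>h \<in> L. a \<odot>\<^bsub>Z\<^esub> \<psi> f = h \<oplus>\<^bsub>Z\<^esub> \<psi> (\<kappa> a \<odot>\<^bsub>H Y\<^esub> f)"
  shows "fl A Z {h \<oplus>\<^bsub>Z\<^esub> \<psi> f | h f. h \<in> L \<and> f \<in> carrier (H Y)}"
  using Y cl add sm
proof (induction Y arbitrary: \<psi> rule: ss_induct)
  case (zero W)
  interpret lu_ring A E by (rule A)
  interpret Z: abelian_group Z using nu_moduleD(1)[OF Z] .
  have W: "W \<in> Ob B" using zero by (simp add: zero_obj_def)
  note LD = nu_submodD[OF Z fl_submod[OF Z L]]
  have "\<psi> \<zero>\<^bsub>H W\<^esub> = \<zero>\<^bsub>Z\<^esub>" using additive_zero(1)[OF H_group[OF W] nu_moduleD(1)[OF Z], of \<psi>] zero.prems by simp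
  then have "{h \<oplus>\<^bsub>Z\<^esub> \<psi> f | h f. h \<in> L \<and> f \<in> carrier (H W)} = {h \<oplus>\<^bsub>Z\<^esub> \<zero>\<^bsub>Z\<^esub> | h. h \<in> L}"
    using H_zero_obj[OF zero.hyps] by auto
  also have "\<dots> = L" using LD(1) by force
  finally show ?case using L by simp
next
  case (step A1 S X i1 i2 p1 p2)
  interpret lu_ring A E by (rule A)
  interpret Z: abelian_group Z using nu_moduleD(1)[OF Z] .
  note D = biprodD[OF step.hyps(2)] and ZD = nu_moduleD[OF Z] and S = step.hyps(1)
  interpret HX: abelian_group "H X" by (rule H_group[OF D(3)])
  let ?L1 = "{h \<oplus>\<^bsub>Z\<^esub> \<psi> (hmap A1 X i1 f) | h f. h \<in> L \<and> f \<in> carrier (H A1)}"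
  let ?L2 = "{h \<oplus>\<^bsub>Z\<^esub> \<psi> f | h f. h \<in> L \<and> f \<in> carrier (H X)}"
  note LD = nu_submodD[OF Z fl_submod[OF Z L]]
  have L1: "fl A Z ?L1"
  proof (rule step.IH)
    fix a f assume a: "a \<in> carrier A" "f \<in> carrier (H A1)"
    then show "\<exists>h\<in>L. a \<odot>\<^bsub>Z\<^esub> \<psi> (hmap A1 X i1 f) = h \<oplus>\<^bsub>Z\<^esub> \<psi> (hmap A1 X i1 (\<kappa> a \<odot>\<^bsub>H A1\<^esub> f))"
      using step.prems(3)[OF a(1) hmap_closed[OF D(1,3,4) a(2)]] hmap_smult[OF D(1,3,4) \<kappa>(1)[OF a(1)] a(2)] by simp
  qed (use step.prems hmap_closed hmap_add D in auto)
  note L1D = nu_submodD[OF Z fl_submod[OF Z L1]]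
  have LL1: "L \<subseteq> ?L1"
  proof
    interpret HA: abelian_group "H A1" by (rule H_group[OF D(1)])
    fix h assume h: "h \<in> L"
    have "hmap A1 X i1 \<zero>\<^bsub>H A1\<^esub> = \<zero>\<^bsub>H X\<^esub>" using D by (auto simp: hmap_def H_ops intro!: restrict_ext)
    then have "\<psi> (hmap A1 X i1 \<zero>\<^bsub>H A1\<^esub>) = \<zero>\<^bsub>Z\<^esub>"
      using additive_zero(1)[OF H_group[OF D(3)] ZD(1), of \<psi>] step.prems by simp
    then have "h = h \<oplus>\<^bsub>Z\<^esub> \<psi> (hmap A1 X i1 \<zero>\<^bsub>H A1\<^esub>)" using h LD(1) by auto
    then show "h \<in> ?L1" using h HA.zero_closed by blast
  qed
  have L2: "nu_submod A Z ?L2"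
  proof (rule nu_submodI[OF Z])
    show "?L2 \<subseteq> carrier Z" using LD(1) step.prems(1) by auto
    have "\<psi> \<zero>\<^bsub>H X\<^esub> = \<zero>\<^bsub>Z\<^esub>" using additive_zero(1)[OF H_group[OF D(3)] ZD(1), of \<psi>] step.prems by simp
    then have "\<zero>\<^bsub>Z\<^esub> = \<zero>\<^bsub>Z\<^esub> \<oplus>\<^bsub>Z\<^esub> \<psi> \<zero>\<^bsub>H X\<^esub>" by simp
    then show "\<zero>\<^bsub>Z\<^esub> \<in> ?L2" using LD(2) HX.zero_closed by blast
    fix x y assume "x \<in> ?L2" "y \<in> ?L2"
    then obtain h f h' f' where xy: "x = h \<oplus>\<^bsub>Z\<^esub> \<psi> f" "y = h' \<oplus>\<^bsub>Z\<^esub> \<psi> f'" "h \<in> L" "h' \<in> L"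
      "f \<in> carrier (H X)" "f' \<in> carrier (H X)" by blast
    then have "x \<oplus>\<^bsub>Z\<^esub> y = (h \<oplus>\<^bsub>Z\<^esub> h') \<oplus>\<^bsub>Z\<^esub> \<psi> (f \<oplus>\<^bsub>H X\<^esub> f')"
      using step.prems(1,2) LD(1)[THEN subsetD] by (simp add: Z.a_ac)
    then show "x \<oplus>\<^bsub>Z\<^esub> y \<in> ?L2" using LD(3) xy HX.a_closed by blast
  next
    fix a x assume a: "a \<in> carrier A" and "x \<in> ?L2"
    then obtain h f where x: "x = h \<oplus>\<^bsub>Z\<^esub> \<psi> f" "h \<in> L" "f \<in> carrier (H X)" by blast
    obtain h' where h': "h' \<in> L" "a \<odot>\<^bsub>Z\<^esub> \<psi> f = h' \<oplus>\<^bsub>Z\<^esub> \<psi> (\<kappa> a \<odot>\<^bsub>H X\<^esub> f)" using step.prems(3) a x by blast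
    have rf: "\<kappa> a \<odot>\<^bsub>H X\<^esub> f \<in> carrier (H X)" using H_smult_closed D(3) \<kappa>(1) a x by blast
    have "a \<odot>\<^bsub>Z\<^esub> x = (a \<odot>\<^bsub>Z\<^esub> h \<oplus>\<^bsub>Z\<^esub> h') \<oplus>\<^bsub>Z\<^esub> \<psi> (\<kappa> a \<odot>\<^bsub>H X\<^esub> f)"
      using x h' ZD(4) ZD(2) a step.prems(1) LD(1)[THEN subsetD] rf by (simp add: Z.a_assoc)
    moreover have "a \<odot>\<^bsub>Z\<^esub> h \<oplus>\<^bsub>Z\<^esub> h' \<in> L" using LD(3,4) a x h' by blast
    ultimately show "a \<odot>\<^bsub>Z\<^esub> x \<in> ?L2" using rf by blast
  qed
  have dec: "\<exists>h1 \<in> ?L1. h \<oplus>\<^bsub>Z\<^esub> \<psi> f = h1 \<oplus>\<^bsub>Z\<^esub> \<psi> (hmap S X i2 (hmap X S p2 f))"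
    if h: "h \<in> L" and f: "f \<in> carrier (H X)" for h f
  proof -
    have c: "hmap X A1 p1 f \<in> carrier (H A1)" "hmap A1 X i1 (hmap X A1 p1 f) \<in> carrier (H X)"
      "hmap S X i2 (hmap X S p2 f) \<in> carrier (H X)" using hmap_closed D f by blast+
    have "\<psi> f = \<psi> (hmap A1 X i1 (hmap X A1 p1 f)) \<oplus>\<^bsub>Z\<^esub> \<psi> (hmap S X i2 (hmap X S p2 f))"
      using step.prems(2) c hmap_biprod[OF step.hyps(2) f] by metis
    then have "h \<oplus>\<^bsub>Z\<^esub> \<psi> f = (h \<oplus>\<^bsub>Z\<^esub> \<psi> (hmap A1 X i1 (hmap X A1 p1 f))) \<oplus>\<^bsub>Z\<^esub> \<psi> (hmap S X i2 (hmap X S p2 f))"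
      using step.prems(1) c h LD(1)[THEN subsetD] by (simp add: Z.a_assoc)
    then show ?thesis using h c by blast
  qed
  have L12: "?L1 \<subseteq> ?L2" using hmap_closed D by blast
  show ?case
  \<comment> \<open>Passing from \<open>?L1\<close> to \<open>?L2\<close> adds a quotient of the
    simple module \<open>H S\<close>: either nothing or one composition factor.\<close>
  proof (cases "?L1 = ?L2")
    case True
    then show ?thesis using L1 by simp
  next
    case False
    show ?thesis
    proof (rule fl.step[OF L1 L2])
      show "?L1 \<subset> ?L2" using L12 False by blast
      fix K assume K: "nu_submod A Z K" "?L1 \<subset> K" "K \<subset> ?L2"
      note KD = nu_submodD[OF Z K(1)]
      obtain z where z: "z \<in> K" "z \<notin> ?L1" using K by blast
      then obtain h f where hf: "z = h \<oplus>\<^bsub>Z\<^esub> \<psi> f" "h \<in> L" "f \<in> carrier (H X)" using K by blast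
      obtain h1 where h1: "h1 \<in> ?L1" "z = h1 \<oplus>\<^bsub>Z\<^esub> \<psi> (hmap S X i2 (hmap X S p2 f))" using dec hf by blast
      define g where "g = hmap X S p2 f"
      have g: "g \<in> carrier (H S)" "hmap S X i2 g \<in> carrier (H X)" using hmap_closed D hf by (auto simp: g_def)
      have gS: "g S \<in> Hom B S S" using g S D by (simp add: H_carrier)
      have h1Z: "h1 \<in> carrier Z" using h1 L1D(1) by blast
      have "g S \<noteq> Zer B S S"
      proof
        assume "g S = Zer B S S"
        then have "g S' = Zer B S' S" if "S' \<in> J" for S'
          using that J_hom_zero[of S' S "g S'"] S g(1) D(2) by (cases "S' = S") (auto simp: H_carrier)
        then have "hmap S X i2 g = \<zero>\<^bsub>H X\<^esub>"
          using D by (auto simp: hmap_def H_ops intro!: restrict_ext)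
        then have "z = h1" using h1 h1Z additive_zero(1)[OF H_group[OF D(3)] ZD(1), of \<psi>] step.prems
          by (simp add: g_def)
        then show False using z h1 by blast
      qed
      then obtain d where d: "d \<in> Hom B S S" "Cmp B S S S (g S) d = Idt B S" using J_inverse S gS by metis
      have gK: "\<psi> (hmap S X i2 g) \<in> K"
      proof -
        have "\<psi> (hmap S X i2 g) = z \<oplus>\<^bsub>Z\<^esub> (\<ominus>\<^bsub>Z\<^esub> h1)"
          unfolding h1(2) g_def[symmetric] Z.a_comm[OF h1Z step.prems(1)[OF g(2)]]
          using h1Z step.prems(1)[OF g(2)] by (simp add: Z.a_assoc Z.r_neg)
        then show ?thesis using KD(3)[OF z(1) KD(5)[OF subsetD[OF psubset_imp_subset[OF K(2)] h1(1)]]] by simp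
      qed
      have "?L2 \<subseteq> K"
      proof
        fix w assume "w \<in> ?L2"
        then obtain h' f' where w: "w = h' \<oplus>\<^bsub>Z\<^esub> \<psi> f'" "h' \<in> L" "f' \<in> carrier (H X)" by blast
        obtain h2 where h2: "h2 \<in> ?L1" "w = h2 \<oplus>\<^bsub>Z\<^esub> \<psi> (hmap S X i2 (hmap X S p2 f'))" using dec w by blast
        define g' where "g' = hmap X S p2 f'"
        have g': "g' \<in> carrier (H S)" "hmap S X i2 g' \<in> carrier (H X)" using hmap_closed D w by (auto simp: g'_def)
        have g'S: "g' S \<in> Hom B S S" using g' S D by (simp add: H_carrier)
        \<comment> \<open>Since \<open>d\<close> is inverse to \<open>g S\<close> from the right,
          the scalar \<open>rsing S ?d\<close> carries \<open>g\<close> to \<open>g'\<close>. A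
          scalar \<open>a\<close> over it therefore moves the known element of \<open>K\<close> to
          any other one, up to \<open>L\<close>.\<close>
        let ?d = "Cmp B S S S d (g' S)"
        obtain a where a: "a \<in> carrier A" "\<kappa> a = rsing S ?d" using \<kappa>(2) rsing_carrier S d g'S D by (meson cmp_in_hom)
        have "rsing S ?d \<odot>\<^bsub>H S\<^esub> g = sing S S (Cmp B S S S (g S) ?d)"
          by (rule rsing_smult) (use S D d g'S g in auto)
        also have "Cmp B S S S (g S) ?d = g' S" using D d g'S gS by (simp add: cmp_assoc)
        finally have "\<kappa> a \<odot>\<^bsub>H S\<^esub> g = g'" using a H_simple[OF S g'(1)] by simp
        then have "\<kappa> a \<odot>\<^bsub>H X\<^esub> hmap S X i2 g = hmap S X i2 g'"
          using hmap_smult[OF D(2,3,5) \<kappa>(1)[OF a(1)] g(1)] by simp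
        then obtain h3 where h3: "h3 \<in> L" "a \<odot>\<^bsub>Z\<^esub> \<psi> (hmap S X i2 g) = h3 \<oplus>\<^bsub>Z\<^esub> \<psi> (hmap S X i2 g')"
          using step.prems(3)[OF a(1) g(2)] by auto
        have "\<psi> (hmap S X i2 g') = (\<ominus>\<^bsub>Z\<^esub> h3) \<oplus>\<^bsub>Z\<^esub> a \<odot>\<^bsub>Z\<^esub> \<psi> (hmap S X i2 g)"
          unfolding h3(2) using h3(1) LD(1) step.prems(1)[OF g'(2)] by (simp add: subset_iff Z.a_assoc[symmetric] Z.l_neg)
        moreover have "\<ominus>\<^bsub>Z\<^esub> h3 \<in> K"
          by (rule KD(5)[OF subsetD[OF psubset_imp_subset[OF K(2)] subsetD[OF LL1 h3(1)]]])
        ultimately have "\<psi> (hmap S X i2 g') \<in> K" using KD(3,4) a gK by simp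
        then show "w \<in> K" unfolding h2(2) g'_def[symmetric]
          by (rule KD(3)[OF subsetD[OF psubset_imp_subset[OF K(2)] h2(1)]])
      qed
      then show False using K by blast
    qed
  qed
qed

lemma infinite_prod_lepoll:
  assumes "infinite (UNIV :: 'u set)" "A \<lesssim> (UNIV :: 'u set)" "A' \<lesssim> (UNIV :: 'u set)"
  shows "A \<times> A' \<lesssim> (UNIV :: 'u set)"
proof -
  have "A \<times> A' \<lesssim> (UNIV :: 'u set) \<times> (UNIV :: 'u set)" using assms(2,3) by (rule times_lepoll_mono)
  also have "\<dots> \<approx> (UNIV :: 'u set)"
    using card_of_Times_same_infinite[OF assms(1)] by (simp add: eqpoll_iff_card_of_ordIso)
  finally show ?thesis .
qed

text \<open>Along \<open>ss_induct\<close> the set embeds into a finite product of Hom-sets. The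
  bound makes it possible to copy \<open>H Y\<close> into the type \<open>'u\<close>.\<close>

lemma H_lepoll:
  assumes inf: "infinite (UNIV :: 'u set)" and Y: "Y \<in> Ob B"
    and hom: "\<And>A A'. \<lbrakk>A \<in> Ob B; A' \<in> Ob B\<rbrakk> \<Longrightarrow> Hom B A A' \<lesssim> (UNIV :: 'u set)"
  shows "carrier (H Y) \<lesssim> (UNIV :: 'u set)"
  using Y
proof (induction Y rule: ss_induct)
  case (zero Z)
  then show ?case using H_zero_obj by (simp add: finite_lepoll_infinite inf)
next
  case (step A S X i1 i2 p1 p2)
  note D = biprodD[OF step.hyps(2)]
  define k where "k f = (hmap X A p1 f, Cmp B S X S p2 (f S))" for f
  have "inj_on k (carrier (H X))"
  proof (rule inj_onI)
    fix f g assume fg: "f \<in> carrier (H X)" "g \<in> carrier (H X)" "k f = k g"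
    then have "hmap X A p1 f = hmap X A p1 g" "hmap X S p2 f S = hmap X S p2 g S"
      using step.hyps by (auto simp: k_def hmap_def)
    moreover have "hmap X S p2 f = sing S S (hmap X S p2 f S)" "hmap X S p2 g = sing S S (hmap X S p2 g S)"
      using H_simple step.hyps hmap_closed D fg by blast+
    ultimately show "f = g" using hmap_biprod[OF step.hyps(2)] fg by metis
  qed
  moreover have "k ` carrier (H X) \<subseteq> carrier (H A) \<times> Hom B S S"
    using hmap_closed[of X A p1] D step.hyps by (auto simp: k_def H_carrier)
  ultimately have "carrier (H X) \<lesssim> carrier (H A) \<times> Hom B S S" unfolding lepoll_def by blast
  then show ?case using infinite_prod_lepoll[OF inf step.IH hom[OF D(2,2)]] lepoll_trans by blast
qed

end

section \<open>The triangular matrix ring and the modules of triples\<close>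

lemma additive_finsum:
  assumes N: "abelian_group N" and N': "abelian_group N'"
    and cl: "\<And>x. x \<in> carrier N \<Longrightarrow> h x \<in> carrier N'"
    and add: "\<And>x y. \<lbrakk>x \<in> carrier N; y \<in> carrier N\<rbrakk> \<Longrightarrow> h (x \<oplus>\<^bsub>N\<^esub> y) = h x \<oplus>\<^bsub>N'\<^esub> h y"
    and K: "finite K" "\<And>i. i \<in> K \<Longrightarrow> f i \<in> carrier N"
  shows "h (finsum N f K) = finsum N' (\<lambda>i. h (f i)) K"
proof -
  interpret N: abelian_group N by (rule N)
  interpret N': abelian_group N' by (rule N')
  show ?thesis using K
  proof (induction K)
    case empty
    then show ?case using additive_zero(1)[OF N N' cl add] by simp
  next
    case (insert i K)
    then have "f \<in> K \<rightarrow> carrier N" "(\<lambda>i. h (f i)) \<in> K \<rightarrow> carrier N'" "f i \<in> carrier N" using cl by auto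
    then show ?case using insert add cl N.finsum_closed by simp
  qed
qed

text \<open>\<open>A\<close> and \<open>B\<close> stand for the categories \<open>\<X>\<close> and
  \<open>\<Y>\<close> of the theorem, \<open>D\<close> for the larger semi-simple category. The last
  two assumptions bound the modules of triples so that they fit into \<open>'u\<close>.\<close>

locale triple_modules = triple_data B D F P + B: fin_ss B J + A: fin_ss A I
  for B D A :: "('o, 'm) precat" and F P J I +
  fixes \<Phi> :: "('o, 'm, ('o \<Rightarrow> 'm, 'u) module, 'u \<Rightarrow> 'u) functr"
  assumes A_sub: "is_full_subcat A D" and A_serre: "serre_subcat D (Ob A)"
    and Phi: "extends_simples_hom A D I \<Phi>"
    and inf: "infinite (UNIV :: 'u set)"
    and hom_small: "\<lbrakk>Y \<in> Ob B; Y' \<in> Ob B\<rbrakk> \<Longrightarrow> Hom B Y Y' \<lesssim> (UNIV :: 'u set)"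
begin

abbreviation PhO :: "'o \<Rightarrow> ('o \<Rightarrow> 'm, 'u) module" where "PhO \<equiv> fob \<Phi>"
abbreviation FO :: "'o \<Rightarrow> 'o" where "FO \<equiv> fob F"

sublocale Phi: abelian_equivalence D "mod_cat A.R (semisimple_mod A.R)" \<Phi>
  using Phi A.R.mod_cat_preadditive D.preadditive_cat_axioms D.abelian_axioms
  by (auto simp: extends_simples_hom_def abelian_equivalence_def additive_equivalence_def additive_equivalence_axioms_def)

lemma PhO_semisimple: "X \<in> Ob D \<Longrightarrow> semisimple_mod A.R (PhO X)"
  using Phi.ob by simp

lemma PhO_module [simp]: "X \<in> Ob D \<Longrightarrow> nu_module A.R (PhO X)"
  using Phi.ob by simp

lemma PhO_group [simp]: "X \<in> Ob D \<Longrightarrow> abelian_group (PhO X)"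
  using nu_moduleD(1) PhO_module by blast

lemma PhM: "\<lbrakk>X \<in> Ob D; X' \<in> Ob D; u \<in> Hom D X X'\<rbrakk> \<Longrightarrow> fmp \<Phi> X X' u \<in> mod_homs A.R (PhO X) (PhO X')"
  using Phi.hom by simp

lemmas PhM_closed [simp] = mod_homsD(1)[OF PhM]
  and PhM_add = mod_homsD(2)[OF PhM] and PhM_smult = mod_homsD(3)[OF PhM] and PhM_ext = mod_homsD(4)[OF PhM]

lemma PhM_id [simp]: "\<lbrakk>X \<in> Ob D; x \<in> carrier (PhO X)\<rbrakk> \<Longrightarrow> fmp \<Phi> X X (Idt D X) x = x"
  by simp

lemma PhM_cmp:
  "\<lbrakk>X \<in> Ob D; X' \<in> Ob D; X'' \<in> Ob D; u \<in> Hom D X X'; v \<in> Hom D X' X''; x \<in> carrier (PhO X)\<rbrakk> \<Longrightarrow>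
    fmp \<Phi> X X'' (Cmp D X X' X'' v u) x = fmp \<Phi> X' X'' v (fmp \<Phi> X X' u x)"
  by (simp add: Phi.cmp compose_def)

lemma PhM_sum:
  "\<lbrakk>X \<in> Ob D; X' \<in> Ob D; u \<in> Hom D X X'; v \<in> Hom D X X'; x \<in> carrier (PhO X)\<rbrakk> \<Longrightarrow>
    fmp \<Phi> X X' (Add D X X' u v) x = fmp \<Phi> X X' u x \<oplus>\<^bsub>PhO X'\<^esub> fmp \<Phi> X X' v x"
  by (simp add: Phi.add)

lemma PhM_zer:
  "\<lbrakk>X \<in> Ob D; X' \<in> Ob D; x \<in> carrier (PhO X)\<rbrakk> \<Longrightarrow> fmp \<Phi> X X' (Zer D X X') x = \<zero>\<^bsub>PhO X'\<^esub>"
  by (simp add: Phi.zer)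

lemma PhM_zero:
  "\<lbrakk>X \<in> Ob D; X' \<in> Ob D; u \<in> Hom D X X'\<rbrakk> \<Longrightarrow> fmp \<Phi> X X' u \<zero>\<^bsub>PhO X\<^esub> = \<zero>\<^bsub>PhO X'\<^esub>"
  using mod_homs_zero(1) PhM PhO_group by blast

lemma PhM_eqI:
  assumes "X \<in> Ob D" "X' \<in> Ob D" "u \<in> Hom D X X'" "v \<in> Hom D X X'"
    and "\<And>x. x \<in> carrier (PhO X) \<Longrightarrow> fmp \<Phi> X X' u x = fmp \<Phi> X X' v x"
  shows "u = v"
  by (rule Phi.faithful) (use assms PhM_ext in \<open>auto intro!: extensionalityI\<close>)

lemma PhO_zero_closed [simp]: "X \<in> Ob D \<Longrightarrow> \<zero>\<^bsub>PhO X\<^esub> \<in> carrier (PhO X)"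
  by (rule abelian_groupE(2)[OF PhO_group])

lemma PhO_add_closed [simp]:
  "\<lbrakk>X \<in> Ob D; x \<in> carrier (PhO X); y \<in> carrier (PhO X)\<rbrakk> \<Longrightarrow> x \<oplus>\<^bsub>PhO X\<^esub> y \<in> carrier (PhO X)"
  by (rule abelian_groupE(1)[OF PhO_group])

lemma PhO_smult_closed [simp]:
  "\<lbrakk>X \<in> Ob D; s \<in> carrier A.R; y \<in> carrier (PhO X)\<rbrakk> \<Longrightarrow> s \<odot>\<^bsub>PhO X\<^esub> y \<in> carrier (PhO X)"
  by (rule nu_moduleD(2)[OF PhO_module])

definition FP :: "'o \<Rightarrow> 'o \<Rightarrow> 'm \<Rightarrow> 'u \<Rightarrow> 'u" where
  "FP Y Y' v = fmp \<Phi> (FO Y) (FO Y') (fmp F Y Y' v)"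

lemma FP_closed [simp]:
  "\<lbrakk>Y \<in> Ob B; Y' \<in> Ob B; v \<in> Hom B Y Y'; z \<in> carrier (PhO (FO Y))\<rbrakk> \<Longrightarrow> FP Y Y' v z \<in> carrier (PhO (FO Y'))"
  by (simp add: FP_def)

lemma FP_add:
  "\<lbrakk>Y \<in> Ob B; Y' \<in> Ob B; v \<in> Hom B Y Y'; z \<in> carrier (PhO (FO Y)); z' \<in> carrier (PhO (FO Y))\<rbrakk> \<Longrightarrow>
    FP Y Y' v (z \<oplus>\<^bsub>PhO (FO Y)\<^esub> z') = FP Y Y' v z \<oplus>\<^bsub>PhO (FO Y')\<^esub> FP Y Y' v z'"
  by (simp add: FP_def PhM_add)

lemma FP_smult:
  "\<lbrakk>Y \<in> Ob B; Y' \<in> Ob B; v \<in> Hom B Y Y'; s \<in> carrier A.R; z \<in> carrier (PhO (FO Y))\<rbrakk> \<Longrightarrow>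
    FP Y Y' v (s \<odot>\<^bsub>PhO (FO Y)\<^esub> z) = s \<odot>\<^bsub>PhO (FO Y')\<^esub> FP Y Y' v z"
  by (simp add: FP_def PhM_smult)

lemma FP_cmp:
  "\<lbrakk>Y \<in> Ob B; Y' \<in> Ob B; Y'' \<in> Ob B; v \<in> Hom B Y Y'; w \<in> Hom B Y' Y''; z \<in> carrier (PhO (FO Y))\<rbrakk> \<Longrightarrow>
    FP Y Y'' (Cmp B Y Y' Y'' w v) z = FP Y' Y'' w (FP Y Y' v z)"
  by (simp add: FP_def F_cmp PhM_cmp)

lemma FP_sum:
  "\<lbrakk>Y \<in> Ob B; Y' \<in> Ob B; v \<in> Hom B Y Y'; w \<in> Hom B Y Y'; z \<in> carrier (PhO (FO Y))\<rbrakk> \<Longrightarrow>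
    FP Y Y' (Add B Y Y' v w) z = FP Y Y' v z \<oplus>\<^bsub>PhO (FO Y')\<^esub> FP Y Y' w z"
  by (simp add: FP_def F_add PhM_sum)

lemma FP_id [simp]: "\<lbrakk>Y \<in> Ob B; z \<in> carrier (PhO (FO Y))\<rbrakk> \<Longrightarrow> FP Y Y (Idt B Y) z = z"
  by (simp add: FP_def)

lemma FP_zer [simp]:
  "\<lbrakk>Y \<in> Ob B; Y' \<in> Ob B; z \<in> carrier (PhO (FO Y))\<rbrakk> \<Longrightarrow> FP Y Y' (Zer B Y Y') z = \<zero>\<^bsub>PhO (FO Y')\<^esub>"
  by (simp add: FP_def PhM_zer)

lemma FP_zero [simp]:
  "\<lbrakk>Y \<in> Ob B; Y' \<in> Ob B; v \<in> Hom B Y Y'\<rbrakk> \<Longrightarrow> FP Y Y' v \<zero>\<^bsub>PhO (FO Y)\<^esub> = \<zero>\<^bsub>PhO (FO Y')\<^esub>"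
  by (simp add: FP_def PhM_zero)

section \<open>The bimodule \<open>M\<close> and its pairing with \<open>H Y\<close>\<close>

abbreviation M where "M \<equiv> simples_bimod J F \<Phi> :: ('o \<Rightarrow> 'm, 'o \<Rightarrow> 'u) module"
abbreviation ra where "ra \<equiv> simples_bimod_right J F \<Phi>"

lemma M_carrier:
  "m \<in> carrier M \<longleftrightarrow> m \<in> extensional J \<and> (\<forall>S\<in>J. m S \<in> carrier (PhO (FO S))) \<and>
    finite {S \<in> J. m S \<noteq> \<zero>\<^bsub>PhO (FO S)\<^esub>}"
proof -
  have "\<And>S. S \<in> J \<Longrightarrow> Group.group (add_monoid (PhO (FO S)))"
    using PhO_group abelian_group.a_group by (metis B.J_Ob F_ob)
  then show ?thesis unfolding simples_bimod_def by (simp add: carrier_sum_group PiE_iff) blast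
qed

lemma M_ops:
  "\<zero>\<^bsub>M\<^esub> = (\<lambda>S\<in>J. \<zero>\<^bsub>PhO (FO S)\<^esub>)" "m \<oplus>\<^bsub>M\<^esub> m' = (\<lambda>S\<in>J. m S \<oplus>\<^bsub>PhO (FO S)\<^esub> m' S)"
  "s \<odot>\<^bsub>M\<^esub> m = (\<lambda>S\<in>J. s \<odot>\<^bsub>PhO (FO S)\<^esub> m S)" "ra m r = (\<lambda>S\<in>J. FP S S (r S) (m S))"
  by (simp_all add: simples_bimod_def simples_bimod_right_def FP_def)

lemma M_group: "abelian_group M"
proof (rule abelian_group_sum_group[of J "\<lambda>S. add_monoid (PhO (FO S))"])
  show "\<And>S. S \<in> J \<Longrightarrow> comm_group (add_monoid (PhO (FO S)))"
    using PhO_group abelian_group.a_comm_group by (metis B.J_Ob F_ob)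
qed (auto simp: simples_bimod_def)

lemma M_smult_closed:
  assumes "s \<in> carrier A.R" "m \<in> carrier M"
  shows "s \<odot>\<^bsub>M\<^esub> m \<in> carrier M"
  using assms B.finite_supp_add[of m "\<lambda>S. \<zero>\<^bsub>PhO (FO S)\<^esub>" m "s \<odot>\<^bsub>M\<^esub> m"] A.R.smult_zero(2)[OF PhO_module]
  by (auto simp: M_carrier M_ops)

lemma ra_closed:
  assumes "r \<in> carrier B.R" "m \<in> carrier M"
  shows "ra m r \<in> carrier M"
  using assms B.finite_supp_add[of m "\<lambda>S. \<zero>\<^bsub>PhO (FO S)\<^esub>" m "ra m r"]
  by (auto simp: M_carrier M_ops B.R_carrier)

lemma unit_on_mono:
  assumes "nu_module A.R N" "x \<in> carrier N" "finite K" "finite K'" "K \<subseteq> K'" "A.unit_on K \<odot>\<^bsub>N\<^esub> x = x"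
  shows "A.unit_on K' \<odot>\<^bsub>N\<^esub> x = x"
proof -
  have "A.unit_on K' \<otimes>\<^bsub>A.R\<^esub> A.unit_on K = A.unit_on K"
    by (rule A.unit_on_mult) (use assms A.unit_on_carrier in \<open>auto simp: A.unit_on_def split: if_splits\<close>)
  then show ?thesis using nu_moduleD(5)[OF assms(1) A.unit_on_carrier A.unit_on_carrier assms(2), of K' K] assms by simp
qed

lemma M_unit:
  assumes m: "m \<in> carrier M"
  obtains K where "finite K" "A.unit_on K \<odot>\<^bsub>M\<^esub> m = m"
proof -
  let ?S = "{S \<in> J. m S \<noteq> \<zero>\<^bsub>PhO (FO S)\<^esub>}"
  have fin: "finite ?S" using m by (simp add: M_carrier)
  have "\<exists>K. finite K \<and> A.unit_on K \<odot>\<^bsub>PhO (FO S)\<^esub> m S = m S" if "S \<in> J" for S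
    using A.R.nu_unit[OF PhO_module, of "FO S" "m S"] that m by (auto simp: M_carrier)
  then obtain K where K: "\<And>S. S \<in> J \<Longrightarrow> finite (K S) \<and> A.unit_on (K S) \<odot>\<^bsub>PhO (FO S)\<^esub> m S = m S" by metis
  let ?K = "\<Union>S\<in>?S. K S"
  have fK: "finite ?K" using fin K by auto
  have "A.unit_on ?K \<odot>\<^bsub>PhO (FO S)\<^esub> m S = m S" if S: "S \<in> J" for S
  proof (cases "m S = \<zero>\<^bsub>PhO (FO S)\<^esub>")
    case True
    then show ?thesis using A.R.smult_zero(2)[OF PhO_module A.unit_on_carrier[OF fK]] S by simp
  next
    case False
    then show ?thesis using unit_on_mono[OF PhO_module, of "FO S" "m S" "K S" ?K] S m K[OF S] fK by (auto simp: M_carrier)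
  qed
  then have "A.unit_on ?K \<odot>\<^bsub>M\<^esub> m = m" using m
    by (intro ext) (auto simp: M_ops M_carrier extensional_def)
  then show ?thesis using that fK by blast
qed

lemma M_module: "nu_module A.R M"
proof (rule nu_moduleI[OF M_group M_smult_closed])
  fix m assume "m \<in> carrier M"
  then show "\<exists>a\<in>carrier A.R. a \<odot>\<^bsub>M\<^esub> m = m" using M_unit A.unit_on_carrier by metis
qed (auto simp: M_ops M_carrier nu_moduleD(3,4,5)[OF PhO_module] intro!: restrict_ext)

interpretation M: abelian_group M by (rule M_group)

definition msing :: "'o \<Rightarrow> 'u \<Rightarrow> 'o \<Rightarrow> 'u" where
  "msing S z = (\<lambda>S'\<in>J. if S' = S then z else \<zero>\<^bsub>PhO (FO S')\<^esub>)"

lemma msing_closed: "\<lbrakk>S \<in> J; z \<in> carrier (PhO (FO S))\<rbrakk> \<Longrightarrow> msing S z \<in> carrier M"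
  by (auto simp: M_carrier msing_def intro: finite_subset[of _ "{S}"])

lemma msing_add:
  "\<lbrakk>S \<in> J; z \<in> carrier (PhO (FO S)); z' \<in> carrier (PhO (FO S))\<rbrakk> \<Longrightarrow>
    msing S (z \<oplus>\<^bsub>PhO (FO S)\<^esub> z') = msing S z \<oplus>\<^bsub>M\<^esub> msing S z'"
  using abelian_monoid.l_zero[OF abelian_group.axioms(1)[OF PhO_group]]
  by (auto simp: M_ops msing_def intro!: restrict_ext)

lemma msing_smult:
  "\<lbrakk>S \<in> J; s \<in> carrier A.R; z \<in> carrier (PhO (FO S))\<rbrakk> \<Longrightarrow> msing S (s \<odot>\<^bsub>PhO (FO S)\<^esub> z) = s \<odot>\<^bsub>M\<^esub> msing S z"
  using A.R.smult_zero(2)[OF PhO_module] by (auto simp: M_ops msing_def intro!: restrict_ext)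

lemma ra_rsing:
  "\<lbrakk>S \<in> J; d \<in> Hom B S S; m \<in> carrier M\<rbrakk> \<Longrightarrow> ra m (B.rsing S d) = msing S (FP S S d (m S))"
  by (auto simp: M_ops M_carrier msing_def B.rsing_def intro!: restrict_ext)

text \<open>Every element of \<open>M\<close> is a finite sum of elements \<open>msing S z\<close>;
  the induction removes one point of its support at a time.\<close>

lemma M_additive_ext:
  assumes G: "abelian_group G"
    and "\<And>m. m \<in> carrier M \<Longrightarrow> a m \<in> carrier G" "\<And>m. m \<in> carrier M \<Longrightarrow> b m \<in> carrier G"
    and "\<And>m m'. \<lbrakk>m \<in> carrier M; m' \<in> carrier M\<rbrakk> \<Longrightarrow> a (m \<oplus>\<^bsub>M\<^esub> m') = a m \<oplus>\<^bsub>G\<^esub> a m'"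
    and "\<And>m m'. \<lbrakk>m \<in> carrier M; m' \<in> carrier M\<rbrakk> \<Longrightarrow> b (m \<oplus>\<^bsub>M\<^esub> m') = b m \<oplus>\<^bsub>G\<^esub> b m'"
    and ab: "\<And>S z. \<lbrakk>S \<in> J; z \<in> carrier (PhO (FO S))\<rbrakk> \<Longrightarrow> a (msing S z) = b (msing S z)"
    and m: "m \<in> carrier M"
  shows "a m = b m"
proof -
  have "a m = b m" if "finite K" "m \<in> carrier M" "\<forall>S\<in>J - K. m S = \<zero>\<^bsub>PhO (FO S)\<^esub>" for K m
    using that
  proof (induction K arbitrary: m)
    case empty
    then have "m = \<zero>\<^bsub>M\<^esub>" by (intro ext) (auto simp: M_carrier M_ops extensional_def)
    then show ?case using additive_zero(1)[OF M_group G, of a] additive_zero(1)[OF M_group G, of b] assms by metis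
  next
    case (insert S K)
    show ?case
    proof (cases "S \<in> J")
      case False
      then show ?thesis using insert by blast
    next
      case True
      have mS: "m S \<in> carrier (PhO (FO S))" using True insert.prems by (simp add: M_carrier)
      define n where "n = (\<lambda>S'\<in>J. if S' = S then \<zero>\<^bsub>PhO (FO S')\<^esub> else m S')"
      have n: "n \<in> carrier M"
        using insert.prems(1) by (auto simp: M_carrier n_def elim!: rev_finite_subset)
      have "m = msing S (m S) \<oplus>\<^bsub>M\<^esub> n"
        using insert.prems abelian_monoid.l_zero[OF abelian_group.axioms(1)[OF PhO_group]]
          abelian_monoid.r_zero[OF abelian_group.axioms(1)[OF PhO_group]]
        by (intro ext) (auto simp: M_carrier M_ops msing_def n_def extensional_def)
      moreover have "a n = b n" by (rule insert.IH[OF n]) (use insert.prems in \<open>auto simp: n_def\<close>)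
      ultimately show ?thesis using assms(4,5) ab[OF True mS] msing_closed[OF True mS] n by metis
    qed
  qed
  moreover have "finite {S \<in> J. m S \<noteq> \<zero>\<^bsub>PhO (FO S)\<^esub>}" using m by (simp add: M_carrier)
  ultimately show ?thesis using m by blast
qed

text \<open>\<open>\<mu> Y\<close> is the canonical isomorphism from the tensor product of \<open>M\<close> and \<open>H Y\<close> over \<open>R\<close> to
  \<open>\<Phi> (F Y)\<close>.\<close>

definition \<mu> :: "'o \<Rightarrow> ('o \<Rightarrow> 'u) \<Rightarrow> ('o \<Rightarrow> 'm) \<Rightarrow> 'u" where
  "\<mu> Y m f = finsum (PhO (FO Y)) (\<lambda>S. FP S Y (f S) (m S)) {S \<in> J. m S \<noteq> \<zero>\<^bsub>PhO (FO S)\<^esub>}"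

text \<open>Allows the sum to be taken over any finite set that contains the support, so that the
  pairings of two elements of \<open>M\<close> can be compared over a common index set.\<close>

lemma \<mu>_eq:
  assumes Y: "Y \<in> Ob B" and m: "m \<in> carrier M" and f: "f \<in> carrier (B.H Y)"
    and K: "finite K" "K \<subseteq> J" "\<And>S. S \<in> J - K \<Longrightarrow> m S = \<zero>\<^bsub>PhO (FO S)\<^esub>"
  shows "\<mu> Y m f = finsum (PhO (FO Y)) (\<lambda>S. FP S Y (f S) (m S)) K"
proof -
  interpret Y: abelian_group "PhO (FO Y)" using PhO_group Y by simp
  show ?thesis unfolding \<mu>_def
    by (rule Y.add.finprod_mono_neutral_cong_left)
      (use assms in \<open>auto simp: M_carrier B.H_carrier subset_iff\<close>)
qed

lemma terms_closed:
  "\<lbrakk>Y \<in> Ob B; m \<in> carrier M; f \<in> carrier (B.H Y); S \<in> J\<rbrakk> \<Longrightarrow> FP S Y (f S) (m S) \<in> carrier (PhO (FO Y))"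
  by (simp add: M_carrier B.H_carrier)

lemma finite_supp: "m \<in> carrier M \<Longrightarrow> finite {S \<in> J. m S \<noteq> \<zero>\<^bsub>PhO (FO S)\<^esub>}"
  by (simp add: M_carrier)

lemma \<mu>_closed [simp]:
  assumes "Y \<in> Ob B" "m \<in> carrier M" "f \<in> carrier (B.H Y)"
  shows "\<mu> Y m f \<in> carrier (PhO (FO Y))"
proof -
  interpret Y: abelian_group "PhO (FO Y)" using PhO_group assms by simp
  show ?thesis unfolding \<mu>_def by (rule Y.finsum_closed) (use terms_closed assms in auto)
qed

lemma \<mu>_add_left:
  assumes Y: "Y \<in> Ob B" and m: "m \<in> carrier M" "m' \<in> carrier M" and f: "f \<in> carrier (B.H Y)"
  shows "\<mu> Y (m \<oplus>\<^bsub>M\<^esub> m') f = \<mu> Y m f \<oplus>\<^bsub>PhO (FO Y)\<^esub> \<mu> Y m' f"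
proof -
  interpret Y: abelian_group "PhO (FO Y)" using PhO_group Y by simp
  let ?K = "{S \<in> J. m S \<noteq> \<zero>\<^bsub>PhO (FO S)\<^esub>} \<union> {S \<in> J. m' S \<noteq> \<zero>\<^bsub>PhO (FO S)\<^esub>}"
  have K: "finite ?K" "?K \<subseteq> J" using finite_supp m by auto
  have "\<mu> Y (m \<oplus>\<^bsub>M\<^esub> m') f = finsum (PhO (FO Y)) (\<lambda>S. FP S Y (f S) ((m \<oplus>\<^bsub>M\<^esub> m') S)) ?K"
    by (rule \<mu>_eq[OF Y M.a_closed[OF m] f K])
      (use abelian_monoid.l_zero[OF abelian_group.axioms(1)[OF PhO_group]] in \<open>auto simp: M_ops\<close>)
  also have "\<dots> = finsum (PhO (FO Y)) (\<lambda>S. FP S Y (f S) (m S) \<oplus>\<^bsub>PhO (FO Y)\<^esub> FP S Y (f S) (m' S)) ?K"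
    by (rule Y.finsum_cong') (use m f Y terms_closed in \<open>auto simp: M_ops FP_add M_carrier B.H_carrier\<close>)
  also have "\<dots> = finsum (PhO (FO Y)) (\<lambda>S. FP S Y (f S) (m S)) ?K \<oplus>\<^bsub>PhO (FO Y)\<^esub>
      finsum (PhO (FO Y)) (\<lambda>S. FP S Y (f S) (m' S)) ?K"
    by (rule Y.finsum_addf) (use m f Y terms_closed in auto)
  also have "\<dots> = \<mu> Y m f \<oplus>\<^bsub>PhO (FO Y)\<^esub> \<mu> Y m' f"
    using \<mu>_eq[OF Y m(1) f K] \<mu>_eq[OF Y m(2) f K] by auto
  finally show ?thesis .
qed

lemma \<mu>_add_right:
  assumes Y: "Y \<in> Ob B" and m: "m \<in> carrier M" and f: "f \<in> carrier (B.H Y)" "g \<in> carrier (B.H Y)"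
  shows "\<mu> Y m (f \<oplus>\<^bsub>B.H Y\<^esub> g) = \<mu> Y m f \<oplus>\<^bsub>PhO (FO Y)\<^esub> \<mu> Y m g"
proof -
  interpret Y: abelian_group "PhO (FO Y)" using PhO_group Y by simp
  have "\<mu> Y m (f \<oplus>\<^bsub>B.H Y\<^esub> g) = finsum (PhO (FO Y)) (\<lambda>S. FP S Y (f S) (m S) \<oplus>\<^bsub>PhO (FO Y)\<^esub> FP S Y (g S) (m S))
      {S \<in> J. m S \<noteq> \<zero>\<^bsub>PhO (FO S)\<^esub>}"
    unfolding \<mu>_def by (rule Y.finsum_cong') (use m f Y terms_closed in \<open>auto simp: B.H_ops FP_sum M_carrier B.H_carrier\<close>)
  also have "\<dots> = \<mu> Y m f \<oplus>\<^bsub>PhO (FO Y)\<^esub> \<mu> Y m g"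
    unfolding \<mu>_def by (rule Y.finsum_addf) (use m f Y terms_closed in auto)
  finally show ?thesis .
qed

lemma \<mu>_smult:
  assumes Y: "Y \<in> Ob B" and m: "m \<in> carrier M" and f: "f \<in> carrier (B.H Y)" and s: "s \<in> carrier A.R"
  shows "\<mu> Y (s \<odot>\<^bsub>M\<^esub> m) f = s \<odot>\<^bsub>PhO (FO Y)\<^esub> \<mu> Y m f"
proof -
  interpret Y: abelian_group "PhO (FO Y)" using PhO_group Y by simp
  let ?K = "{S \<in> J. m S \<noteq> \<zero>\<^bsub>PhO (FO S)\<^esub>}"
  have "\<mu> Y (s \<odot>\<^bsub>M\<^esub> m) f = finsum (PhO (FO Y)) (\<lambda>S. FP S Y (f S) ((s \<odot>\<^bsub>M\<^esub> m) S)) ?K"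
    by (rule \<mu>_eq[OF Y M_smult_closed[OF s m] f finite_supp[OF m]])
      (use s A.R.smult_zero(2)[OF PhO_module] in \<open>auto simp: M_ops\<close>)
  also have "\<dots> = finsum (PhO (FO Y)) (\<lambda>S. s \<odot>\<^bsub>PhO (FO Y)\<^esub> FP S Y (f S) (m S)) ?K"
    by (rule Y.finsum_cong') (use s m f Y terms_closed in \<open>auto simp: M_ops FP_smult M_carrier B.H_carrier\<close>)
  also have "\<dots> = s \<odot>\<^bsub>PhO (FO Y)\<^esub> \<mu> Y m f" unfolding \<mu>_def
    by (rule additive_finsum[symmetric, OF Y.abelian_group_axioms Y.abelian_group_axioms])
      (use s m f Y terms_closed nu_moduleD(4)[OF PhO_module] finite_supp in auto)
  finally show ?thesis .
qed

text \<open>Balancedness, that is, the relation that defines the tensor product over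
  \<open>B.R\<close>; it reduces to functoriality of \<open>\<Phi> F\<close> in each
  summand.\<close>

lemma \<mu>_ra:
  assumes Y: "Y \<in> Ob B" and m: "m \<in> carrier M" and f: "f \<in> carrier (B.H Y)" and r: "r \<in> carrier B.R"
  shows "\<mu> Y (ra m r) f = \<mu> Y m (r \<odot>\<^bsub>B.H Y\<^esub> f)"
proof -
  interpret Y: abelian_group "PhO (FO Y)" using PhO_group Y by simp
  let ?K = "{S \<in> J. m S \<noteq> \<zero>\<^bsub>PhO (FO S)\<^esub>}"
  have "\<mu> Y (ra m r) f = finsum (PhO (FO Y)) (\<lambda>S. FP S Y (f S) (ra m r S)) ?K"
    by (rule \<mu>_eq[OF Y ra_closed[OF r m] f finite_supp[OF m]]) (use r in \<open>auto simp: M_ops B.R_carrier\<close>)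
  also have "\<dots> = \<mu> Y m (r \<odot>\<^bsub>B.H Y\<^esub> f)" unfolding \<mu>_def
    by (rule Y.finsum_cong')
      (use r m f Y terms_closed[OF Y m B.H_smult_closed[OF Y r f]] in \<open>auto simp: M_ops FP_cmp M_carrier B.H_carrier B.R_carrier B.H_ops\<close>)
  finally show ?thesis .
qed

text \<open>This is what makes a morphism of triples commute with the action of \<open>M\<close> in
  \<open>Nmap_hom\<close>.\<close>

lemma \<mu>_natural:
  assumes Y: "Y \<in> Ob B" "Y' \<in> Ob B" and m: "m \<in> carrier M" and f: "f \<in> carrier (B.H Y)" and v: "v \<in> Hom B Y Y'"
  shows "\<mu> Y' m (B.hmap Y Y' v f) = FP Y Y' v (\<mu> Y m f)"
proof -
  interpret Y: abelian_group "PhO (FO Y)" using PhO_group Y by simp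
  interpret Y': abelian_group "PhO (FO Y')" using PhO_group Y by simp
  let ?K = "{S \<in> J. m S \<noteq> \<zero>\<^bsub>PhO (FO S)\<^esub>}"
  have "\<mu> Y' m (B.hmap Y Y' v f) = finsum (PhO (FO Y')) (\<lambda>S. FP Y Y' v (FP S Y (f S) (m S))) ?K" unfolding \<mu>_def
    by (rule Y'.finsum_cong') (use v m f Y terms_closed in \<open>auto simp: FP_cmp M_carrier B.H_carrier B.hmap_def\<close>)
  also have "\<dots> = FP Y Y' v (\<mu> Y m f)" unfolding \<mu>_def
    by (rule additive_finsum[symmetric, OF Y.abelian_group_axioms Y'.abelian_group_axioms])
      (use v m f Y terms_closed FP_add finite_supp in auto)
  finally show ?thesis .
qed

lemma \<mu>_msing:
  assumes Y: "Y \<in> Ob B" and f: "f \<in> carrier (B.H Y)" and S: "S \<in> J" and z: "z \<in> carrier (PhO (FO S))"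
  shows "\<mu> Y (msing S z) f = FP S Y (f S) z"
proof -
  interpret Y: abelian_group "PhO (FO Y)" using PhO_group Y by simp
  have "\<mu> Y (msing S z) f = finsum (PhO (FO Y)) (\<lambda>S'. FP S' Y (f S') (msing S z S')) {S}"
    by (rule \<mu>_eq[OF Y msing_closed[OF S z] f]) (use S in \<open>auto simp: msing_def\<close>)
  then show ?thesis using S z f Y by (simp add: msing_def B.H_carrier)
qed

section \<open>The triangular matrix ring and the module of a triple\<close>

abbreviation RR where "RR \<equiv> tri_ring B.R M ra A.R"

lemma RR_simps [simp]:
  "carrier RR = carrier B.R \<times> carrier M \<times> carrier A.R" "\<zero>\<^bsub>RR\<^esub> = (\<zero>\<^bsub>B.R\<^esub>, \<zero>\<^bsub>M\<^esub>, \<zero>\<^bsub>A.R\<^esub>)"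
  "(r, m, s) \<oplus>\<^bsub>RR\<^esub> (r', m', s') = (r \<oplus>\<^bsub>B.R\<^esub> r', m \<oplus>\<^bsub>M\<^esub> m', s \<oplus>\<^bsub>A.R\<^esub> s')"
  "(r, m, s) \<otimes>\<^bsub>RR\<^esub> (r', m', s') = (r \<otimes>\<^bsub>B.R\<^esub> r', ra m r' \<oplus>\<^bsub>M\<^esub> s \<odot>\<^bsub>M\<^esub> m', s \<otimes>\<^bsub>A.R\<^esub> s')"
  by (simp_all add: tri_ring_def)

lemma ra_zero: "r \<in> carrier B.R \<Longrightarrow> ra \<zero>\<^bsub>M\<^esub> r = \<zero>\<^bsub>M\<^esub>" "m \<in> carrier M \<Longrightarrow> ra m \<zero>\<^bsub>B.R\<^esub> = \<zero>\<^bsub>M\<^esub>"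
  by (auto simp: M_ops B.R_ops B.R_carrier M_carrier intro!: restrict_ext)

lemma RR_group: "abelian_group RR"
proof (rule abelian_groupI)
  fix x assume "x \<in> carrier RR"
  then show "\<exists>y\<in>carrier RR. y \<oplus>\<^bsub>RR\<^esub> x = \<zero>\<^bsub>RR\<^esub>"
    by (cases x) (auto intro!: bexI[of _ "(\<ominus>\<^bsub>B.R\<^esub> fst x, \<ominus>\<^bsub>M\<^esub> fst (snd x), \<ominus>\<^bsub>A.R\<^esub> snd (snd x))"]
        simp: B.R.A.l_neg A.R.A.l_neg M.l_neg)
qed (auto simp: B.R.A.a_ac A.R.A.a_ac M.a_ac)

lemma M_zero_smult: "s \<in> carrier A.R \<Longrightarrow> s \<odot>\<^bsub>M\<^esub> \<zero>\<^bsub>M\<^esub> = \<zero>\<^bsub>M\<^esub>"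
  "m \<in> carrier M \<Longrightarrow> \<zero>\<^bsub>A.R\<^esub> \<odot>\<^bsub>M\<^esub> m = \<zero>\<^bsub>M\<^esub>"
  using A.R.smult_zero(1,2)[OF M_module] by auto

text \<open>Diagonal idempotents suffice as left units, because an idempotent of \<open>A.R\<close>
  can be chosen to fix a given off-diagonal entry as well.\<close>

definition RE :: "(('o \<Rightarrow> 'm) \<times> ('o \<Rightarrow> 'u) \<times> ('o \<Rightarrow> 'm)) set" where
  "RE = {(B.unit_on K, \<zero>\<^bsub>M\<^esub>, A.unit_on K') | K K'. finite K \<and> finite K'}"

sublocale RR: lu_ring RR RE
proof (rule lu_ring.intro[OF RR_group])
  show "a \<otimes>\<^bsub>RR\<^esub> b \<in> carrier RR" if "a \<in> carrier RR" "b \<in> carrier RR" for a b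
    using that B.R_mult_closed A.R_mult_closed ra_closed M_smult_closed by (cases a; cases b) auto
  show "RE \<subseteq> carrier RR" using B.unit_on_carrier A.unit_on_carrier by (auto simp: RE_def)
  show "\<exists>e\<in>RE. e \<otimes>\<^bsub>RR\<^esub> a = a" if a: "a \<in> carrier RR" for a
  proof -
    obtain r m s where rms: "a = (r, m, s)" "r \<in> carrier B.R" "m \<in> carrier M" "s \<in> carrier A.R"
      using a by (cases a) auto
    obtain K where K: "finite K" "B.unit_on K \<otimes>\<^bsub>B.R\<^esub> r = r" using B.R.E_unit[OF rms(2)] by blast
    obtain K1 where K1: "finite K1" "A.unit_on K1 \<odot>\<^bsub>M\<^esub> m = m" using M_unit rms by blast
    let ?K2 = "{S \<in> I. s S \<noteq> Zer A S S}"
    have K2: "finite ?K2" using rms by (simp add: A.R_carrier)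
    \<comment> \<open>One idempotent of \<open>A.R\<close> multiplies both \<open>m\<close> and
      \<open>s\<close> from the left, so it has to be large enough for the two of them.\<close>
    have "A.unit_on (K1 \<union> ?K2) \<odot>\<^bsub>M\<^esub> m = m"
      by (rule unit_on_mono[OF M_module rms(3) K1(1) _ _ K1(2)]) (use K1 K2 in auto)
    moreover have "A.unit_on (K1 \<union> ?K2) \<otimes>\<^bsub>A.R\<^esub> s = s" by (rule A.unit_on_mult) (use rms in auto)
    ultimately have "(B.unit_on K, \<zero>\<^bsub>M\<^esub>, A.unit_on (K1 \<union> ?K2)) \<otimes>\<^bsub>RR\<^esub> a = a"
      using K rms by (simp add: ra_zero)
    then show ?thesis using K K1 K2 unfolding RE_def by blast
  qed
  fix e e' assume "e \<in> RE" "e' \<in> RE"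
  then obtain K L K' L' where K: "finite K" "finite L" "finite K'" "finite L'"
    "e = (B.unit_on K, \<zero>\<^bsub>M\<^esub>, A.unit_on L)" "e' = (B.unit_on K', \<zero>\<^bsub>M\<^esub>, A.unit_on L')" unfolding RE_def by blast
  let ?d = "(B.unit_on (K \<union> K'), \<zero>\<^bsub>M\<^esub>, A.unit_on (L \<union> L'))"
  have b: "B.unit_on (K \<union> K') \<otimes>\<^bsub>B.R\<^esub> B.unit_on K = B.unit_on K" "B.unit_on (K \<union> K') \<otimes>\<^bsub>B.R\<^esub> B.unit_on K' = B.unit_on K'"
    by (rule B.unit_on_mult; use K B.unit_on_carrier in \<open>auto simp: B.unit_on_def split: if_splits\<close>)+
  have a: "A.unit_on (L \<union> L') \<otimes>\<^bsub>A.R\<^esub> A.unit_on L = A.unit_on L" "A.unit_on (L \<union> L') \<otimes>\<^bsub>A.R\<^esub> A.unit_on L' = A.unit_on L'"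
    by (rule A.unit_on_mult; use K A.unit_on_carrier in \<open>auto simp: A.unit_on_def split: if_splits\<close>)+
  have "?d \<otimes>\<^bsub>RR\<^esub> e = e" "?d \<otimes>\<^bsub>RR\<^esub> e' = e'"
    unfolding K using a b K A.unit_on_carrier B.unit_on_carrier by (simp_all add: ra_zero M_zero_smult)
  moreover have "?d \<in> RE" using K unfolding RE_def by blast
  ultimately show "\<exists>d\<in>RE. d \<otimes>\<^bsub>RR\<^esub> e = e \<and> d \<otimes>\<^bsub>RR\<^esub> e' = e'" by blast
qed

text \<open>Column vectors with upper entry \<open>f\<close> and lower entry \<open>x\<close>,
  stored as \<open>(x, f)\<close>, on which the lower triangular matrix with entries
  \<open>r\<close>, \<open>m\<close>, \<open>s\<close> acts as usual. The product of
  \<open>m\<close> and \<open>f\<close> is \<open>\<mu> Y m f\<close>, carried into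
  \<open>PhO X\<close> by the structure map \<open>e\<close>.\<close>

definition Nmod :: "'o \<times> 'o \<times> 'm \<Rightarrow> (('o \<Rightarrow> 'm) \<times> ('o \<Rightarrow> 'u) \<times> ('o \<Rightarrow> 'm), 'u \<times> ('o \<Rightarrow> 'm)) module" where
  "Nmod = (\<lambda>(X, Y, e). \<lparr>carrier = carrier (PhO X) \<times> carrier (B.H Y), monoid.mult = undefined, one = undefined,
    zero = (\<zero>\<^bsub>PhO X\<^esub>, \<zero>\<^bsub>B.H Y\<^esub>), add = (\<lambda>(x, f) (x', f'). (x \<oplus>\<^bsub>PhO X\<^esub> x', f \<oplus>\<^bsub>B.H Y\<^esub> f')),
    smult = (\<lambda>(r, m, s) (x, f). (s \<odot>\<^bsub>PhO X\<^esub> x \<oplus>\<^bsub>PhO X\<^esub> fmp \<Phi> (FO Y) X e (\<mu> Y m f), r \<odot>\<^bsub>B.H Y\<^esub> f))\<rparr>)"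

lemma Nmod_simps [simp]:
  "carrier (Nmod (X, Y, e)) = carrier (PhO X) \<times> carrier (B.H Y)" "\<zero>\<^bsub>Nmod (X, Y, e)\<^esub> = (\<zero>\<^bsub>PhO X\<^esub>, \<zero>\<^bsub>B.H Y\<^esub>)"
  "(x, f) \<oplus>\<^bsub>Nmod (X, Y, e)\<^esub> (x', f') = (x \<oplus>\<^bsub>PhO X\<^esub> x', f \<oplus>\<^bsub>B.H Y\<^esub> f')"
  "(r, m, s) \<odot>\<^bsub>Nmod (X, Y, e)\<^esub> (x, f) =
    (s \<odot>\<^bsub>PhO X\<^esub> x \<oplus>\<^bsub>PhO X\<^esub> fmp \<Phi> (FO Y) X e (\<mu> Y m f), r \<odot>\<^bsub>B.H Y\<^esub> f)"
  by (simp_all add: Nmod_def)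

lemma \<mu>_zero:
  "\<lbrakk>Y \<in> Ob B; f \<in> carrier (B.H Y)\<rbrakk> \<Longrightarrow> \<mu> Y \<zero>\<^bsub>M\<^esub> f = \<zero>\<^bsub>PhO (FO Y)\<^esub>"
  "\<lbrakk>Y \<in> Ob B; m \<in> carrier M\<rbrakk> \<Longrightarrow> \<mu> Y m \<zero>\<^bsub>B.H Y\<^esub> = \<zero>\<^bsub>PhO (FO Y)\<^esub>"
  using additive_zero(1)[OF M_group PhO_group, of "FO Y" "\<lambda>m. \<mu> Y m f"] \<mu>_add_left
    additive_zero(1)[OF B.H_group PhO_group, of Y "FO Y" "\<lambda>f. \<mu> Y m f"] \<mu>_add_right by simp_all

lemma Nmod_group:
  assumes "(X, Y, e) \<in> Ob T"
  shows "abelian_group (Nmod (X, Y, e))"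
proof -
  have X: "X \<in> Ob D" and Y: "Y \<in> Ob B" using assms by auto
  interpret X: abelian_group "PhO X" using PhO_group X by blast
  interpret Y: abelian_group "B.H Y" using B.H_group Y by blast
  show ?thesis
  proof (rule abelian_groupI)
    fix x assume "x \<in> carrier (Nmod (X, Y, e))"
    then show "\<exists>y\<in>carrier (Nmod (X, Y, e)). y \<oplus>\<^bsub>Nmod (X, Y, e)\<^esub> x = \<zero>\<^bsub>Nmod (X, Y, e)\<^esub>"
      by (cases x) (auto intro!: bexI[of _ "(\<ominus>\<^bsub>PhO X\<^esub> fst x, \<ominus>\<^bsub>B.H Y\<^esub> snd x)"] simp: X.l_neg Y.l_neg)
  qed (auto simp: X.a_ac Y.a_ac)
qed

lemma Nmod_module:
  assumes t: "(X, Y, e) \<in> Ob T"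
  shows "nu_module RR (Nmod (X, Y, e))"
proof -
  have X: "X \<in> Ob D" and Y: "Y \<in> Ob B" and e: "e \<in> Hom D (FO Y) X" using t by auto
  note XD = nu_moduleD[OF PhO_module[OF X]] and YD = nu_moduleD[OF B.H_module[OF Y]]
  interpret X: abelian_group "PhO X" using PhO_group X by blast
  interpret Y: abelian_group "B.H Y" using B.H_group Y by blast
  let ?e = "fmp \<Phi> (FO Y) X e"
  have ec: "?e z \<in> carrier (PhO X)" if "z \<in> carrier (PhO (FO Y))" for z using that X Y e by simp
  have ea: "?e (z \<oplus>\<^bsub>PhO (FO Y)\<^esub> z') = ?e z \<oplus>\<^bsub>PhO X\<^esub> ?e z'"
    if "z \<in> carrier (PhO (FO Y))" "z' \<in> carrier (PhO (FO Y))" for z z' using that X Y e PhM_add by simp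
  have es: "?e (s \<odot>\<^bsub>PhO (FO Y)\<^esub> z) = s \<odot>\<^bsub>PhO X\<^esub> ?e z" if "s \<in> carrier A.R" "z \<in> carrier (PhO (FO Y))" for s z
    using that X Y e PhM_smult by simp
  show ?thesis
  proof (rule nu_moduleI[OF Nmod_group[OF t]])
    fix a x assume "a \<in> carrier RR" "x \<in> carrier (Nmod (X, Y, e))"
    then show "a \<odot>\<^bsub>Nmod (X, Y, e)\<^esub> x \<in> carrier (Nmod (X, Y, e))"
      using XD(2) YD(2) ec Y by (cases a; cases x) auto
  next
    fix a b x assume "a \<in> carrier RR" "b \<in> carrier RR" "x \<in> carrier (Nmod (X, Y, e))"
    then show "(a \<oplus>\<^bsub>RR\<^esub> b) \<odot>\<^bsub>Nmod (X, Y, e)\<^esub> x = a \<odot>\<^bsub>Nmod (X, Y, e)\<^esub> x \<oplus>\<^bsub>Nmod (X, Y, e)\<^esub> b \<odot>\<^bsub>Nmod (X, Y, e)\<^esub> x"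
      using XD(2,3) YD(3) ec ea Y \<mu>_add_left by (cases a; cases b; cases x) (auto simp: X.a_ac)
  next
    fix a x y assume "a \<in> carrier RR" "x \<in> carrier (Nmod (X, Y, e))" "y \<in> carrier (Nmod (X, Y, e))"
    then show "a \<odot>\<^bsub>Nmod (X, Y, e)\<^esub> (x \<oplus>\<^bsub>Nmod (X, Y, e)\<^esub> y) = a \<odot>\<^bsub>Nmod (X, Y, e)\<^esub> x \<oplus>\<^bsub>Nmod (X, Y, e)\<^esub> a \<odot>\<^bsub>Nmod (X, Y, e)\<^esub> y"
      using XD(2,4) YD(4) ec ea Y \<mu>_add_right by (cases a; cases x; cases y) (auto simp: X.a_ac)
  next
    fix a b x assume a: "a \<in> carrier RR" and b: "b \<in> carrier RR" and x: "x \<in> carrier (Nmod (X, Y, e))"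
    obtain r m s where a': "a = (r, m, s)" "r \<in> carrier B.R" "m \<in> carrier M" "s \<in> carrier A.R" using a by (cases a) auto
    obtain r' m' s' where b': "b = (r', m', s')" "r' \<in> carrier B.R" "m' \<in> carrier M" "s' \<in> carrier A.R" using b by (cases b) auto
    obtain x' f where x': "x = (x', f)" "x' \<in> carrier (PhO X)" "f \<in> carrier (B.H Y)" using x by (cases x) auto
    \<comment> \<open>The off-diagonal entry of a product is \<open>m r' + s m'\<close>, so
      associativity of the action rests on \<open>\<mu>\<close> being balanced and linear over
      \<open>A.R\<close>.\<close>
    have "\<mu> Y (ra m r' \<oplus>\<^bsub>M\<^esub> s \<odot>\<^bsub>M\<^esub> m') f = \<mu> Y m (r' \<odot>\<^bsub>B.H Y\<^esub> f) \<oplus>\<^bsub>PhO (FO Y)\<^esub> s \<odot>\<^bsub>PhO (FO Y)\<^esub> \<mu> Y m' f"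
      using \<mu>_add_left[OF Y ra_closed M_smult_closed] \<mu>_ra \<mu>_smult a' b' x' Y by simp
    then have "?e (\<mu> Y (ra m r' \<oplus>\<^bsub>M\<^esub> s \<odot>\<^bsub>M\<^esub> m') f) = ?e (\<mu> Y m (r' \<odot>\<^bsub>B.H Y\<^esub> f)) \<oplus>\<^bsub>PhO X\<^esub> s \<odot>\<^bsub>PhO X\<^esub> ?e (\<mu> Y m' f)"
      using ea es a' b' x' Y B.H_smult_closed by simp
    then show "(a \<otimes>\<^bsub>RR\<^esub> b) \<odot>\<^bsub>Nmod (X, Y, e)\<^esub> x = a \<odot>\<^bsub>Nmod (X, Y, e)\<^esub> (b \<odot>\<^bsub>Nmod (X, Y, e)\<^esub> x)"
      using a' b' x' XD(2,4,5) YD(5) ec Y B.H_smult_closed by (simp add: X.a_ac)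
  next
    fix x assume x: "x \<in> carrier (Nmod (X, Y, e))"
    obtain x' f where x': "x = (x', f)" "x' \<in> carrier (PhO X)" "f \<in> carrier (B.H Y)" using x by (cases x) auto
    obtain a where a: "a \<in> carrier A.R" "a \<odot>\<^bsub>PhO X\<^esub> x' = x'"
      using A.R.nu_unit[OF PhO_module[OF X] x'(2)] A.R.E_sub by blast
    obtain b where b: "b \<in> carrier B.R" "b \<odot>\<^bsub>B.H Y\<^esub> f = f"
      using B.R.nu_unit[OF B.H_module[OF Y] x'(3)] B.R.E_sub by blast
    have "(b, \<zero>\<^bsub>M\<^esub>, a) \<odot>\<^bsub>Nmod (X, Y, e)\<^esub> x = x"
      using a b x' X Y e by (simp add: \<mu>_zero PhM_zero)
    then show "\<exists>a\<in>carrier RR. a \<odot>\<^bsub>Nmod (X, Y, e)\<^esub> x = x" using a b by (intro bexI[of _ "(b, \<zero>\<^bsub>M\<^esub>, a)"]) auto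
  qed
qed

section \<open>The module of a triple as a fully faithful functor\<close>

definition Nmap :: "'o \<times> 'o \<times> 'm \<Rightarrow> 'o \<times> 'o \<times> 'm \<Rightarrow> 'm \<times> 'm \<Rightarrow> 'u \<times> ('o \<Rightarrow> 'm) \<Rightarrow> 'u \<times> ('o \<Rightarrow> 'm)" where
  "Nmap = (\<lambda>(X, Y, e) (X', Y', e') (u, v). \<lambda>(x, f) \<in> carrier (PhO X) \<times> carrier (B.H Y).
    (fmp \<Phi> X X' u x, B.hmap Y Y' v f))"

lemma Nmap_simp [simp]:
  "\<lbrakk>x \<in> carrier (PhO X); f \<in> carrier (B.H Y)\<rbrakk> \<Longrightarrow>
    Nmap (X, Y, e) (X', Y', e') (u, v) (x, f) = (fmp \<Phi> X X' u x, B.hmap Y Y' v f)"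
  by (simp add: Nmap_def)

lemma Nmap_hom:
  assumes t: "(X, Y, e) \<in> Ob T" and t': "(X', Y', e') \<in> Ob T" and uv: "(u, v) \<in> Hom T (X, Y, e) (X', Y', e')"
  shows "Nmap (X, Y, e) (X', Y', e') (u, v) \<in> mod_homs RR (Nmod (X, Y, e)) (Nmod (X', Y', e'))"
proof (rule mod_homsI)
  note tt = t[unfolded T_Ob] t'[unfolded T_Ob] uv[unfolded T_Hom]
  interpret X: abelian_group "PhO X" using PhO_group tt by blast
  interpret Y: abelian_group "B.H Y" using B.H_group tt by blast
  show "Nmap (X, Y, e) (X', Y', e') (u, v) x \<in> carrier (Nmod (X', Y', e'))" if "x \<in> carrier (Nmod (X, Y, e))" for x
    using that tt B.hmap_closed by auto
  fix x assume x: "x \<in> carrier (Nmod (X, Y, e))"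
  obtain x1 f where x1: "x = (x1, f)" "x1 \<in> carrier (PhO X)" "f \<in> carrier (B.H Y)" using x by (cases x) auto
  show "Nmap (X, Y, e) (X', Y', e') (u, v) (x \<oplus>\<^bsub>Nmod (X, Y, e)\<^esub> y) =
      Nmap (X, Y, e) (X', Y', e') (u, v) x \<oplus>\<^bsub>Nmod (X', Y', e')\<^esub> Nmap (X, Y, e) (X', Y', e') (u, v) y"
    if "y \<in> carrier (Nmod (X, Y, e))" for y
    using that x1 tt by (cases y) (simp add: PhM_add B.hmap_add)
  fix a assume "a \<in> carrier RR"
  then obtain r m s where a: "a = (r, m, s)" "r \<in> carrier B.R" "m \<in> carrier M" "s \<in> carrier A.R" by (cases a) auto
  have "fmp \<Phi> X X' u (fmp \<Phi> (FO Y) X e (\<mu> Y m f)) = fmp \<Phi> (FO Y') X' e' (\<mu> Y' m (B.hmap Y Y' v f))"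
  proof -
    have "fmp \<Phi> X X' u (fmp \<Phi> (FO Y) X e (\<mu> Y m f)) = fmp \<Phi> (FO Y) X' (Cmp D (FO Y) X X' u e) (\<mu> Y m f)"
      using tt(1,2) tt(3)[THEN conjunct1] a x1 by (simp add: PhM_cmp)
    also have "\<dots> = fmp \<Phi> (FO Y) X' (Cmp D (FO Y) (FO Y') X' e' (fmp F Y Y' v)) (\<mu> Y m f)"
      using tt(3) by simp
    also have "\<dots> = fmp \<Phi> (FO Y') X' e' (FP Y Y' v (\<mu> Y m f))"
      using tt(1,2) tt(3)[THEN conjunct2, THEN conjunct1] a x1 by (simp add: PhM_cmp FP_def)
    also have "\<dots> = fmp \<Phi> (FO Y') X' e' (\<mu> Y' m (B.hmap Y Y' v f))" using \<mu>_natural tt a x1 by simp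
    finally show ?thesis .
  qed
  then show "Nmap (X, Y, e) (X', Y', e') (u, v) (a \<odot>\<^bsub>Nmod (X, Y, e)\<^esub> x) =
      a \<odot>\<^bsub>Nmod (X', Y', e')\<^esub> Nmap (X, Y, e) (X', Y', e') (u, v) x"
    using a x1 tt by (simp add: PhM_add PhM_smult B.hmap_smult B.H_smult_closed)
qed (auto simp: Nmap_def)

lemma Nmap_cmp:
  assumes "(X, Y, e) \<in> Ob T" "(X', Y', e') \<in> Ob T" "(X'', Y'', e'') \<in> Ob T"
    "(u, v) \<in> Hom T (X, Y, e) (X', Y', e')" "(u', v') \<in> Hom T (X', Y', e') (X'', Y'', e'')"
    "x \<in> carrier (Nmod (X, Y, e))"
  shows "Nmap (X, Y, e) (X'', Y'', e'') (Cmp T (X, Y, e) (X', Y', e') (X'', Y'', e'') (u', v') (u, v)) x =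
    Nmap (X', Y', e') (X'', Y'', e'') (u', v') (Nmap (X, Y, e) (X', Y', e') (u, v) x)"
  using assms by (cases x) (simp add: PhM_cmp B.hmap_cmp B.hmap_closed)

lemma Nmap_id:
  assumes "(X, Y, e) \<in> Ob T" "x \<in> carrier (Nmod (X, Y, e))"
  shows "Nmap (X, Y, e) (X, Y, e) (Idt T (X, Y, e)) x = x"
  using assms by (cases x) (simp add: B.hmap_id del: Phi.id)

text \<open>The first component is settled by faithfulness of \<open>\<Phi>\<close>. For the second,
  the families \<open>sing Y S f\<close> recover the composites of \<open>v\<close> with morphisms
  out of simple objects, which separate.\<close>

lemma Nmap_faithful:
  assumes t: "(X, Y, e) \<in> Ob T" and t': "(X', Y', e') \<in> Ob T"
    and uv: "(u, v) \<in> Hom T (X, Y, e) (X', Y', e')" "(u', v') \<in> Hom T (X, Y, e) (X', Y', e')"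
    and eq: "\<And>x. x \<in> carrier (Nmod (X, Y, e)) \<Longrightarrow>
      Nmap (X, Y, e) (X', Y', e') (u, v) x = Nmap (X, Y, e) (X', Y', e') (u', v') x"
  shows "(u, v) = (u', v')"
proof -
  note tt = t[unfolded T_Ob] t'[unfolded T_Ob] uv[unfolded T_Hom]
  interpret Y: abelian_group "B.H Y" using B.H_group tt by blast
  have "u = u'"
    by (rule PhM_eqI[of X X']) (use tt eq[of "(_, \<zero>\<^bsub>B.H Y\<^esub>)"] in auto)
  moreover have "v = v'"
  proof (rule B.J_separating[of Y Y'])
    fix S f assume S: "S \<in> J" "f \<in> Hom B S Y"
    then have "B.hmap Y Y' v (B.sing Y S f) = B.hmap Y Y' v' (B.sing Y S f)"
      using eq[of "(\<zero>\<^bsub>PhO X\<^esub>, B.sing Y S f)"] tt B.sing_carrier by simp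
    then show "Cmp B S Y Y' v f = Cmp B S Y Y' v' f"
      using S by (auto simp: B.hmap_def B.sing_def dest: fun_cong[of _ _ S])
  qed (use tt in auto)
  ultimately show ?thesis by simp
qed

lemma F_biprod:
  assumes "is_biprod B Y S X i1 i2 p1 p2"
  shows "is_biprod D (FO Y) (FO S) (FO X) (fmp F Y X i1) (fmp F S X i2) (fmp F X Y p1) (fmp F X S p2)"
  using B.biprodD[OF assms] unfolding is_biprod_def by (simp flip: F_cmp F_add)

lemma F_zero_obj: "zero_obj B Z \<Longrightarrow> zero_obj D (FO Z)"
  using F_id F_zer by (metis B.zero_obj_iff D.zero_obj_iff F_ob)

text \<open>\<open>F\<close> preserves biproducts, so \<open>F Y\<close> is a finite direct sum of
  objects \<open>F S\<close> with \<open>S\<close> in \<open>J\<close>, and \<open>a\<close> and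
  \<open>b\<close> are compared on each of them.\<close>

lemma F_separating:
  assumes Y: "Y \<in> Ob B" and X: "X \<in> Ob D" and ab: "a \<in> Hom D (FO Y) X" "b \<in> Hom D (FO Y) X"
    and "\<And>S f. \<lbrakk>S \<in> J; f \<in> Hom B S Y\<rbrakk> \<Longrightarrow> Cmp D (FO S) (FO Y) X a (fmp F S Y f) = Cmp D (FO S) (FO Y) X b (fmp F S Y f)"
  shows "a = b"
  using Y ab assms(5)
proof (induction Y arbitrary: a b rule: B.ss_induct)
  case (zero Z)
  then show ?case using D.zero_obj_from[OF F_zero_obj[OF zero.hyps] X] by metis
next
  case (step Y S X' i1 i2 p1 p2)
  note BD = B.biprodD[OF step.hyps(2)]
  show ?case
  proof (rule D.biprod_eqI[OF F_biprod[OF step.hyps(2)] X step.prems(1,2)])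
    show "Cmp D (FO Y) (FO X') X a (fmp F Y X' i1) = Cmp D (FO Y) (FO X') X b (fmp F Y X' i1)"
    proof (rule step.IH)
      fix S' f assume f: "S' \<in> J" "f \<in> Hom B S' Y"
      have "Cmp D (FO S') (FO X') X a (fmp F S' X' (Cmp B S' Y X' i1 f)) =
          Cmp D (FO S') (FO X') X b (fmp F S' X' (Cmp B S' Y X' i1 f))"
        using step.prems(3) f BD by simp
      then show "Cmp D (FO S') (FO Y) X (Cmp D (FO Y) (FO X') X a (fmp F Y X' i1)) (fmp F S' Y f) =
          Cmp D (FO S') (FO Y) X (Cmp D (FO Y) (FO X') X b (fmp F Y X' i1)) (fmp F S' Y f)"
        using f BD step.prems(1,2) X by (simp add: F_cmp D.cmp_assoc')
    qed (use BD step.prems(1,2) X in auto)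
    show "Cmp D (FO S) (FO X') X a (fmp F S X' i2) = Cmp D (FO S) (FO X') X b (fmp F S X' i2)"
      using step BD by blast
  qed
qed

lemma PhM_full:
  assumes "X \<in> Ob D" "X' \<in> Ob D"
    and "\<And>x. x \<in> carrier (PhO X) \<Longrightarrow> h x \<in> carrier (PhO X')"
    and "\<And>x y. \<lbrakk>x \<in> carrier (PhO X); y \<in> carrier (PhO X)\<rbrakk> \<Longrightarrow> h (x \<oplus>\<^bsub>PhO X\<^esub> y) = h x \<oplus>\<^bsub>PhO X'\<^esub> h y"
    and "\<And>s x. \<lbrakk>s \<in> carrier A.R; x \<in> carrier (PhO X)\<rbrakk> \<Longrightarrow> h (s \<odot>\<^bsub>PhO X\<^esub> x) = s \<odot>\<^bsub>PhO X'\<^esub> h x"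
  shows "\<exists>u \<in> Hom D X X'. \<forall>x \<in> carrier (PhO X). fmp \<Phi> X X' u x = h x"
proof -
  have "restrict h (carrier (PhO X)) \<in> mod_homs A.R (PhO X) (PhO X')"
    by (rule mod_homsI) (use assms in auto)
  then have "restrict h (carrier (PhO X)) \<in> Hom (mod_cat A.R (semisimple_mod A.R)) (PhO X) (PhO X')" by simp
  then obtain u where "u \<in> Hom D X X'" "fmp \<Phi> X X' u = restrict h (carrier (PhO X))"
    using Phi.full assms(1,2) by metis
  then show ?thesis by (intro bexI[of _ u]) auto
qed

text \<open>Local units force \<open>g\<close> to respect the two summands. Its restrictions
  \<open>\<alpha>\<close> and \<open>\<beta>\<close> are linear over the diagonal rings and hence
  come from morphisms \<open>u\<close> and \<open>v\<close>; linearity over \<open>M\<close> then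
  says that these form a morphism of triples.\<close>

lemma Nmap_full:
  assumes t: "(X, Y, e) \<in> Ob T" and t': "(X', Y', e') \<in> Ob T"
    and g: "g \<in> mod_homs RR (Nmod (X, Y, e)) (Nmod (X', Y', e'))"
  shows "\<exists>u v. (u, v) \<in> Hom T (X, Y, e) (X', Y', e') \<and> Nmap (X, Y, e) (X', Y', e') (u, v) = g"
proof -
  note tt = t[unfolded T_Ob] t'[unfolded T_Ob] and gD = mod_homsD[OF g]
  have O: "X \<in> Ob D" "X' \<in> Ob D" "Y \<in> Ob B" "Y' \<in> Ob B" using tt by auto
  interpret X: abelian_group "PhO X" using PhO_group O by blast
  interpret Y: abelian_group "B.H Y" using B.H_group O by blast
  interpret X': abelian_group "PhO X'" using PhO_group O by blast
  interpret Y': abelian_group "B.H Y'" using B.H_group O by blast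
  note z = A.R.smult_zero[OF PhO_module] B.R.smult_zero[OF B.H_module]
  \<comment> \<open>A local unit of \<open>x\<close> in \<open>A.R\<close> annihilates every second
    component, and it fixes \<open>g (x, 0)\<close>. The statement \<open>gY\<close> uses a local
    unit of \<open>f\<close> in \<open>B.R\<close> in the same way.\<close>
  have gX: "snd (g (x, \<zero>\<^bsub>B.H Y\<^esub>)) = \<zero>\<^bsub>B.H Y'\<^esub>" if x: "x \<in> carrier (PhO X)" for x
  proof -
    obtain s where s: "s \<in> carrier A.R" "s \<odot>\<^bsub>PhO X\<^esub> x = x"
      using A.R.nu_unit[OF PhO_module[OF O(1)] x] A.R.E_sub by blast
    have c: "g (x, \<zero>\<^bsub>B.H Y\<^esub>) \<in> carrier (Nmod (X', Y', e'))" using gD(1) x by simp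
    have "(\<zero>\<^bsub>B.R\<^esub>, \<zero>\<^bsub>M\<^esub>, s) \<odot>\<^bsub>Nmod (X, Y, e)\<^esub> (x, \<zero>\<^bsub>B.H Y\<^esub>) = (x, \<zero>\<^bsub>B.H Y\<^esub>)"
      using s x tt by (simp add: z \<mu>_zero PhM_zero)
    then have "g (x, \<zero>\<^bsub>B.H Y\<^esub>) = (\<zero>\<^bsub>B.R\<^esub>, \<zero>\<^bsub>M\<^esub>, s) \<odot>\<^bsub>Nmod (X', Y', e')\<^esub> g (x, \<zero>\<^bsub>B.H Y\<^esub>)"
      using gD(3)[of "(\<zero>\<^bsub>B.R\<^esub>, \<zero>\<^bsub>M\<^esub>, s)" "(x, \<zero>\<^bsub>B.H Y\<^esub>)"] s x by simp
    then show ?thesis using c O by (cases "g (x, \<zero>\<^bsub>B.H Y\<^esub>)") (auto simp: z)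
  qed
  have gY: "fst (g (\<zero>\<^bsub>PhO X\<^esub>, f)) = \<zero>\<^bsub>PhO X'\<^esub>" if f: "f \<in> carrier (B.H Y)" for f
  proof -
    obtain r where r: "r \<in> carrier B.R" "r \<odot>\<^bsub>B.H Y\<^esub> f = f"
      using B.R.nu_unit[OF B.H_module[OF O(3)] f] B.R.E_sub by blast
    have c: "g (\<zero>\<^bsub>PhO X\<^esub>, f) \<in> carrier (Nmod (X', Y', e'))" using gD(1) f by simp
    have "(r, \<zero>\<^bsub>M\<^esub>, \<zero>\<^bsub>A.R\<^esub>) \<odot>\<^bsub>Nmod (X, Y, e)\<^esub> (\<zero>\<^bsub>PhO X\<^esub>, f) = (\<zero>\<^bsub>PhO X\<^esub>, f)"
      using r f tt by (simp add: z \<mu>_zero PhM_zero)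
    then have "g (\<zero>\<^bsub>PhO X\<^esub>, f) = (r, \<zero>\<^bsub>M\<^esub>, \<zero>\<^bsub>A.R\<^esub>) \<odot>\<^bsub>Nmod (X', Y', e')\<^esub> g (\<zero>\<^bsub>PhO X\<^esub>, f)"
      using gD(3)[of "(r, \<zero>\<^bsub>M\<^esub>, \<zero>\<^bsub>A.R\<^esub>)" "(\<zero>\<^bsub>PhO X\<^esub>, f)"] r f by simp
    then show ?thesis using c tt by (cases "g (\<zero>\<^bsub>PhO X\<^esub>, f)") (auto simp: z \<mu>_zero PhM_zero)
  qed
  define \<alpha> where "\<alpha> x = fst (g (x, \<zero>\<^bsub>B.H Y\<^esub>))" for x
  define \<beta> where "\<beta> f = snd (g (\<zero>\<^bsub>PhO X\<^esub>, f))" for f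
  have ga: "g (x, \<zero>\<^bsub>B.H Y\<^esub>) = (\<alpha> x, \<zero>\<^bsub>B.H Y'\<^esub>)" "\<alpha> x \<in> carrier (PhO X')" if "x \<in> carrier (PhO X)" for x
    using gX[OF that] gD(1)[of "(x, \<zero>\<^bsub>B.H Y\<^esub>)"] that by (auto simp: \<alpha>_def intro: prod_eqI)
  have gb: "g (\<zero>\<^bsub>PhO X\<^esub>, f) = (\<zero>\<^bsub>PhO X'\<^esub>, \<beta> f)" "\<beta> f \<in> carrier (B.H Y')" if "f \<in> carrier (B.H Y)" for f
    using gY[OF that] gD(1)[of "(\<zero>\<^bsub>PhO X\<^esub>, f)"] that by (auto simp: \<beta>_def intro: prod_eqI)
  have gab: "g (x, f) = (\<alpha> x, \<beta> f)" if "x \<in> carrier (PhO X)" "f \<in> carrier (B.H Y)" for x f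
  proof -
    have "g (x, f) = g ((x, \<zero>\<^bsub>B.H Y\<^esub>) \<oplus>\<^bsub>Nmod (X, Y, e)\<^esub> (\<zero>\<^bsub>PhO X\<^esub>, f))" using that by simp
    also have "\<dots> = g (x, \<zero>\<^bsub>B.H Y\<^esub>) \<oplus>\<^bsub>Nmod (X', Y', e')\<^esub> g (\<zero>\<^bsub>PhO X\<^esub>, f)" by (rule gD(2)) (use that in auto)
    finally show ?thesis using ga gb that by simp
  qed
  have "\<exists>u \<in> Hom D X X'. \<forall>x \<in> carrier (PhO X). fmp \<Phi> X X' u x = \<alpha> x"
  proof (rule PhM_full[OF O(1,2) ga(2)])
    fix x y assume "x \<in> carrier (PhO X)" "y \<in> carrier (PhO X)"
    then show "\<alpha> (x \<oplus>\<^bsub>PhO X\<^esub> y) = \<alpha> x \<oplus>\<^bsub>PhO X'\<^esub> \<alpha> y"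
      using gD(2)[of "(x, \<zero>\<^bsub>B.H Y\<^esub>)" "(y, \<zero>\<^bsub>B.H Y\<^esub>)"] ga by simp
  next
    fix s x assume "s \<in> carrier A.R" "x \<in> carrier (PhO X)"
    then show "\<alpha> (s \<odot>\<^bsub>PhO X\<^esub> x) = s \<odot>\<^bsub>PhO X'\<^esub> \<alpha> x"
      using gD(3)[of "(\<zero>\<^bsub>B.R\<^esub>, \<zero>\<^bsub>M\<^esub>, s)" "(x, \<zero>\<^bsub>B.H Y\<^esub>)"] ga tt O by (simp add: z \<mu>_zero PhM_zero)
  qed
  then obtain u where u: "u \<in> Hom D X X'" "\<And>x. x \<in> carrier (PhO X) \<Longrightarrow> fmp \<Phi> X X' u x = \<alpha> x" by blast
  have "\<exists>v \<in> Hom B Y Y'. \<forall>f \<in> carrier (B.H Y). \<beta> f = B.hmap Y Y' v f"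
  proof (rule B.hmap_full[OF O(3,4) gb(2)])
    fix f f' assume "f \<in> carrier (B.H Y)" "f' \<in> carrier (B.H Y)"
    then show "\<beta> (f \<oplus>\<^bsub>B.H Y\<^esub> f') = \<beta> f \<oplus>\<^bsub>B.H Y'\<^esub> \<beta> f'"
      using gD(2)[of "(\<zero>\<^bsub>PhO X\<^esub>, f)" "(\<zero>\<^bsub>PhO X\<^esub>, f')"] gb by simp
  next
    fix r f assume "r \<in> carrier B.R" "f \<in> carrier (B.H Y)"
    then show "\<beta> (r \<odot>\<^bsub>B.H Y\<^esub> f) = r \<odot>\<^bsub>B.H Y'\<^esub> \<beta> f"
      using gD(3)[of "(r, \<zero>\<^bsub>M\<^esub>, \<zero>\<^bsub>A.R\<^esub>)" "(\<zero>\<^bsub>PhO X\<^esub>, f)"] gb tt O by (simp add: z \<mu>_zero PhM_zero B.H_smult_closed)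
  qed
  then obtain v where v: "v \<in> Hom B Y Y'" "\<And>f. f \<in> carrier (B.H Y) \<Longrightarrow> \<beta> f = B.hmap Y Y' v f" by blast
  \<comment> \<open>By \<open>F_separating\<close> it is enough to compare the two sides on the
    objects \<open>F S\<close>, and there on elements, since \<open>\<Phi>\<close> is
    faithful.\<close>
  have "Cmp D (FO Y) X X' u e = Cmp D (FO Y) (FO Y') X' e' (fmp F Y Y' v)"
  proof (rule F_separating[OF O(3,2)])
    fix S f assume S: "S \<in> J" "f \<in> Hom B S Y"
    show "Cmp D (FO S) (FO Y) X' (Cmp D (FO Y) X X' u e) (fmp F S Y f) =
        Cmp D (FO S) (FO Y) X' (Cmp D (FO Y) (FO Y') X' e' (fmp F Y Y' v)) (fmp F S Y f)"
    proof (rule PhM_eqI[of "FO S" X'])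
      fix x assume x: "x \<in> carrier (PhO (FO S))"
      have sc: "B.sing Y S f \<in> carrier (B.H Y)" "B.hmap Y Y' v (B.sing Y S f) \<in> carrier (B.H Y')"
        using B.sing_carrier B.hmap_closed S O v by blast+
      have SS: "B.sing Y S f S = f" "B.hmap Y Y' v (B.sing Y S f) S = Cmp B S Y Y' v f"
        using S by (auto simp: B.sing_def B.hmap_def)
      \<comment> \<open>Applied to \<open>sing Y S f\<close>, this matrix produces the image of
        \<open>x\<close> under \<open>F f\<close> and then \<open>e\<close>; commuting with
        \<open>g\<close> is exactly the required equation at \<open>x\<close>.\<close>
      let ?a = "(\<zero>\<^bsub>B.R\<^esub>, msing S x, \<zero>\<^bsub>A.R\<^esub>)"
      have ac: "?a \<in> carrier RR" using msing_closed S x by simp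
      have "g (?a \<odot>\<^bsub>Nmod (X, Y, e)\<^esub> (\<zero>\<^bsub>PhO X\<^esub>, B.sing Y S f)) = ?a \<odot>\<^bsub>Nmod (X', Y', e')\<^esub> g (\<zero>\<^bsub>PhO X\<^esub>, B.sing Y S f)"
        by (rule gD(3)[OF ac]) (use sc in simp)
      moreover have "?a \<odot>\<^bsub>Nmod (X, Y, e)\<^esub> (\<zero>\<^bsub>PhO X\<^esub>, B.sing Y S f) = (fmp \<Phi> (FO Y) X e (FP S Y f x), \<zero>\<^bsub>B.H Y\<^esub>)"
        using sc S x O tt(1) by (simp add: z \<mu>_msing SS)
      moreover have "g (\<zero>\<^bsub>PhO X\<^esub>, B.sing Y S f) = (\<zero>\<^bsub>PhO X'\<^esub>, B.hmap Y Y' v (B.sing Y S f))"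
        using gb(1)[OF sc(1)] v(2)[OF sc(1)] by simp
      moreover have "?a \<odot>\<^bsub>Nmod (X', Y', e')\<^esub> (\<zero>\<^bsub>PhO X'\<^esub>, B.hmap Y Y' v (B.sing Y S f)) =
          (fmp \<Phi> (FO Y') X' e' (FP S Y' (Cmp B S Y Y' v f) x), \<zero>\<^bsub>B.H Y'\<^esub>)"
        using sc(2) S x O tt(2) v(1) by (simp add: z \<mu>_msing SS)
      moreover have ec: "fmp \<Phi> (FO Y) X e (FP S Y f x) \<in> carrier (PhO X)" using S x O tt(1) by simp
      ultimately have "\<alpha> (fmp \<Phi> (FO Y) X e (FP S Y f x)) = fmp \<Phi> (FO Y') X' e' (FP S Y' (Cmp B S Y Y' v f) x)"
        using ga(1)[OF ec] by simp
      then have "fmp \<Phi> X X' u (fmp \<Phi> (FO Y) X e (FP S Y f x)) = fmp \<Phi> (FO Y') X' e' (FP Y Y' v (FP S Y f x))"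
        using u(2) FP_cmp S x O tt v(1) by simp
      then show "fmp \<Phi> (FO S) X' (Cmp D (FO S) (FO Y) X' (Cmp D (FO Y) X X' u e) (fmp F S Y f)) x =
          fmp \<Phi> (FO S) X' (Cmp D (FO S) (FO Y) X' (Cmp D (FO Y) (FO Y') X' e' (fmp F Y Y' v)) (fmp F S Y f)) x"
        using S x O tt u v by (simp add: PhM_cmp FP_def)
    qed (use S O tt u v in auto)
  qed (use O tt u v in auto)
  then have "(u, v) \<in> Hom T (X, Y, e) (X', Y', e')" using u v by simp
  moreover have "Nmap (X, Y, e) (X', Y', e') (u, v) = g"
  proof
    fix p show "Nmap (X, Y, e) (X', Y', e') (u, v) p = g p"
      using gab u v gD(4) by (cases p) (auto simp: Nmap_def extensional_def)
  qed
  ultimately show ?thesis by blast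
qed

text \<open>A family \<open>b\<close> as below is a balanced pairing of \<open>M\<close> and \<open>H Y\<close>; since \<open>\<Phi> (F Y)\<close> is their tensor
  product, it factors through a morphism \<open>F Y \<rightarrow> X\<close>.\<close>

lemma pairing_representable:
  assumes Y: "Y \<in> Ob B" and X: "X \<in> Ob D"
    and cl: "\<And>S f z. \<lbrakk>S \<in> J; f \<in> Hom B S Y; z \<in> carrier (PhO (FO S))\<rbrakk> \<Longrightarrow> b S f z \<in> carrier (PhO X)"
    and addz: "\<And>S f z z'. \<lbrakk>S \<in> J; f \<in> Hom B S Y; z \<in> carrier (PhO (FO S)); z' \<in> carrier (PhO (FO S))\<rbrakk> \<Longrightarrow>
      b S f (z \<oplus>\<^bsub>PhO (FO S)\<^esub> z') = b S f z \<oplus>\<^bsub>PhO X\<^esub> b S f z'"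
    and smz: "\<And>S f s z. \<lbrakk>S \<in> J; f \<in> Hom B S Y; s \<in> carrier A.R; z \<in> carrier (PhO (FO S))\<rbrakk> \<Longrightarrow>
      b S f (s \<odot>\<^bsub>PhO (FO S)\<^esub> z) = s \<odot>\<^bsub>PhO X\<^esub> b S f z"
    and addf: "\<And>S f g z. \<lbrakk>S \<in> J; f \<in> Hom B S Y; g \<in> Hom B S Y; z \<in> carrier (PhO (FO S))\<rbrakk> \<Longrightarrow>
      b S (Add B S Y f g) z = b S f z \<oplus>\<^bsub>PhO X\<^esub> b S g z"
    and bal: "\<And>S f d z. \<lbrakk>S \<in> J; f \<in> Hom B S Y; d \<in> Hom B S S; z \<in> carrier (PhO (FO S))\<rbrakk> \<Longrightarrow>
      b S (Cmp B S S Y f d) z = b S f (FP S S d z)"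
  shows "\<exists>e \<in> Hom D (FO Y) X. \<forall>S \<in> J. \<forall>f \<in> Hom B S Y. \<forall>z \<in> carrier (PhO (FO S)).
    fmp \<Phi> (FO Y) X e (FP S Y f z) = b S f z"
  using Y cl addz smz addf bal
proof (induction Y arbitrary: b rule: B.ss_induct)
  case (zero Z)
  interpret X: abelian_group "PhO X" using PhO_group X by blast
  have Z: "Z \<in> Ob B" using zero.hyps by (simp add: zero_obj_def)
  show ?case
  proof (intro bexI ballI)
    fix S f z assume S: "S \<in> J" "f \<in> Hom B S Z" "z \<in> carrier (PhO (FO S))"
    have f: "f = Zer B S Z" using B.zero_obj_to[OF zero.hyps] S by simp
    have "b S f z = b S f z \<oplus>\<^bsub>PhO X\<^esub> b S f z" using zero.prems(4)[OF S(1) S(2) S(2) S(3)] f S Z by simp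
    then have "b S f z = \<zero>\<^bsub>PhO X\<^esub>" using zero.prems(1)[OF S] by simp
    then show "fmp \<Phi> (FO Z) X (Zer D (FO Z) X) (FP S Z f z) = b S f z"
      using S X Z by (simp add: PhM_zer)
  qed (use X Z in auto)
next
  case (step Y S X' i1 i2 p1 p2)
  interpret X: abelian_group "PhO X" using PhO_group X by blast
  note BD = B.biprodD[OF step.hyps(2)] and S = step.hyps(1)
  note cl = step.prems(1) and addz = step.prems(2) and smz = step.prems(3) and addf = step.prems(4) and bal = step.prems(5)
  have "\<exists>e\<in>Hom D (FO Y) X. \<forall>S\<in>J. \<forall>f\<in>Hom B S Y. \<forall>z\<in>carrier (PhO (FO S)).
      fmp \<Phi> (FO Y) X e (FP S Y f z) = b S (Cmp B S Y X' i1 f) z"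
    by (rule step.IH) (use BD cl addz smz addf bal in \<open>simp_all add: B.cmp_add_right B.cmp_assoc\<close>)
  then obtain e1 where e1: "e1 \<in> Hom D (FO Y) X" "\<And>S f z. \<lbrakk>S\<in>J; f\<in>Hom B S Y; z\<in>carrier (PhO (FO S))\<rbrakk> \<Longrightarrow>
      fmp \<Phi> (FO Y) X e1 (FP S Y f z) = b S (Cmp B S Y X' i1 f) z" by blast
  \<comment> \<open>By balancedness the pairing on the summand \<open>S\<close> is determined by its
    values at the injection \<open>i2\<close>.\<close>
  have "\<exists>u \<in> Hom D (FO S) X. \<forall>x \<in> carrier (PhO (FO S)). fmp \<Phi> (FO S) X u x = b S i2 x"
    by (rule PhM_full) (use X S BD cl addz smz in auto)
  then obtain e2 where e2: "e2 \<in> Hom D (FO S) X" "\<And>z. z \<in> carrier (PhO (FO S)) \<Longrightarrow> fmp \<Phi> (FO S) X e2 z = b S i2 z" by blast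
  let ?e = "Add D (FO X') X (Cmp D (FO X') (FO Y) X e1 (fmp F X' Y p1)) (Cmp D (FO X') (FO S) X e2 (fmp F X' S p2))"
  show ?case
  proof (intro bexI ballI)
    fix S' f z assume S': "S' \<in> J" and f: "f \<in> Hom B S' X'" and z: "z \<in> carrier (PhO (FO S'))"
    let ?d = "Cmp B S' X' S p2 f"
    have dH: "?d \<in> Hom B S' S" using S' f BD by simp
    \<comment> \<open>For \<open>S' = S\<close> this is balancedness. Otherwise the morphism from
      \<open>S'\<close> to \<open>S\<close> is zero by Schur's lemma, and both sides vanish, the
      right one by additivity of the pairing.\<close>
    have 2: "fmp \<Phi> (FO S) X e2 (FP S' S ?d z) = b S' (Cmp B S' S X' i2 ?d) z"
    proof (cases "S' = S")
      case True
      then show ?thesis using e2 bal[of S i2 ?d z] S BD dH z by simp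
    next
      case False
      then have d0: "?d = Zer B S' S" using B.J_hom_zero S' S dH by blast
      let ?z = "Zer B S' X'"
      have zH: "?z \<in> Hom B S' X'" using S' BD by simp
      have "b S' ?z z = b S' ?z z \<oplus>\<^bsub>PhO X\<^esub> b S' ?z z" using addf[OF S' zH zH z] S' BD by simp
      then have "b S' ?z z = \<zero>\<^bsub>PhO X\<^esub>" using cl[OF S' zH z] by simp
      then show ?thesis unfolding d0 using S' S z X e2 BD by (simp add: PhM_zero)
    qed
    have "fmp \<Phi> (FO X') X ?e (FP S' X' f z) =
        fmp \<Phi> (FO Y) X e1 (FP X' Y p1 (FP S' X' f z)) \<oplus>\<^bsub>PhO X\<^esub> fmp \<Phi> (FO S) X e2 (FP X' S p2 (FP S' X' f z))"
      using S' f z X BD(1-7) e1(1) e2(1) by (simp add: PhM_sum PhM_cmp FP_def)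
    also have "FP X' Y p1 (FP S' X' f z) = FP S' Y (Cmp B S' X' Y p1 f) z" using FP_cmp S' f z BD by simp
    also have "FP X' S p2 (FP S' X' f z) = FP S' S ?d z" using FP_cmp S' f z BD by simp
    also have "fmp \<Phi> (FO Y) X e1 (FP S' Y (Cmp B S' X' Y p1 f) z) = b S' (Cmp B S' Y X' i1 (Cmp B S' X' Y p1 f)) z"
      using e1(2) S' f z BD by simp
    also have "b S' (Cmp B S' Y X' i1 (Cmp B S' X' Y p1 f)) z \<oplus>\<^bsub>PhO X\<^esub> fmp \<Phi> (FO S) X e2 (FP S' S ?d z) =
        b S' (Add B S' X' (Cmp B S' Y X' i1 (Cmp B S' X' Y p1 f)) (Cmp B S' S X' i2 ?d)) z"
      unfolding 2 using addf S' f z BD(1-7) by simp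
    also have "\<dots> = b S' f z" using B.biprod_decomp[OF step.hyps(2) B.J_Ob[OF S'] f] by simp
    finally show "fmp \<Phi> (FO X') X ?e (FP S' X' f z) = b S' f z" .
  qed (use e1 e2 BD X in auto)
qed

end

section \<open>Decomposition of modules over the triangular matrix ring\<close>

context fin_ss
begin

lemma R_zero_mult [simp]:
  "r \<in> carrier R \<Longrightarrow> \<zero>\<^bsub>R\<^esub> \<otimes>\<^bsub>R\<^esub> r = \<zero>\<^bsub>R\<^esub>" "r \<in> carrier R \<Longrightarrow> r \<otimes>\<^bsub>R\<^esub> \<zero>\<^bsub>R\<^esub> = \<zero>\<^bsub>R\<^esub>"
  by (auto simp: R_ops R_carrier intro!: restrict_ext)

end

context triple_modules
begin

interpretation M: abelian_group M by (rule M_group)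

abbreviation inB where "inB r \<equiv> (r, \<zero>\<^bsub>M\<^esub>, \<zero>\<^bsub>A.R\<^esub>)"
abbreviation inM where "inM m \<equiv> (\<zero>\<^bsub>B.R\<^esub>, m, \<zero>\<^bsub>A.R\<^esub>)"
abbreviation inA where "inA s \<equiv> (\<zero>\<^bsub>B.R\<^esub>, \<zero>\<^bsub>M\<^esub>, s)"

text \<open>The right-hand counterpart of \<open>M_unit'\<close>. In \<open>from_parts\<close> the
  two together show that \<open>M\<close> kills the part \<open>XZ\<close> and takes all its values
  in it.\<close>

lemma ra_unit:
  assumes "m \<in> carrier M"
  obtains e where "e \<in> carrier B.R" "ra m e = m"
proof
  let ?K = "{S \<in> J. m S \<noteq> \<zero>\<^bsub>PhO (FO S)\<^esub>}"
  show "B.unit_on ?K \<in> carrier B.R" using assms by (intro B.unit_on_carrier) (simp add: M_carrier)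
  show "ra m (B.unit_on ?K) = m"
    using assms by (intro ext) (auto simp: M_ops M_carrier B.unit_on_def extensional_def)
qed

lemma M_unit': "m \<in> carrier M \<Longrightarrow> \<exists>e \<in> carrier A.R. e \<odot>\<^bsub>M\<^esub> m = m"
  using M_unit A.unit_on_carrier by metis

context
  fixes Z :: "(('o \<Rightarrow> 'm) \<times> ('o \<Rightarrow> 'u) \<times> ('o \<Rightarrow> 'm), 'v) module"
  assumes Z: "nu_module RR Z"
begin

interpretation Z: abelian_group Z using nu_moduleD(1)[OF Z] .

lemma act_closed:
  "\<lbrakk>r \<in> carrier B.R; z \<in> carrier Z\<rbrakk> \<Longrightarrow> inB r \<odot>\<^bsub>Z\<^esub> z \<in> carrier Z"
  "\<lbrakk>m \<in> carrier M; z \<in> carrier Z\<rbrakk> \<Longrightarrow> inM m \<odot>\<^bsub>Z\<^esub> z \<in> carrier Z"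
  "\<lbrakk>s \<in> carrier A.R; z \<in> carrier Z\<rbrakk> \<Longrightarrow> inA s \<odot>\<^bsub>Z\<^esub> z \<in> carrier Z"
  using nu_moduleD(2)[OF Z] by simp_all

lemma act_split:
  assumes "r \<in> carrier B.R" "m \<in> carrier M" "s \<in> carrier A.R" "z \<in> carrier Z"
  shows "(r, m, s) \<odot>\<^bsub>Z\<^esub> z = inB r \<odot>\<^bsub>Z\<^esub> z \<oplus>\<^bsub>Z\<^esub> (inM m \<odot>\<^bsub>Z\<^esub> z \<oplus>\<^bsub>Z\<^esub> inA s \<odot>\<^bsub>Z\<^esub> z)"
  using nu_moduleD(3)[OF Z, of "inB r" "(\<zero>\<^bsub>B.R\<^esub>, m, s)" z] nu_moduleD(3)[OF Z, of "inM m" "inA s" z] assms by simp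

lemma act_sum:
  "\<lbrakk>m \<in> carrier M; m' \<in> carrier M; z \<in> carrier Z\<rbrakk> \<Longrightarrow> inM (m \<oplus>\<^bsub>M\<^esub> m') \<odot>\<^bsub>Z\<^esub> z = inM m \<odot>\<^bsub>Z\<^esub> z \<oplus>\<^bsub>Z\<^esub> inM m' \<odot>\<^bsub>Z\<^esub> z"
  "\<lbrakk>r \<in> carrier B.R; r' \<in> carrier B.R; z \<in> carrier Z\<rbrakk> \<Longrightarrow> inB (r \<oplus>\<^bsub>B.R\<^esub> r') \<odot>\<^bsub>Z\<^esub> z = inB r \<odot>\<^bsub>Z\<^esub> z \<oplus>\<^bsub>Z\<^esub> inB r' \<odot>\<^bsub>Z\<^esub> z"
  "\<lbrakk>s \<in> carrier A.R; s' \<in> carrier A.R; z \<in> carrier Z\<rbrakk> \<Longrightarrow> inA (s \<oplus>\<^bsub>A.R\<^esub> s') \<odot>\<^bsub>Z\<^esub> z = inA s \<odot>\<^bsub>Z\<^esub> z \<oplus>\<^bsub>Z\<^esub> inA s' \<odot>\<^bsub>Z\<^esub> z"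
  using nu_moduleD(3)[OF Z, of "inM m" "inM m'" z] nu_moduleD(3)[OF Z, of "inB r" "inB r'" z]
    nu_moduleD(3)[OF Z, of "inA s" "inA s'" z] by simp_all

lemma act_mult:
  assumes "r \<in> carrier B.R" "r' \<in> carrier B.R" "m \<in> carrier M" "s \<in> carrier A.R" "s' \<in> carrier A.R" "z \<in> carrier Z"
  shows "inB r \<odot>\<^bsub>Z\<^esub> (inB r' \<odot>\<^bsub>Z\<^esub> z) = inB (r \<otimes>\<^bsub>B.R\<^esub> r') \<odot>\<^bsub>Z\<^esub> z"
    "inA s \<odot>\<^bsub>Z\<^esub> (inA s' \<odot>\<^bsub>Z\<^esub> z) = inA (s \<otimes>\<^bsub>A.R\<^esub> s') \<odot>\<^bsub>Z\<^esub> z"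
    "inM m \<odot>\<^bsub>Z\<^esub> (inB r \<odot>\<^bsub>Z\<^esub> z) = inM (ra m r) \<odot>\<^bsub>Z\<^esub> z"
    "inA s \<odot>\<^bsub>Z\<^esub> (inM m \<odot>\<^bsub>Z\<^esub> z) = inM (s \<odot>\<^bsub>M\<^esub> m) \<odot>\<^bsub>Z\<^esub> z"
    "inB r \<odot>\<^bsub>Z\<^esub> (inA s \<odot>\<^bsub>Z\<^esub> z) = \<zero>\<^bsub>Z\<^esub>" "inA s \<odot>\<^bsub>Z\<^esub> (inB r \<odot>\<^bsub>Z\<^esub> z) = \<zero>\<^bsub>Z\<^esub>"
    "inB r \<odot>\<^bsub>Z\<^esub> (inM m \<odot>\<^bsub>Z\<^esub> z) = \<zero>\<^bsub>Z\<^esub>" "inM m \<odot>\<^bsub>Z\<^esub> (inA s \<odot>\<^bsub>Z\<^esub> z) = \<zero>\<^bsub>Z\<^esub>"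
  using assms RR.smult_zero(1)[OF Z, of z] M_smult_closed ra_closed
  by (simp_all add: nu_moduleD(5)[OF Z, symmetric] ra_zero M_zero_smult del: RR_simps(2))
    (simp_all add: ra_zero M_zero_smult)

text \<open>Annihilation by the opposite diagonal ring singles out the diagonal parts without an
  identity matrix; by \<open>XP_unit\<close> and \<open>YP_unit\<close> every element of a part is
  then fixed by some element of its own ring.\<close>

definition XP where "XP = {z \<in> carrier Z. \<forall>r \<in> carrier B.R. inB r \<odot>\<^bsub>Z\<^esub> z = \<zero>\<^bsub>Z\<^esub>}"
definition YP where "YP = {z \<in> carrier Z. \<forall>s \<in> carrier A.R. inA s \<odot>\<^bsub>Z\<^esub> z = \<zero>\<^bsub>Z\<^esub>}"

text \<open>\<open>r\<close> and \<open>s\<close> are the diagonal entries of a local unit of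
  \<open>z\<close>.\<close>

lemma unit_decomp:
  assumes z: "z \<in> carrier Z"
  obtains r s where "r \<in> carrier B.R" "s \<in> carrier A.R" "z = inB r \<odot>\<^bsub>Z\<^esub> z \<oplus>\<^bsub>Z\<^esub> inA s \<odot>\<^bsub>Z\<^esub> z"
proof -
  obtain e where e: "e \<in> RE" "e \<odot>\<^bsub>Z\<^esub> z = z" using RR.nu_unit[OF Z z] by blast
  then obtain K K' where K: "finite K" "finite K'" "e = (B.unit_on K, \<zero>\<^bsub>M\<^esub>, A.unit_on K')" unfolding RE_def by blast
  note c = B.unit_on_carrier[OF K(1)] A.unit_on_carrier[OF K(2)]
  have "\<zero>\<^bsub>RR\<^esub> \<odot>\<^bsub>Z\<^esub> z = \<zero>\<^bsub>Z\<^esub>" using RR.smult_zero(1)[OF Z z] .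
  then have "z = inB (B.unit_on K) \<odot>\<^bsub>Z\<^esub> z \<oplus>\<^bsub>Z\<^esub> inA (A.unit_on K') \<odot>\<^bsub>Z\<^esub> z"
    using act_split[OF c(1) M.zero_closed c(2) z] e K act_closed c z by simp
  then show ?thesis using that c by blast
qed

lemma XP_YP_parts:
  assumes z: "z \<in> carrier Z"
  shows "r \<in> carrier B.R \<Longrightarrow> inB r \<odot>\<^bsub>Z\<^esub> z \<in> YP" "s \<in> carrier A.R \<Longrightarrow> inA s \<odot>\<^bsub>Z\<^esub> z \<in> XP"
    "m \<in> carrier M \<Longrightarrow> inM m \<odot>\<^bsub>Z\<^esub> z \<in> XP"
  using act_closed[OF _ z] act_mult(5)[OF _ B.R.A.zero_closed M.zero_closed _ A.R.A.zero_closed z]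
    act_mult(6)[OF _ B.R.A.zero_closed M.zero_closed _ A.R.A.zero_closed z]
    act_mult(7)[OF _ B.R.A.zero_closed _ A.R.A.zero_closed A.R.A.zero_closed z]
  by (auto simp: XP_def YP_def)

lemma XP_sub: "XP \<subseteq> carrier Z" and YP_sub: "YP \<subseteq> carrier Z"
  by (auto simp: XP_def YP_def)

lemma act_zero:
  "r \<in> carrier B.R \<Longrightarrow> inB r \<odot>\<^bsub>Z\<^esub> \<zero>\<^bsub>Z\<^esub> = \<zero>\<^bsub>Z\<^esub>" "m \<in> carrier M \<Longrightarrow> inM m \<odot>\<^bsub>Z\<^esub> \<zero>\<^bsub>Z\<^esub> = \<zero>\<^bsub>Z\<^esub>"
  "s \<in> carrier A.R \<Longrightarrow> inA s \<odot>\<^bsub>Z\<^esub> \<zero>\<^bsub>Z\<^esub> = \<zero>\<^bsub>Z\<^esub>"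
  using RR.smult_zero(2)[OF Z] by simp_all

lemma act_add:
  assumes "z \<in> carrier Z" "z' \<in> carrier Z"
  shows "r \<in> carrier B.R \<Longrightarrow> inB r \<odot>\<^bsub>Z\<^esub> (z \<oplus>\<^bsub>Z\<^esub> z') = inB r \<odot>\<^bsub>Z\<^esub> z \<oplus>\<^bsub>Z\<^esub> inB r \<odot>\<^bsub>Z\<^esub> z'"
    "m \<in> carrier M \<Longrightarrow> inM m \<odot>\<^bsub>Z\<^esub> (z \<oplus>\<^bsub>Z\<^esub> z') = inM m \<odot>\<^bsub>Z\<^esub> z \<oplus>\<^bsub>Z\<^esub> inM m \<odot>\<^bsub>Z\<^esub> z'"
    "s \<in> carrier A.R \<Longrightarrow> inA s \<odot>\<^bsub>Z\<^esub> (z \<oplus>\<^bsub>Z\<^esub> z') = inA s \<odot>\<^bsub>Z\<^esub> z \<oplus>\<^bsub>Z\<^esub> inA s \<odot>\<^bsub>Z\<^esub> z'"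
  using nu_moduleD(4)[OF Z] assms by simp_all

lemma XP_add: "\<lbrakk>x \<in> XP; y \<in> XP\<rbrakk> \<Longrightarrow> x \<oplus>\<^bsub>Z\<^esub> y \<in> XP" and YP_add: "\<lbrakk>x \<in> YP; y \<in> YP\<rbrakk> \<Longrightarrow> x \<oplus>\<^bsub>Z\<^esub> y \<in> YP"
  by (auto simp: XP_def YP_def act_add)

lemma XP_zero: "\<zero>\<^bsub>Z\<^esub> \<in> XP" and YP_zero: "\<zero>\<^bsub>Z\<^esub> \<in> YP"
  by (auto simp: XP_def YP_def act_zero)

lemma XP_neg: "x \<in> XP \<Longrightarrow> \<ominus>\<^bsub>Z\<^esub> x \<in> XP" and YP_neg: "x \<in> YP \<Longrightarrow> \<ominus>\<^bsub>Z\<^esub> x \<in> YP"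
  using RR.smult_zero(4)[OF Z] by (auto simp: XP_def YP_def)

lemma XP_unit:
  assumes "x \<in> XP"
  obtains s where "s \<in> carrier A.R" "inA s \<odot>\<^bsub>Z\<^esub> x = x"
proof -
  obtain r s where rs: "r \<in> carrier B.R" "s \<in> carrier A.R" "x = inB r \<odot>\<^bsub>Z\<^esub> x \<oplus>\<^bsub>Z\<^esub> inA s \<odot>\<^bsub>Z\<^esub> x"
    using unit_decomp assms XP_sub by blast
  have "inB r \<odot>\<^bsub>Z\<^esub> x = \<zero>\<^bsub>Z\<^esub>" using assms rs(1) by (simp add: XP_def)
  then have "inB r \<odot>\<^bsub>Z\<^esub> x \<oplus>\<^bsub>Z\<^esub> inA s \<odot>\<^bsub>Z\<^esub> x = inA s \<odot>\<^bsub>Z\<^esub> x"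
    using act_closed(3)[OF rs(2)] assms XP_sub by auto
  then have "inA s \<odot>\<^bsub>Z\<^esub> x = x" using trans[OF _ rs(3)[symmetric]] by metis
  then show ?thesis using that rs by blast
qed

lemma YP_unit:
  assumes "x \<in> YP"
  obtains r where "r \<in> carrier B.R" "inB r \<odot>\<^bsub>Z\<^esub> x = x"
proof -
  obtain r s where rs: "r \<in> carrier B.R" "s \<in> carrier A.R" "x = inB r \<odot>\<^bsub>Z\<^esub> x \<oplus>\<^bsub>Z\<^esub> inA s \<odot>\<^bsub>Z\<^esub> x"
    using unit_decomp assms YP_sub by blast
  have "inA s \<odot>\<^bsub>Z\<^esub> x = \<zero>\<^bsub>Z\<^esub>" using assms rs(2) by (simp add: YP_def)
  then have "inB r \<odot>\<^bsub>Z\<^esub> x \<oplus>\<^bsub>Z\<^esub> inA s \<odot>\<^bsub>Z\<^esub> x = inB r \<odot>\<^bsub>Z\<^esub> x"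
    using act_closed(1)[OF rs(1)] assms YP_sub by auto
  then have "inB r \<odot>\<^bsub>Z\<^esub> x = x" using trans[OF _ rs(3)[symmetric]] by metis
  then show ?thesis using that rs by blast
qed

lemma XP_act:
  assumes "x \<in> XP"
  shows "r \<in> carrier B.R \<Longrightarrow> inB r \<odot>\<^bsub>Z\<^esub> x = \<zero>\<^bsub>Z\<^esub>" "m \<in> carrier M \<Longrightarrow> inM m \<odot>\<^bsub>Z\<^esub> x = \<zero>\<^bsub>Z\<^esub>"
proof -
  show "r \<in> carrier B.R \<Longrightarrow> inB r \<odot>\<^bsub>Z\<^esub> x = \<zero>\<^bsub>Z\<^esub>" using assms by (simp add: XP_def)
  assume m: "m \<in> carrier M"
  obtain s where s: "s \<in> carrier A.R" "inA s \<odot>\<^bsub>Z\<^esub> x = x" using XP_unit assms by blast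
  show "inM m \<odot>\<^bsub>Z\<^esub> x = \<zero>\<^bsub>Z\<^esub>"
    using act_mult(8)[OF B.R.A.zero_closed B.R.A.zero_closed m s(1) s(1), of x] s assms XP_sub by auto
qed

lemma YP_act: "\<lbrakk>y \<in> YP; s \<in> carrier A.R\<rbrakk> \<Longrightarrow> inA s \<odot>\<^bsub>Z\<^esub> y = \<zero>\<^bsub>Z\<^esub>"
  by (simp add: YP_def)

lemma XP_YP_inter: "\<lbrakk>z \<in> XP; z \<in> YP\<rbrakk> \<Longrightarrow> z = \<zero>\<^bsub>Z\<^esub>"
  using XP_unit YP_act by metis

lemma XP_YP_unique:
  assumes "x \<in> XP" "x' \<in> XP" "y \<in> YP" "y' \<in> YP" and eq: "x \<oplus>\<^bsub>Z\<^esub> y = x' \<oplus>\<^bsub>Z\<^esub> y'"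
  shows "x = x' \<and> y = y'"
proof -
  have c: "x \<in> carrier Z" "x' \<in> carrier Z" "y \<in> carrier Z" "y' \<in> carrier Z" using assms XP_sub YP_sub by auto
  let ?w = "(\<ominus>\<^bsub>Z\<^esub> x') \<oplus>\<^bsub>Z\<^esub> x"
  have "?w \<oplus>\<^bsub>Z\<^esub> y = (\<ominus>\<^bsub>Z\<^esub> x') \<oplus>\<^bsub>Z\<^esub> (x' \<oplus>\<^bsub>Z\<^esub> y')" using c eq by (simp add: Z.a_assoc)
  also have "\<dots> = y'" using c by (simp add: Z.a_assoc[symmetric] Z.l_neg)
  finally have wy: "?w \<oplus>\<^bsub>Z\<^esub> y = y'" .
  then have "?w = y' \<oplus>\<^bsub>Z\<^esub> (\<ominus>\<^bsub>Z\<^esub> y)" using c by (metis Z.a_assoc Z.a_closed Z.a_inv_closed Z.r_neg Z.r_zero)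
  then have "?w \<in> YP" using YP_add YP_neg assms by simp
  moreover have "?w \<in> XP" using XP_add XP_neg assms by simp
  ultimately have w0: "?w = \<zero>\<^bsub>Z\<^esub>" using XP_YP_inter by blast
  then have "y = y'" using wy c by simp
  moreover have "x = x'" using w0 c Z.minus_equality[of "\<ominus>\<^bsub>Z\<^esub> x'" x] by (metis Z.minus_minus Z.a_inv_closed)
  ultimately show ?thesis by blast
qed

lemma restrict_simps:
  "carrier (restrict_right A' M' Z L) = L" "x \<oplus>\<^bsub>restrict_right A' M' Z L\<^esub> y = x \<oplus>\<^bsub>Z\<^esub> y"
  "\<zero>\<^bsub>restrict_right A' M' Z L\<^esub> = \<zero>\<^bsub>Z\<^esub>" "s \<odot>\<^bsub>restrict_right A' M' Z L\<^esub> x = (\<zero>\<^bsub>A'\<^esub>, \<zero>\<^bsub>M'\<^esub>, s) \<odot>\<^bsub>Z\<^esub> x"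
  "carrier (restrict_left M' B' Z L) = L" "x \<oplus>\<^bsub>restrict_left M' B' Z L\<^esub> y = x \<oplus>\<^bsub>Z\<^esub> y"
  "\<zero>\<^bsub>restrict_left M' B' Z L\<^esub> = \<zero>\<^bsub>Z\<^esub>" "r \<odot>\<^bsub>restrict_left M' B' Z L\<^esub> x = (r, \<zero>\<^bsub>M'\<^esub>, \<zero>\<^bsub>B'\<^esub>) \<odot>\<^bsub>Z\<^esub> x"
  by (simp_all add: restrict_right_def restrict_left_def)

abbreviation XN where "XN \<equiv> restrict_right B.R M Z"
abbreviation YN where "YN \<equiv> restrict_left M A.R Z"

lemma restrict_group:
  assumes "L \<subseteq> carrier Z" "\<zero>\<^bsub>Z\<^esub> \<in> L" "\<And>x y. \<lbrakk>x \<in> L; y \<in> L\<rbrakk> \<Longrightarrow> x \<oplus>\<^bsub>Z\<^esub> y \<in> L" "\<And>x. x \<in> L \<Longrightarrow> \<ominus>\<^bsub>Z\<^esub> x \<in> L"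
    and N: "carrier N = L" "\<And>x y. x \<oplus>\<^bsub>N\<^esub> y = x \<oplus>\<^bsub>Z\<^esub> y" "\<zero>\<^bsub>N\<^esub> = \<zero>\<^bsub>Z\<^esub>"
  shows "abelian_group N"
proof (rule abelian_groupI)
  note s = assms(1)[THEN subsetD]
  fix x assume "x \<in> carrier N"
  then show "\<exists>y\<in>carrier N. y \<oplus>\<^bsub>N\<^esub> x = \<zero>\<^bsub>N\<^esub>"
    using assms(4) s by (intro bexI[of _ "\<ominus>\<^bsub>Z\<^esub> x"]) (auto simp: N Z.l_neg)
qed (use assms(1-3) in \<open>auto simp: N Z.a_ac subset_iff\<close>)

lemma XN_module: "nu_module A.R (XN XP)"
proof (rule nu_moduleI)
  show "abelian_group (XN XP)"
    by (rule restrict_group[OF XP_sub XP_zero XP_add XP_neg]) (simp_all add: restrict_simps)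
  fix x assume "x \<in> carrier (XN XP)"
  then show "\<exists>a\<in>carrier A.R. a \<odot>\<^bsub>XN XP\<^esub> x = x" using XP_unit by (auto simp: restrict_simps)
qed (use XP_sub XP_YP_parts(2) B.R.A.zero_closed M.zero_closed in
    \<open>auto simp: restrict_simps act_sum act_add act_mult(2)[OF B.R.A.zero_closed B.R.A.zero_closed M.zero_closed] subset_iff\<close>)

lemma YN_module: "nu_module B.R (YN YP)"
proof (rule nu_moduleI)
  show "abelian_group (YN YP)"
    by (rule restrict_group[OF YP_sub YP_zero YP_add YP_neg]) (simp_all add: restrict_simps)
  fix x assume "x \<in> carrier (YN YP)"
  then show "\<exists>a\<in>carrier B.R. a \<odot>\<^bsub>YN YP\<^esub> x = x" using YP_unit by (auto simp: restrict_simps)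
qed (use YP_sub XP_YP_parts(1) A.R.A.zero_closed M.zero_closed in
    \<open>auto simp: restrict_simps act_sum act_add act_mult(1)[OF _ _ M.zero_closed A.R.A.zero_closed A.R.A.zero_closed] subset_iff\<close>)

section \<open>Finite length of the two diagonal parts\<close>

lemma sum_submod:
  assumes H: "nu_submod RR Z H" and K: "K \<subseteq> carrier Z" "\<zero>\<^bsub>Z\<^esub> \<in> K" "\<And>x y. \<lbrakk>x \<in> K; y \<in> K\<rbrakk> \<Longrightarrow> x \<oplus>\<^bsub>Z\<^esub> y \<in> K"
    and act: "\<And>a k. \<lbrakk>a \<in> carrier RR; k \<in> K\<rbrakk> \<Longrightarrow> \<exists>h \<in> H. \<exists>k' \<in> K. a \<odot>\<^bsub>Z\<^esub> k = h \<oplus>\<^bsub>Z\<^esub> k'"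
  shows "nu_submod RR Z {h \<oplus>\<^bsub>Z\<^esub> k | h k. h \<in> H \<and> k \<in> K}" (is "nu_submod RR Z ?L")
proof (rule RR.nu_submodI[OF Z])
  note HD = RR.nu_submodD[OF Z H] and ZD = nu_moduleD[OF Z]
  have c: "h \<in> H \<Longrightarrow> h \<in> carrier Z" "k \<in> K \<Longrightarrow> k \<in> carrier Z" for h k using HD K by auto
  show "?L \<subseteq> carrier Z" using c by auto
  have "\<zero>\<^bsub>Z\<^esub> = \<zero>\<^bsub>Z\<^esub> \<oplus>\<^bsub>Z\<^esub> \<zero>\<^bsub>Z\<^esub>" by simp
  then show "\<zero>\<^bsub>Z\<^esub> \<in> ?L" using HD(2) K(2) by blast
  fix x y assume "x \<in> ?L" "y \<in> ?L"
  then obtain h k h' k' where xy: "x = h \<oplus>\<^bsub>Z\<^esub> k" "y = h' \<oplus>\<^bsub>Z\<^esub> k'" "h \<in> H" "h' \<in> H" "k \<in> K" "k' \<in> K" by blast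
  then have "x \<oplus>\<^bsub>Z\<^esub> y = (h \<oplus>\<^bsub>Z\<^esub> h') \<oplus>\<^bsub>Z\<^esub> (k \<oplus>\<^bsub>Z\<^esub> k')" using c by (simp add: Z.a_ac)
  then show "x \<oplus>\<^bsub>Z\<^esub> y \<in> ?L" using HD(3) K(3) xy by blast
next
  note HD = RR.nu_submodD[OF Z H] and ZD = nu_moduleD[OF Z]
  have c: "h \<in> H \<Longrightarrow> h \<in> carrier Z" "k \<in> K \<Longrightarrow> k \<in> carrier Z" for h k using HD K by auto
  fix a x assume a: "a \<in> carrier RR" and "x \<in> ?L"
  then obtain h k where x: "x = h \<oplus>\<^bsub>Z\<^esub> k" "h \<in> H" "k \<in> K" by blast
  obtain h' k' where h': "h' \<in> H" "k' \<in> K" "a \<odot>\<^bsub>Z\<^esub> k = h' \<oplus>\<^bsub>Z\<^esub> k'" using act a x by blast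
  have ah: "a \<odot>\<^bsub>Z\<^esub> h \<in> H" using HD(4) a x by blast
  have "a \<odot>\<^bsub>Z\<^esub> x = (a \<odot>\<^bsub>Z\<^esub> h \<oplus>\<^bsub>Z\<^esub> h') \<oplus>\<^bsub>Z\<^esub> k'" using ZD(4)[OF a] x h' ah c by (simp add: Z.a_assoc)
  then show "a \<odot>\<^bsub>Z\<^esub> x \<in> ?L" using HD(3)[OF ah h'(1)] h' by blast
qed

text \<open>The modular law: as \<open>K\<close> contains \<open>H \<inter> Q\<close> and lies in
  \<open>Q\<close>, the sum of \<open>H\<close> and \<open>K\<close> meets \<open>Q\<close> exactly
  in \<open>K\<close>. So it equals neither \<open>H\<close> nor \<open>H'\<close>.\<close>

lemma sum_between:
  assumes H: "nu_submod RR Z H" and H': "nu_submod RR Z H'" "H \<subseteq> H'"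
    and K: "\<zero>\<^bsub>Z\<^esub> \<in> K" "\<And>x. x \<in> K \<Longrightarrow> \<ominus>\<^bsub>Z\<^esub> x \<in> K" "\<And>x y. \<lbrakk>x \<in> K; y \<in> K\<rbrakk> \<Longrightarrow> x \<oplus>\<^bsub>Z\<^esub> y \<in> K" "H \<inter> Q \<subset> K" "K \<subset> H' \<inter> Q"
    and Q: "Q \<subseteq> carrier Z" "\<And>x. x \<in> Q \<Longrightarrow> \<ominus>\<^bsub>Z\<^esub> x \<in> Q" "\<And>x y. \<lbrakk>x \<in> Q; y \<in> Q\<rbrakk> \<Longrightarrow> x \<oplus>\<^bsub>Z\<^esub> y \<in> Q"
  shows "H \<subset> {h \<oplus>\<^bsub>Z\<^esub> k | h k. h \<in> H \<and> k \<in> K}" "{h \<oplus>\<^bsub>Z\<^esub> k | h k. h \<in> H \<and> k \<in> K} \<subset> H'"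
proof -
  note HD = RR.nu_submodD[OF Z H] and H'D = RR.nu_submodD[OF Z H'(1)]
  have c: "h \<in> H' \<Longrightarrow> h \<in> carrier Z" for h using H'D by auto
  have KH: "k \<in> K \<Longrightarrow> k \<in> H' \<and> k \<in> Q" for k using K(5) by blast
  let ?L = "{h \<oplus>\<^bsub>Z\<^esub> k | h k. h \<in> H \<and> k \<in> K}"
  have HL: "H \<subseteq> ?L"
  proof
    fix h assume h: "h \<in> H"
    then have "h = h \<oplus>\<^bsub>Z\<^esub> \<zero>\<^bsub>Z\<^esub>" using HD(1) by auto
    then show "h \<in> ?L" using h K(1) by blast
  qed
  obtain k where k: "k \<in> K" "k \<notin> H \<inter> Q" using K(4) by blast
  have "k = \<zero>\<^bsub>Z\<^esub> \<oplus>\<^bsub>Z\<^esub> k" using KH c k by simp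
  then have "k \<in> ?L" using k HD(2) by blast
  moreover have "k \<notin> H" using k KH by blast
  ultimately show "H \<subset> ?L" using HL by blast
  have "?L \<subseteq> H'" using H'D(3) H'(2) KH by blast
  moreover obtain x where x: "x \<in> H'" "x \<in> Q" "x \<notin> K" using K(5) by blast
  have "x \<notin> ?L"
  proof
    assume "x \<in> ?L"
    then obtain h k where hk: "x = h \<oplus>\<^bsub>Z\<^esub> k" "h \<in> H" "k \<in> K" by blast
    have cc: "h \<in> carrier Z" "k \<in> carrier Z" using hk KH c H'(2) by auto
    have "h = x \<oplus>\<^bsub>Z\<^esub> (\<ominus>\<^bsub>Z\<^esub> k)" unfolding hk(1) using cc by (simp add: Z.a_assoc Z.r_neg)
    then have "h \<in> Q" using Q x KH hk by blast
    then have "h \<in> K" using hk K(4) by blast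
    then show False using x hk K(3) by blast
  qed
  ultimately show "?L \<subset> H'" using x by blast
qed

text \<open>In each composition step exactly one of the two parts grows. A submodule strictly inside
  the growth of that part would, added to \<open>H\<close>, give a submodule strictly between
  \<open>H\<close> and \<open>H'\<close>; this is where \<open>sum_between\<close> enters.\<close>

lemma fl_parts:
  assumes "fl RR Z H"
  shows "fl A.R (XN XP) (H \<inter> XP) \<and> fl B.R (YN YP) (H \<inter> YP)"
  using assms
proof induction
  case zero
  have "{\<zero>\<^bsub>Z\<^esub>} \<inter> XP = {\<zero>\<^bsub>XN XP\<^esub>}" "{\<zero>\<^bsub>Z\<^esub>} \<inter> YP = {\<zero>\<^bsub>YN YP\<^esub>}"
    using XP_zero YP_zero by (auto simp: restrict_simps)
  then show ?case using fl.zero by metis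
next
  case (step H H')
  note H = RR.fl_submod[OF Z step.hyps(1)] and H' = step.hyps(2)
  note HD = RR.nu_submodD[OF Z H] and H'D = RR.nu_submodD[OF Z H']
  have sX: "nu_submod A.R (XN XP) (L \<inter> XP)" if "nu_submod RR Z L" for L
    by (rule A.R.nu_submodI[OF XN_module])
      (use RR.nu_submodD[OF Z that] XP_zero XP_add XP_YP_parts(2) XP_sub in \<open>auto simp: restrict_simps\<close>)
  have sY: "nu_submod B.R (YN YP) (L \<inter> YP)" if "nu_submod RR Z L" for L
    by (rule B.R.nu_submodI[OF YN_module])
      (use RR.nu_submodD[OF Z that] YP_zero YP_add XP_YP_parts(1) YP_sub in \<open>auto simp: restrict_simps\<close>)
  have dec: "\<exists>x \<in> L \<inter> XP. \<exists>y \<in> L \<inter> YP. z = y \<oplus>\<^bsub>Z\<^esub> x" if L: "nu_submod RR Z L" and z: "z \<in> L" for L z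
  proof -
    note LD = RR.nu_submodD[OF Z L]
    have zZ: "z \<in> carrier Z" using z LD by blast
    obtain r s where rs: "r \<in> carrier B.R" "s \<in> carrier A.R" "z = inB r \<odot>\<^bsub>Z\<^esub> z \<oplus>\<^bsub>Z\<^esub> inA s \<odot>\<^bsub>Z\<^esub> z"
      using unit_decomp[OF zZ] .
    moreover have "inB r \<odot>\<^bsub>Z\<^esub> z \<in> L \<inter> YP" "inA s \<odot>\<^bsub>Z\<^esub> z \<in> L \<inter> XP"
      using LD(4)[of "inB r" z] LD(4)[of "inA s" z] XP_YP_parts(1,2) zZ z rs by auto
    ultimately show ?thesis by blast
  qed
  show ?case
  proof (cases "H' \<inter> XP = H \<inter> XP")
    case False
    let ?L = "{h \<oplus>\<^bsub>Z\<^esub> k | h k. h \<in> H \<and> k \<in> H' \<inter> XP}"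
    \<comment> \<open>Of a matrix only the entry from \<open>A.R\<close> acts on elements of
      \<open>XP\<close>, so subsets of \<open>XP\<close> stable under \<open>A.R\<close> can be used
      in \<open>sum_submod\<close>.\<close>
    have actX: "\<exists>h\<in>H. \<exists>k'\<in>K. a \<odot>\<^bsub>Z\<^esub> k = h \<oplus>\<^bsub>Z\<^esub> k'"
      if a: "a \<in> carrier RR" and k: "k \<in> K" and K: "K \<subseteq> XP" "\<And>s k. \<lbrakk>s \<in> carrier A.R; k \<in> K\<rbrakk> \<Longrightarrow> inA s \<odot>\<^bsub>Z\<^esub> k \<in> K" for a k K
    proof -
      obtain r m s where rms: "a = (r, m, s)" "r \<in> carrier B.R" "m \<in> carrier M" "s \<in> carrier A.R" using a by (cases a) auto
      have kX: "k \<in> XP" "k \<in> carrier Z" using k K XP_sub by auto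
      have "a \<odot>\<^bsub>Z\<^esub> k = \<zero>\<^bsub>Z\<^esub> \<oplus>\<^bsub>Z\<^esub> inA s \<odot>\<^bsub>Z\<^esub> k"
        using act_split[OF rms(2-4) kX(2)] rms XP_act[OF kX(1)] act_closed(3) kX by simp
      then show ?thesis using HD(2) K(2) rms k by blast
    qed
    have L: "nu_submod RR Z ?L"
    proof (rule sum_submod[OF H])
      show "\<exists>h\<in>H. \<exists>k'\<in>H' \<inter> XP. a \<odot>\<^bsub>Z\<^esub> k = h \<oplus>\<^bsub>Z\<^esub> k'" if "a \<in> carrier RR" "k \<in> H' \<inter> XP" for a k
        by (rule actX[OF that]) (use H'D(4)[of "inA _"] XP_YP_parts(2) XP_sub in auto)
    qed (use H'D XP_zero XP_add in auto)
    have "H \<subset> ?L"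
    proof -
      obtain k where k: "k \<in> H' \<inter> XP" "k \<notin> H" using False step.hyps(3) by blast
      have "k = \<zero>\<^bsub>Z\<^esub> \<oplus>\<^bsub>Z\<^esub> k" using k H'D by auto
      then have "k \<in> ?L" using HD(2) k by blast
      moreover have "h \<in> ?L" if "h \<in> H" for h
      proof -
        have "h = h \<oplus>\<^bsub>Z\<^esub> \<zero>\<^bsub>Z\<^esub>" using that HD by auto
        then show ?thesis using that H'D(2) XP_zero by blast
      qed
      ultimately show ?thesis using k by blast
    qed
    moreover have "?L \<subseteq> H'" using H'D(3) step.hyps(3) by blast
    ultimately have LH: "?L = H'" using step.hyps(4)[OF L] by blast
    \<comment> \<open>Now \<open>H'\<close> is \<open>H\<close> plus elements of \<open>XP\<close>.
      Multiplying \<open>y = h + k\<close> by a local unit of \<open>y\<close> in \<open>B.R\<close>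
      removes \<open>k\<close> and leaves an element of \<open>H\<close>.\<close>
    have "H' \<inter> YP \<subseteq> H"
    proof
      fix y assume y: "y \<in> H' \<inter> YP"
      then obtain h k where hk: "y = h \<oplus>\<^bsub>Z\<^esub> k" "h \<in> H" "k \<in> XP" using LH by blast
      obtain r where r: "r \<in> carrier B.R" "inB r \<odot>\<^bsub>Z\<^esub> y = y" using YP_unit y by blast
      have c: "h \<in> carrier Z" "k \<in> carrier Z" using hk HD XP_sub by auto
      have "inB r \<odot>\<^bsub>Z\<^esub> h \<in> H" using HD(4)[of "inB r"] hk r by simp
      moreover have "y = inB r \<odot>\<^bsub>Z\<^esub> h"
        using r(2) unfolding hk(1) act_add(1)[OF c r(1)] using XP_act(1)[OF hk(3) r(1)] act_closed(1)[OF r(1) c(1)] by simp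
      ultimately show "y \<in> H" by simp
    qed
    then have Y: "H' \<inter> YP = H \<inter> YP" using step.hyps(3) by blast
    have "fl A.R (XN XP) (H' \<inter> XP)"
    proof (rule fl.step[OF step.IH[THEN conjunct1] sX[OF H']])
      show "H \<inter> XP \<subset> H' \<inter> XP" using False step.hyps(3) by blast
      fix K assume K: "nu_submod A.R (XN XP) K" "H \<inter> XP \<subset> K" "K \<subset> H' \<inter> XP"
      note KD = A.R.nu_submodD[OF XN_module K(1), unfolded restrict_simps]
      have neg: "\<ominus>\<^bsub>Z\<^esub> k \<in> K" if "k \<in> K" for k
      proof -
        have kX: "k \<in> carrier Z" "k \<in> XP" using that KD XP_sub by auto
        obtain s where s: "s \<in> carrier A.R" "inA s \<odot>\<^bsub>Z\<^esub> k = k" using XP_unit kX by blast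
        have "inA (\<ominus>\<^bsub>A.R\<^esub> s) \<odot>\<^bsub>Z\<^esub> k \<oplus>\<^bsub>Z\<^esub> k = \<zero>\<^bsub>Z\<^esub>"
          using act_sum(3)[OF A.R.A.a_inv_closed[OF s(1)] s(1) kX(1)] s RR.smult_zero(1)[OF Z kX(1)] by (simp add: A.R.A.l_neg)
        then have "\<ominus>\<^bsub>Z\<^esub> k = inA (\<ominus>\<^bsub>A.R\<^esub> s) \<odot>\<^bsub>Z\<^esub> k" using Z.minus_equality kX act_closed(3) s by simp
        then show ?thesis using KD(4) s that by simp
      qed
      have "nu_submod RR Z {h \<oplus>\<^bsub>Z\<^esub> k | h k. h \<in> H \<and> k \<in> K}"
        by (rule sum_submod[OF H _ KD(2,3) actX]) (use KD XP_sub in auto)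
      moreover note sum_between[OF H H' _ KD(2) neg KD(3) K(2,3) XP_sub XP_neg XP_add]
      ultimately show False using step.hyps(3,4) by blast
    qed
    then show ?thesis using step.IH Y by simp
  next
    case True
    have neq: "H \<inter> YP \<noteq> H' \<inter> YP"
    proof
      assume eq: "H \<inter> YP = H' \<inter> YP"
      have "H' \<subseteq> H"
      proof
        fix z assume "z \<in> H'"
        then obtain x y where "x \<in> H' \<inter> XP" "y \<in> H' \<inter> YP" "z = y \<oplus>\<^bsub>Z\<^esub> x" using dec[OF H'] by blast
        then show "z \<in> H" using eq True HD(3) by blast
      qed
      then show False using step.hyps(3) by blast
    qed
    have "fl B.R (YN YP) (H' \<inter> YP)"
    proof (rule fl.step[OF step.IH[THEN conjunct2] sY[OF H']])
      show "H \<inter> YP \<subset> H' \<inter> YP" using neq step.hyps(3) by blast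
      fix K assume K: "nu_submod B.R (YN YP) K" "H \<inter> YP \<subset> K" "K \<subset> H' \<inter> YP"
      note KD = B.R.nu_submodD[OF YN_module K(1), unfolded restrict_simps]
      have neg: "\<ominus>\<^bsub>Z\<^esub> k \<in> K" if "k \<in> K" for k
      proof -
        have kX: "k \<in> carrier Z" "k \<in> YP" using that KD YP_sub by auto
        obtain s where s: "s \<in> carrier B.R" "inB s \<odot>\<^bsub>Z\<^esub> k = k" using YP_unit kX by blast
        have "inB (\<ominus>\<^bsub>B.R\<^esub> s) \<odot>\<^bsub>Z\<^esub> k \<oplus>\<^bsub>Z\<^esub> k = \<zero>\<^bsub>Z\<^esub>"
          using act_sum(2)[OF B.R.A.a_inv_closed[OF s(1)] s(1) kX(1)] s RR.smult_zero(1)[OF Z kX(1)] by (simp add: B.R.A.l_neg)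
        then have "\<ominus>\<^bsub>Z\<^esub> k = inB (\<ominus>\<^bsub>B.R\<^esub> s) \<odot>\<^bsub>Z\<^esub> k" using Z.minus_equality kX act_closed(1) s by simp
        then show ?thesis using KD(4) s that by simp
      qed
      have "nu_submod RR Z {h \<oplus>\<^bsub>Z\<^esub> k | h k. h \<in> H \<and> k \<in> K}"
      proof (rule sum_submod[OF H _ KD(2,3)])
        fix a k assume a: "a \<in> carrier RR" and k: "k \<in> K"
        obtain r m s where rms: "a = (r, m, s)" "r \<in> carrier B.R" "m \<in> carrier M" "s \<in> carrier A.R" using a by (cases a) auto
        have kY: "k \<in> YP" "k \<in> carrier Z" "k \<in> H'" using k K KD YP_sub by auto
        \<comment> \<open>A subset of \<open>YP\<close> is not stable under \<open>M\<close>, but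
          its products with \<open>M\<close> lie in \<open>H' \<inter> XP\<close>. This part does
          not grow, so they already lie in \<open>H\<close>, and stability up to \<open>H\<close> is
          all that \<open>sum_submod\<close> demands.\<close>
        have "inM m \<odot>\<^bsub>Z\<^esub> k \<in> H'" using H'D(4)[of "inM m"] kY rms by simp
        then have mH: "inM m \<odot>\<^bsub>Z\<^esub> k \<in> H" using XP_YP_parts(3)[OF kY(2) rms(3)] True by blast
        have "a \<odot>\<^bsub>Z\<^esub> k = inM m \<odot>\<^bsub>Z\<^esub> k \<oplus>\<^bsub>Z\<^esub> inB r \<odot>\<^bsub>Z\<^esub> k"
          using act_split[OF rms(2-4) kY(2)] rms YP_act[OF kY(1)] act_closed kY Z.a_comm by simp
        then show "\<exists>h\<in>H. \<exists>k'\<in>K. a \<odot>\<^bsub>Z\<^esub> k = h \<oplus>\<^bsub>Z\<^esub> k'" using mH KD(4)[OF rms(2) k] by blast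
      qed (use KD YP_sub in auto)
      moreover note sum_between[OF H H' _ KD(2) neg KD(3) K(2,3) YP_sub YP_neg YP_add]
      ultimately show False using step.hyps(3,4) by blast
    qed
    then show ?thesis using step.IH True by simp
  qed
qed

text \<open>The action of \<open>M\<close> sends \<open>YZ\<close> into \<open>XZ\<close>.
  Transported along \<open>\<alpha>\<close> and \<open>\<beta>\<close> it becomes a balanced pairing
  of \<open>M\<close> with \<open>H Y\<close>, and \<open>pairing_representable\<close> turns this
  into the structure map \<open>e\<close>.\<close>

lemma from_parts:
  assumes X: "X \<in> P" "X \<in> Ob D" and Y: "Y \<in> Ob B" and sub: "XZ \<subseteq> carrier Z" "YZ \<subseteq> carrier Z"
    and dec: "\<And>z. z \<in> carrier Z \<Longrightarrow> \<exists>!(x, y). x \<in> XZ \<and> y \<in> YZ \<and> z = x \<oplus>\<^bsub>Z\<^esub> y"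
    and \<alpha>: "\<alpha> \<in> mod_homs A.R (PhO X) (XN XZ)" "bij_betw \<alpha> (carrier (PhO X)) XZ"
    and \<beta>: "\<beta> \<in> mod_homs B.R (B.H Y) (YN YZ)" "bij_betw \<beta> (carrier (B.H Y)) YZ"
    and X0: "\<And>r x. \<lbrakk>r \<in> carrier B.R; x \<in> XZ\<rbrakk> \<Longrightarrow> inB r \<odot>\<^bsub>Z\<^esub> x = \<zero>\<^bsub>Z\<^esub>"
    and Y0: "\<And>s y. \<lbrakk>s \<in> carrier A.R; y \<in> YZ\<rbrakk> \<Longrightarrow> inA s \<odot>\<^bsub>Z\<^esub> y = \<zero>\<^bsub>Z\<^esub>"
  shows "\<exists>e. (X, Y, e) \<in> Ob T \<and>
    (\<exists>g \<in> mod_homs RR (Nmod (X, Y, e)) Z. bij_betw g (carrier (Nmod (X, Y, e))) (carrier Z))"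
proof -
  interpret X: abelian_group "PhO X" using PhO_group X by blast
  interpret Y: abelian_group "B.H Y" using B.H_group Y by blast
  have aX: "\<alpha> x \<in> XZ" "\<alpha> x \<in> carrier Z" if "x \<in> carrier (PhO X)" for x
    using mod_homsD(1)[OF \<alpha>(1) that] sub by (auto simp: restrict_simps)
  have a_add: "\<alpha> (x \<oplus>\<^bsub>PhO X\<^esub> x') = \<alpha> x \<oplus>\<^bsub>Z\<^esub> \<alpha> x'" if "x \<in> carrier (PhO X)" "x' \<in> carrier (PhO X)" for x x'
    using mod_homsD(2)[OF \<alpha>(1) that] by (simp add: restrict_simps)
  have a_sm: "\<alpha> (s \<odot>\<^bsub>PhO X\<^esub> x) = inA s \<odot>\<^bsub>Z\<^esub> \<alpha> x" if "s \<in> carrier A.R" "x \<in> carrier (PhO X)" for s x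
    using mod_homsD(3)[OF \<alpha>(1) that] by (simp add: restrict_simps)
  have bY: "\<beta> f \<in> YZ" "\<beta> f \<in> carrier Z" if "f \<in> carrier (B.H Y)" for f
    using mod_homsD(1)[OF \<beta>(1) that] sub by (auto simp: restrict_simps)
  have b_add: "\<beta> (f \<oplus>\<^bsub>B.H Y\<^esub> f') = \<beta> f \<oplus>\<^bsub>Z\<^esub> \<beta> f'" if "f \<in> carrier (B.H Y)" "f' \<in> carrier (B.H Y)" for f f'
    using mod_homsD(2)[OF \<beta>(1) that] by (simp add: restrict_simps)
  have b_sm: "\<beta> (r \<odot>\<^bsub>B.H Y\<^esub> f) = inB r \<odot>\<^bsub>Z\<^esub> \<beta> f" if "r \<in> carrier B.R" "f \<in> carrier (B.H Y)" for r f
    using mod_homsD(3)[OF \<beta>(1) that] by (simp add: restrict_simps)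
  define \<alpha>' where "\<alpha>' = inv_into (carrier (PhO X)) \<alpha>"
  have a': "\<alpha>' x \<in> carrier (PhO X)" "\<alpha> (\<alpha>' x) = x" if "x \<in> XZ" for x
    using that \<alpha>(2) unfolding \<alpha>'_def bij_betw_def by (auto simp: inv_into_into f_inv_into_f)
  have inj: "x = x'" if "x \<in> carrier (PhO X)" "x' \<in> carrier (PhO X)" "\<alpha> x = \<alpha> x'" for x x'
    using that \<alpha>(2) unfolding bij_betw_def inj_on_def by blast
  \<comment> \<open>Write \<open>m\<close> as \<open>m e\<close> with \<open>e\<close> in
    \<open>B.R\<close>; this \<open>e\<close> already kills \<open>XZ\<close>.\<close>
  have mX: "inM m \<odot>\<^bsub>Z\<^esub> \<alpha> x = \<zero>\<^bsub>Z\<^esub>" if m: "m \<in> carrier M" and x: "x \<in> carrier (PhO X)" for m x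
  proof -
    obtain e where e: "e \<in> carrier B.R" "ra m e = m" using ra_unit[OF m] .
    have "inM m \<odot>\<^bsub>Z\<^esub> \<alpha> x = inM m \<odot>\<^bsub>Z\<^esub> (inB e \<odot>\<^bsub>Z\<^esub> \<alpha> x)"
      using act_mult(3)[OF e(1) e(1) m A.R.A.zero_closed A.R.A.zero_closed aX(2)[OF x]] e by simp
    then show ?thesis using X0[OF e(1) aX(1)[OF x]] act_zero(2)[OF m] by simp
  qed
  \<comment> \<open>Write \<open>m\<close> as \<open>e m\<close> with \<open>e\<close> in
    \<open>A.R\<close>; this \<open>e\<close> kills the \<open>YZ\<close>-component of the product
    and keeps its \<open>XZ\<close>-component inside \<open>XZ\<close>.\<close>
  have mY: "inM m \<odot>\<^bsub>Z\<^esub> z \<in> XZ" if m: "m \<in> carrier M" and z: "z \<in> carrier Z" for m z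
  proof -
    obtain e where e: "e \<in> carrier A.R" "e \<odot>\<^bsub>M\<^esub> m = m" using M_unit' m by blast
    let ?w = "inM m \<odot>\<^bsub>Z\<^esub> z"
    have w: "?w \<in> carrier Z" using act_closed m z by blast
    have we: "?w = inA e \<odot>\<^bsub>Z\<^esub> ?w"
      using act_mult(4)[OF B.R.A.zero_closed B.R.A.zero_closed m e(1) e(1) z] e by simp
    obtain x y where xy: "x \<in> XZ" "y \<in> YZ" "?w = x \<oplus>\<^bsub>Z\<^esub> y" using dec[OF w] by auto
    have c: "x \<in> carrier Z" "y \<in> carrier Z" using xy sub by auto
    have "?w = inA e \<odot>\<^bsub>Z\<^esub> (x \<oplus>\<^bsub>Z\<^esub> y)" using we unfolding xy(3) .
    also have "\<dots> = inA e \<odot>\<^bsub>Z\<^esub> x" using act_add(3)[OF c e(1)] Y0[OF e(1) xy(2)] act_closed(3)[OF e(1) c(1)] by simp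
    also have "\<dots> = \<alpha> (e \<odot>\<^bsub>PhO X\<^esub> \<alpha>' x)" using a_sm[OF e(1)] a' xy by simp
    finally show ?thesis using aX(1) a' xy e(1) X by simp
  qed
  \<comment> \<open>The element of \<open>PhO X\<close> that corresponds under
    \<open>\<alpha>\<close> to the product of \<open>msing S z\<close> with the image of
    \<open>sing Y S f\<close> in \<open>YZ\<close>.\<close>
  define b where "b S f z = \<alpha>' (inM (msing S z) \<odot>\<^bsub>Z\<^esub> \<beta> (B.sing Y S f))" for S f z
  have sc: "B.sing Y S f \<in> carrier (B.H Y)" if "S \<in> J" "f \<in> Hom B S Y" for S f using B.sing_carrier Y that by blast
  have b: "b S f z \<in> carrier (PhO X)" "\<alpha> (b S f z) = inM (msing S z) \<odot>\<^bsub>Z\<^esub> \<beta> (B.sing Y S f)"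
    if "S \<in> J" "f \<in> Hom B S Y" "z \<in> carrier (PhO (FO S))" for S f z
    unfolding b_def using a'[OF mY[OF msing_closed[OF that(1,3)] bY(2)[OF sc[OF that(1,2)]]]] .
  have "\<exists>e \<in> Hom D (FO Y) X. \<forall>S \<in> J. \<forall>f \<in> Hom B S Y. \<forall>z \<in> carrier (PhO (FO S)).
      fmp \<Phi> (FO Y) X e (FP S Y f z) = b S f z"
  proof (rule pairing_representable[OF Y X(2) b(1)])
    fix S f z z' assume *: "S \<in> J" "f \<in> Hom B S Y" "z \<in> carrier (PhO (FO S))" "z' \<in> carrier (PhO (FO S))"
    then have zz: "z \<oplus>\<^bsub>PhO (FO S)\<^esub> z' \<in> carrier (PhO (FO S))" by simp
    show "b S f (z \<oplus>\<^bsub>PhO (FO S)\<^esub> z') = b S f z \<oplus>\<^bsub>PhO X\<^esub> b S f z'"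
      by (rule inj) (use * zz b a_add msing_add act_sum(1) msing_closed bY(2) sc in simp_all)
  next
    fix S f s z assume *: "S \<in> J" "f \<in> Hom B S Y" "s \<in> carrier A.R" "z \<in> carrier (PhO (FO S))"
    then have zz: "s \<odot>\<^bsub>PhO (FO S)\<^esub> z \<in> carrier (PhO (FO S))" by simp
    show "b S f (s \<odot>\<^bsub>PhO (FO S)\<^esub> z) = s \<odot>\<^bsub>PhO X\<^esub> b S f z"
      by (rule inj) (use * X zz b a_sm msing_smult msing_closed bY(2) sc
          act_mult(4)[OF B.R.A.zero_closed B.R.A.zero_closed _ *(3) *(3)] in simp_all)
  next
    fix S f g z assume *: "S \<in> J" "f \<in> Hom B S Y" "g \<in> Hom B S Y" "z \<in> carrier (PhO (FO S))"
    have "B.sing Y S (Add B S Y f g) = B.sing Y S f \<oplus>\<^bsub>B.H Y\<^esub> B.sing Y S g"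
      using * Y by (auto simp: B.sing_def B.H_ops intro!: restrict_ext)
    moreover have "Add B S Y f g \<in> Hom B S Y" using * Y by simp
    ultimately show "b S (Add B S Y f g) z = b S f z \<oplus>\<^bsub>PhO X\<^esub> b S g z"
      by (intro inj) (use * b a_add act_add(2) b_add msing_closed bY(2) sc in simp_all)
  next
    fix S f d z assume *: "S \<in> J" "f \<in> Hom B S Y" "d \<in> Hom B S S" "z \<in> carrier (PhO (FO S))"
    have rc: "B.rsing S d \<in> carrier B.R" using B.rsing_carrier * by blast
    have "B.sing Y S (Cmp B S S Y f d) = B.rsing S d \<odot>\<^bsub>B.H Y\<^esub> B.sing Y S f"
      using B.rsing_smult[OF Y *(1,3) sc[OF *(1,2)]] * by (simp add: B.sing_def)
    then have "inM (msing S z) \<odot>\<^bsub>Z\<^esub> \<beta> (B.sing Y S (Cmp B S S Y f d)) =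
        inM (msing S z) \<odot>\<^bsub>Z\<^esub> (inB (B.rsing S d) \<odot>\<^bsub>Z\<^esub> \<beta> (B.sing Y S f))" using b_sm rc sc * by simp
    also have "\<dots> = inM (ra (msing S z) (B.rsing S d)) \<odot>\<^bsub>Z\<^esub> \<beta> (B.sing Y S f)"
      using act_mult(3)[OF rc rc msing_closed A.R.A.zero_closed A.R.A.zero_closed bY(2)] sc * by blast
    also have "ra (msing S z) (B.rsing S d) = msing S (FP S S d z)"
      using ra_rsing[OF *(1,3) msing_closed] * by (simp add: msing_def)
    finally show "b S (Cmp B S S Y f d) z = b S f (FP S S d z)" by (simp add: b_def)
  qed
  then obtain e where e: "e \<in> Hom D (FO Y) X"
    "\<And>S f z. \<lbrakk>S \<in> J; f \<in> Hom B S Y; z \<in> carrier (PhO (FO S))\<rbrakk> \<Longrightarrow> fmp \<Phi> (FO Y) X e (FP S Y f z) = b S f z" by blast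
  have t: "(X, Y, e) \<in> Ob T" using X Y e by simp
  let ?e = "fmp \<Phi> (FO Y) X e"
  have ec: "?e z \<in> carrier (PhO X)" if "z \<in> carrier (PhO (FO Y))" for z using that X Y e by simp
  \<comment> \<open>Both sides are additive in \<open>m\<close>, so it suffices to take
    \<open>m = msing S z\<close>. The idempotent of \<open>S\<close> then replaces \<open>f\<close>
    by its component at \<open>S\<close>, where \<open>e\<close> is known.\<close>
  have main: "inM m \<odot>\<^bsub>Z\<^esub> \<beta> f = \<alpha> (?e (\<mu> Y m f))" if m: "m \<in> carrier M" and f: "f \<in> carrier (B.H Y)" for m f
  proof (rule M_additive_ext[OF Z.abelian_group_axioms _ _ _ _ _ m])
    fix S z assume S: "S \<in> J" "z \<in> carrier (PhO (FO S))"
    have fS: "f S \<in> Hom B S Y" using f S Y by (simp add: B.H_carrier)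
    let ?u = "B.rsing S (Idt B S)"
    have rc: "?u \<in> carrier B.R" using B.rsing_carrier S by simp
    note mc = msing_closed[OF S]
    have "ra (msing S z) ?u = msing S z" using ra_rsing[OF S(1) _ mc, of "Idt B S"] S by (simp add: msing_def)
    then have "inM (msing S z) \<odot>\<^bsub>Z\<^esub> \<beta> f = inM (msing S z) \<odot>\<^bsub>Z\<^esub> (inB ?u \<odot>\<^bsub>Z\<^esub> \<beta> f)"
      using act_mult(3)[OF rc rc mc A.R.A.zero_closed A.R.A.zero_closed bY(2)[OF f]] by simp
    also have "inB ?u \<odot>\<^bsub>Z\<^esub> \<beta> f = \<beta> (B.sing Y S (f S))"
      using b_sm[OF rc f] B.rsing_smult[OF Y S(1) _ f, of "Idt B S"] S fS Y by simp
    also have "inM (msing S z) \<odot>\<^bsub>Z\<^esub> \<beta> (B.sing Y S (f S)) = \<alpha> (b S (f S) z)" using b(2) S fS by simp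
    also have "b S (f S) z = ?e (\<mu> Y (msing S z) f)" using e(2) S fS \<mu>_msing Y f by simp
    finally show "inM (msing S z) \<odot>\<^bsub>Z\<^esub> \<beta> f = \<alpha> (?e (\<mu> Y (msing S z) f))" .
  qed (use f Y X e ec aX(2) bY(2) act_closed(2) act_sum(1) a_add \<mu>_add_left PhM_add in simp_all)
  define g where "g = (\<lambda>(x, f) \<in> carrier (PhO X) \<times> carrier (B.H Y). \<alpha> x \<oplus>\<^bsub>Z\<^esub> \<beta> f)"
  have g: "g (x, f) = \<alpha> x \<oplus>\<^bsub>Z\<^esub> \<beta> f" if "x \<in> carrier (PhO X)" "f \<in> carrier (B.H Y)" for x f
    using that by (simp add: g_def)
  have "g \<in> mod_homs RR (Nmod (X, Y, e)) Z"
  proof (rule mod_homsI)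
    fix p assume "p \<in> carrier (Nmod (X, Y, e))"
    then show "g p \<in> carrier Z" using g aX bY by auto
  next
    fix p q assume "p \<in> carrier (Nmod (X, Y, e))" "q \<in> carrier (Nmod (X, Y, e))"
    then obtain x f x' f' where pq: "p = (x, f)" "q = (x', f')" "x \<in> carrier (PhO X)" "x' \<in> carrier (PhO X)"
      "f \<in> carrier (B.H Y)" "f' \<in> carrier (B.H Y)" by auto
    then show "g (p \<oplus>\<^bsub>Nmod (X, Y, e)\<^esub> q) = g p \<oplus>\<^bsub>Z\<^esub> g q"
      using g aX(2) bY(2) a_add b_add by (simp add: Z.a_ac)
  next
    fix a p assume "a \<in> carrier RR" "p \<in> carrier (Nmod (X, Y, e))"
    then obtain r m s x f where ap: "a = (r, m, s)" "r \<in> carrier B.R" "m \<in> carrier M" "s \<in> carrier A.R"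
      "p = (x, f)" "x \<in> carrier (PhO X)" "f \<in> carrier (B.H Y)" by auto
    have c: "\<alpha> x \<in> carrier Z" "\<beta> f \<in> carrier Z" using ap aX bY by auto
    have "a \<odot>\<^bsub>Z\<^esub> g p = (r, m, s) \<odot>\<^bsub>Z\<^esub> \<alpha> x \<oplus>\<^bsub>Z\<^esub> (r, m, s) \<odot>\<^bsub>Z\<^esub> \<beta> f"
      using nu_moduleD(4)[OF Z, of a "\<alpha> x" "\<beta> f"] ap c g by simp
    also have "(r, m, s) \<odot>\<^bsub>Z\<^esub> \<alpha> x = \<alpha> (s \<odot>\<^bsub>PhO X\<^esub> x)"
      using act_split[OF ap(2-4) c(1)] X0[OF ap(2) aX(1)] mX a_sm ap act_closed(3) c by simp
    also have "(r, m, s) \<odot>\<^bsub>Z\<^esub> \<beta> f = \<beta> (r \<odot>\<^bsub>B.H Y\<^esub> f) \<oplus>\<^bsub>Z\<^esub> \<alpha> (?e (\<mu> Y m f))"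
      using act_split[OF ap(2-4) c(2)] Y0[OF ap(4) bY(1)] main b_sm ap aX(2)[OF ec] \<mu>_closed Y c by simp
    finally have "a \<odot>\<^bsub>Z\<^esub> g p = \<alpha> (s \<odot>\<^bsub>PhO X\<^esub> x \<oplus>\<^bsub>PhO X\<^esub> ?e (\<mu> Y m f)) \<oplus>\<^bsub>Z\<^esub> \<beta> (r \<odot>\<^bsub>B.H Y\<^esub> f)"
      using ap ec Y X a_add aX(2) bY(2) B.H_smult_closed by (simp add: Z.a_ac)
    then show "g (a \<odot>\<^bsub>Nmod (X, Y, e)\<^esub> p) = a \<odot>\<^bsub>Z\<^esub> g p"
      using ap g ec X Y B.H_smult_closed by simp
  qed (simp add: g_def)
  moreover have "bij_betw g (carrier (Nmod (X, Y, e))) (carrier Z)"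
  proof (rule bij_betwI')
    fix p q assume "p \<in> carrier (Nmod (X, Y, e))" "q \<in> carrier (Nmod (X, Y, e))"
    then obtain x f x' f' where pq: "p = (x, f)" "q = (x', f')" "x \<in> carrier (PhO X)" "x' \<in> carrier (PhO X)"
      "f \<in> carrier (B.H Y)" "f' \<in> carrier (B.H Y)" by auto
    show "(g p = g q) = (p = q)"
    proof
      assume "g p = g q"
      then have eq: "\<alpha> x \<oplus>\<^bsub>Z\<^esub> \<beta> f = \<alpha> x' \<oplus>\<^bsub>Z\<^esub> \<beta> f'" using g pq by simp
      define Q where "Q = (\<lambda>(u, v). u \<in> XZ \<and> v \<in> YZ \<and> \<alpha> x \<oplus>\<^bsub>Z\<^esub> \<beta> f = u \<oplus>\<^bsub>Z\<^esub> v)"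
      have "\<exists>!p. Q p" unfolding Q_def by (rule dec) (use aX(2) bY(2) pq in simp)
      moreover have "Q (\<alpha> x, \<beta> f)" using aX(1) bY(1) pq by (simp add: Q_def)
      moreover have "Q (\<alpha> x', \<beta> f')" using aX(1) bY(1) pq eq by (simp add: Q_def)
      ultimately have "(\<alpha> x, \<beta> f) = (\<alpha> x', \<beta> f')" by blast
      then show "p = q" using pq inj \<beta>(2) unfolding bij_betw_def inj_on_def by auto
    qed simp
  next
    fix p assume "p \<in> carrier (Nmod (X, Y, e))"
    then show "g p \<in> carrier Z" using g aX bY by auto
  next
    fix z assume "z \<in> carrier Z"
    then obtain x y where xy: "x \<in> XZ" "y \<in> YZ" "z = x \<oplus>\<^bsub>Z\<^esub> y" using dec by blast
    obtain f where f: "f \<in> carrier (B.H Y)" "\<beta> f = y" using \<beta>(2) xy unfolding bij_betw_def by blast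
    have "g (\<alpha>' x, f) = z" using g a' xy f by simp
    then show "\<exists>p\<in>carrier (Nmod (X, Y, e)). z = g p" using a' xy f by (intro bexI[of _ "(\<alpha>' x, f)"]) auto
  qed
  ultimately show ?thesis using t by blast
qed

end

end

section \<open>The equivalence with modules over the triangular matrix ring\<close>

context triple_modules
begin

lemma Phi_iso_simples_hom:
  assumes "X \<in> Ob A"
  obtains \<theta> where "\<theta> \<in> mod_homs A.R (PhO X) (A.H X)" "bij_betw \<theta> (carrier (PhO X)) (carrier (A.H X))"
  using Phi assms unfolding extends_simples_hom_def by blast

section \<open>Finiteness of the modules isomorphic to the module of a triple\<close>

context
  fixes Z :: "(('o \<Rightarrow> 'm) \<times> ('o \<Rightarrow> 'u) \<times> ('o \<Rightarrow> 'm), 'v) module" and X Y e g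
  assumes Z: "nu_module RR Z" and t: "(X, Y, e) \<in> Ob T"
    and g: "g \<in> mod_homs RR (Nmod (X, Y, e)) Z" and gb: "bij_betw g (carrier (Nmod (X, Y, e))) (carrier Z)"
begin

interpretation M: abelian_group M by (rule M_group)
interpretation Z: abelian_group Z using nu_moduleD(1)[OF Z] .

definition gx where "gx x = g (x, \<zero>\<^bsub>B.H Y\<^esub>)"
definition gy where "gy f = g (\<zero>\<^bsub>PhO X\<^esub>, f)"

lemma XY: "X \<in> Ob D" "Y \<in> Ob B" "e \<in> Hom D (FO Y) X" "X \<in> P"
  using t by auto

interpretation X: abelian_group "PhO X" using PhO_group XY(1) by blast
interpretation Y: abelian_group "B.H Y" using B.H_group XY(2) by blast

lemma gx_closed: "x \<in> carrier (PhO X) \<Longrightarrow> gx x \<in> carrier Z"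
  and gy_closed: "f \<in> carrier (B.H Y) \<Longrightarrow> gy f \<in> carrier Z"
  using mod_homsD(1)[OF g] by (simp_all add: gx_def gy_def)

lemma gx_add: "\<lbrakk>x \<in> carrier (PhO X); x' \<in> carrier (PhO X)\<rbrakk> \<Longrightarrow> gx (x \<oplus>\<^bsub>PhO X\<^esub> x') = gx x \<oplus>\<^bsub>Z\<^esub> gx x'"
  using mod_homsD(2)[OF g, of "(x, \<zero>\<^bsub>B.H Y\<^esub>)" "(x', \<zero>\<^bsub>B.H Y\<^esub>)"] by (simp add: gx_def)

lemma gy_add: "\<lbrakk>f \<in> carrier (B.H Y); f' \<in> carrier (B.H Y)\<rbrakk> \<Longrightarrow> gy (f \<oplus>\<^bsub>B.H Y\<^esub> f') = gy f \<oplus>\<^bsub>Z\<^esub> gy f'"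
  using mod_homsD(2)[OF g, of "(\<zero>\<^bsub>PhO X\<^esub>, f)" "(\<zero>\<^bsub>PhO X\<^esub>, f')"] by (simp add: gy_def)

lemma g_split: "\<lbrakk>x \<in> carrier (PhO X); f \<in> carrier (B.H Y)\<rbrakk> \<Longrightarrow> g (x, f) = gx x \<oplus>\<^bsub>Z\<^esub> gy f"
  using mod_homsD(2)[OF g, of "(x, \<zero>\<^bsub>B.H Y\<^esub>)" "(\<zero>\<^bsub>PhO X\<^esub>, f)"] by (simp add: gx_def gy_def)

lemma gx_smult:
  assumes "r \<in> carrier B.R" "m \<in> carrier M" "s \<in> carrier A.R" "x \<in> carrier (PhO X)"
  shows "(r, m, s) \<odot>\<^bsub>Z\<^esub> gx x = gx (s \<odot>\<^bsub>PhO X\<^esub> x)"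
  using mod_homsD(3)[OF g, of "(r, m, s)" "(x, \<zero>\<^bsub>B.H Y\<^esub>)"] assms XY
  by (simp add: gx_def \<mu>_zero PhM_zero B.R.smult_zero(2)[OF B.H_module])

lemma gy_smult:
  assumes "r \<in> carrier B.R" "m \<in> carrier M" "s \<in> carrier A.R" "f \<in> carrier (B.H Y)"
  shows "(r, m, s) \<odot>\<^bsub>Z\<^esub> gy f = gx (fmp \<Phi> (FO Y) X e (\<mu> Y m f)) \<oplus>\<^bsub>Z\<^esub> gy (r \<odot>\<^bsub>B.H Y\<^esub> f)"
  using mod_homsD(3)[OF g, of "(r, m, s)" "(\<zero>\<^bsub>PhO X\<^esub>, f)"] assms XY B.H_smult_closed
  by (simp add: g_split[symmetric] A.R.smult_zero(2)[OF PhO_module]) (simp add: gy_def)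

lemma gx_zero: "gx \<zero>\<^bsub>PhO X\<^esub> = \<zero>\<^bsub>Z\<^esub>" and gy_zero: "gy \<zero>\<^bsub>B.H Y\<^esub> = \<zero>\<^bsub>Z\<^esub>"
  using mod_homs_zero(1)[OF Nmod_group[OF t] Z.abelian_group_axioms g] by (simp_all add: gx_def gy_def)

lemma gx_inj: "inj_on gx (carrier (PhO X))"
proof (rule inj_onI)
  fix x x' assume "x \<in> carrier (PhO X)" "x' \<in> carrier (PhO X)" "gx x = gx x'"
  then show "x = x'"
    using inj_onD[OF bij_betw_imp_inj_on[OF gb], of "(x, \<zero>\<^bsub>B.H Y\<^esub>)" "(x', \<zero>\<^bsub>B.H Y\<^esub>)"] by (simp add: gx_def)
qed

lemma gy_inj: "inj_on gy (carrier (B.H Y))"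
proof (rule inj_onI)
  fix f f' assume "f \<in> carrier (B.H Y)" "f' \<in> carrier (B.H Y)" "gy f = gy f'"
  then show "f = f'"
    using inj_onD[OF bij_betw_imp_inj_on[OF gb], of "(\<zero>\<^bsub>PhO X\<^esub>, f)" "(\<zero>\<^bsub>PhO X\<^esub>, f')"] by (simp add: gy_def)
qed

lemma g_surj:
  assumes "z \<in> carrier Z"
  obtains x f where "x \<in> carrier (PhO X)" "f \<in> carrier (B.H Y)" "z = g (x, f)"
proof -
  obtain p where p: "p \<in> carrier (Nmod (X, Y, e))" "z = g p"
    using assms bij_betw_imp_surj_on[OF gb] by blast
  then show thesis using that[of "fst p" "snd p"] by (cases p) simp
qed

text \<open>The summands are the images of \<open>PhO X\<close> and of \<open>H Y\<close>. The first
  is semi-simple as a copy of \<open>PhO X\<close>; the second has finite length by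
  \<open>B.fl_hom_image\<close>, applied over the ring \<open>B.R\<close> itself and starting from
  zero.\<close>

lemma image_locally_finite: "locally_finite_mod B.R M A.R Z"
proof -
  let ?X = "gx ` carrier (PhO X)" and ?Y = "gy ` carrier (B.H Y)"
  let ?XN = "restrict_right B.R M Z ?X" and ?YN = "restrict_left M A.R Z ?Y"
  note rs = restrict_simps[OF Z]
  have z: "\<zero>\<^bsub>B.R\<^esub> \<in> carrier B.R" "\<zero>\<^bsub>A.R\<^esub> \<in> carrier A.R" "\<zero>\<^bsub>M\<^esub> \<in> carrier M" by simp_all
  have gy0: "inB r \<odot>\<^bsub>Z\<^esub> gy f = gy (r \<odot>\<^bsub>B.H Y\<^esub> f)" if "r \<in> carrier B.R" "f \<in> carrier (B.H Y)" for r f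
    using gy_smult[OF that(1) z(3) z(2) that(2)] that XY by (simp add: \<mu>_zero PhM_zero gx_zero gy_closed B.H_smult_closed)
  have XN: "nu_module A.R ?XN"
    by (rule A.R.nu_module_iso[OF PhO_module[OF XY(1)], of gx])
      (use gx_inj gx_add gx_zero gx_smult[OF z(1) z(3)] in \<open>auto simp: rs bij_betw_def\<close>)
  have YN: "nu_module B.R ?YN"
    by (rule B.R.nu_module_iso[OF B.H_module[OF XY(2)], of gy])
      (use gy_inj gy_add gy_zero gy0 in \<open>auto simp: rs bij_betw_def\<close>)
  have ex1: "\<exists>!(x, y). x \<in> ?X \<and> y \<in> ?Y \<and> z = x \<oplus>\<^bsub>Z\<^esub> y" if z: "z \<in> carrier Z" for z
  proof -
    obtain x f where xf: "x \<in> carrier (PhO X)" "f \<in> carrier (B.H Y)" "z = g (x, f)"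
      using g_surj[OF z] .
    show ?thesis
    proof (rule ex1I[of _ "(gx x, gy f)"])
      show "case (gx x, gy f) of (x, y) \<Rightarrow> x \<in> ?X \<and> y \<in> ?Y \<and> z = x \<oplus>\<^bsub>Z\<^esub> y" using xf g_split by simp
      fix p assume p: "case p of (x, y) \<Rightarrow> x \<in> ?X \<and> y \<in> ?Y \<and> z = x \<oplus>\<^bsub>Z\<^esub> y"
      then obtain x' f' where xf': "x' \<in> carrier (PhO X)" "f' \<in> carrier (B.H Y)" "p = (gx x', gy f')" "z = gx x' \<oplus>\<^bsub>Z\<^esub> gy f'"
        by (cases p) auto
      then have "g (x', f') = g (x, f)" using xf g_split by simp
      then have "(x', f') = (x, f)" by (rule inj_onD[OF bij_betw_imp_inj_on[OF gb]]) (use xf xf' in auto)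
      then show "p = (gx x, gy f)" using xf' by simp
    qed
  qed
  have ss: "semisimple_mod A.R ?XN"
  proof (rule A.R.semisimple_iso[OF PhO_semisimple[OF XY(1)] XN, of "restrict gx (carrier (PhO X))"])
    show "restrict gx (carrier (PhO X)) \<in> mod_homs A.R (PhO X) ?XN"
      by (rule mod_homsI) (use gx_add gx_smult[OF z(1) z(3)] XY(1) in \<open>auto simp: rs\<close>)
    show "bij_betw (restrict gx (carrier (PhO X))) (carrier (PhO X)) (carrier ?XN)"
      using gx_inj by (auto simp: rs bij_betw_def inj_on_def)
  qed
  have fl: "finite_length_mod B.R ?YN"
    unfolding B.R.finite_length_iff
  proof (intro conjI YN)
    have "fl B.R ?YN {h \<oplus>\<^bsub>?YN\<^esub> gy f | h f. h \<in> {\<zero>\<^bsub>?YN\<^esub>} \<and> f \<in> carrier (B.H Y)}"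
    proof (rule B.fl_hom_image[OF B.R.lu_ring_axioms YN XY(2), where \<kappa> = "\<lambda>r. r"])
      fix a f assume af: "a \<in> carrier B.R" "f \<in> carrier (B.H Y)"
      then show "\<exists>h\<in>{\<zero>\<^bsub>?YN\<^esub>}. a \<odot>\<^bsub>?YN\<^esub> gy f = h \<oplus>\<^bsub>?YN\<^esub> gy (a \<odot>\<^bsub>B.H Y\<^esub> f)"
        using gy0 gy_closed[OF B.H_smult_closed[OF XY(2) af]] by (simp add: rs)
    qed (use gy_add fl.zero[of B.R ?YN] in \<open>auto simp: rs\<close>)
    moreover have "{h \<oplus>\<^bsub>?YN\<^esub> gy f | h f. h \<in> {\<zero>\<^bsub>?YN\<^esub>} \<and> f \<in> carrier (B.H Y)} = carrier ?YN"
      using gy_closed by (force simp: rs)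
    ultimately show "fl B.R ?YN (carrier ?YN)" by simp
  qed
  show ?thesis unfolding locally_finite_mod_def
  proof (rule exI[of _ ?X], rule exI[of _ ?Y], intro conjI ballI ss fl ex1)
    show "inB r \<odot>\<^bsub>Z\<^esub> x = \<zero>\<^bsub>Z\<^esub>" if "r \<in> carrier B.R" "x \<in> ?X" for r x
      using that gx_smult[OF that(1) z(3) z(2)] A.R.smult_zero(1)[OF PhO_module[OF XY(1)]] gx_zero by auto
    show "inA s \<odot>\<^bsub>Z\<^esub> y = \<zero>\<^bsub>Z\<^esub>" if "s \<in> carrier A.R" "y \<in> ?Y" for s y
      using that gy_smult[OF z(1) z(3) that(1)] B.R.smult_zero(1)[OF B.H_module[OF XY(2)]] gx_zero gy_zero XY
      by (auto simp: \<mu>_zero PhM_zero)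
  qed (use gx_closed gy_closed in auto)
qed

text \<open>For \<open>X\<close> in \<open>A\<close> the module \<open>PhO X\<close> is a copy of
  \<open>H X\<close>, so \<open>A.fl_hom_image\<close> builds a composition series of the
  \<open>X\<close>-part, which is a submodule. \<open>B.fl_hom_image\<close> continues it through
  the \<open>Y\<close>-part. The scalars act through the projections of a matrix to \<open>s\<close>
  and to \<open>r\<close>.\<close>

lemma image_finite_length:
  assumes XA: "X \<in> Ob A"
  shows "finite_length_mod RR Z"
  unfolding RR.finite_length_iff
proof (intro conjI Z)
  obtain \<theta> where th: "\<theta> \<in> mod_homs A.R (PhO X) (A.H X)" "bij_betw \<theta> (carrier (PhO X)) (carrier (A.H X))"
    using Phi_iso_simples_hom[OF XA] .
  define \<theta>' where "\<theta>' = restrict (inv_into (carrier (PhO X)) \<theta>) (carrier (A.H X))"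
  have "\<theta>' \<in> mod_homs A.R (A.H X) (PhO X)" unfolding \<theta>'_def using mod_homs_inv[OF PhO_module[OF XY(1)] th] .
  note th' = mod_homsD[OF this]
  have surj: "\<exists>f \<in> carrier (A.H X). \<theta>' f = x" if "x \<in> carrier (PhO X)" for x
    using that th mod_homsD(1)[OF th(1)] by (intro bexI[of _ "\<theta> x"]) (auto simp: \<theta>'_def bij_betw_def)
  let ?L1 = "{h \<oplus>\<^bsub>Z\<^esub> gx (\<theta>' f) | h f. h \<in> {\<zero>\<^bsub>Z\<^esub>} \<and> f \<in> carrier (A.H X)}"
  have L1: "fl RR Z ?L1"
  proof (rule A.fl_hom_image[OF RR.lu_ring_axioms Z XA, where \<kappa> = "\<lambda>(r, m, s). s"])
    fix s assume "s \<in> carrier A.R"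
    then show "\<exists>a\<in>carrier RR. (case a of (r, m, s) \<Rightarrow> s) = s" by (intro bexI[of _ "inA s"]) auto
  next
    fix a f assume a: "a \<in> carrier RR" and f: "f \<in> carrier (A.H X)"
    obtain r m s where rms: "a = (r, m, s)" "r \<in> carrier B.R" "m \<in> carrier M" "s \<in> carrier A.R" using a by (cases a) auto
    have "a \<odot>\<^bsub>Z\<^esub> gx (\<theta>' f) = gx (\<theta>' (s \<odot>\<^bsub>A.H X\<^esub> f))"
      unfolding rms using gx_smult[OF rms(2-4) th'(1)[OF f]] th'(3)[OF rms(4) f] by simp
    then show "\<exists>h\<in>{\<zero>\<^bsub>Z\<^esub>}. a \<odot>\<^bsub>Z\<^esub> gx (\<theta>' f) = h \<oplus>\<^bsub>Z\<^esub> gx (\<theta>' ((case a of (r, m, s) \<Rightarrow> s) \<odot>\<^bsub>A.H X\<^esub> f))"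
      using rms gx_closed[OF th'(1)[OF A.H_smult_closed[OF XA rms(4) f]]] by simp
  qed (use th' gx_closed gx_add fl.zero in auto)
  have L1x: "gx x \<in> ?L1" if x: "x \<in> carrier (PhO X)" for x
  proof -
    obtain f where f: "f \<in> carrier (A.H X)" "\<theta>' f = x" using surj x by blast
    then have "gx x = \<zero>\<^bsub>Z\<^esub> \<oplus>\<^bsub>Z\<^esub> gx (\<theta>' f)" using gx_closed x by simp
    then show ?thesis using f by blast
  qed
  let ?L2 = "{h \<oplus>\<^bsub>Z\<^esub> gy f | h f. h \<in> ?L1 \<and> f \<in> carrier (B.H Y)}"
  have "fl RR Z ?L2"
  \<comment> \<open>The map \<open>gy\<close> is linear only modulo \<open>?L1\<close>: the entry
    \<open>m\<close> of a matrix adds an element of the \<open>X\<close>-part.\<close>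
  proof (rule B.fl_hom_image[OF RR.lu_ring_axioms Z XY(2), where \<kappa> = fst])
    fix r assume "r \<in> carrier B.R"
    then show "\<exists>a\<in>carrier RR. fst a = r" by (intro bexI[of _ "inB r"]) auto
  next
    fix a f assume a: "a \<in> carrier RR" and f: "f \<in> carrier (B.H Y)"
    obtain r m s where rms: "a = (r, m, s)" "r \<in> carrier B.R" "m \<in> carrier M" "s \<in> carrier A.R" using a by (cases a) auto
    show "\<exists>h\<in>?L1. a \<odot>\<^bsub>Z\<^esub> gy f = h \<oplus>\<^bsub>Z\<^esub> gy (fst a \<odot>\<^bsub>B.H Y\<^esub> f)"
    proof (rule bexI)
      show "a \<odot>\<^bsub>Z\<^esub> gy f = gx (fmp \<Phi> (FO Y) X e (\<mu> Y m f)) \<oplus>\<^bsub>Z\<^esub> gy (fst a \<odot>\<^bsub>B.H Y\<^esub> f)"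
        using gy_smult[OF rms(2-4) f] rms by simp
      show "gx (fmp \<Phi> (FO Y) X e (\<mu> Y m f)) \<in> ?L1" by (rule L1x) (use XY rms f in simp)
    qed
  qed (use L1 gy_closed gy_add in auto)
  moreover have "?L2 = carrier Z"
  proof
    show "?L2 \<subseteq> carrier Z" using gx_closed th'(1) gy_closed by auto
    show "carrier Z \<subseteq> ?L2"
    proof
      fix z assume z: "z \<in> carrier Z"
      obtain x f where xf: "x \<in> carrier (PhO X)" "f \<in> carrier (B.H Y)" "z = g (x, f)"
        using g_surj[OF z] .
      have "z = gx x \<oplus>\<^bsub>Z\<^esub> gy f" using g_split[OF xf(1,2)] xf(3) by simp
      then show "z \<in> ?L2" using L1x[OF xf(1)] xf(2) by blast
    qed
  qed
  ultimately show "fl RR Z (carrier Z)" by simp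
qed

end

text \<open>\<open>X\<close> comes from essential surjectivity of \<open>\<Phi>\<close>, which
  reaches all semi-simple modules, and \<open>P = Ob D\<close> admits every such \<open>X\<close>.
  \<open>Y\<close> comes from \<open>B.fl_rep\<close>.\<close>

lemma locally_finite_image:
  fixes Z :: "(('o \<Rightarrow> 'm) \<times> ('o \<Rightarrow> 'u) \<times> ('o \<Rightarrow> 'm), 'u) module"
  assumes P: "P = Ob D" and Z: "nu_module RR Z" and lf: "locally_finite_mod B.R M A.R Z"
  shows "\<exists>t \<in> Ob T. \<exists>g \<in> mod_homs RR (Nmod t) Z. bij_betw g (carrier (Nmod t)) (carrier Z)"
proof -
  from lf obtain XZ YZ where sub: "XZ \<subseteq> carrier Z" "YZ \<subseteq> carrier Z"
    and dec: "\<forall>z \<in> carrier Z. \<exists>!(x, y). x \<in> XZ \<and> y \<in> YZ \<and> z = x \<oplus>\<^bsub>Z\<^esub> y"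
    and ss: "semisimple_mod A.R (restrict_right B.R M Z XZ)" and fl: "finite_length_mod B.R (restrict_left M A.R Z YZ)"
    and X0: "\<forall>r \<in> carrier B.R. \<forall>x \<in> XZ. inB r \<odot>\<^bsub>Z\<^esub> x = \<zero>\<^bsub>Z\<^esub>"
    and Y0: "\<forall>s \<in> carrier A.R. \<forall>y \<in> YZ. inA s \<odot>\<^bsub>Z\<^esub> y = \<zero>\<^bsub>Z\<^esub>"
    unfolding locally_finite_mod_def by (elim exE conjE) (rule that)
  have XN: "nu_module A.R (restrict_right B.R M Z XZ)" using ss by (simp add: semisimple_mod_def)
  obtain X where X: "X \<in> Ob D" "iso_obj (mod_cat A.R (semisimple_mod A.R)) (PhO X) (restrict_right B.R M Z XZ)"
    using Phi.ess_surj[of "restrict_right B.R M Z XZ"] ss XN by auto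
  obtain \<alpha> where \<alpha>: "\<alpha> \<in> mod_homs A.R (PhO X) (restrict_right B.R M Z XZ)"
    "bij_betw \<alpha> (carrier (PhO X)) (carrier (restrict_right B.R M Z XZ))"
    using X(2) unfolding iso_obj_def mod_iso_iff[OF PhO_module[OF X(1)] PhO_semisimple[OF X(1)] XN ss] by blast
  have YN: "nu_module B.R (restrict_left M A.R Z YZ)" and flY: "fl B.R (restrict_left M A.R Z YZ) YZ"
    using fl[unfolded B.R.finite_length_iff restrict_simps[OF Z]] by simp_all
  obtain Y \<beta> where \<beta>: "Y \<in> Ob B" "\<beta> \<in> mod_homs B.R (B.H Y) (restrict_left M A.R Z YZ)"
    "bij_betw \<beta> (carrier (B.H Y)) YZ"
    using B.fl_rep[OF YN flY] unfolding B.rep_def bij_betw_def by blast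
  have "\<exists>e. (X, Y, e) \<in> Ob T \<and>
      (\<exists>g \<in> mod_homs RR (Nmod (X, Y, e)) Z. bij_betw g (carrier (Nmod (X, Y, e))) (carrier Z))"
  proof (rule from_parts[OF Z _ X(1) \<beta>(1) sub _ \<alpha>(1) _ \<beta>(2,3)])
    show "\<exists>!(x, y). x \<in> XZ \<and> y \<in> YZ \<and> z = x \<oplus>\<^bsub>Z\<^esub> y" if "z \<in> carrier Z" for z
      using bspec[OF dec that] .
    show "inB r \<odot>\<^bsub>Z\<^esub> x = \<zero>\<^bsub>Z\<^esub>" if "r \<in> carrier B.R" "x \<in> XZ" for r x using X0 that by blast
    show "inA s \<odot>\<^bsub>Z\<^esub> y = \<zero>\<^bsub>Z\<^esub>" if "s \<in> carrier A.R" "y \<in> YZ" for s y using Y0 that by blast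
    show "X \<in> P" using P X(1) by simp
    show "bij_betw \<alpha> (carrier (PhO X)) XZ" using \<alpha>(2) unfolding restrict_simps[OF Z] .
  qed
  then show ?thesis by blast
qed

text \<open>By \<open>fl_parts\<close> both diagonal parts have finite length, so
  \<open>fl_rep\<close> represents them by some \<open>H X\<close> and \<open>H Y\<close> with
  \<open>X\<close> in \<open>A\<close>; the comparison \<open>\<theta>\<close> replaces
  \<open>H X\<close> by \<open>PhO X\<close>.\<close>

lemma finite_length_image:
  fixes Z :: "(('o \<Rightarrow> 'm) \<times> ('o \<Rightarrow> 'u) \<times> ('o \<Rightarrow> 'm), 'v) module"
  assumes P: "P = Ob A" and Z: "nu_module RR Z" and fl: "finite_length_mod RR Z"
  shows "\<exists>t \<in> Ob T. \<exists>g \<in> mod_homs RR (Nmod t) Z. bij_betw g (carrier (Nmod t)) (carrier Z)"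
proof -
  interpret Z: abelian_group Z using nu_moduleD(1)[OF Z] .
  let ?X = "XP Z" and ?Y = "YP Z"
  have "fl RR Z (carrier Z)" using fl RR.finite_length_iff by blast
  note fls = fl_parts[OF Z this]
  have sub: "?X \<subseteq> carrier Z" "?Y \<subseteq> carrier Z" using XP_sub[OF Z] YP_sub[OF Z] by auto
  then have "carrier Z \<inter> ?X = ?X" "carrier Z \<inter> ?Y = ?Y" by auto
  note fls = fls[unfolded this]
  obtain X \<psi> where X: "X \<in> Ob A" "\<psi> \<in> mod_homs A.R (A.H X) (restrict_right B.R M Z ?X)"
    "bij_betw \<psi> (carrier (A.H X)) ?X"
    using A.fl_rep[OF XN_module[OF Z] fls[THEN conjunct1]] unfolding A.rep_def bij_betw_def by blast
  obtain Y \<beta> where \<beta>: "Y \<in> Ob B" "\<beta> \<in> mod_homs B.R (B.H Y) (restrict_left M A.R Z ?Y)"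
    "bij_betw \<beta> (carrier (B.H Y)) ?Y"
    using B.fl_rep[OF YN_module[OF Z] fls[THEN conjunct2]] unfolding B.rep_def bij_betw_def by blast
  have XD: "X \<in> Ob D" using X A_sub by (auto simp: is_full_subcat_def)
  obtain \<theta> where th: "\<theta> \<in> mod_homs A.R (PhO X) (A.H X)" "bij_betw \<theta> (carrier (PhO X)) (carrier (A.H X))"
    using Phi_iso_simples_hom[OF X(1)] .
  have \<alpha>: "compose (carrier (PhO X)) \<psi> \<theta> \<in> mod_homs A.R (PhO X) (restrict_right B.R M Z ?X)"
    "bij_betw (compose (carrier (PhO X)) \<psi> \<theta>) (carrier (PhO X)) ?X"
    using mod_homs_compose[OF PhO_module[OF XD] th(1) X(2)] bij_betw_compose[OF th(2) X(3)] by auto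
  have dec: "\<exists>!(x, y). x \<in> ?X \<and> y \<in> ?Y \<and> z = x \<oplus>\<^bsub>Z\<^esub> y" if z: "z \<in> carrier Z" for z
  proof -
    obtain r s where rs: "r \<in> carrier B.R" "s \<in> carrier A.R" "z = inB r \<odot>\<^bsub>Z\<^esub> z \<oplus>\<^bsub>Z\<^esub> inA s \<odot>\<^bsub>Z\<^esub> z"
      using unit_decomp[OF Z z] .
    define x y where "x = inA s \<odot>\<^bsub>Z\<^esub> z" and "y = inB r \<odot>\<^bsub>Z\<^esub> z"
    have xy: "x \<in> ?X" "y \<in> ?Y" using XP_YP_parts[OF Z z] rs by (auto simp: x_def y_def)
    have c: "x \<in> carrier Z" "y \<in> carrier Z" using xy sub by blast+
    have zxy: "z = x \<oplus>\<^bsub>Z\<^esub> y" using rs(3) unfolding x_def[symmetric] y_def[symmetric] Z.a_comm[OF c(2,1)] .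
    show ?thesis
    proof (rule ex1I[of _ "(x, y)"])
      show "case (x, y) of (x, y) \<Rightarrow> x \<in> ?X \<and> y \<in> ?Y \<and> z = x \<oplus>\<^bsub>Z\<^esub> y" using xy zxy by simp
      fix p assume "case p of (x, y) \<Rightarrow> x \<in> ?X \<and> y \<in> ?Y \<and> z = x \<oplus>\<^bsub>Z\<^esub> y"
      then show "p = (x, y)" using XP_YP_unique[OF Z _ xy(1) _ xy(2)] zxy by (cases p) auto
    qed
  qed
  have "X \<in> P" using X(1) P by simp
  from from_parts[OF Z this XD \<beta>(1) sub dec \<alpha> \<beta>(2,3) XP_act(1)[OF Z] YP_act[OF Z]]
  show ?thesis by blast
qed

text \<open>The carrier of \<open>Nmod t\<close> does not lie in \<open>'u\<close>, but it is small enough to be copied into \<open>'u\<close>.\<close>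

definition emb :: "'o \<times> 'o \<times> 'm \<Rightarrow> 'u \<times> ('o \<Rightarrow> 'm) \<Rightarrow> 'u" where
  "emb t = (SOME i. inj_on i (carrier (Nmod t)))"

definition unemb :: "'o \<times> 'o \<times> 'm \<Rightarrow> 'u \<Rightarrow> 'u \<times> ('o \<Rightarrow> 'm)" where
  "unemb t = inv_into (carrier (Nmod t)) (emb t)"

text \<open>The structure of \<open>Nmod t\<close> transported along \<open>emb t\<close>.\<close>

definition MO :: "'o \<times> 'o \<times> 'm \<Rightarrow> (('o \<Rightarrow> 'm) \<times> ('o \<Rightarrow> 'u) \<times> ('o \<Rightarrow> 'm), 'u) module" where
  "MO t = \<lparr>carrier = emb t ` carrier (Nmod t), monoid.mult = undefined, one = undefined,
    zero = emb t \<zero>\<^bsub>Nmod t\<^esub>, add = (\<lambda>x y. emb t (unemb t x \<oplus>\<^bsub>Nmod t\<^esub> unemb t y)),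
    smult = (\<lambda>a x. emb t (a \<odot>\<^bsub>Nmod t\<^esub> unemb t x))\<rparr>"

lemma emb_inj:
  assumes "t \<in> Ob T"
  shows "inj_on (emb t) (carrier (Nmod t))"
proof -
  obtain X Y e where t: "t = (X, Y, e)" by (cases t)
  have "carrier (PhO X) \<lesssim> (UNIV :: 'u set)" by (simp add: subset_imp_lepoll)
  moreover have "carrier (B.H Y) \<lesssim> (UNIV :: 'u set)" using B.H_lepoll[OF inf _ hom_small] assms t by simp
  ultimately have "carrier (Nmod t) \<lesssim> (UNIV :: 'u set)" using B.infinite_prod_lepoll[OF inf] t by simp
  then have "\<exists>i :: _ \<Rightarrow> 'u. inj_on i (carrier (Nmod t))" unfolding lepoll_def by blast
  then show ?thesis unfolding emb_def by (rule someI_ex)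
qed

lemma Nmod_module': "t \<in> Ob T \<Longrightarrow> nu_module RR (Nmod t)"
  using Nmod_module by (cases t) auto

lemma unemb:
  assumes "t \<in> Ob T"
  shows "x \<in> carrier (Nmod t) \<Longrightarrow> unemb t (emb t x) = x"
    "z \<in> carrier (MO t) \<Longrightarrow> unemb t z \<in> carrier (Nmod t)" "z \<in> carrier (MO t) \<Longrightarrow> emb t (unemb t z) = z"
  using emb_inj[OF assms] by (auto simp: unemb_def MO_def)

lemma emb_hom:
  assumes t: "t \<in> Ob T"
  shows "restrict (emb t) (carrier (Nmod t)) \<in> mod_homs RR (Nmod t) (MO t)"
    "bij_betw (restrict (emb t) (carrier (Nmod t))) (carrier (Nmod t)) (carrier (MO t))"
    "nu_module RR (MO t)" "restrict (unemb t) (carrier (MO t)) \<in> mod_homs RR (MO t) (Nmod t)"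
proof -
  interpret N: abelian_group "Nmod t" using nu_moduleD(1)[OF Nmod_module'[OF t]] .
  have sm: "a \<odot>\<^bsub>Nmod t\<^esub> x \<in> carrier (Nmod t)" if "a \<in> carrier RR" "x \<in> carrier (Nmod t)" for a x
    using nu_moduleD(2)[OF Nmod_module'[OF t]] that .
  show 1: "restrict (emb t) (carrier (Nmod t)) \<in> mod_homs RR (Nmod t) (MO t)"
    by (rule mod_homsI) (use sm unemb(1)[OF t] in \<open>simp_all add: MO_def\<close>)
  show 2: "bij_betw (restrict (emb t) (carrier (Nmod t))) (carrier (Nmod t)) (carrier (MO t))"
    using emb_inj[OF t] by (auto simp: MO_def bij_betw_def inj_on_def)
  show "nu_module RR (MO t)"
    by (rule RR.nu_module_iso[OF Nmod_module'[OF t] 2]) (use mod_homsD(2,3)[OF 1] in \<open>simp_all, simp add: MO_def\<close>)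
  have "restrict (unemb t) (carrier (MO t)) = restrict (inv_into (carrier (Nmod t)) (restrict (emb t) (carrier (Nmod t)))) (carrier (MO t))"
  proof (rule restrict_ext)
    fix z assume z: "z \<in> carrier (MO t)"
    have "inv_into (carrier (Nmod t)) (restrict (emb t) (carrier (Nmod t))) (restrict (emb t) (carrier (Nmod t)) (unemb t z)) = unemb t z"
      by (rule inv_into_f_f) (use 2 unemb(2)[OF t z] in \<open>auto simp: bij_betw_def\<close>)
    then show "unemb t z = inv_into (carrier (Nmod t)) (restrict (emb t) (carrier (Nmod t))) z"
      using unemb(2,3)[OF t z] by simp
  qed
  then show "restrict (unemb t) (carrier (MO t)) \<in> mod_homs RR (MO t) (Nmod t)"
    using mod_homs_inv[OF Nmod_module'[OF t] 1 2] by simp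
qed

text \<open>Nothing in this functor refers to \<open>P\<close>, so literally the same functor serves
  both categories of triples.\<close>

definition MM :: "('o \<times> 'o \<times> 'm, 'm \<times> 'm, (('o \<Rightarrow> 'm) \<times> ('o \<Rightarrow> 'u) \<times> ('o \<Rightarrow> 'm), 'u) module, 'u \<Rightarrow> 'u) functr" where
  "MM = \<lparr>fob = MO, fmp = (\<lambda>t t' a. \<lambda>z \<in> carrier (MO t). emb t' (Nmap t t' a (unemb t z)))\<rparr>"

lemma Nmap_hom':
  "\<lbrakk>t \<in> Ob T; t' \<in> Ob T; a \<in> Hom T t t'\<rbrakk> \<Longrightarrow> Nmap t t' a \<in> mod_homs RR (Nmod t) (Nmod t')"
  using Nmap_hom by (cases t; cases t'; cases a) auto

text \<open>Faithfulness and fullness come from \<open>Nmap\<close> whatever \<open>Q\<close> is;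
  the property only decides which modules have to be reached. It is applied with finite length and
  with local finiteness.\<close>

lemma MM_equivalence:
  assumes Q: "\<And>t. t \<in> Ob T \<Longrightarrow> Q (MO t)"
    and ess: "\<And>Z. nu_module RR Z \<Longrightarrow> Q Z \<Longrightarrow> \<exists>t \<in> Ob T. \<exists>g \<in> mod_homs RR (Nmod t) Z. bij_betw g (carrier (Nmod t)) (carrier Z)"
  shows "is_equivalence T (mod_cat RR Q) MM"
proof (rule is_equivalenceI[OF T.preadditive_cat_axioms RR.mod_cat_preadditive])
  show "is_functor T (mod_cat RR Q) MM"
    unfolding is_functor_def mod_cat_simps MM_def functr.simps
  proof (intro conjI ballI CollectI)
    fix t assume t: "t \<in> Ob T"
    show "nu_module RR (MO t)" "Q (MO t)" using emb_hom(3) Q t by auto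
    have "Nmap t t (Idt T t) x = x" if "x \<in> carrier (Nmod t)" for x
      using Nmap_id t that by (cases t) blast
    then have "emb t (Nmap t t (Idt T t) (unemb t z)) = z" if "z \<in> carrier (MO t)" for z
      using unemb(2,3)[OF t that] by simp
    then show "(\<lambda>z\<in>carrier (MO t). emb t (Nmap t t (Idt T t) (unemb t z))) = (\<lambda>x\<in>carrier (MO t). x)"
      by (rule restrict_ext)
  next
    fix t t' a assume *: "t \<in> Ob T" "t' \<in> Ob T" "a \<in> Hom T t t'"
    have "compose (carrier (MO t)) (restrict (emb t') (carrier (Nmod t')))
        (compose (carrier (MO t)) (Nmap t t' a) (restrict (unemb t) (carrier (MO t)))) \<in> mod_homs RR (MO t) (MO t')"
      using mod_homs_compose[OF emb_hom(3)[OF *(1)] mod_homs_compose[OF emb_hom(3)[OF *(1)] emb_hom(4)[OF *(1)]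
          Nmap_hom'[OF *]] emb_hom(1)[OF *(2)]] .
    moreover have "Nmap t t' a (unemb t z) \<in> carrier (Nmod t')" if "z \<in> carrier (MO t)" for z
      using mod_homsD(1)[OF Nmap_hom'[OF *]] unemb(2)[OF *(1) that] by blast
    ultimately show "(\<lambda>z\<in>carrier (MO t). emb t' (Nmap t t' a (unemb t z))) \<in> mod_homs RR (MO t) (MO t')"
      by (simp add: compose_def cong: restrict_cong)
  next
    fix t t' t'' a b assume *: "t \<in> Ob T" "t' \<in> Ob T" "t'' \<in> Ob T" "a \<in> Hom T t t'" "b \<in> Hom T t' t''"
    have c: "Nmap t t' a (unemb t z) \<in> carrier (Nmod t')" if "z \<in> carrier (MO t)" for z
      using mod_homsD(1)[OF Nmap_hom'[OF *(1,2,4)]] unemb(2)[OF *(1) that] by blast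
    then have c': "emb t' (Nmap t t' a (unemb t z)) \<in> carrier (MO t')" if "z \<in> carrier (MO t)" for z
      using that by (auto simp: MO_def)
    have n: "Nmap t t'' (Cmp T t t' t'' b a) x = Nmap t' t'' b (Nmap t t' a x)" if "x \<in> carrier (Nmod t)" for x
      using Nmap_cmp * that by (cases t; cases t'; cases t''; cases a; cases b) blast
    show "(\<lambda>z\<in>carrier (MO t). emb t'' (Nmap t t'' (Cmp T t t' t'' b a) (unemb t z))) =
        compose (carrier (MO t)) (\<lambda>z\<in>carrier (MO t'). emb t'' (Nmap t' t'' b (unemb t' z)))
          (\<lambda>z\<in>carrier (MO t). emb t' (Nmap t t' a (unemb t z)))"
      unfolding compose_def
    proof (rule restrict_ext)
      fix z assume z: "z \<in> carrier (MO t)"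
      show "emb t'' (Nmap t t'' (Cmp T t t' t'' b a) (unemb t z)) =
          (\<lambda>z\<in>carrier (MO t'). emb t'' (Nmap t' t'' b (unemb t' z)))
            ((\<lambda>z\<in>carrier (MO t). emb t' (Nmap t t' a (unemb t z))) z)"
        using n[OF unemb(2)[OF *(1) z]] unemb(1)[OF *(2) c[OF z]] c'[OF z] z by simp
    qed
  qed
next
  fix t t' a b assume *: "t \<in> Ob T" "t' \<in> Ob T" "a \<in> Hom T t t'" "b \<in> Hom T t t'" "fmp MM t t' a = fmp MM t t' b"
  have "Nmap t t' a x = Nmap t t' b x" if x: "x \<in> carrier (Nmod t)" for x
  proof -
    have "emb t x \<in> carrier (MO t)" using x by (simp add: MO_def)
    then have "emb t' (Nmap t t' a x) = emb t' (Nmap t t' b x)"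
      using fun_cong[OF *(5), of "emb t x"] unemb(1)[OF *(1) x] by (simp add: MM_def)
    then show ?thesis
      using inj_onD[OF emb_inj[OF *(2)]] mod_homsD(1)[OF Nmap_hom'[OF *(1,2)]] * x by blast
  qed
  then show "a = b" using Nmap_faithful * by (cases t; cases t'; cases a; cases b) blast
next
  fix t t' h assume *: "t \<in> Ob T" "t' \<in> Ob T" "h \<in> Hom (mod_cat RR Q) (fob MM t) (fob MM t')"
  then have h: "h \<in> mod_homs RR (MO t) (MO t')" by (simp add: MM_def)
  let ?k = "compose (carrier (Nmod t)) (restrict (unemb t') (carrier (MO t')))
    (compose (carrier (Nmod t)) h (restrict (emb t) (carrier (Nmod t))))"
  have "?k \<in> mod_homs RR (Nmod t) (Nmod t')"
    using mod_homs_compose[OF Nmod_module'[OF *(1)] mod_homs_compose[OF Nmod_module'[OF *(1)] emb_hom(1)[OF *(1)]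
        h] emb_hom(4)[OF *(2)]] .
  then obtain a where a: "a \<in> Hom T t t'" "Nmap t t' a = ?k"
    using Nmap_full * by (cases t; cases t') blast
  have "fmp MM t t' a = h"
  proof
    fix z
    show "fmp MM t t' a z = h z"
    proof (cases "z \<in> carrier (MO t)")
      case True
      then show ?thesis using unemb[OF *(1)] unemb[OF *(2)] mod_homsD(1)[OF h] by (simp add: MM_def a(2) compose_def)
    next
      case False
      then show ?thesis using mod_homsD(4)[OF h] by (simp add: MM_def extensional_def)
    qed
  qed
  then show "\<exists>a \<in> Hom T t t'. fmp MM t t' a = h" using a by blast
next
  fix Z assume "Z \<in> Ob (mod_cat RR Q)"
  then have Z: "nu_module RR Z" "Q Z" by auto
  obtain t g where t: "t \<in> Ob T" and g: "g \<in> mod_homs RR (Nmod t) Z" "bij_betw g (carrier (Nmod t)) (carrier Z)"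
    using ess Z by blast
  let ?u = "restrict (unemb t) (carrier (MO t))"
  have "bij_betw ?u (carrier (MO t)) (carrier (Nmod t))"
    by (rule bij_betwI[of _ _ _ "emb t"]) (use unemb[OF t] in \<open>auto simp: MO_def\<close>)
  then have "iso_mor (mod_cat RR Q) (MO t) Z (compose (carrier (MO t)) g ?u)"
    using mod_iso_iff[OF emb_hom(3)[OF t] Q[OF t] Z] mod_homs_compose[OF emb_hom(3)[OF t] emb_hom(4)[OF t] g(1)]
      bij_betw_compose g(2) by blast
  then show "\<exists>t \<in> Ob T. iso_obj (mod_cat RR Q) (fob MM t) Z"
    unfolding iso_obj_def using t by (intro bexI[of _ t]) (auto simp: MM_def)
qed

lemma MO_locally_finite:
  assumes t: "t \<in> Ob T"
  shows "locally_finite_mod B.R M A.R (MO t)"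
proof -
  obtain X Y e where e: "t = (X, Y, e)" by (cases t)
  show ?thesis using image_locally_finite[OF emb_hom(3)[OF t] t[unfolded e]] emb_hom(1,2)[OF t] unfolding e by blast
qed

lemma MO_finite_length:
  assumes t: "t \<in> Ob T" and P: "P = Ob A"
  shows "finite_length_mod RR (MO t)"
proof -
  obtain X Y e where e: "t = (X, Y, e)" by (cases t)
  have "X \<in> Ob A" using t P unfolding e T_Ob by blast
  then show ?thesis
    using image_finite_length[OF emb_hom(3)[OF t] t[unfolded e]] emb_hom(1,2)[OF t] unfolding e by blast
qed

end

text \<open>The kernel in \<open>C\<close> of a morphism between objects of \<open>P\<close> is a
  subobject of an object of \<open>P\<close>, hence in \<open>P\<close>. So monomorphisms of the
  full subcategory are monomorphisms of \<open>C\<close>, simple objects of \<open>C\<close> in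
  \<open>P\<close> stay simple, and a composition series stays one.\<close>

lemma finite_length_full_sub:
  assumes C: "abelian_cat C" and S: "abelian_cat (full_sub C P)" and P: "serre_subcat C P"
    and X: "finite_length_obj C X" "X \<in> P"
  shows "finite_length_obj (full_sub C P) X"
proof -
  interpret C: abelian C using C by (simp add: abelian_locale)
  interpret S: abelian "full_sub C P" using S by (simp add: abelian_locale)
  have simps [simp]: "Ob (full_sub C P) = P" "Hom (full_sub C P) = Hom C" "Cmp (full_sub C P) = Cmp C"
    "Zer (full_sub C P) = Zer C" "Idt (full_sub C P) = Idt C" by (simp_all add: full_sub_def)
  have PC: "Y \<in> P \<Longrightarrow> Y \<in> Ob C" for Y using P unfolding serre_subcat_def strictly_full_def by blast
  have zero: "zero_obj (full_sub C P) Z" if "zero_obj C Z" "Z \<in> P" for Z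
    using that unfolding C.zero_obj_iff S.zero_obj_iff by simp
  have mono: "mono_mor C Y Y' m" if m: "mono_mor (full_sub C P) Y Y' m" for Y Y' m
  proof -
    note D = S.monoD[OF m, simplified]
    obtain K k where k: "is_ker C Y Y' m K k" using C.ker_ex D PC by metis
    note kD = C.is_kerD[OF k]
    have "K \<in> P" using P C.is_ker_mono[OF k] D unfolding serre_subcat_def by blast
    then have "k = Zer C K Y" using S.monoD_zero[OF m, of K k] kD by simp
    then show ?thesis unfolding C.mono_iff
      using C.is_ker_factor[OF k] kD PC by (metis C.cmp_zero_left)
  qed
  show ?thesis using X
  proof induction
    case (zero Z)
    then show ?case using finite_length_obj.zero[of "full_sub C P"] \<open>zero_obj C Z \<Longrightarrow> Z \<in> P \<Longrightarrow> _\<close> by blast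
  next
    case (step A S X f g)
    have e: "epi_mor C X S g" "mono_mor C A X f" using step(3) by (auto simp: short_exact_def)
    have AS: "A \<in> P" "S \<in> P" using P e step(5) unfolding serre_subcat_def by blast+
    have k: "is_ker C X S g A f" using C.short_exactD(1)[OF step(3)] .
    have "is_ker (full_sub C P) X S g A f" using k AS step(5) PC unfolding is_ker_def by simp
    moreover have "epi_mor (full_sub C P) X S g" using e AS step(5) PC unfolding epi_mor_def by auto
    ultimately have se: "short_exact (full_sub C P) A X S f g" by (rule S.short_exactI)
    have "simple_obj (full_sub C P) S"
      unfolding simple_obj_def
    proof (intro conjI allI impI)
      show "S \<in> Ob (full_sub C P)" using AS by simp
      show "\<not> zero_obj (full_sub C P) S"
        using step(2) AS PC unfolding simple_obj_def C.zero_obj_iff S.zero_obj_iff by simp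
      fix Y m assume m: "mono_mor (full_sub C P) Y S m"
      then have "zero_obj C Y \<or> iso_mor C Y S m" using mono step(2) unfolding simple_obj_def by blast
      then show "zero_obj (full_sub C P) Y \<or> iso_mor (full_sub C P) Y S m"
        using S.monoD[OF m] zero unfolding iso_mor_def by auto
    qed
    then show ?case using finite_length_obj.step[OF step(4)[OF AS(1)] _ se] by blast
  qed
qed

theorem theorem2p13:
  fixes C Xt :: "('o, 'm) precat"
    and \<X> \<Y> I J :: "'o set"
    and F :: "('o, 'm, 'o, 'm) functr"
    and \<Phi> :: "('o, 'm, ('o \<Rightarrow> 'm, 'u) module, 'u \<Rightarrow> 'u) functr"
  assumes C_abelian: "abelian_cat C"
    and C_finite_length: "\<forall>A \<in> Ob C. finite_length_obj C A"
    and torsion: "torsion_pair C \<X> \<Y>"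
    and cond_a: "serre_subcat C \<X>" "serre_subcat C \<Y>"
    and cond_b: "semisimple_cat (full_sub C \<X>)" "semisimple_cat (full_sub C \<Y>)"
    and cond_c: "\<forall>X \<in> \<X>. \<forall>Y \<in> \<Y>. Hom C Y X = {Zer C Y X}"
    and cond_d: "semisimple_cat Xt" "is_full_subcat (full_sub C \<X>) Xt" "serre_subcat Xt \<X>"
      "exact_functor (full_sub C \<Y>) Xt F" "\<exists>\<phi>. ext_hom_iso C Xt \<X> \<Y> F \<phi>"
    and I_reps: "simple_reps (full_sub C \<X>) I"
    and J_reps: "simple_reps (full_sub C \<Y>) J"
    and universe: "infinite (UNIV :: 'u set)"
      "\<forall>A \<in> Ob C. \<forall>B \<in> Ob C. Hom C A B \<lesssim> (UNIV :: 'u set)"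
    and cond_e: "extends_simples_hom (full_sub C \<X>) Xt I \<Phi>"
  shows
    "let \<F> = triple_subcat C Xt \<X> \<Y> F;
         \<F>t = triple_cat C Xt \<Y> F;
         R\<X> = simples_ring (full_sub C \<X>) I;
         R\<Y> = simples_ring (full_sub C \<Y>) J;
         M = simples_bimod J F \<Phi>;
         R = tri_ring R\<Y> M (simples_bimod_right J F \<Phi>) R\<X>;
         Rmod = (mod_cat R (finite_length_mod R) :: (_, 'u \<Rightarrow> 'u) precat);
         Rmodt = (mod_cat R (locally_finite_mod R\<Y> M R\<X>) :: (_, 'u \<Rightarrow> 'u) precat)
     in hereditary_cat \<F> \<and> hereditary_cat \<F>t \<and> enough_projectives \<F>t \<and>
        (\<exists>\<M> \<M>t. is_equivalence \<F> Rmod \<M> \<and> is_equivalence \<F>t Rmodt \<M>t \<and>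
          extends_functor \<F> \<M> \<M>t)"
proof -
  let ?A = "full_sub C \<X>" and ?B = "full_sub C \<Y>"
  have simps: "Ob (full_sub C P) = P" "Hom (full_sub C P) = Hom C" for P by (simp_all add: full_sub_def)
  have cats: "triple_cat ?B Xt (Ob ?B) F = triple_cat C Xt \<Y> F"
    by (simp add: triple_cat_def full_sub_def)
  have sub_C: "\<X> \<subseteq> Ob C" "\<Y> \<subseteq> Ob C" using cond_a by (auto simp: serre_subcat_def strictly_full_def)
  have reg: "regular_cat ?A" "regular_cat ?B" "regular_cat Xt" using cond_b cond_d(1) semisimple_regular by blast+
  have fin: "finite_length_obj (full_sub C P) X"
    if "semisimple_cat (full_sub C P)" "serre_subcat C P" "X \<in> P" for P X
  proof (rule finite_length_full_sub[OF C_abelian _ that(2) _ that(3)])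
    show "abelian_cat (full_sub C P)" using that(1) by (simp add: semisimple_cat_def)
    have "P \<subseteq> Ob C" using that(2) by (simp add: serre_subcat_def strictly_full_def)
    then show "finite_length_obj C X" using that(3) C_finite_length by blast
  qed
  have ss: "fin_ss ?A I" "fin_ss ?B J"
    using reg I_reps J_reps fin cond_a cond_b by (simp_all add: fin_ss_def fin_ss_axioms_def simps)
  \<comment> \<open>The whole category is a Serre subcategory of itself; as \<open>P\<close> it
    yields all triples.\<close>
  have serre: "serre_subcat Xt (Ob Xt)"
    using cond_d(3)
    by (auto simp: serre_subcat_def strictly_full_def iso_obj_def iso_mor_def mono_mor_def epi_mor_def short_exact_def)
  have modules: "triple_modules ?B Xt ?A F P J I \<Phi>" if "serre_subcat Xt P" for P
  proof -
    have "triple_data ?B Xt F P"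
      unfolding triple_data_def triple_data_axioms_def
      using reg cond_d(4) that unfolding exact_functor_def by blast
    moreover have "triple_modules_axioms ?B Xt ?A I \<Phi>"
      unfolding triple_modules_axioms_def simps
      using cond_d(2,3) cond_e universe sub_C by blast
    ultimately show ?thesis using ss by (simp add: triple_modules_def)
  qed
  interpret S: triple_modules ?B Xt ?A F "\<X>" J I \<Phi> using modules cond_d(3) .
  interpret L: triple_modules ?B Xt ?A F "Ob Xt" J I \<Phi> using modules serre .
  have ST: "S.T = triple_subcat C Xt \<X> \<Y> F" by (simp add: S.T_def cats triple_subcat_def)
  have "{t \<in> Ob (triple_cat C Xt \<Y> F). fst t \<in> Ob Xt} = Ob (triple_cat C Xt \<Y> F)"
    by (auto simp: triple_cat_def)
  then have LT: "L.T = triple_cat C Xt \<Y> F" unfolding L.T_def cats by (simp add: full_sub_def)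
  have "is_equivalence S.T (mod_cat S.RR (finite_length_mod S.RR)) S.MM"
    by (rule S.MM_equivalence) (simp_all add: S.MO_finite_length S.finite_length_image simps)
  \<comment> \<open>\<open>S.MM\<close> appears here as well: the two interpretations share the
    functor, which makes the extension property a triviality.\<close>
  moreover have "is_equivalence L.T (mod_cat S.RR (locally_finite_mod S.B.R S.M S.A.R)) S.MM"
    by (rule L.MM_equivalence) (simp_all add: L.MO_locally_finite L.locally_finite_image)
  moreover have "extends_functor S.T S.MM S.MM" by (simp add: extends_functor_def)
  ultimately show ?thesis
    unfolding Let_def ST[symmetric] LT[symmetric]
    using S.T_hereditary L.T_hereditary L.T_enough_projectives by blast
qed

end
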